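(* Let $(R,S)$ be an admissible pair of irreducible reduced root systems, and let $p_\lambda$ ($\lambda\in P^+$) be the associated (monic) Macdonald polynomials with parameters $q$ and $t$. Let $\omega\in\Lambda^+$ be small. Then for every $\lambda\in P^+$ one has $$D_{\omega}\,p_\lambda=E_\omega^S(\lambda+\rho_{t,S})\,p_\lambda ,$$ where $$E_\omega^S:=\sum_{\mu\in\Lambda^+,\ \mu\leq\omega}\epsilon_{\omega,\mu}\,m_\mu\in\mathbb{C}[\Lambda],\qquad \epsilon_{\omega,\mu}:=\sum_{\eta\in W_\mu\omega}\ \prod_{\alpha\in S_\mu^+,\ |\langle\alpha,\eta\rangle|=1}t_\alpha^{\langle\alpha,\eta\rangle/2},$$ with $S_\mu^+:=\{\alpha\in S^+\mid\langle\alpha,\mu\rangle=0\}$, and $$\rho_{t,S}:=\frac12\sum_{\alpha\in S^+}\log_q(t_\alpha)\,\alpha .$$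
   Context: Setting. $E$ is a real finite-dimensional Euclidean space with inner product $\langle\cdot,\cdot\rangle$; $\alpha^\vee:=2\alpha/\langle\alpha,\alpha\rangle$. $R$ is an irreducible reduced crystallographic root system spanning $E$, with dual $R^\vee=\{\alpha^\vee\mid\alpha\in R\}$ and Weyl group $W$. $(R,S)$ admissible means $S=R$ or $S=R^\vee$. For $\alpha\in R$ put $u_\alpha:=1$ if $S=R$ and $u_\alpha:=\langle\alpha,\alpha\rangle/2$ if $S=R^\vee$, and $\alpha_*:=u_\alpha^{-1}\alpha$; then $\alpha\mapsto\alpha_*$ is a bijection $R\to S$. Fix positive roots $R^+$, and correspondingly $S^+=\{\alpha_*\mid\alpha\in R^+\}$, etc. $P$ is the weight lattice of $R$, $P^+$ its dominant cone; $\Lambda$ is the weight lattice of $S^\vee$, $\Lambda^+$ its dominant cone. Dominance order on $P$: $\lambda\ge\mu$ iff $\lambda-\mu$ is a nonnegative integral combination of elements of $R^+$; dominance order on $\Lambda$: the same with $(S^\vee)^+$. For a lattice $L\in\{P,\Lambda\}$, $\mathbb{C}[L]$ is the group algebra with basis $e^\lambda$ ($\lambda\in L$), $e^\lambda e^\mu=e^{\lambda+\mu}$, $e^0=1$; $W$ acts by $we^\lambda=e^{w\lambda}$, with invariants $\mathbb{C}[L]^W$. For $\lambda$ dominant, $m_\lambda:=\sum_{\eta\in W\lambda}e^\eta$ (sum over the orbit). Evaluation at $x\in E$: $e^\lambda(x):=q^{\langle\lambda,x\rangle}$, extended linearly. Parameters: $0<q<1$; $t:R\cup R^\vee\to(0,1)$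 with $t_{\alpha^\vee}=t_\alpha$, $t_{w\alpha}=t_\alpha$ for $w\in W$; $q_\alpha:=q^{u_\alpha}$; $(a;q)_m:=\prod_{k=0}^{m-1}(1-aq^k)$, $m$ a nonnegative integer or $\infty$. Macdonald polynomials. For $f,g\in\mathbb{C}[P]$, $\langle f,g\rangle_\Delta:=|W|^{-1}\int f\,\overline{g}\,\Delta$, where $\int$ is the constant term (coefficient of $e^0$), $\overline{\sum g_\lambda e^\lambda}=\sum\overline{g_\lambda}e^{-\lambda}$, and $\Delta:=\prod_{\alpha\in R}\frac{(e^\alpha;q_\alpha)_\infty}{(t_\alpha e^\alpha;q_\alpha)_\infty}$ (each factor expanded as a power series in $e^\alpha$; the constant term is well defined by absolute convergence). $p_\lambda$ ($\lambda\in P^+$) is the unique element of $\mathbb{C}[P]$ of the form $p_\lambda=m_\lambda+\sum_{\mu\in P^+,\mu<\lambda}a_{\lambda\mu}m_\mu$ with $a_{\lambda\mu}\in\mathbb{C}$ such that $\langle p_\lambda,m_\mu\rangle_\Delta=0$ for all $\mu\in P^+$ with $\mu<\lambda$. Small weights. $\omega\in\Lambda^+$ is small if $\langle\omega,\alpha\rangle\le2$ for all $\alpha\in S^+$. The operator $D_\omega$. For $\omega\in\Lambda^+$ let $\Lambda_\omega:=\bigcup_{\mu\in\Lambda^+,\mu\le\omega}W\mu$. For $x\in E$, $T_x:\mathbb{C}[P]\to\mathbb{C}[P]$, $T_xe^\lambda:=q^{\langle\lambda,x\rangle}e^\lambda$. $W_x$ is the stabilizer of $x$ in $W$ and $R_x:=\{\alpha\in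 R\mid\langle\alpha,x\rangle=0\}$. For $\nu\in\Lambda$ choose $w_\nu\in W$ with $w_\nu\nu\in\Lambda^+$. With $v_\alpha(z):=t_\alpha^{-1/2}(1-t_\alpha z)/(1-z)$, for $\omega$ small $$D_\omega:=\sum_{\nu\in\Lambda_\omega}\ \sum_{\eta\in W_\nu(w_\nu^{-1}\omega)}U_{\nu,\eta}V_\nu T_\nu,$$ $$V_\nu:=\prod_{\alpha\in R,\ \langle\alpha_*,\nu\rangle>0}v_\alpha(e^\alpha)\prod_{\alpha\in R,\ \langle\alpha_*,\nu\rangle=2}v_\alpha(q_\alpha e^\alpha),\qquad U_{\nu,\eta}:=\prod_{\alpha\in R_\nu,\ \langle\alpha_*,\eta\rangle>0}v_\alpha(e^\alpha)\prod_{\alpha\in R_\nu,\ \langle\alpha_*,\eta\rangle=2}v_\alpha(q_\alpha^{-1}e^{-\alpha}).$$ $D_\omega$ maps $\mathbb{C}[P]$ to its quotient field. Here $W_\nu(w_\nu^{-1}\omega)$ is the $W_\nu$-orbit of $w_\nu^{-1}\omega$. *)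

theory Defs
  imports
    "HOL-Complex_Analysis.Complex_Analysis"
    "HOL-Library.Poly_Mapping"
    "HOL-Library.FuncSet"
    "HOL-Computational_Algebra.Fraction_Field"
begin

section \<open>Root systems, Weyl groups and weight lattices\<close>

definition coroot :: "'a::euclidean_space \<Rightarrow> 'a" where
  "coroot \<alpha> = (2 / (\<alpha> \<bullet> \<alpha>)) *\<^sub>R \<alpha>"

definition reflection :: "'a::euclidean_space \<Rightarrow> 'a \<Rightarrow> 'a" where
  "reflection \<alpha> x = x - (x \<bullet> coroot \<alpha>) *\<^sub>R \<alpha>"

definition root_system :: "'a::euclidean_space set \<Rightarrow> bool" where
  "root_system R \<longleftrightarrow>
     finite R \<and> 0 \<notin> R \<and> span R = UNIV \<and>
     (\<forall>\<alpha>\<in>R. reflection \<alpha> ` R \<subseteq> R) \<and>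
     (\<forall>\<alpha>\<in>R. \<forall>\<beta>\<in>R. \<beta> \<bullet> coroot \<alpha> \<in> \<int>)"

definition reduced_root_system :: "'a::euclidean_space set \<Rightarrow> bool" where
  "reduced_root_system R \<longleftrightarrow>
     root_system R \<and> (\<forall>\<alpha>\<in>R. \<forall>c. c *\<^sub>R \<alpha> \<in> R \<longrightarrow> c = 1 \<or> c = -1)"

definition irreducible_root_system :: "'a::euclidean_space set \<Rightarrow> bool" where
  "irreducible_root_system R \<longleftrightarrow>
     root_system R \<and> R \<noteq> {} \<and>
     \<not> (\<exists>A B. A \<noteq> {} \<and> B \<noteq> {} \<and> A \<inter> B = {} \<and> A \<union> B = R \<and>
            (\<forall>\<alpha>\<in>A. \<forall>\<beta>\<in>B. \<alpha> \<bullet> \<beta> = 0))"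

inductive_set weyl_group :: "'a::euclidean_space set \<Rightarrow> ('a \<Rightarrow> 'a) set"
  for R :: "'a set" where
  weyl_id: "id \<in> weyl_group R"
| weyl_step: "\<alpha> \<in> R \<Longrightarrow> w \<in> weyl_group R \<Longrightarrow> reflection \<alpha> \<circ> w \<in> weyl_group R"

definition weyl_orbit :: "'a::euclidean_space set \<Rightarrow> 'a \<Rightarrow> 'a set" where
  "weyl_orbit R x = (\<lambda>w. w x) ` weyl_group R"

definition weyl_stabilizer :: "'a::euclidean_space set \<Rightarrow> 'a \<Rightarrow> ('a \<Rightarrow> 'a) set" where
  "weyl_stabilizer R x = {w \<in> weyl_group R. w x = x}"

definition stabilizer_orbit :: "'a::euclidean_space set \<Rightarrow> 'a \<Rightarrow> 'a \<Rightarrow> 'a set" where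
  "stabilizer_orbit R x y = (\<lambda>w. w y) ` weyl_stabilizer R x"

definition positive_system :: "'a::euclidean_space set \<Rightarrow> 'a set \<Rightarrow> bool" where
  "positive_system R Rp \<longleftrightarrow>
     (\<exists>v. (\<forall>\<alpha>\<in>R. \<alpha> \<bullet> v \<noteq> 0) \<and> Rp = {\<alpha> \<in> R. \<alpha> \<bullet> v > 0})"

definition admissible :: "'a::euclidean_space set \<Rightarrow> 'a set \<Rightarrow> bool" where
  "admissible R S \<longleftrightarrow> S = R \<or> S = coroot ` R"

text \<open>There is no conflict if \<open>S = R\<close> and \<open>S = coroot ` R\<close> hold simultaneously: a reduced \<open>R\<close>
  with \<open>coroot ` R = R\<close> satisfies \<open>\<alpha> \<bullet> \<alpha> = 2\<close> for all \<open>\<alpha> \<in> R\<close>.\<close>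

definition u_factor :: "'a::euclidean_space set \<Rightarrow> 'a set \<Rightarrow> 'a \<Rightarrow> real" where
  "u_factor R S \<alpha> = (if S = R then 1 else (\<alpha> \<bullet> \<alpha>) / 2)"

definition star :: "'a::euclidean_space set \<Rightarrow> 'a set \<Rightarrow> 'a \<Rightarrow> 'a" where
  "star R S \<alpha> = inverse (u_factor R S \<alpha>) *\<^sub>R \<alpha>"

definition weight_lattice :: "'a::euclidean_space set \<Rightarrow> 'a set" where
  "weight_lattice R = {lam. \<forall>\<alpha>\<in>R. lam \<bullet> coroot \<alpha> \<in> \<int>}"

definition dominant_weights :: "'a::euclidean_space set \<Rightarrow> 'a set \<Rightarrow> 'a set" where
  "dominant_weights R Rp = {lam \<in> weight_lattice R. \<forall>\<alpha>\<in>Rp. lam \<bullet> coroot \<alpha> \<ge> 0}"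

definition dominance_le :: "'a::euclidean_space set \<Rightarrow> 'a \<Rightarrow> 'a \<Rightarrow> bool" where
  "dominance_le Rp \<mu> lam \<longleftrightarrow> (\<exists>c :: 'a \<Rightarrow> nat. lam - \<mu> = (\<Sum>\<alpha>\<in>Rp. real (c \<alpha>) *\<^sub>R \<alpha>))"

text \<open>The lattices \<open>P\<close> and \<open>\<Lambda>\<close> of a pair \<open>(R, S)\<close> are \<open>weight_lattice R\<close> and
  \<open>weight_lattice (coroot ` S)\<close>. The next three definitions belong to \<open>\<Lambda>\<close>, whose dominant
  cone and dominance order refer to the positive system \<open>coroot ` S\<^sup>+\<close> of \<open>S\<^sup>\<or>\<close>.\<close>

definition positive_star :: "'a::euclidean_space set \<Rightarrow> 'a set \<Rightarrow> 'a set \<Rightarrow> 'a set" where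
  "positive_star R Rp S = star R S ` Rp"

definition dominant_Lambda :: "'a::euclidean_space set \<Rightarrow> 'a set \<Rightarrow> 'a set \<Rightarrow> 'a set" where
  "dominant_Lambda R Rp S = dominant_weights (coroot ` S) (coroot ` positive_star R Rp S)"

definition dominant_Lambda_below ::
  "'a::euclidean_space set \<Rightarrow> 'a set \<Rightarrow> 'a set \<Rightarrow> 'a \<Rightarrow> 'a set" where
  "dominant_Lambda_below R Rp S \<omega> =
     {\<mu> \<in> dominant_Lambda R Rp S. dominance_le (coroot ` positive_star R Rp S) \<mu> \<omega>}"

definition small_weight :: "'a::euclidean_space set \<Rightarrow> 'a set \<Rightarrow> 'a set \<Rightarrow> 'a \<Rightarrow> bool" where
  "small_weight R Rp S \<omega> \<longleftrightarrow>
     \<omega> \<in> dominant_Lambda R Rp S \<and> (\<forall>\<alpha>\<in>positive_star R Rp S. \<omega> \<bullet> \<alpha> \<le> 2)"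

text \<open>The parameter \<open>t\<close> is only used on \<open>R \<union> R\<^sup>\<or>\<close>; its values elsewhere are irrelevant.\<close>

definition parameter_family :: "'a::euclidean_space set \<Rightarrow> ('a \<Rightarrow> real) \<Rightarrow> bool" where
  "parameter_family R t \<longleftrightarrow>
     (\<forall>\<alpha> \<in> R \<union> coroot ` R. 0 < t \<alpha> \<and> t \<alpha> < 1) \<and>
     (\<forall>\<alpha> \<in> R. t (coroot \<alpha>) = t \<alpha>) \<and>
     (\<forall>w \<in> weyl_group R. \<forall>\<alpha> \<in> R \<union> coroot ` R. t (w \<alpha>) = t \<alpha>)"

section \<open>The group algebra and its quotient field\<close>

text \<open>The group algebra of the full vector space, \<open>\<complex>[E]\<close>, is \<open>'a \<Rightarrow>\<^sub>0 complex\<close>; for a lattice \<open>L\<close>,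
  \<open>\<complex>[L]\<close> is the subring of all elements with \<open>Poly_Mapping.keys f \<subseteq> L\<close>.\<close>

abbreviation ga_exp :: "'a::euclidean_space \<Rightarrow> ('a \<Rightarrow>\<^sub>0 complex)" where
  "ga_exp lam \<equiv> Poly_Mapping.single lam 1"

abbreviation ga_const :: "complex \<Rightarrow> ('a::euclidean_space \<Rightarrow>\<^sub>0 complex)" where
  "ga_const c \<equiv> Poly_Mapping.single 0 c"

definition ga_bar :: "('a::euclidean_space \<Rightarrow>\<^sub>0 complex) \<Rightarrow> ('a \<Rightarrow>\<^sub>0 complex)" where
  "ga_bar f = (\<Sum>lam\<in>Poly_Mapping.keys f.
                 Poly_Mapping.single (- lam) (cnj (Poly_Mapping.lookup f lam)))"

definition ga_eval :: "real \<Rightarrow> ('a::euclidean_space \<Rightarrow>\<^sub>0 complex) \<Rightarrow> 'a \<Rightarrow> complex" where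
  "ga_eval q f x = (\<Sum>lam\<in>Poly_Mapping.keys f.
                      Poly_Mapping.lookup f lam * of_real (q powr (lam \<bullet> x)))"

definition translation ::
  "real \<Rightarrow> 'a::euclidean_space \<Rightarrow> ('a \<Rightarrow>\<^sub>0 complex) \<Rightarrow> ('a \<Rightarrow>\<^sub>0 complex)" where
  "translation q x f = (\<Sum>lam\<in>Poly_Mapping.keys f.
     Poly_Mapping.single lam (of_real (q powr (lam \<bullet> x)) * Poly_Mapping.lookup f lam))"

definition monomial_sym :: "'a::euclidean_space set \<Rightarrow> 'a \<Rightarrow> ('a \<Rightarrow>\<^sub>0 complex)" where
  "monomial_sym R lam = (\<Sum>\<eta>\<in>weyl_orbit R lam. ga_exp \<eta>)"

text \<open>The library makes \<^typ>\<open>'a \<Rightarrow>\<^sub>0 complex\<close> an integral domain only for linearly ordered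
  exponents. The following copy of \<open>\<complex>[E]\<close> carries that instance, so that \<open>'a ga_domain fract\<close> is
  the quotient field of \<open>\<complex>[E]\<close>, which contains the quotient field of every \<open>\<complex>[L]\<close>.\<close>

lemma exists_generic_vector:
  fixes D :: "'a::euclidean_space set"
  assumes "finite D" "0 \<notin> D"
  shows "\<exists>v. \<forall>d\<in>D. d \<bullet> v \<noteq> 0"
proof (rule ccontr)
  assume "\<not> (\<exists>v. \<forall>d\<in>D. d \<bullet> v \<noteq> 0)"
  then have "(\<Union>d\<in>D. {x. d \<bullet> x = 0}) = UNIV" by auto
  moreover have "negligible (\<Union>d\<in>D. {x. d \<bullet> x = 0})"
    using assms by (intro negligible_Union) (auto intro!: negligible_hyperplane)
  ultimately show False using non_negligible_UNIV by metis
qed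

lemma group_algebra_no_zero_divisors:
  fixes f g :: "'a::euclidean_space \<Rightarrow>\<^sub>0 complex"
  assumes "f \<noteq> 0" "g \<noteq> 0"
  shows "f * g \<noteq> 0"
proof -
  define F where "F = Poly_Mapping.keys f"
  define G where "G = Poly_Mapping.keys g"
  have fin: "finite F" "finite G" by (simp_all add: F_def G_def)
  have ne: "F \<noteq> {}" "G \<noteq> {}" using assms by (simp_all add: F_def G_def)
  define D where "D = (\<lambda>(x, y). x - y) ` (F \<times> F \<union> G \<times> G) - {0}"
  have "finite D" "0 \<notin> D" using fin by (auto simp: D_def)
  from exists_generic_vector[OF this] obtain v where "\<forall>d\<in>D. d \<bullet> v \<noteq> 0" ..
  then have v: "\<And>d. d \<in> D \<Longrightarrow> d \<bullet> v \<noteq> 0" by simp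
  have max: "\<exists>m\<in>X. \<forall>x\<in>X. x \<bullet> v \<le> m \<bullet> v" if "finite X" "X \<noteq> {}" for X :: "'a set"
  proof -
    have "Max ((\<lambda>x. x \<bullet> v) ` X) \<in> (\<lambda>x. x \<bullet> v) ` X" using that by (intro Max_in) auto
    then obtain m where m: "m \<in> X" "Max ((\<lambda>x. x \<bullet> v) ` X) = m \<bullet> v" by blast
    have "x \<bullet> v \<le> m \<bullet> v" if "x \<in> X" for x
      unfolding m(2)[symmetric] using that \<open>finite X\<close> by (intro Max_ge) auto
    with m(1) show ?thesis by blast
  qed
  obtain a where a: "a \<in> F" "\<And>x. x \<in> F \<Longrightarrow> x \<bullet> v \<le> a \<bullet> v"
    using max[OF fin(1) ne(1)] by blast
  obtain b where b: "b \<in> G" "\<And>x. x \<in> G \<Longrightarrow> x \<bullet> v \<le> b \<bullet> v"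
    using max[OF fin(2) ne(2)] by blast
  have lt_a: "x \<bullet> v < a \<bullet> v" if "x \<in> F" "x \<noteq> a" for x
  proof -
    have "(x, a) \<in> F \<times> F \<union> G \<times> G" using that a(1) by blast
    from imageI[OF this, of "\<lambda>(x, y). x - y"] have "x - a \<in> D" using that(2) by (simp add: D_def)
    from v[OF this] a(2)[OF that(1)] show ?thesis by (simp add: inner_diff_left)
  qed
  have lt_b: "x \<bullet> v < b \<bullet> v" if "x \<in> G" "x \<noteq> b" for x
  proof -
    have "(x, b) \<in> F \<times> F \<union> G \<times> G" using that b(1) by blast
    from imageI[OF this, of "\<lambda>(x, y). x - y"] have "x - b \<in> D" using that(2) by (simp add: D_def)
    from v[OF this] b(2)[OF that(1)] show ?thesis by (simp add: inner_diff_left)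
  qed
  have uniq: "x = a \<and> y = b" if "x \<in> F" "y \<in> G" "a + b = x + y" for x y
  proof -
    have eq: "a \<bullet> v + b \<bullet> v = x \<bullet> v + y \<bullet> v" using arg_cong[OF that(3), of "\<lambda>z. z \<bullet> v"] by (simp add: inner_add_left)
    have "x = a"
    proof (rule ccontr)
      assume "x \<noteq> a"
      from lt_a[OF that(1) this] b(2)[OF that(2)] eq show False by linarith
    qed
    then show ?thesis using that(3) by simp
  qed
  have fin': "finite {x. Poly_Mapping.lookup f x \<noteq> 0}" "finite {x. Poly_Mapping.lookup g x \<noteq> 0}"
    by simp_all
  have "Poly_Mapping.lookup (f * g) (a + b) =
      (\<Sum>(x, y). Poly_Mapping.lookup f x * Poly_Mapping.lookup g y when a + b = x + y)"
    unfolding times_poly_mapping.rep_eq prod_fun_unfold_prod[OF fin'] ..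
  also have "\<dots> = (\<Sum>xy. (case xy of (x, y) \<Rightarrow>
      Poly_Mapping.lookup f x * Poly_Mapping.lookup g y) when (a, b) = xy)"
  proof (rule Sum_any.cong)
    fix xy :: "'a \<times> 'a"
    obtain x y where xy: "xy = (x, y)" by (cases xy)
    show "(case xy of (x, y) \<Rightarrow>
        Poly_Mapping.lookup f x * Poly_Mapping.lookup g y when a + b = x + y) =
      ((case xy of (x, y) \<Rightarrow> Poly_Mapping.lookup f x * Poly_Mapping.lookup g y) when (a, b) = xy)"
      using uniq[of x y] by (auto simp: xy when_def F_def G_def in_keys_iff)
  qed
  also have "\<dots> = Poly_Mapping.lookup f a * Poly_Mapping.lookup g b" by simp
  also have "\<dots> \<noteq> 0" using a(1) b(1) by (simp add: F_def G_def in_keys_iff)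
  finally have "Poly_Mapping.lookup (f * g) (a + b) \<noteq> 0" .
  then show ?thesis by (metis lookup_zero)
qed

typedef (overloaded) 'a ga_domain = "UNIV :: ('a::euclidean_space \<Rightarrow>\<^sub>0 complex) set"
  morphisms of_ga_domain to_ga_domain ..

setup_lifting type_definition_ga_domain

instantiation ga_domain :: (euclidean_space) idom
begin

lift_definition zero_ga_domain :: "'a ga_domain" is 0 .
lift_definition one_ga_domain :: "'a ga_domain" is 1 .
lift_definition plus_ga_domain :: "'a ga_domain \<Rightarrow> 'a ga_domain \<Rightarrow> 'a ga_domain" is "(+)" .
lift_definition minus_ga_domain :: "'a ga_domain \<Rightarrow> 'a ga_domain \<Rightarrow> 'a ga_domain" is "(-)" .
lift_definition uminus_ga_domain :: "'a ga_domain \<Rightarrow> 'a ga_domain" is "uminus" .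
lift_definition times_ga_domain :: "'a ga_domain \<Rightarrow> 'a ga_domain \<Rightarrow> 'a ga_domain" is "(*)" .

instance
  by standard
    (transfer; simp add: algebra_simps group_algebra_no_zero_divisors)+

end

definition ga_frac :: "('a::euclidean_space \<Rightarrow>\<^sub>0 complex) \<Rightarrow> 'a ga_domain fract" where
  "ga_frac f = Fract (to_ga_domain f) 1"

section \<open>Macdonald polynomials\<close>

definition qpoch_inf :: "complex \<Rightarrow> real \<Rightarrow> complex" where
  "qpoch_inf a q = prodinf (\<lambda>k. 1 - a * of_real q ^ k)"

text \<open>Coefficient of \<open>z ^ n\<close> in the power series expansion of \<open>(z; q\<^sub>\<alpha>)\<^sub>\<infinity> / (t\<^sub>\<alpha> z; q\<^sub>\<alpha>)\<^sub>\<infinity>\<close>, where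
  \<open>q\<^sub>\<alpha> = q powr u\<^sub>\<alpha>\<close>.\<close>

definition Delta_factor_coeff ::
  "'a::euclidean_space set \<Rightarrow> 'a set \<Rightarrow> real \<Rightarrow> ('a \<Rightarrow> real) \<Rightarrow> 'a \<Rightarrow> nat \<Rightarrow> complex" where
  "Delta_factor_coeff R S q t \<alpha> n =
     fps_nth (fps_expansion
       (\<lambda>z. qpoch_inf z (q powr u_factor R S \<alpha>) /
            qpoch_inf (of_real (t \<alpha>) * z) (q powr u_factor R S \<alpha>)) 0) n"

text \<open>Coefficient of \<open>e\<^sup>\<mu>\<close> in the product \<open>\<Delta>\<close> of these series at \<open>z = e\<^sup>\<alpha>\<close>, \<open>\<alpha> \<in> R\<close>.
  As \<open>\<alpha>\<close> and \<open>-\<alpha>\<close> both occur, this is an infinite (absolutely convergent) sum.\<close>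

definition Delta_coeff ::
  "'a::euclidean_space set \<Rightarrow> 'a set \<Rightarrow> real \<Rightarrow> ('a \<Rightarrow> real) \<Rightarrow> 'a \<Rightarrow> complex" where
  "Delta_coeff R S q t \<mu> =
     infsum (\<lambda>n. \<Prod>\<alpha>\<in>R. Delta_factor_coeff R S q t \<alpha> (n \<alpha>))
       {n \<in> R \<rightarrow>\<^sub>E UNIV. (\<Sum>\<alpha>\<in>R. real (n \<alpha>) *\<^sub>R \<alpha>) = \<mu>}"

definition Delta_constant_term ::
  "'a::euclidean_space set \<Rightarrow> 'a set \<Rightarrow> real \<Rightarrow> ('a \<Rightarrow> real) \<Rightarrow> ('a \<Rightarrow>\<^sub>0 complex) \<Rightarrow> complex" where
  "Delta_constant_term R S q t h =
     (\<Sum>\<mu>\<in>Poly_Mapping.keys h. Poly_Mapping.lookup h \<mu> * Delta_coeff R S q t (- \<mu>))"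

definition Delta_inner ::
  "'a::euclidean_space set \<Rightarrow> 'a set \<Rightarrow> real \<Rightarrow> ('a \<Rightarrow> real) \<Rightarrow>
   ('a \<Rightarrow>\<^sub>0 complex) \<Rightarrow> ('a \<Rightarrow>\<^sub>0 complex) \<Rightarrow> complex" where
  "Delta_inner R S q t f g =
     Delta_constant_term R S q t (f * ga_bar g) / of_nat (card (weyl_group R))"

definition dominant_strictly_below :: "'a::euclidean_space set \<Rightarrow> 'a set \<Rightarrow> 'a \<Rightarrow> 'a set" where
  "dominant_strictly_below R Rp lam =
     {\<mu> \<in> dominant_weights R Rp. dominance_le Rp \<mu> lam \<and> \<mu> \<noteq> lam}"

definition is_macdonald_poly ::
  "'a::euclidean_space set \<Rightarrow> 'a set \<Rightarrow> 'a set \<Rightarrow> real \<Rightarrow> ('a \<Rightarrow> real) \<Rightarrow>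
   'a \<Rightarrow> ('a \<Rightarrow>\<^sub>0 complex) \<Rightarrow> bool" where
  "is_macdonald_poly R Rp S q t lam p \<longleftrightarrow>
     (\<exists>a :: 'a \<Rightarrow> complex. p = monomial_sym R lam +
        (\<Sum>\<mu>\<in>dominant_strictly_below R Rp lam. ga_const (a \<mu>) * monomial_sym R \<mu>)) \<and>
     (\<forall>\<mu>\<in>dominant_strictly_below R Rp lam. Delta_inner R S q t p (monomial_sym R \<mu>) = 0)"

definition macdonald_poly ::
  "'a::euclidean_space set \<Rightarrow> 'a set \<Rightarrow> 'a set \<Rightarrow> real \<Rightarrow> ('a \<Rightarrow> real) \<Rightarrow>
   'a \<Rightarrow> ('a \<Rightarrow>\<^sub>0 complex)" where
  "macdonald_poly R Rp S q t lam = (THE p. is_macdonald_poly R Rp S q t lam p)"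

section \<open>The operator attached to a small weight\<close>

definition Lambda_saturated ::
  "'a::euclidean_space set \<Rightarrow> 'a set \<Rightarrow> 'a set \<Rightarrow> 'a \<Rightarrow> 'a set" where
  "Lambda_saturated R Rp S \<omega> = (\<Union>\<mu>\<in>dominant_Lambda_below R Rp S \<omega>. weyl_orbit R \<mu>)"

text \<open>\<open>v_factor \<tau> z\<close> is \<open>\<tau>\<^sup>-\<^sup>1\<^sup>/\<^sup>2 (1 - \<tau> z) / (1 - z)\<close>, and \<open>scaled_exp c \<mu>\<close> is \<open>c e\<^sup>\<mu>\<close>, both in the
  quotient field.\<close>

definition scaled_exp :: "real \<Rightarrow> 'a::euclidean_space \<Rightarrow> 'a ga_domain fract" where
  "scaled_exp c \<mu> = ga_frac (Poly_Mapping.single \<mu> (of_real c))"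

definition v_factor :: "real \<Rightarrow> 'a::euclidean_space ga_domain fract \<Rightarrow> 'a ga_domain fract" where
  "v_factor \<tau> z = scaled_exp (\<tau> powr (- 1 / 2)) 0 * ((1 - scaled_exp \<tau> 0 * z) / (1 - z))"

definition V_term ::
  "'a::euclidean_space set \<Rightarrow> 'a set \<Rightarrow> real \<Rightarrow> ('a \<Rightarrow> real) \<Rightarrow> 'a \<Rightarrow> 'a ga_domain fract" where
  "V_term R S q t \<nu> =
     (\<Prod>\<alpha> | \<alpha> \<in> R \<and> star R S \<alpha> \<bullet> \<nu> > 0. v_factor (t \<alpha>) (scaled_exp 1 \<alpha>)) *
     (\<Prod>\<alpha> | \<alpha> \<in> R \<and> star R S \<alpha> \<bullet> \<nu> = 2.
        v_factor (t \<alpha>) (scaled_exp (q powr u_factor R S \<alpha>) \<alpha>))"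

definition U_term ::
  "'a::euclidean_space set \<Rightarrow> 'a set \<Rightarrow> real \<Rightarrow> ('a \<Rightarrow> real) \<Rightarrow>
   'a \<Rightarrow> 'a \<Rightarrow> 'a ga_domain fract" where
  "U_term R S q t \<nu> \<eta> =
     (\<Prod>\<alpha> | \<alpha> \<in> R \<and> \<alpha> \<bullet> \<nu> = 0 \<and> star R S \<alpha> \<bullet> \<eta> > 0. v_factor (t \<alpha>) (scaled_exp 1 \<alpha>)) *
     (\<Prod>\<alpha> | \<alpha> \<in> R \<and> \<alpha> \<bullet> \<nu> = 0 \<and> star R S \<alpha> \<bullet> \<eta> = 2.
        v_factor (t \<alpha>) (scaled_exp (inverse (q powr u_factor R S \<alpha>)) (- \<alpha>)))"

text \<open>\<open>w \<nu>\<close> is the chosen element \<open>w\<^sub>\<nu>\<close> of the Weyl group, subject to \<open>dominating_choice\<close>.\<close>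

definition dominating_choice ::
  "'a::euclidean_space set \<Rightarrow> 'a set \<Rightarrow> 'a set \<Rightarrow> ('a \<Rightarrow> 'a \<Rightarrow> 'a) \<Rightarrow> bool" where
  "dominating_choice R Rp S w \<longleftrightarrow>
     (\<forall>\<nu> \<in> weight_lattice (coroot ` S).
        w \<nu> \<in> weyl_group R \<and> w \<nu> \<nu> \<in> dominant_Lambda R Rp S)"

definition D_operator ::
  "'a::euclidean_space set \<Rightarrow> 'a set \<Rightarrow> 'a set \<Rightarrow> real \<Rightarrow> ('a \<Rightarrow> real) \<Rightarrow>
   ('a \<Rightarrow> 'a \<Rightarrow> 'a) \<Rightarrow> 'a \<Rightarrow> ('a \<Rightarrow>\<^sub>0 complex) \<Rightarrow> 'a ga_domain fract" where
  "D_operator R Rp S q t w \<omega> f =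
     (\<Sum>\<nu>\<in>Lambda_saturated R Rp S \<omega>.
        \<Sum>\<eta>\<in>stabilizer_orbit R \<nu> (inv (w \<nu>) \<omega>).
          U_term R S q t \<nu> \<eta> * V_term R S q t \<nu> * ga_frac (translation q \<nu> f))"

section \<open>The eigenvalue\<close>

definition epsilon_coeff ::
  "'a::euclidean_space set \<Rightarrow> 'a set \<Rightarrow> 'a set \<Rightarrow> ('a \<Rightarrow> real) \<Rightarrow> 'a \<Rightarrow> 'a \<Rightarrow> real" where
  "epsilon_coeff R Rp S t \<omega> \<mu> =
     (\<Sum>\<eta>\<in>stabilizer_orbit R \<mu> \<omega>.
        \<Prod>\<alpha> | \<alpha> \<in> positive_star R Rp S \<and> \<alpha> \<bullet> \<mu> = 0 \<and> \<bar>\<alpha> \<bullet> \<eta>\<bar> = 1.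
          t \<alpha> powr ((\<alpha> \<bullet> \<eta>) / 2))"

definition E_symmetric ::
  "'a::euclidean_space set \<Rightarrow> 'a set \<Rightarrow> 'a set \<Rightarrow> ('a \<Rightarrow> real) \<Rightarrow> 'a \<Rightarrow> ('a \<Rightarrow>\<^sub>0 complex)" where
  "E_symmetric R Rp S t \<omega> =
     (\<Sum>\<mu>\<in>dominant_Lambda_below R Rp S \<omega>.
        ga_const (of_real (epsilon_coeff R Rp S t \<omega> \<mu>)) * monomial_sym R \<mu>)"

definition rho_t ::
  "'a::euclidean_space set \<Rightarrow> 'a set \<Rightarrow> 'a set \<Rightarrow> real \<Rightarrow> ('a \<Rightarrow> real) \<Rightarrow> 'a" where
  "rho_t R Rp S q t = (1 / 2) *\<^sub>R (\<Sum>\<alpha>\<in>positive_star R Rp S. log q (t \<alpha>) *\<^sub>R \<alpha>)"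

end

theory Submission
  imports Defs
begin

text \<open>
  Put \<open>\<eta>' = 2 \<nu> - \<eta>\<close>. Smallness of \<open>\<omega>\<close> turns the double sum defining \<open>D\<^sub>\<omega>\<close> into the sum over all pairs
  \<open>(\<eta>, \<eta>')\<close> in the orbit of \<open>\<omega>\<close> which are congruent modulo twice the coroot lattice of \<open>S\<close>, and \<open>\<nu>\<close> is
  the midpoint of such a pair. On Weyl invariant Laurent polynomials the poles along
  \<open>1 - e\<^sup>\<alpha>\<close> cancel between a pair and its image under \<open>s\<^sub>\<alpha>\<close>, and those along
  \<open>1 - q\<^sub>\<alpha> e\<^sup>\<alpha>\<close> cancel when only \<open>\<eta>'\<close> is reflected; so \<open>D\<^sub>\<omega>\<close> preserves the invariant
  Laurent polynomials. Expanding all factors at infinity in the positive chamber shows that \<open>D\<^sub>\<omega>\<close>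
  is triangular on the \<open>m\<^sub>\<lambda>\<close>, with \<open>E\<^sub>\<omega>(\<lambda> + \<rho>)\<close> on the diagonal. It is also symmetric for
  \<open>\<langle>\<cdot>, \<cdot>\<rangle>\<^sub>\<Delta>\<close>: after multiplication by the weight, in the convolution algebra of absolutely
  summable families, the term of \<open>(\<eta>, \<eta>')\<close> is adjoint to the term of \<open>(\<eta>', \<eta>)\<close>. Hence
  \<open>D\<^sub>\<omega> p\<^sub>\<lambda> - E\<^sub>\<omega>(\<lambda> + \<rho>) p\<^sub>\<lambda>\<close> is a combination of lower \<open>m\<^sub>\<mu>\<close> and orthogonal to all of them, so it vanishes
  because the form is definite.
\<close>

section \<open>Root systems\<close>

text \<open>Two obstacles shape the proof. With exponents in all of E a binomial
  \<open>1 - e^\<alpha>\<close> factors without end, starting with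
  \<open>(1 - e^(\<alpha>/2)) (1 + e^(\<alpha>/2))\<close>, so poles cannot be located by prime
  factors; regularity along a binomial means having a denominator that can be cancelled modulo it.
  The weight has factors for both \<alpha> and -\<alpha>, so its coefficients are infinite sums, and
  \<open>1 - e^\<alpha>\<close> is not invertible among summable families; hence the fractions in
  the operator cannot be mapped there. Instead the common denominator is divided out of the weight,
  which is possible because the q-difference equation of each factor exhibits it, up to a unit, as a
  multiple of \<open>1 - e^\<alpha>\<close>. Smallness enters through a table: only thirteen values
  of the pairings of \<nu> and \<eta> with a root occur, so each check at a root is finite. The
  eigenvalue arises from the limits \<open>t^(1/2)\<close> and \<open>t^(-1/2)\<close> of the
  function v at infinity and zero: roots not orthogonal to \<nu> produce \<rho>, and those
  orthogonal to \<nu> produce \<epsilon>.\<close>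

lemma coroot_zero [simp]: "coroot 0 = 0"
  by (simp add: coroot_def)

lemma inner_coroot_self: "\<alpha> \<noteq> 0 \<Longrightarrow> \<alpha> \<bullet> coroot \<alpha> = 2"
  by (simp add: coroot_def)

lemma inner_coroot: "x \<bullet> coroot \<alpha> = 2 * (x \<bullet> \<alpha>) / (\<alpha> \<bullet> \<alpha>)"
  by (simp add: coroot_def)

lemma coroot_minus [simp]: "coroot (- \<alpha>) = - coroot \<alpha>"
  by (simp add: coroot_def)

lemma coroot_coroot [simp]: "coroot (coroot \<alpha>) = \<alpha>"
  by (cases "\<alpha> = 0") (simp_all add: coroot_def)

lemma inner_coroot_pos_iff: "\<alpha> \<noteq> 0 \<Longrightarrow> x \<bullet> coroot \<alpha> > 0 \<longleftrightarrow> x \<bullet> \<alpha> > 0"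
  using inner_gt_zero_iff[of \<alpha>] by (simp only: inner_coroot zero_less_divide_iff mult_less_0_iff zero_less_mult_iff) (auto simp flip: inner_gt_zero_iff)

lemma inner_coroot_nonneg_iff: "\<alpha> \<noteq> 0 \<Longrightarrow> x \<bullet> coroot \<alpha> \<ge> 0 \<longleftrightarrow> x \<bullet> \<alpha> \<ge> 0"
  using inner_gt_zero_iff[of \<alpha>] by (simp only: inner_coroot zero_le_divide_iff mult_le_0_iff zero_le_mult_iff not_le[symmetric]) auto

lemma linear_reflection: "linear (reflection \<alpha>)"
  by (rule linearI) (simp_all add: reflection_def algebra_simps inner_add_left)

lemma reflection_inner [simp]: "reflection \<alpha> x \<bullet> reflection \<alpha> y = x \<bullet> y"
proof (cases "\<alpha> = 0")
  case True
  then show ?thesis by (simp add: reflection_def)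
next
  case False
  then have "\<alpha> \<bullet> \<alpha> \<noteq> 0" by simp
  then show ?thesis
    by (simp add: reflection_def coroot_def inner_diff_left inner_diff_right inner_commute field_simps)
qed

lemma reflection_reflection [simp]: "reflection \<alpha> (reflection \<alpha> x) = x"
proof (cases "\<alpha> = 0")
  case True
  then show ?thesis by (simp add: reflection_def)
next
  case False
  then show ?thesis
    by (simp add: reflection_def inner_diff_left inner_coroot_self algebra_simps)
qed

lemma reflection_self: "reflection \<alpha> \<alpha> = - \<alpha>"
  by (cases "\<alpha> = 0") (simp_all add: reflection_def inner_coroot_self scaleR_2)

lemma reflection_minus [simp]: "reflection (- \<alpha>) = reflection \<alpha>"
  by (rule ext) (simp add: reflection_def)

lemma reflection_adjoint: "reflection \<alpha> x \<bullet> y = x \<bullet> reflection \<alpha> y"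
  using reflection_inner[of \<alpha> x "reflection \<alpha> y"] by simp

lemma reflection_conj:
  assumes "linear w" "\<And>x y. w x \<bullet> w y = x \<bullet> y"
  shows "w (reflection \<alpha> x) = reflection (w \<alpha>) (w x)"
  using assms by (simp add: reflection_def coroot_def linear_diff linear_cmul)

text \<open>The generic vector is a parameter because it does more than define positivity: pairing
  with \<open>v\<close> serves as a height, which drives the inductions on roots and weights and
  selects extremal elements of finite sets.\<close>

locale root_sys =
  fixes R Rp :: "'a::euclidean_space set" and v :: 'a
  assumes reduced: "reduced_root_system R"
    and generic: "\<And>\<alpha>. \<alpha> \<in> R \<Longrightarrow> \<alpha> \<bullet> v \<noteq> 0"
    and Rp_def: "Rp = {\<alpha> \<in> R. \<alpha> \<bullet> v > 0}"
begin

abbreviation "W \<equiv> weyl_group R"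

lemma root_system: "root_system R"
  using reduced by (simp add: reduced_root_system_def)

lemma finite_R [simp]: "finite R" and span_R: "span R = UNIV"
  using root_system by (auto simp: root_system_def)

lemma root_nonzero: "\<alpha> \<in> R \<Longrightarrow> \<alpha> \<noteq> 0"
  using root_system by (auto simp: root_system_def)

lemma reflection_root: "\<alpha> \<in> R \<Longrightarrow> \<beta> \<in> R \<Longrightarrow> reflection \<alpha> \<beta> \<in> R"
  using root_system by (auto simp: root_system_def)

lemma root_integral: "\<alpha> \<in> R \<Longrightarrow> \<beta> \<in> R \<Longrightarrow> \<beta> \<bullet> coroot \<alpha> \<in> \<int>"
  using root_system by (auto simp: root_system_def)

lemma root_multiple: "\<alpha> \<in> R \<Longrightarrow> c *\<^sub>R \<alpha> \<in> R \<Longrightarrow> c = 1 \<or> c = -1"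
  using reduced by (auto simp: reduced_root_system_def)

lemma root_minus: "\<alpha> \<in> R \<Longrightarrow> - \<alpha> \<in> R"
  using reflection_root[of \<alpha> \<alpha>] by (simp add: reflection_self)

lemma finite_Rp [simp]: "finite Rp"
  by (simp add: Rp_def)

lemma Rp_R: "\<alpha> \<in> Rp \<Longrightarrow> \<alpha> \<in> R"
  by (simp add: Rp_def)

lemma Rp_pos: "\<alpha> \<in> Rp \<Longrightarrow> \<alpha> \<bullet> v > 0"
  by (simp add: Rp_def)

lemma Rp_cases: "\<alpha> \<in> R \<Longrightarrow> \<alpha> \<in> Rp \<or> - \<alpha> \<in> Rp"
  using generic[of \<alpha>] root_minus[of \<alpha>] by (auto simp: Rp_def)

lemma Rp_not_minus: "\<alpha> \<in> Rp \<Longrightarrow> - \<alpha> \<notin> Rp"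
  by (auto simp: Rp_def)

section \<open>The Weyl group: isometries, inverses, finiteness and orbits\<close>

lemma weyl_linear: "w \<in> W \<Longrightarrow> linear w"
proof (induction rule: weyl_group.induct)
  case weyl_id
  show ?case by (rule linear_id)
next
  case (weyl_step \<alpha> w)
  show ?case by (rule linear_compose[OF weyl_step(3) linear_reflection])
qed

lemma weyl_inner: "w \<in> W \<Longrightarrow> w x \<bullet> w y = x \<bullet> y"
  by (induction rule: weyl_group.induct) auto

lemma weyl_norm: "w \<in> W \<Longrightarrow> norm (w x) = norm x"
  by (simp add: norm_eq_sqrt_inner weyl_inner)

lemma weyl_root: "w \<in> W \<Longrightarrow> \<alpha> \<in> R \<Longrightarrow> w \<alpha> \<in> R"
  by (induction rule: weyl_group.induct) (auto intro: reflection_root)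

lemma weyl_comp: "w \<in> W \<Longrightarrow> w' \<in> W \<Longrightarrow> w \<circ> w' \<in> W"
  by (induction rule: weyl_group.induct) (auto simp: comp_assoc intro: weyl_group.intros)

lemma weyl_reflection: "\<alpha> \<in> R \<Longrightarrow> reflection \<alpha> \<in> W"
  using weyl_step[OF _ weyl_id] by fastforce

lemma weyl_inverse: "w \<in> W \<Longrightarrow> \<exists>w'\<in>W. w' \<circ> w = id \<and> w \<circ> w' = id"
proof (induction rule: weyl_group.induct)
  case weyl_id
  then show ?case by (intro bexI[of _ id]) (auto intro: weyl_group.intros)
next
  case (weyl_step \<alpha> w)
  then obtain w' where w': "w' \<in> W" "w' \<circ> w = id" "w \<circ> w' = id" by blast
  have "(w' \<circ> reflection \<alpha>) \<circ> (reflection \<alpha> \<circ> w) = id"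
    using w'(2) by (auto simp: fun_eq_iff)
  moreover have "(reflection \<alpha> \<circ> w) \<circ> (w' \<circ> reflection \<alpha>) = id"
    using w'(3) by (auto simp: fun_eq_iff)
  moreover have "w' \<circ> reflection \<alpha> \<in> W"
    using w'(1) weyl_step by (intro weyl_comp weyl_reflection)
  ultimately show ?case by blast
qed

lemma weyl_inv: assumes "w \<in> W"
  shows "inv w \<in> W" and "inv w (w x) = x" and "w (inv w x) = x" and "bij w"
proof -
  obtain w' where w': "w' \<in> W" "w' \<circ> w = id" "w \<circ> w' = id" using weyl_inverse[OF assms] by blast
  show bij: "bij w" using w'(2,3) o_bij by blast
  have "inv w = w'" using w'(2,3) by (metis inv_unique_comp)
  then show "inv w \<in> W" using w' by simp
  show "inv w (w x) = x" using bij by (simp add: bij_is_inj)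
  show "w (inv w x) = x" using bij by (simp add: bij_is_surj surj_f_inv_f)
qed

lemma weyl_image_R: "w \<in> W \<Longrightarrow> w ` R = R"
  by (rule endo_inj_surj) (auto intro: weyl_root inj_on_subset[OF bij_is_inj[OF weyl_inv(4)]])

lemma weyl_zero: "w \<in> W \<Longrightarrow> w 0 = 0"
  by (simp add: weyl_linear linear_0)

lemma weyl_add: "w \<in> W \<Longrightarrow> w (x + y) = w x + w y"
  by (simp add: weyl_linear linear_add)

lemma weyl_diff: "w \<in> W \<Longrightarrow> w (x - y) = w x - w y"
  by (simp add: weyl_linear linear_diff)

lemma weyl_minus: "w \<in> W \<Longrightarrow> w (- x) = - w x"
  by (simp add: weyl_linear linear_neg)

lemma weyl_scale: "w \<in> W \<Longrightarrow> w (c *\<^sub>R x) = c *\<^sub>R w x"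
  by (simp add: weyl_linear linear_cmul)

lemma weyl_coroot: "w \<in> W \<Longrightarrow> w (coroot \<alpha>) = coroot (w \<alpha>)"
  using weyl_inner[of w \<alpha> \<alpha>]
  by (simp add: coroot_def weyl_scale)

lemma weyl_reflection_conj: "w \<in> W \<Longrightarrow> w (reflection \<alpha> x) = reflection (w \<alpha>) (w x)"
  by (rule reflection_conj[OF weyl_linear weyl_inner])

lemma weyl_inner_swap: "w \<in> W \<Longrightarrow> w x \<bullet> y = x \<bullet> inv w y"
  by (metis weyl_inner weyl_inv(3))

text \<open>Elements of \<open>W\<close> are linear and \<open>R\<close> spans, so each is
  determined by the permutation of the finite set \<open>R\<close> that it induces.\<close>

lemma finite_W [simp]: "finite W"
proof -
  have "inj_on (\<lambda>w. restrict w R) W"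
  proof (rule inj_onI)
    fix w w' assume w: "w \<in> W" "w' \<in> W" and eq: "restrict w R = restrict w' R"
    have "w x = w' x" if "x \<in> R" for x using eq that by (metis restrict_apply')
    then have "w x = w' x" for x
      using linear_eq_on_span[OF weyl_linear[OF w(1)] weyl_linear[OF w(2)], of R x] span_R by auto
    then show "w = w'" by auto
  qed
  moreover have "(\<lambda>w. restrict w R) ` W \<subseteq> R \<rightarrow>\<^sub>E R" using weyl_root by auto
  moreover have "finite (R \<rightarrow>\<^sub>E R)" by (intro finite_PiE) auto
  ultimately show ?thesis by (meson finite_imageD finite_subset)
qed

lemma card_W_pos: "card W > 0"
  using weyl_id by (auto simp: card_gt_0_iff)

lemma finite_orbit [simp]: "finite (weyl_orbit R x)"
  by (simp add: weyl_orbit_def)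

lemma orbitI: "w \<in> W \<Longrightarrow> w x \<in> weyl_orbit R x"
  by (simp add: weyl_orbit_def)

lemma orbit_self: "x \<in> weyl_orbit R x"
  using orbitI[OF weyl_id] by simp

lemma orbitE: assumes "y \<in> weyl_orbit R x" obtains w where "w \<in> W" "y = w x"
  using assms by (auto simp: weyl_orbit_def)

lemma orbit_sym: assumes "y \<in> weyl_orbit R x" shows "x \<in> weyl_orbit R y"
proof -
  obtain w where w: "w \<in> W" "y = w x" using assms by (rule orbitE)
  then show ?thesis using orbitI[OF weyl_inv(1)[OF w(1)], of y] weyl_inv(2)[OF w(1)] by simp
qed

lemma orbit_closed: assumes "y \<in> weyl_orbit R x" "w \<in> W" shows "w y \<in> weyl_orbit R x"
proof -
  obtain w' where w: "w' \<in> W" "y = w' x" using assms(1) by (rule orbitE)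
  then show ?thesis using orbitI[OF weyl_comp[OF assms(2) w(1)], of x] by simp
qed

lemma orbit_trans: assumes "z \<in> weyl_orbit R y" "y \<in> weyl_orbit R x" shows "z \<in> weyl_orbit R x"
proof -
  obtain w where w: "w \<in> W" "z = w y" using assms(1) by (rule orbitE)
  then show ?thesis using orbit_closed[OF assms(2)] by simp
qed

lemma orbit_eq: "y \<in> weyl_orbit R x \<Longrightarrow> weyl_orbit R y = weyl_orbit R x"
  using orbit_trans orbit_sym by blast

text \<open>Reflecting in a positive root with negative pairing raises the height. The set
  \<open>X\<close> is arbitrary so that the argument serves full orbits, stabilizer orbits and sets
  of images of \<open>v\<close> alike.\<close>

lemma maximal_imp_dominant:
  assumes X: "finite X" and x: "x \<in> X" "\<And>y. y \<in> X \<Longrightarrow> y \<bullet> v \<le> x \<bullet> v"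
    and \<alpha>: "\<alpha> \<in> Rp" "reflection \<alpha> x \<in> X"
  shows "x \<bullet> \<alpha> \<ge> 0"
proof (rule ccontr)
  assume "\<not> x \<bullet> \<alpha> \<ge> 0"
  then have "x \<bullet> coroot \<alpha> < 0"
    using inner_coroot_nonneg_iff[of \<alpha> x] root_nonzero[OF Rp_R[OF \<alpha>(1)]] by simp
  then have "(x \<bullet> coroot \<alpha>) * (\<alpha> \<bullet> v) < 0" using Rp_pos[OF \<alpha>(1)] by (simp add: mult_neg_pos)
  then have "reflection \<alpha> x \<bullet> v > x \<bullet> v" by (simp add: reflection_def inner_diff_left)
  with x(2)[OF \<alpha>(2)] show False by simp
qed

lemma maximal_exists:
  assumes "finite X" "X \<noteq> {}"
  obtains x where "x \<in> X" "\<And>y. y \<in> X \<Longrightarrow> y \<bullet> (z::'a) \<le> x \<bullet> z"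
proof -
  have "Max ((\<lambda>x. x \<bullet> z) ` X) \<in> (\<lambda>x. x \<bullet> z) ` X" using assms by (intro Max_in) auto
  then obtain m where m: "m \<in> X" "Max ((\<lambda>x. x \<bullet> z) ` X) = m \<bullet> z" by blast
  show ?thesis
  proof (rule that[OF m(1)])
    fix y assume "y \<in> X"
    then show "y \<bullet> z \<le> m \<bullet> z" unfolding m(2)[symmetric] using assms(1) by (intro Max_ge) auto
  qed
qed

definition dominant :: "'a \<Rightarrow> bool" where
  "dominant x \<longleftrightarrow> (\<forall>\<alpha>\<in>Rp. x \<bullet> \<alpha> \<ge> 0)"

lemma exists_dominant: "\<exists>w\<in>W. dominant (w x)"
proof -
  obtain y where y: "y \<in> weyl_orbit R x" "\<And>z. z \<in> weyl_orbit R x \<Longrightarrow> z \<bullet> v \<le> y \<bullet> v"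
    using maximal_exists[of "weyl_orbit R x" v] orbit_self by auto
  have "dominant y"
    unfolding dominant_def
    using maximal_imp_dominant[OF finite_orbit y] orbit_closed[OF y(1)] weyl_reflection Rp_R by blast
  then show ?thesis using y(1) by (auto elim: orbitE)
qed

text \<open>The conclusion says that \<open>u \<eta>\<close> is dominant for the root subsystem orthogonal to \<open>\<mu>\<close>.\<close>

lemma exists_stabilizer_dominant:
  "\<exists>u\<in>weyl_stabilizer R \<mu>. \<forall>\<alpha>\<in>Rp. \<alpha> \<bullet> \<mu> = 0 \<longrightarrow> u \<eta> \<bullet> \<alpha> \<ge> 0"
proof -
  let ?X = "stabilizer_orbit R \<mu> \<eta>"
  have fin: "finite ?X" by (simp add: stabilizer_orbit_def weyl_stabilizer_def)
  have "\<eta> \<in> ?X" unfolding stabilizer_orbit_def weyl_stabilizer_def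
    by (rule image_eqI[of _ _ id]) (auto intro: weyl_id)
  then obtain y where y: "y \<in> ?X" "\<And>z. z \<in> ?X \<Longrightarrow> z \<bullet> v \<le> y \<bullet> v"
    using maximal_exists[OF fin, of v] by auto
  then obtain u where u: "u \<in> weyl_stabilizer R \<mu>" "y = u \<eta>" by (auto simp: stabilizer_orbit_def)
  have "y \<bullet> \<alpha> \<ge> 0" if "\<alpha> \<in> Rp" "\<alpha> \<bullet> \<mu> = 0" for \<alpha>
  proof (rule maximal_imp_dominant[OF fin y that(1)])
    have "reflection \<alpha> \<mu> = \<mu>" using that(2) by (simp add: reflection_def inner_coroot inner_commute)
    then have "reflection \<alpha> \<circ> u \<in> weyl_stabilizer R \<mu>"
      using u(1) that(1) by (auto simp: weyl_stabilizer_def intro: weyl_comp weyl_reflection Rp_R)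
    then show "reflection \<alpha> y \<in> ?X" unfolding stabilizer_orbit_def u(2)
      by (intro image_eqI[of _ _ "reflection \<alpha> \<circ> u"]) auto
  qed
  then show ?thesis using u by auto
qed

text \<open>The two Cartan integers are positive, and their product is four times the squared cosine
  of the angle, hence at most 4. If both were at least 2, the roots would be proportional, which
  reducedness excludes for distinct roots at an acute angle.\<close>

lemma cartan_product:
  assumes "\<alpha> \<in> R" "\<beta> \<in> R" "\<alpha> \<noteq> \<beta>" "\<alpha> \<bullet> \<beta> > 0"
  shows "\<alpha> \<bullet> coroot \<beta> = 1 \<or> \<beta> \<bullet> coroot \<alpha> = 1"
proof -
  have nz: "\<alpha> \<bullet> \<alpha> > 0" "\<beta> \<bullet> \<beta> > 0" using assms root_nonzero by auto
  obtain a b :: int where ab: "\<alpha> \<bullet> coroot \<beta> = of_int a" "\<beta> \<bullet> coroot \<alpha> = of_int b"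
    using root_integral[of \<alpha> \<beta>] root_integral[of \<beta> \<alpha>] assms by (auto elim!: Ints_cases)
  have pos: "a > 0" "b > 0"
    using ab inner_coroot_pos_iff[of \<beta> \<alpha>] inner_coroot_pos_iff[of \<alpha> \<beta>] assms root_nonzero
    by (auto simp: inner_commute)
  have prod: "real_of_int (a * b) = 4 * (\<alpha> \<bullet> \<beta>)\<^sup>2 / ((\<alpha> \<bullet> \<alpha>) * (\<beta> \<bullet> \<beta>))"
    using ab by (simp flip: ab add: inner_coroot inner_commute power2_eq_square)
  have cs: "(\<alpha> \<bullet> \<beta>)\<^sup>2 \<le> (\<alpha> \<bullet> \<alpha>) * (\<beta> \<bullet> \<beta>)" by (rule Cauchy_Schwarz_ineq)
  have "\<not> (a \<ge> 2 \<and> b \<ge> 2)"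
  proof
    assume ge: "a \<ge> 2 \<and> b \<ge> 2"
    then have "a * b \<ge> 2 * 2" by (intro mult_mono) auto
    then have "4 \<le> real_of_int (a * b)" by linarith
    then have "(\<alpha> \<bullet> \<beta>)\<^sup>2 \<ge> (\<alpha> \<bullet> \<alpha>) * (\<beta> \<bullet> \<beta>)"
      unfolding prod using nz by (simp add: le_divide_eq)
    then have eq: "(\<alpha> \<bullet> \<beta>)\<^sup>2 = (\<alpha> \<bullet> \<alpha>) * (\<beta> \<bullet> \<beta>)" using cs by simp
    then have "(norm \<alpha> * norm \<beta>)\<^sup>2 = (\<alpha> \<bullet> \<beta>)\<^sup>2" by (simp add: power_mult_distrib power2_norm_eq_inner)
    then have "norm \<alpha> * norm \<beta> = \<alpha> \<bullet> \<beta>" using assms(4)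
      by (smt (verit) norm_ge_zero power2_eq_imp_eq mult_nonneg_nonneg)
    then have "\<alpha> \<bullet> \<beta> = norm \<alpha> * norm \<beta>" by simp
    then have "norm \<alpha> *\<^sub>R \<beta> = norm \<beta> *\<^sub>R \<alpha>" using norm_cauchy_schwarz_eq by blast
    moreover have "norm \<alpha> > 0" using nz by auto
    ultimately have \<beta>: "\<beta> = (norm \<beta> / norm \<alpha>) *\<^sub>R \<alpha>"
      by (metis divide_inverse_commute divideR_right less_irrefl scaleR_scaleR)
    then have "norm \<beta> / norm \<alpha> = 1 \<or> norm \<beta> / norm \<alpha> = -1" using root_multiple assms(1,2) by metis
    moreover have "norm \<beta> / norm \<alpha> \<ge> 0" by simp
    ultimately have "norm \<beta> / norm \<alpha> = 1" by linarith
    then have "\<beta> = \<alpha>" by (subst \<beta>) (simp only: scaleR_one)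
    then show False using assms(3) by simp
  qed
  then have "a = 1 \<or> b = 1" using pos by linarith
  then show ?thesis using ab by auto
qed

lemma root_difference:
  assumes "\<alpha> \<in> R" "\<beta> \<in> R" "\<alpha> \<noteq> \<beta>" "\<alpha> \<bullet> \<beta> > 0"
  shows "\<alpha> - \<beta> \<in> R"
  using cartan_product[OF assms]
proof
  assume "\<alpha> \<bullet> coroot \<beta> = 1"
  then show ?thesis using reflection_root[OF assms(2,1)] by (simp add: reflection_def)
next
  assume "\<beta> \<bullet> coroot \<alpha> = 1"
  then have "\<beta> - \<alpha> \<in> R" using reflection_root[OF assms(1,2)] by (simp add: reflection_def)
  then show ?thesis using root_minus by fastforce
qed

section \<open>Simple roots, words in simple reflections and the exchange condition\<close>

definition simple_roots :: "'a set" where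
  "simple_roots = {\<alpha> \<in> Rp. \<not> (\<exists>\<beta>\<in>Rp. \<exists>\<gamma>\<in>Rp. \<alpha> = \<beta> + \<gamma>)}"

lemma simple_Rp: "\<alpha> \<in> simple_roots \<Longrightarrow> \<alpha> \<in> Rp"
  by (simp add: simple_roots_def)

text \<open>Both summands of a decomposable positive root have smaller height. Heights are real
  numbers, so the measure is the number of positive roots of smaller height.\<close>

lemma Rp_induct [consumes 1, case_names simple add]:
  assumes "\<alpha> \<in> Rp"
    and "\<And>\<alpha>. \<alpha> \<in> simple_roots \<Longrightarrow> P \<alpha>"
    and "\<And>\<alpha> \<beta>. \<alpha> \<in> Rp \<Longrightarrow> \<beta> \<in> Rp \<Longrightarrow> \<alpha> + \<beta> \<in> Rp \<Longrightarrow> P \<alpha> \<Longrightarrow> P \<beta> \<Longrightarrow> P (\<alpha> + \<beta>)"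
  shows "P \<alpha>"
  using assms(1)
proof (induction "card {\<beta> \<in> Rp. \<beta> \<bullet> v < \<alpha> \<bullet> v}" arbitrary: \<alpha> rule: less_induct)
  case less
  show ?case
  proof (cases "\<alpha> \<in> simple_roots")
    case True
    then show ?thesis by (rule assms(2))
  next
    case False
    then obtain \<beta> \<gamma> where bg: "\<beta> \<in> Rp" "\<gamma> \<in> Rp" "\<alpha> = \<beta> + \<gamma>"
      using less.prems by (auto simp: simple_roots_def)
    have smaller: "card {\<delta> \<in> Rp. \<delta> \<bullet> v < \<kappa> \<bullet> v} < card {\<delta> \<in> Rp. \<delta> \<bullet> v < \<alpha> \<bullet> v}"
      if "\<kappa> \<in> Rp" "\<kappa> \<bullet> v < \<alpha> \<bullet> v" for \<kappa>
      by (rule psubset_card_mono) (use that in auto)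
    have "\<beta> \<bullet> v < \<alpha> \<bullet> v" "\<gamma> \<bullet> v < \<alpha> \<bullet> v"
      using bg Rp_pos[OF bg(1)] Rp_pos[OF bg(2)] by (auto simp: inner_add_left)
    then show ?thesis
      using assms(3)[OF bg(1,2)] less.hyps[OF smaller] bg less.prems by simp
  qed
qed

text \<open>Simplicity is indecomposability, so the argument follows the root string from
  \<open>\<beta>\<close> down to its reflection: a step from a positive to a negative root would
  write \<open>\<alpha>\<close> as a sum of two positive roots.\<close>

lemma simple_reflection_Rp:
  assumes \<alpha>: "\<alpha> \<in> simple_roots" and \<beta>: "\<beta> \<in> Rp" "\<beta> \<noteq> \<alpha>"
  shows "reflection \<alpha> \<beta> \<in> Rp"
proof (rule ccontr)
  assume neg: "reflection \<alpha> \<beta> \<notin> Rp"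
  have \<alpha>R: "\<alpha> \<in> R" "\<alpha> \<in> Rp" "\<alpha> \<noteq> 0" using simple_Rp[OF \<alpha>] Rp_R root_nonzero by auto
  have \<beta>R: "\<beta> \<in> R" using \<beta> Rp_R by auto
  obtain k :: int where k: "\<beta> \<bullet> coroot \<alpha> = of_int k"
    using root_integral[OF \<alpha>R(1) \<beta>R] by (auto elim: Ints_cases)
  have notmult: "\<beta> - c *\<^sub>R \<alpha> \<noteq> \<alpha>" for c
  proof
    assume "\<beta> - c *\<^sub>R \<alpha> = \<alpha>"
    then have "\<beta> = (1 + c) *\<^sub>R \<alpha>" by (simp add: algebra_simps)
    then have "1 + c = 1 \<or> 1 + c = -1" using root_multiple \<alpha>R(1) \<beta>R by metis
    then have "\<beta> = \<alpha> \<or> \<beta> = - \<alpha>" using \<open>\<beta> = (1 + c) *\<^sub>R \<alpha>\<close> by fastforce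
    then show False using \<beta> Rp_not_minus[OF \<alpha>R(2)] by auto
  qed
  \<comment> \<open>As long as the pairing with \<open>\<alpha>\<close> is positive,
    \<open>root_difference\<close> permits one more subtraction; the bound says exactly that the
    pairing before the last step was positive.\<close>
  have half: "\<beta> - of_nat j *\<^sub>R \<alpha> \<in> R" if "2 * int j \<le> k + 1" for j
    using that
  proof (induction j)
    case 0
    then show ?case using \<beta>R by simp
  next
    case (Suc j)
    then have IH: "\<beta> - of_nat j *\<^sub>R \<alpha> \<in> R" by simp
    have "(\<beta> - of_nat j *\<^sub>R \<alpha>) \<bullet> coroot \<alpha> = of_int (k - 2 * int j)"
      using k inner_coroot_self[OF \<alpha>R(3)] by (simp add: inner_diff_left)
    moreover have "k - 2 * int j > 0" using Suc.prems by simp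
    ultimately have "(\<beta> - of_nat j *\<^sub>R \<alpha>) \<bullet> coroot \<alpha> > 0" by simp
    then have "(\<beta> - of_nat j *\<^sub>R \<alpha>) \<bullet> \<alpha> > 0" using inner_coroot_pos_iff[OF \<alpha>R(3)] by blast
    then have "\<beta> - of_nat j *\<^sub>R \<alpha> - \<alpha> \<in> R"
      using root_difference[OF IH \<alpha>R(1)] notmult by blast
    then show ?case by (simp add: algebra_simps)
  qed
  \<comment> \<open>The second half of the string is the mirror image of the first: the reflection
    sends index \<open>k - j\<close> to index \<open>j\<close>.\<close>
  have string: "\<beta> - of_nat j *\<^sub>R \<alpha> \<in> R" if "int j \<le> k" for j
  proof (cases "2 * int j \<le> k + 1")
    case True
    then show ?thesis by (rule half)
  next
    case False
    have j: "of_nat (nat (k - int j)) = (of_int k - of_nat j :: real)" using that by simp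
    have "\<beta> - of_nat (nat (k - int j)) *\<^sub>R \<alpha> \<in> R" using that False by (intro half) auto
    then have "reflection \<alpha> (\<beta> - (of_int k - of_nat j) *\<^sub>R \<alpha>) \<in> R"
      unfolding j by (intro reflection_root \<alpha>R(1))
    moreover have "reflection \<alpha> (\<beta> - (of_int k - of_nat j) *\<^sub>R \<alpha>) = \<beta> - of_nat j *\<^sub>R \<alpha>"
      using k inner_coroot_self[OF \<alpha>R(3)]
      by (simp add: reflection_def inner_diff_left algebra_simps flip: scaleR_add_left)
    ultimately show ?thesis by simp
  qed
  have refl: "reflection \<alpha> \<beta> = \<beta> - of_int k *\<^sub>R \<alpha>" using k by (simp add: reflection_def)
  have "k > 0"
  proof (rule ccontr)
    assume "\<not> k > 0"
    then have "\<beta> \<bullet> v \<le> (\<beta> - of_int k *\<^sub>R \<alpha>) \<bullet> v"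
      using Rp_pos[OF \<alpha>R(2)] by (simp add: inner_diff_left mult_nonpos_nonneg)
    then have "reflection \<alpha> \<beta> \<in> Rp"
      using Rp_pos[OF \<beta>(1)] reflection_root[OF \<alpha>R(1) \<beta>R] unfolding refl Rp_def by simp
    then show False using neg by simp
  qed
  have pos: "\<beta> - of_nat j *\<^sub>R \<alpha> \<in> Rp" if "int j \<le> k" for j
    using that
  proof (induction j)
    case 0
    then show ?case using \<beta> by simp
  next
    case (Suc j)
    then have IH: "\<beta> - of_nat j *\<^sub>R \<alpha> \<in> Rp" by simp
    show ?case
    proof (rule ccontr)
      assume "\<not> ?thesis"
      then have "- (\<beta> - of_nat (Suc j) *\<^sub>R \<alpha>) \<in> Rp" using Rp_cases[OF string[OF Suc.prems]] by blast
      moreover have "\<alpha> = (\<beta> - of_nat j *\<^sub>R \<alpha>) + - (\<beta> - of_nat (Suc j) *\<^sub>R \<alpha>)"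
        by (simp add: algebra_simps)
      ultimately show False using \<alpha> IH unfolding simple_roots_def by blast
    qed
  qed
  have "of_nat (nat k) = (of_int k :: real)" using \<open>k > 0\<close> by simp
  then have "\<beta> - of_int k *\<^sub>R \<alpha> \<in> Rp" using pos[of "nat k"] \<open>k > 0\<close> by simp
  then show False using neg refl by simp
qed

lemma simple_dominant:
  assumes "\<And>\<alpha>. \<alpha> \<in> simple_roots \<Longrightarrow> x \<bullet> \<alpha> \<ge> 0" and "\<beta> \<in> Rp"
  shows "x \<bullet> \<beta> \<ge> 0"
  using assms(2) by (induction rule: Rp_induct) (auto simp: assms(1) inner_add_right)

primrec word :: "'a list \<Rightarrow> 'a \<Rightarrow> 'a" where
  "word [] = id"
| "word (\<alpha> # s) = reflection \<alpha> \<circ> word s"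

lemma word_append: "word (s @ s') = word s \<circ> word s'"
  by (induction s) (auto simp: comp_assoc)

lemma word_W: "set s \<subseteq> simple_roots \<Longrightarrow> word s \<in> W"
  by (induction s) (auto intro!: weyl_group.intros Rp_R simple_Rp)

text \<open>A positive root pairs positively with some simple root, since otherwise its negative
  would pair nonnegatively with every positive root, itself included. If it is not simple,
  reflecting there gives a positive root of smaller height, and conjugation recovers the
  reflection.\<close>

lemma reflection_word:
  assumes "\<beta> \<in> Rp"
  shows "\<exists>s. set s \<subseteq> simple_roots \<and> reflection \<beta> = word s"
  using assms
proof (induction "card {\<delta> \<in> Rp. \<delta> \<bullet> v < \<beta> \<bullet> v}" arbitrary: \<beta> rule: less_induct)
  case less
  show ?case
  proof (cases "\<beta> \<in> simple_roots")
    case True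
    then show ?thesis by (intro exI[of _ "[\<beta>]"]) simp
  next
    case False
    have "\<exists>\<alpha>\<in>simple_roots. \<beta> \<bullet> \<alpha> > 0"
    proof (rule ccontr)
      assume "\<not> ?thesis"
      then have "(- \<beta>) \<bullet> \<beta> \<ge> 0" by (intro simple_dominant[OF _ less.prems]) (auto simp: not_less)
      then show False using root_nonzero[OF Rp_R[OF less.prems]] inner_gt_zero_iff[of \<beta>]
        by (simp del: inner_gt_zero_iff)
    qed
    then obtain \<alpha> where \<alpha>: "\<alpha> \<in> simple_roots" "\<beta> \<bullet> \<alpha> > 0" by auto
    define \<gamma> where "\<gamma> = reflection \<alpha> \<beta>"
    have \<alpha>': "\<alpha> \<in> Rp" "\<alpha> \<in> R" "\<alpha> \<noteq> 0" using simple_Rp[OF \<alpha>(1)] Rp_R root_nonzero by auto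
    have \<gamma>: "\<gamma> \<in> Rp" unfolding \<gamma>_def using simple_reflection_Rp[OF \<alpha>(1) less.prems] False \<alpha>(1) by auto
    have "(\<beta> \<bullet> coroot \<alpha>) * (\<alpha> \<bullet> v) > 0"
      using \<alpha>(2) inner_coroot_pos_iff[OF \<alpha>'(3)] Rp_pos[OF \<alpha>'(1)] by simp
    then have "\<gamma> \<bullet> v < \<beta> \<bullet> v" by (simp add: \<gamma>_def reflection_def inner_diff_left)
    then have "card {\<delta> \<in> Rp. \<delta> \<bullet> v < \<gamma> \<bullet> v} < card {\<delta> \<in> Rp. \<delta> \<bullet> v < \<beta> \<bullet> v}"
      by (intro psubset_card_mono) (use \<gamma> in auto)
    from less.hyps[OF this \<gamma>] obtain s where s: "set s \<subseteq> simple_roots" "reflection \<gamma> = word s" by blast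
    have "reflection \<beta> = reflection \<alpha> \<circ> reflection \<gamma> \<circ> reflection \<alpha>"
      using weyl_reflection_conj[OF weyl_reflection[OF \<alpha>'(2)], of \<gamma>]
      by (auto simp: fun_eq_iff \<gamma>_def)
    then have "reflection \<beta> = word (\<alpha> # s @ [\<alpha>])" using s(2) by (simp add: word_append comp_assoc)
    then show ?thesis using s(1) \<alpha>(1) by (intro exI[of _ "\<alpha> # s @ [\<alpha>]"]) auto
  qed
qed

lemma weyl_word: "w \<in> W \<Longrightarrow> \<exists>s. set s \<subseteq> simple_roots \<and> w = word s"
proof (induction rule: weyl_group.induct)
  case weyl_id
  then show ?case by (intro exI[of _ "[]"]) simp
next
  case (weyl_step \<alpha> w)
  then obtain s where s: "set s \<subseteq> simple_roots" "w = word s" by blast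
  have "\<exists>s. set s \<subseteq> simple_roots \<and> reflection \<alpha> = word s"
    using Rp_cases[OF weyl_step(1)] reflection_word[of \<alpha>] reflection_word[of "- \<alpha>"]
    unfolding reflection_minus by blast
  then obtain s' where s': "set s' \<subseteq> simple_roots" "reflection \<alpha> = word s'" by blast
  have "reflection \<alpha> \<circ> w = word (s' @ s)" unfolding word_append s s' ..
  moreover have "set (s' @ s) \<subseteq> simple_roots" using s(1) s'(1) by simp
  ultimately show ?case by (intro exI[of _ "s' @ s"] conjI)
qed

text \<open>Some letter \<open>\<beta>\<close> of the word turns the image of
  \<open>\<alpha>\<close> from positive to negative. A simple reflection makes only its own positive
  root negative, so that image was \<open>\<beta>\<close>, and the letter cancels against
  \<open>reflection \<alpha>\<close>.\<close>

lemma exchange: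
  assumes "set s \<subseteq> simple_roots" "\<alpha> \<in> simple_roots" "word s \<alpha> \<notin> Rp"
  shows "\<exists>s'. set s' \<subseteq> simple_roots \<and> length s' < length s \<and> word s \<circ> reflection \<alpha> = word s'"
  using assms(1,3)
proof (induction s)
  case Nil
  then show ?case using simple_Rp[OF assms(2)] by simp
next
  case (Cons \<beta> s)
  show ?case
  proof (cases "word s \<alpha> \<in> Rp")
    case False
    then obtain s' where "set s' \<subseteq> simple_roots" "length s' < length s" "word s \<circ> reflection \<alpha> = word s'"
      using Cons.IH Cons.prems(1) by (meson set_subset_Cons order_trans)
    then show ?thesis using Cons.prems by (intro exI[of _ "\<beta> # s'"]) (simp add: fun_eq_iff)
  next
    case True
    then have eq: "word s \<alpha> = \<beta>" using simple_reflection_Rp[of \<beta> "word s \<alpha>"] Cons.prems by auto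
    have "word s \<in> W" using Cons.prems word_W by auto
    then have "reflection \<beta> \<circ> word s = word s \<circ> reflection \<alpha>"
      using weyl_reflection_conj[of "word s" \<alpha>] eq by (auto simp: fun_eq_iff)
    then have "word (\<beta> # s) \<circ> reflection \<alpha> = word s" by (auto simp: fun_eq_iff)
    then show ?thesis using Cons.prems by (intro exI[of _ s]) (simp add: fun_eq_iff)
  qed
qed

text \<open>A nonempty word preserving positivity can be shortened: without its last letter it sends
  that simple root to a negative one, so the exchange condition applies.\<close>

lemma word_preserving_Rp:
  "set s \<subseteq> simple_roots \<Longrightarrow> word s ` Rp \<subseteq> Rp \<Longrightarrow> word s = id"
proof (induction "length s" arbitrary: s rule: less_induct)
  case less
  show ?case
  proof (cases s rule: rev_cases)
    case Nil
    then show ?thesis by simp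
  next
    case (snoc s1 \<alpha>)
    then have s1: "set s1 \<subseteq> simple_roots" "\<alpha> \<in> simple_roots" "word s = word s1 \<circ> reflection \<alpha>"
      using less.prems by (auto simp: word_append)
    have "word s \<alpha> = - word s1 \<alpha>"
      using s1 word_W[OF s1(1)] by (simp add: reflection_self weyl_minus)
    moreover have "word s \<alpha> \<in> Rp" using less.prems(2) simple_Rp[OF s1(2)] by auto
    ultimately have "word s1 \<alpha> \<notin> Rp" using Rp_not_minus by metis
    from exchange[OF s1(1,2) this] obtain s' where
      "set s' \<subseteq> simple_roots" "length s' < length s1" "word s = word s'" using s1(3) by auto
    then show ?thesis using less.hyps[of s'] less.prems(2) snoc by simp
  qed
qed

lemma weyl_preserving_Rp: "w \<in> W \<Longrightarrow> w ` Rp \<subseteq> Rp \<Longrightarrow> w = id"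
  using weyl_word word_preserving_Rp by blast

text \<open>Among the elements carrying \<open>\<mu>\<close> to \<open>\<nu>\<close>, one with
  maximal \<open>w v \<bullet> v\<close> plays the role of a shortest coset representative. It
  yields uniqueness of dominant representatives, and it later transports the positive roots
  occurring in \<open>epsilon_coeff\<close> along an orbit.\<close>

lemma orbit_positive_transport:
  assumes "\<nu> \<in> weyl_orbit R \<mu>"
  shows "\<exists>w\<in>W. w \<mu> = \<nu> \<and> (\<forall>\<alpha>\<in>Rp. \<alpha> \<bullet> \<nu> = 0 \<longrightarrow> inv w \<alpha> \<in> Rp)"
proof -
  let ?X = "{w \<in> W. w \<mu> = \<nu>}"
  have "finite ((\<lambda>w. w v) ` ?X)" "(\<lambda>w. w v) ` ?X \<noteq> {}" using assms by (auto simp: weyl_orbit_def)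
  then obtain y where y: "y \<in> (\<lambda>w. w v) ` ?X" "\<And>z. z \<in> (\<lambda>w. w v) ` ?X \<Longrightarrow> z \<bullet> v \<le> y \<bullet> v"
    using maximal_exists[of "(\<lambda>w. w v) ` ?X" v] by blast
  then obtain w where w: "w \<in> W" "w \<mu> = \<nu>" "y = w v" by auto
  have "inv w \<alpha> \<in> Rp" if \<alpha>: "\<alpha> \<in> Rp" "\<alpha> \<bullet> \<nu> = 0" for \<alpha>
  proof -
    have \<alpha>R: "\<alpha> \<in> R" using \<alpha> Rp_R by auto
    have "reflection \<alpha> \<nu> = \<nu>" using \<alpha>(2) by (simp add: reflection_def inner_coroot inner_commute)
    then have "reflection \<alpha> \<circ> w \<in> ?X" using w \<alpha>R by (auto intro: weyl_group.intros)
    then have mem: "reflection \<alpha> (w v) \<in> (\<lambda>w. w v) ` ?X"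
      by (intro image_eqI[of _ _ "reflection \<alpha> \<circ> w"]) auto
    have "w v \<bullet> \<alpha> \<ge> 0"
      using maximal_imp_dominant[of "(\<lambda>w. w v) ` ?X" y \<alpha>] y \<alpha>(1) mem w(3) by simp
    then have "inv w \<alpha> \<bullet> v \<ge> 0" using weyl_inner_swap[OF w(1), of v \<alpha>] by (simp add: inner_commute)
    moreover have "inv w \<alpha> \<in> R" using w(1) \<alpha>R by (simp add: weyl_inv weyl_root)
    ultimately show ?thesis using generic[of "inv w \<alpha>"] by (auto simp: Rp_def)
  qed
  then show ?thesis using w by blast
qed

text \<open>The inverse of the transporting element keeps the positive roots orthogonal to
  \<open>y\<close> positive; for the other positive roots the dominance of both vectors forces this.
  So it preserves \<open>Rp\<close> and is the identity.\<close>

lemma dominant_unique: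
  assumes "dominant x" "y \<in> weyl_orbit R x" "dominant y"
  shows "y = x"
proof -
  obtain w where w: "w \<in> W" "w x = y" "\<And>\<alpha>. \<alpha> \<in> Rp \<Longrightarrow> \<alpha> \<bullet> y = 0 \<Longrightarrow> inv w \<alpha> \<in> Rp"
    using orbit_positive_transport[OF assms(2)] by blast
  have "inv w \<alpha> \<in> Rp" if \<alpha>: "\<alpha> \<in> Rp" for \<alpha>
  proof (rule ccontr)
    assume neg: "inv w \<alpha> \<notin> Rp"
    then have "\<alpha> \<bullet> y \<noteq> 0" using w(3) \<alpha> by blast
    moreover have "y \<bullet> \<alpha> \<ge> 0" using assms(3) \<alpha> by (simp add: dominant_def)
    ultimately have "y \<bullet> \<alpha> > 0" by (simp add: inner_commute)
    moreover have "y \<bullet> \<alpha> = x \<bullet> inv w \<alpha>" using weyl_inner_swap[OF w(1), of x \<alpha>] w(2) by simp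
    moreover have "- inv w \<alpha> \<in> Rp"
      using neg Rp_cases[of "inv w \<alpha>"] w(1) \<alpha> Rp_R by (auto simp: weyl_inv weyl_root)
    ultimately show False using assms(1) unfolding dominant_def by force
  qed
  then have "inv w = id" using weyl_preserving_Rp[of "inv w"] weyl_inv(1)[OF w(1)] by auto
  then show ?thesis using weyl_inv(2)[OF w(1), of x] w(2) by simp
qed

section \<open>The cone of nonnegative integral root combinations, which encodes the dominance
  order\<close>

definition root_cone :: "'a set" where
  "root_cone = {x. \<exists>c :: 'a \<Rightarrow> nat. x = (\<Sum>\<alpha>\<in>Rp. real (c \<alpha>) *\<^sub>R \<alpha>)}"

lemma dominance_le_iff: "dominance_le Rp \<mu> lam \<longleftrightarrow> lam - \<mu> \<in> root_cone"
  by (simp add: dominance_le_def root_cone_def)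

lemma root_cone_zero [simp]: "0 \<in> root_cone"
  unfolding root_cone_def by (auto intro!: exI[of _ "\<lambda>_. 0"])

lemma root_cone_add: "x \<in> root_cone \<Longrightarrow> y \<in> root_cone \<Longrightarrow> x + y \<in> root_cone"
proof -
  assume "x \<in> root_cone" "y \<in> root_cone"
  then obtain c d :: "'a \<Rightarrow> nat" where
    "x = (\<Sum>\<alpha>\<in>Rp. real (c \<alpha>) *\<^sub>R \<alpha>)" "y = (\<Sum>\<alpha>\<in>Rp. real (d \<alpha>) *\<^sub>R \<alpha>)" by (auto simp: root_cone_def)
  then have "x + y = (\<Sum>\<alpha>\<in>Rp. real (c \<alpha> + d \<alpha>) *\<^sub>R \<alpha>)" by (simp add: sum.distrib scaleR_add_left)
  then show ?thesis unfolding root_cone_def by (intro CollectI exI[of _ "\<lambda>\<alpha>. c \<alpha> + d \<alpha>"])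
qed

lemma root_cone_scale: "x \<in> root_cone \<Longrightarrow> real n *\<^sub>R x \<in> root_cone"
  by (induction n) (auto simp: scaleR_add_left intro: root_cone_add)

lemma Rp_root_cone: "\<alpha> \<in> Rp \<Longrightarrow> \<alpha> \<in> root_cone"
proof -
  assume \<alpha>: "\<alpha> \<in> Rp"
  have "(\<Sum>\<beta>\<in>Rp. real (if \<beta> = \<alpha> then 1 else 0) *\<^sub>R \<beta>) = (\<Sum>\<beta>\<in>Rp. if \<beta> = \<alpha> then \<alpha> else 0)"
    by (intro sum.cong) auto
  also have "\<dots> = \<alpha>" using \<alpha> by simp
  finally show ?thesis unfolding root_cone_def by (intro CollectI exI[of _ "\<lambda>\<beta>. if \<beta> = \<alpha> then 1 else 0"]) simp
qed

lemma root_cone_dominant: "x \<in> root_cone \<Longrightarrow> dominant y \<Longrightarrow> x \<bullet> y \<ge> 0"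
  by (auto simp: root_cone_def dominant_def inner_sum_right inner_commute[of _ y] intro!: sum_nonneg mult_nonneg_nonneg)

lemma dominant_v: "dominant v"
  using Rp_pos by (auto simp: dominant_def inner_commute less_imp_le)

lemma root_cone_nonneg: "x \<in> root_cone \<Longrightarrow> x \<bullet> v \<ge> 0"
  using root_cone_dominant[OF _ dominant_v] .

lemma root_cone_pos: assumes "x \<in> root_cone" "x \<noteq> 0" shows "x \<bullet> v > 0"
proof (rule ccontr)
  assume "\<not> x \<bullet> v > 0"
  obtain c :: "'a \<Rightarrow> nat" where c: "x = (\<Sum>\<alpha>\<in>Rp. real (c \<alpha>) *\<^sub>R \<alpha>)" using assms by (auto simp: root_cone_def)
  have "(\<Sum>\<alpha>\<in>Rp. real (c \<alpha>) * (\<alpha> \<bullet> v)) = 0"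
    using \<open>\<not> x \<bullet> v > 0\<close> root_cone_nonneg[OF assms(1)] by (simp add: c inner_sum_left)
  then have "\<forall>\<alpha>\<in>Rp. real (c \<alpha>) * (\<alpha> \<bullet> v) = 0"
    by (subst (asm) sum_nonneg_eq_0_iff) (auto intro!: mult_nonneg_nonneg dest: Rp_pos)
  then have "\<forall>\<alpha>\<in>Rp. c \<alpha> = 0" using Rp_pos by fastforce
  then show False using c assms(2) by simp
qed

lemma root_cone_antisym: "x \<in> root_cone \<Longrightarrow> - x \<in> root_cone \<Longrightarrow> x = 0"
  using root_cone_pos[of x] root_cone_nonneg[of "- x"] by fastforce

section \<open>The weight lattice and dominant weights\<close>

abbreviation "P \<equiv> weight_lattice R"

lemma P_iff: "x \<in> P \<longleftrightarrow> (\<forall>\<alpha>\<in>R. x \<bullet> coroot \<alpha> \<in> \<int>)"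
  by (simp add: weight_lattice_def)

lemma P_add: "x \<in> P \<Longrightarrow> y \<in> P \<Longrightarrow> x + y \<in> P"
  by (auto simp: P_iff inner_add_left)

lemma P_diff: "x \<in> P \<Longrightarrow> y \<in> P \<Longrightarrow> x - y \<in> P"
  by (auto simp: P_iff inner_diff_left)

lemma P_zero [simp]: "0 \<in> P"
  by (simp add: P_iff)

lemma P_weyl: "x \<in> P \<Longrightarrow> w \<in> W \<Longrightarrow> w x \<in> P"
  unfolding P_iff using weyl_inner_swap[of w x] weyl_coroot[OF weyl_inv(1)] weyl_root[OF weyl_inv(1)]
  by metis

lemma R_P: "\<alpha> \<in> R \<Longrightarrow> \<alpha> \<in> P"
  by (simp add: P_iff root_integral)

lemma root_cone_P: "x \<in> root_cone \<Longrightarrow> x \<in> P"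
proof -
  have "sum f I \<in> P" if "\<And>i. i \<in> I \<Longrightarrow> f i \<in> P" for f :: "'a \<Rightarrow> 'a" and I
    using that by (induction I rule: infinite_finite_induct) (auto intro: P_add)
  moreover have "real n *\<^sub>R \<alpha> \<in> P" if "\<alpha> \<in> R" for n \<alpha>
    by (induction n) (auto simp: scaleR_add_left intro: P_add R_P that)
  ultimately show "x \<in> root_cone \<Longrightarrow> x \<in> P" by (auto simp: root_cone_def Rp_R)
qed

lemma dominant_weights_iff: "lam \<in> dominant_weights R Rp \<longleftrightarrow> lam \<in> P \<and> dominant lam"
  using inner_coroot_nonneg_iff[OF root_nonzero[OF Rp_R]]
  by (auto simp: dominant_weights_def dominant_def)

text \<open>Reflecting in a positive root of negative pairing adds a nonnegative integral multiple
  of that root and raises the height, so the finite orbit bounds the number of steps.\<close>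

lemma weight_below_dominant:
  assumes "\<kappa> \<in> P"
  shows "\<exists>\<mu>\<in>weyl_orbit R \<kappa>. dominant \<mu> \<and> \<mu> - \<kappa> \<in> root_cone"
  using assms
proof (induction "card {y \<in> weyl_orbit R \<kappa>. y \<bullet> v > \<kappa> \<bullet> v}" arbitrary: \<kappa> rule: less_induct)
  case less
  show ?case
  proof (cases "dominant \<kappa>")
    case True
    then show ?thesis using orbit_self by (intro bexI[of _ \<kappa>]) auto
  next
    case False
    then obtain \<alpha> where \<alpha>: "\<alpha> \<in> Rp" "\<kappa> \<bullet> \<alpha> < 0" by (auto simp: dominant_def)
    then have \<alpha>': "\<alpha> \<in> R" "\<alpha> \<noteq> 0" using Rp_R root_nonzero by auto
    define y where "y = reflection \<alpha> \<kappa>"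
    have neg: "\<kappa> \<bullet> coroot \<alpha> < 0" using \<alpha>(2) inner_coroot_nonneg_iff[OF \<alpha>'(2), of \<kappa>] by simp
    obtain k :: int where k: "\<kappa> \<bullet> coroot \<alpha> = of_int k"
      using less.prems \<alpha>'(1) by (auto simp: P_iff elim: Ints_cases)
    have "y - \<kappa> = real (nat (- k)) *\<^sub>R \<alpha>"
      using neg k by (simp add: y_def reflection_def)
    then have yk: "y - \<kappa> \<in> root_cone" using root_cone_scale Rp_root_cone[OF \<alpha>(1)] by simp
    have y: "y \<in> weyl_orbit R \<kappa>" unfolding y_def by (intro orbitI weyl_reflection \<alpha>')
    have yP: "y \<in> P" unfolding y_def by (rule P_weyl[OF less.prems weyl_reflection[OF \<alpha>'(1)]])
    have "y - \<kappa> \<noteq> 0" using neg \<alpha>'(2) by (simp add: y_def reflection_def)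
    then have "y \<bullet> v > \<kappa> \<bullet> v" using root_cone_pos[OF yk] by (simp add: inner_diff_left)
    then have "card {z \<in> weyl_orbit R y. z \<bullet> v > y \<bullet> v} < card {y \<in> weyl_orbit R \<kappa>. y \<bullet> v > \<kappa> \<bullet> v}"
      using y orbit_eq[OF y] by (intro psubset_card_mono) auto
    from less.hyps[OF this yP] obtain \<mu> where \<mu>: "\<mu> \<in> weyl_orbit R y" "dominant \<mu>" "\<mu> - y \<in> root_cone" by blast
    then show ?thesis using root_cone_add[OF \<mu>(3) yk] orbit_eq[OF y] by (intro bexI[of _ \<mu>]) auto
  qed
qed

lemma orbit_below:
  assumes "lam \<in> P" "dominant lam" "\<kappa> \<in> weyl_orbit R lam"
  shows "lam - \<kappa> \<in> root_cone"
proof -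
  have "\<kappa> \<in> P" using assms(1,3) P_weyl by (metis orbitE)
  from weight_below_dominant[OF this] obtain \<mu> where
    "\<mu> \<in> weyl_orbit R \<kappa>" "dominant \<mu>" "\<mu> - \<kappa> \<in> root_cone" by blast
  then show ?thesis using dominant_unique[OF assms(2)] orbit_eq[OF assms(3)] by auto
qed

text \<open>The dominance order bounds the norm, and a weight is determined by its pairings with
  coroots, which are integers in a bounded range. Since \<open>lam\<close> may fail to be dominant,
  it is compared through the dominant \<open>l\<close> in its orbit.\<close>

lemma finite_dominant_below:
  "finite (dominant_strictly_below R Rp lam)"
proof -
  let ?X = "dominant_strictly_below R Rp lam"
  define h where "h \<mu> = restrict (\<lambda>\<alpha>. \<mu> \<bullet> coroot \<alpha>) R" for \<mu> :: 'a
  have "norm \<mu> \<le> norm lam" if \<mu>X: "\<mu> \<in> ?X" for \<mu>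
  proof -
    have \<mu>: "\<mu> \<in> P" "dominant \<mu>" "lam - \<mu> \<in> root_cone"
      using that by (auto simp: dominant_strictly_below_def dominant_weights_iff dominance_le_iff)
    have "lam \<in> P" using P_add[OF \<mu>(1) root_cone_P[OF \<mu>(3)]] by simp
    from weight_below_dominant[OF this] obtain l where
      l: "l \<in> weyl_orbit R lam" "dominant l" "l - lam \<in> root_cone" by blast
    have "l - \<mu> \<in> root_cone" using root_cone_add[OF l(3) \<mu>(3)] by simp
    \<comment> \<open>A cone element pairs nonnegatively with a dominant vector; here the pairing is
      the difference of the squared norms.\<close>
    then have "(l - \<mu>) \<bullet> (l + \<mu>) \<ge> 0"
      using l(2) \<mu>(2) root_cone_dominant[of "l - \<mu>" "l + \<mu>"] by (simp add: dominant_def inner_add_left)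
    then have "norm \<mu> \<le> norm l" by (simp add: norm_le inner_diff_left inner_add_right inner_commute[of \<mu> l])
    also have "norm l = norm lam" using l(1) by (auto elim!: orbitE simp: weyl_norm)
    finally show ?thesis .
  qed
  then have bd: "\<bar>\<mu> \<bullet> coroot \<alpha>\<bar> \<le> norm lam * norm (coroot \<alpha>)" if "\<mu> \<in> ?X" for \<mu> \<alpha>
    using that by (meson Cauchy_Schwarz_ineq2 mult_right_mono norm_ge_zero order_trans)
  have "h ` ?X \<subseteq> R \<rightarrow>\<^sub>E {x \<in> \<int>. \<bar>x\<bar> \<le> (\<Sum>\<alpha>\<in>R. norm lam * norm (coroot \<alpha>))}"
  proof (rule image_subsetI)
    fix \<mu> assume \<mu>: "\<mu> \<in> ?X"
    have "\<mu> \<bullet> coroot \<alpha> \<in> \<int>" if "\<alpha> \<in> R" for \<alpha>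
      using \<mu> that by (auto simp: dominant_strictly_below_def dominant_weights_iff P_iff)
    moreover have "\<bar>\<mu> \<bullet> coroot \<alpha>\<bar> \<le> (\<Sum>\<alpha>\<in>R. norm lam * norm (coroot \<alpha>))" if "\<alpha> \<in> R" for \<alpha>
    proof -
      have "norm lam * norm (coroot \<alpha>) \<le> (\<Sum>\<alpha>\<in>R. norm lam * norm (coroot \<alpha>))"
        using that by (intro member_le_sum) auto
      then show ?thesis using bd[OF \<mu>, of \<alpha>] by linarith
    qed
    ultimately show "h \<mu> \<in> R \<rightarrow>\<^sub>E {x \<in> \<int>. \<bar>x\<bar> \<le> (\<Sum>\<alpha>\<in>R. norm lam * norm (coroot \<alpha>))}"
      by (auto simp: h_def)
  qed
  moreover have "finite (R \<rightarrow>\<^sub>E {x \<in> \<int>. \<bar>x\<bar> \<le> (\<Sum>\<alpha>\<in>R. norm lam * norm (coroot \<alpha>))})"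
    by (intro finite_PiE finite_R finite_abs_int_segment)
  moreover have "inj_on h ?X"
  proof (rule inj_onI)
    fix x y assume "h x = h y"
    then have "x \<bullet> coroot \<alpha> = y \<bullet> coroot \<alpha>" if "\<alpha> \<in> R" for \<alpha>
      using that unfolding h_def by (metis restrict_apply')
    then have "(x - y) \<bullet> \<alpha> = 0" if "\<alpha> \<in> R" for \<alpha>
      using that root_nonzero by (fastforce simp: inner_coroot inner_diff_left)
    then have "orthogonal (x - y) z" for z
      using orthogonal_to_span[of z R "x - y"] span_R by (auto simp: orthogonal_def)
    then show "x = y" by (metis eq_iff_diff_eq_0 orthogonal_self)
  qed
  ultimately show ?thesis by (meson finite_imageD finite_subset)
qed

end

section \<open>The index set of the operator\<close>

lemma coroot_scale: "c \<noteq> 0 \<Longrightarrow> coroot (c *\<^sub>R \<alpha>) = inverse c *\<^sub>R coroot \<alpha>"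
  by (simp add: coroot_def field_simps)

locale admissible_pair = root_sys R Rp v for R Rp :: "'a::euclidean_space set" and v +
  fixes S :: "'a set"
  assumes admissible: "admissible R S"
begin

abbreviation u where "u \<equiv> u_factor R S"
abbreviation st where "st \<equiv> star R S"
text \<open>For a root this is the root of \<open>S^\<or>\<close> belonging to
  \<open>\<alpha>\<close>, namely \<open>u \<alpha> *\<^sub>R coroot \<alpha>\<close>. These vectors
  generate the dominance order on \<open>Lam\<close>, and every reflection moves a vector by its
  pairing with \<open>st \<alpha>\<close> times \<open>d \<alpha>\<close>.\<close>

definition d where "d \<alpha> = coroot (st \<alpha>)"

lemma u_pos: "\<alpha> \<in> R \<Longrightarrow> u \<alpha> > 0"
  using root_nonzero by (simp add: u_factor_def)

lemma inner_st: "x \<bullet> st \<alpha> = (x \<bullet> \<alpha>) / u \<alpha>"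
  by (simp add: star_def divide_inverse_commute)

lemma d_eq: "\<alpha> \<in> R \<Longrightarrow> d \<alpha> = u \<alpha> *\<^sub>R coroot \<alpha>"
  using u_pos[of \<alpha>] by (simp add: d_def star_def coroot_scale)

lemma u_minus [simp]: "u (- \<alpha>) = u \<alpha>"
  by (simp add: u_factor_def)

lemma st_minus [simp]: "st (- \<alpha>) = - st \<alpha>"
  by (simp add: star_def)

lemma d_minus [simp]: "d (- \<alpha>) = - d \<alpha>"
  by (simp add: d_def)

lemma u_weyl: "w \<in> W \<Longrightarrow> u (w \<alpha>) = u \<alpha>"
  using weyl_inner[of w \<alpha> \<alpha>] by (simp add: u_factor_def)

lemma st_weyl: "w \<in> W \<Longrightarrow> st (w \<alpha>) = w (st \<alpha>)"
  by (simp add: star_def u_weyl[of w] weyl_scale[of w])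

lemma d_weyl: "w \<in> W \<Longrightarrow> d (w \<alpha>) = w (d \<alpha>)"
  by (simp add: d_def st_weyl[of w] weyl_coroot[of w])

lemma R_cases:
  obtains (same) "S = R" "\<And>\<alpha>. u \<alpha> = 1" "\<And>\<alpha>. st \<alpha> = \<alpha>" "\<And>\<alpha>. d \<alpha> = coroot \<alpha>"
  | (dual) "S = coroot ` R" "\<And>\<alpha>. \<alpha> \<in> R \<Longrightarrow> u \<alpha> = (\<alpha> \<bullet> \<alpha>) / 2"
      "\<And>\<alpha>. \<alpha> \<in> R \<Longrightarrow> st \<alpha> = coroot \<alpha>" "\<And>\<alpha>. \<alpha> \<in> R \<Longrightarrow> d \<alpha> = \<alpha>"
proof (cases "S = R")
  case True
  show ?thesis
    by (rule same) (unfold d_def star_def u_factor_def, use True in simp_all)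
next
  case False
  then have "S = coroot ` R" using admissible by (auto simp: admissible_def)
  then show ?thesis
    by (rule dual) (use False in \<open>auto simp: u_factor_def star_def d_def coroot_scale coroot_def\<close>)
qed

lemma S_eq: "S = st ` R"
  by (cases rule: R_cases) auto

lemma st_d_int: "\<alpha> \<in> R \<Longrightarrow> \<beta> \<in> R \<Longrightarrow> d \<alpha> \<bullet> st \<beta> \<in> \<int>"
  using root_integral[of \<alpha> \<beta>] root_integral[of \<beta> \<alpha>]
  by (cases rule: R_cases) (auto simp: inner_commute)

lemma d_st_self: "\<alpha> \<in> R \<Longrightarrow> d \<alpha> \<bullet> st \<alpha> = 2"
  using inner_coroot_self[OF root_nonzero, of \<alpha>]
  by (cases rule: R_cases) (auto simp: inner_commute)

lemma inj_d: "inj_on d R"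
proof (cases rule: R_cases)
  case same
  show ?thesis
  proof (rule inj_onI)
    fix \<alpha> \<beta> assume "d \<alpha> = d \<beta>"
    then have "coroot (coroot \<alpha>) = coroot (coroot \<beta>)" by (simp only: same(4))
    then show "\<alpha> = \<beta>" by simp
  qed
next
  case dual
  then show ?thesis by (simp add: inj_on_def)
qed

lemma reflection_st: "\<alpha> \<in> R \<Longrightarrow> reflection \<alpha> x = x - (x \<bullet> st \<alpha>) *\<^sub>R d \<alpha>"
  using u_pos[of \<alpha>] by (simp add: reflection_def d_eq inner_st inner_coroot) (simp add: coroot_def field_simps)

lemma inner_d_pos_iff: "\<alpha> \<in> R \<Longrightarrow> x \<bullet> d \<alpha> > 0 \<longleftrightarrow> x \<bullet> st \<alpha> > 0"
  using u_pos[of \<alpha>] inner_coroot_pos_iff[OF root_nonzero, of \<alpha> x]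
  by (simp add: d_eq inner_st zero_less_mult_iff zero_less_divide_iff)

lemma inner_st_pos_iff: "\<alpha> \<in> R \<Longrightarrow> x \<bullet> st \<alpha> > 0 \<longleftrightarrow> x \<bullet> \<alpha> > 0"
  using u_pos[of \<alpha>] by (simp add: inner_st zero_less_divide_iff)

lemma inner_st_nonneg_iff: "\<alpha> \<in> R \<Longrightarrow> x \<bullet> st \<alpha> \<ge> 0 \<longleftrightarrow> x \<bullet> \<alpha> \<ge> 0"
  using u_pos[of \<alpha>] by (simp add: inner_st zero_le_divide_iff)

lemma inner_st_zero_iff: "\<alpha> \<in> R \<Longrightarrow> x \<bullet> st \<alpha> = 0 \<longleftrightarrow> x \<bullet> \<alpha> = 0"
  using u_pos[of \<alpha>] by (simp add: inner_st)

lemma dominant_st: "dominant x \<longleftrightarrow> (\<forall>\<alpha>\<in>Rp. x \<bullet> st \<alpha> \<ge> 0)"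
  using inner_st_nonneg_iff[OF Rp_R] by (auto simp: dominant_def)

abbreviation "Lam \<equiv> weight_lattice (coroot ` S)"

lemma Lam_iff: "x \<in> Lam \<longleftrightarrow> (\<forall>\<alpha>\<in>R. x \<bullet> st \<alpha> \<in> \<int>)"
proof -
  have "x \<in> Lam \<longleftrightarrow> (\<forall>s\<in>S. x \<bullet> s \<in> \<int>)" by (simp add: weight_lattice_def)
  also have "\<dots> \<longleftrightarrow> (\<forall>s\<in>st ` R. x \<bullet> s \<in> \<int>)" using S_eq by (rule arg_cong)
  finally show ?thesis by simp
qed

lemma dominant_Lambda_iff: "x \<in> dominant_Lambda R Rp S \<longleftrightarrow> x \<in> Lam \<and> dominant x"
  by (auto simp: dominant_Lambda_def dominant_weights_def positive_star_def dominant_st)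

lemma coroot_positive_star: "coroot ` positive_star R Rp S = d ` Rp"
  by (auto simp: positive_star_def d_def image_image)

lemma dominance_d:
  "dominance_le (coroot ` positive_star R Rp S) \<mu> x \<longleftrightarrow>
    (\<exists>c :: 'a \<Rightarrow> nat. x - \<mu> = (\<Sum>\<alpha>\<in>Rp. real (c \<alpha>) *\<^sub>R d \<alpha>))"
proof -
  have inj: "inj_on d Rp" using inj_d inj_on_subset Rp_R by blast
  have sum: "(\<Sum>\<gamma>\<in>d ` Rp. real (c \<gamma>) *\<^sub>R \<gamma>) = (\<Sum>\<alpha>\<in>Rp. real (c (d \<alpha>)) *\<^sub>R d \<alpha>)" for c :: "'a \<Rightarrow> nat"
    using inj by (simp add: sum.reindex)
  show ?thesis unfolding dominance_le_def coroot_positive_star sum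
  proof
    assume "\<exists>c :: 'a \<Rightarrow> nat. x - \<mu> = (\<Sum>\<alpha>\<in>Rp. real (c (d \<alpha>)) *\<^sub>R d \<alpha>)"
    then show "\<exists>c :: 'a \<Rightarrow> nat. x - \<mu> = (\<Sum>\<alpha>\<in>Rp. real (c \<alpha>) *\<^sub>R d \<alpha>)" by (elim exE) (rule exI)
  next
    assume "\<exists>c :: 'a \<Rightarrow> nat. x - \<mu> = (\<Sum>\<alpha>\<in>Rp. real (c \<alpha>) *\<^sub>R d \<alpha>)"
    then obtain c :: "'a \<Rightarrow> nat" where c: "x - \<mu> = (\<Sum>\<alpha>\<in>Rp. real (c \<alpha>) *\<^sub>R d \<alpha>)" by blast
    have "(\<Sum>\<alpha>\<in>Rp. real (c \<alpha>) *\<^sub>R d \<alpha>) = (\<Sum>\<alpha>\<in>Rp. real (c (inv_into Rp d (d \<alpha>))) *\<^sub>R d \<alpha>)"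
      using inj by (intro sum.cong) auto
    then show "\<exists>c :: 'a \<Rightarrow> nat. x - \<mu> = (\<Sum>\<alpha>\<in>Rp. real (c (d \<alpha>)) *\<^sub>R d \<alpha>)"
      using c by (intro exI[of _ "\<lambda>\<gamma>. c (inv_into Rp d \<gamma>)"]) simp
  qed
qed

text \<open>Since \<open>R = -R\<close>, sums without coefficients already form a group. The list
  form provides a length that can be minimised.\<close>

definition coroot_lattice :: "'a set" where
  "coroot_lattice = {x. \<exists>bs. set bs \<subseteq> R \<and> x = sum_list (map d bs)}"

lemma coroot_lattice_zero [simp]: "0 \<in> coroot_lattice"
  unfolding coroot_lattice_def by (intro CollectI exI[of _ "[]"]) simp

lemma coroot_lattice_add: "x \<in> coroot_lattice \<Longrightarrow> y \<in> coroot_lattice \<Longrightarrow> x + y \<in> coroot_lattice"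
proof -
  assume "x \<in> coroot_lattice" "y \<in> coroot_lattice"
  then obtain a b where "set a \<subseteq> R" "set b \<subseteq> R" "x = sum_list (map d a)" "y = sum_list (map d b)"
    by (auto simp: coroot_lattice_def)
  then show ?thesis unfolding coroot_lattice_def by (intro CollectI exI[of _ "a @ b"]) simp
qed

lemma coroot_lattice_d: "\<alpha> \<in> R \<Longrightarrow> d \<alpha> \<in> coroot_lattice"
  unfolding coroot_lattice_def by (intro CollectI exI[of _ "[\<alpha>]"]) simp

lemma coroot_lattice_weyl: assumes "x \<in> coroot_lattice" "w \<in> W" shows "w x \<in> coroot_lattice"
proof -
  obtain a where a: "set a \<subseteq> R" "x = sum_list (map d a)" using assms by (auto simp: coroot_lattice_def)
  then have "w x = sum_list (map d (map w a))"
    using assms(2)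
    by (induction a arbitrary: x) (auto simp: d_weyl[OF assms(2)] weyl_add[OF assms(2)] weyl_zero[OF assms(2)])
  moreover have "set (map w a) \<subseteq> R" using a(1) weyl_root[OF assms(2)] by auto
  ultimately show ?thesis unfolding coroot_lattice_def by blast
qed

lemma coroot_lattice_minus: assumes "x \<in> coroot_lattice" shows "- x \<in> coroot_lattice"
proof -
  obtain a where a: "set a \<subseteq> R" "x = sum_list (map d a)" using assms by (auto simp: coroot_lattice_def)
  then have "- x = sum_list (map d (map uminus a))"
    by (induction a arbitrary: x) auto
  moreover have "set (map uminus a) \<subseteq> R" using a(1) root_minus by auto
  ultimately show ?thesis unfolding coroot_lattice_def by blast
qed

lemma coroot_lattice_Lam: assumes "x \<in> coroot_lattice" shows "x \<in> Lam"
proof -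
  obtain a where a: "set a \<subseteq> R" "x = sum_list (map d a)" using assms by (auto simp: coroot_lattice_def)
  then show ?thesis
    by (induction a arbitrary: x) (auto simp: Lam_iff inner_add_left st_d_int)
qed

lemma Lam_weyl: "x \<in> Lam \<Longrightarrow> w \<in> W \<Longrightarrow> w x \<in> Lam"
  unfolding Lam_iff
proof
  fix \<alpha> assume x: "\<forall>\<alpha>\<in>R. x \<bullet> st \<alpha> \<in> \<int>" and w: "w \<in> W" and \<alpha>: "\<alpha> \<in> R"
  have "w x \<bullet> st \<alpha> = x \<bullet> st (inv w \<alpha>)"
    using weyl_inner_swap[OF w, of x "st \<alpha>"] st_weyl[OF weyl_inv(1)[OF w], of \<alpha>] by simp
  then show "w x \<bullet> st \<alpha> \<in> \<int>" using x weyl_root[OF weyl_inv(1)[OF w] \<alpha>] by simp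
qed

lemma Lam_diff: "x \<in> Lam \<Longrightarrow> y \<in> Lam \<Longrightarrow> x - y \<in> Lam"
  by (auto simp: Lam_iff inner_diff_left)

text \<open>For an obtuse pair that is not opposite, one of the two Cartan integers is
  \<open>-1\<close>, and the corresponding reflection adds one of the two vectors to the
  other.\<close>

lemma d_sum_cases:
  assumes "\<beta> \<in> R" "\<gamma> \<in> R" "d \<beta> \<bullet> st \<gamma> < 0"
  shows "d \<beta> + d \<gamma> = 0 \<or> (\<exists>\<delta>\<in>R. d \<beta> + d \<gamma> = d \<delta>)"
proof (cases "\<beta> = - \<gamma>")
  case True
  then show ?thesis by simp
next
  case False
  have "\<beta> \<bullet> \<gamma> < 0"
    using assms(3) inner_st_nonneg_iff[OF assms(2), of "d \<beta>"] inner_d_pos_iff[OF assms(1), of "- \<gamma>"]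
      inner_st_pos_iff[OF assms(1), of "- \<gamma>"] by (simp add: inner_commute not_le[symmetric])
  then have "\<beta> \<bullet> coroot (- \<gamma>) = 1 \<or> (- \<gamma>) \<bullet> coroot \<beta> = 1"
    using False assms by (intro cartan_product root_minus) auto
  then have "\<beta> \<bullet> coroot \<gamma> = - 1 \<or> \<gamma> \<bullet> coroot \<beta> = - 1" by auto
  then have "d \<beta> \<bullet> st \<gamma> = - 1 \<or> d \<gamma> \<bullet> st \<beta> = - 1"
    using assms(1,2) by (cases rule: R_cases) (auto simp: inner_commute)
  then show ?thesis
  proof
    assume "d \<beta> \<bullet> st \<gamma> = - 1"
    then have "d (reflection \<gamma> \<beta>) = d \<beta> + d \<gamma>"
      using d_weyl[OF weyl_reflection[OF assms(2)]] reflection_st[OF assms(2)] by simp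
    then show ?thesis using reflection_root assms by metis
  next
    assume "d \<gamma> \<bullet> st \<beta> = - 1"
    then have "d (reflection \<beta> \<gamma>) = d \<beta> + d \<gamma>"
      using d_weyl[OF weyl_reflection[OF assms(1)]] reflection_st[OF assms(1)] by (simp add: add.commute)
    then show ?thesis using reflection_root assms by metis
  qed
qed

text \<open>In a shortest representation as a sum of coroots no two summands form an obtuse angle,
  since their sum would be a single coroot or zero.\<close>

lemma shortest_sum:
  assumes "x \<in> coroot_lattice"
  obtains bs where "set bs \<subseteq> R" "x = sum_list (map d bs)" "\<And>\<beta>. \<beta> \<in> set bs \<Longrightarrow> x \<bullet> st \<beta> \<ge> 2"
proof -
  define good where "good bs \<longleftrightarrow> set bs \<subseteq> R \<and> x = sum_list (map d bs)" for bs
  have "\<exists>bs. good bs" using assms by (auto simp: coroot_lattice_def good_def)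
  then obtain bs where bs: "good bs" "\<And>cs. good cs \<Longrightarrow> length bs \<le> length cs"
    using ex_has_least_nat[of good _ length] by blast
  have "x \<bullet> st \<beta> \<ge> 2" if \<beta>: "\<beta> \<in> set bs" for \<beta>
  proof -
    let ?r = "remove1 \<beta> bs"
    have \<beta>R: "\<beta> \<in> R" using \<beta> bs(1) by (auto simp: good_def)
    have x: "x = d \<beta> + sum_list (map d ?r)"
      using bs(1) sum_list_map_remove1[OF \<beta>] by (simp add: good_def)
    have rR: "set ?r \<subseteq> R" using bs(1) set_remove1_subset by (fastforce simp: good_def)
    have nonneg: "d \<gamma> \<bullet> st \<beta> \<ge> 0" if \<gamma>: "\<gamma> \<in> set ?r" for \<gamma>
    proof (rule ccontr)
      assume "\<not> ?thesis"
      then have neg: "d \<gamma> \<bullet> st \<beta> < 0" by simp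
      have \<gamma>R: "\<gamma> \<in> R" using \<gamma> rR by auto
      let ?r' = "remove1 \<gamma> ?r"
      have x': "x = (d \<gamma> + d \<beta>) + sum_list (map d ?r')"
        using x sum_list_map_remove1[OF \<gamma>] by (simp add: algebra_simps)
      have r'R: "set ?r' \<subseteq> R" using rR set_remove1_subset by fastforce
      have "length ?r' < length ?r" "length ?r < length bs"
        using \<beta> \<gamma> length_pos_if_in_set[OF \<beta>] length_pos_if_in_set[OF \<gamma>]
        by (simp_all add: length_remove1[of \<gamma>] length_remove1[of \<beta> bs])
      then have len: "Suc (length ?r') < length bs" by simp
      from d_sum_cases[OF \<gamma>R \<beta>R neg] show False
      proof
        assume "d \<gamma> + d \<beta> = 0"
        then have "good ?r'" using x' r'R by (simp add: good_def)
        then show False using bs(2) len by fastforce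
      next
        assume "\<exists>\<delta>\<in>R. d \<gamma> + d \<beta> = d \<delta>"
        then obtain \<delta> where "\<delta> \<in> R" "d \<gamma> + d \<beta> = d \<delta>" by blast
        then have "good (\<delta> # ?r')" using x' r'R by (simp add: good_def)
        then show False using bs(2) len by fastforce
      qed
    qed
    have "sum_list (map d l) \<bullet> st \<beta> \<ge> 0" if "set l \<subseteq> set ?r" for l
      using that nonneg by (induction l) (auto simp: inner_add_left)
    then have "sum_list (map d ?r) \<bullet> st \<beta> \<ge> 0" by blast
    then show ?thesis using d_st_self[OF \<beta>R] by (subst x) (simp add: inner_add_left)
  qed
  then show ?thesis using that bs(1) by (auto simp: good_def)
qed

end

section \<open>Midpoints of pairs in the orbit of a small weight\<close>

locale small_setup = admissible_pair R Rp v S for R Rp :: "'a::euclidean_space set" and v S +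
  fixes \<omega> :: 'a
  assumes small: "small_weight R Rp S \<omega>"
begin

lemma \<omega>_Lam: "\<omega> \<in> Lam" and \<omega>_dominant: "dominant \<omega>"
  using small by (auto simp: small_weight_def dominant_Lambda_iff)

lemma orbit_small:
  assumes "\<eta> \<in> weyl_orbit R \<omega>" "\<alpha> \<in> R"
  shows "\<bar>\<eta> \<bullet> st \<alpha>\<bar> \<le> 2" "\<eta> \<bullet> st \<alpha> \<in> \<int>"
proof -
  obtain w where w: "w \<in> W" "\<eta> = w \<omega>" using assms(1) by (rule orbitE)
  have eq: "\<eta> \<bullet> st \<alpha> = \<omega> \<bullet> st (inv w \<alpha>)"
    using weyl_inner_swap[OF w(1)] st_weyl[OF weyl_inv(1)[OF w(1)]] w(2) by simp
  have R: "inv w \<alpha> \<in> R" using weyl_root weyl_inv(1) w(1) assms(2) by blast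
  have pos: "0 \<le> \<omega> \<bullet> st \<beta> \<and> \<omega> \<bullet> st \<beta> \<le> 2" if "\<beta> \<in> Rp" for \<beta>
    using small that \<omega>_dominant by (auto simp: small_weight_def positive_star_def dominant_st)
  show "\<bar>\<eta> \<bullet> st \<alpha>\<bar> \<le> 2"
    unfolding eq using Rp_cases[OF R] pos[of "inv w \<alpha>"] pos[of "- inv w \<alpha>"] by auto
  show "\<eta> \<bullet> st \<alpha> \<in> \<int>" unfolding eq using \<omega>_Lam R by (simp add: Lam_iff)
qed

text \<open>With \<open>\<eta>' = 2 \<nu> - \<eta>\<close> this is the set of all pairs \<open>(\<eta>, \<eta>')\<close> in the orbit of \<open>\<omega>\<close> which
  are congruent modulo twice the coroot lattice, parametrised by the midpoint \<open>\<nu>\<close> and \<open>\<eta>\<close>.\<close>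

definition Pairs :: "('a \<times> 'a) set" where
  "Pairs = {(\<nu>, \<eta>). \<eta> \<in> weyl_orbit R \<omega> \<and> 2 *\<^sub>R \<nu> - \<eta> \<in> weyl_orbit R \<omega> \<and> \<eta> - \<nu> \<in> coroot_lattice}"

lemma Pairs_iff: "(\<nu>, \<eta>) \<in> Pairs \<longleftrightarrow>
    \<eta> \<in> weyl_orbit R \<omega> \<and> 2 *\<^sub>R \<nu> - \<eta> \<in> weyl_orbit R \<omega> \<and> \<eta> - \<nu> \<in> coroot_lattice"
  by (simp add: Pairs_def)

lemma finite_Pairs [simp]: "finite Pairs"
proof -
  have "Pairs \<subseteq> (\<lambda>(\<eta>, \<eta>'). ((1/2) *\<^sub>R (\<eta> + \<eta>'), \<eta>)) ` (weyl_orbit R \<omega> \<times> weyl_orbit R \<omega>)"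
  proof clarify
    fix \<nu> \<eta> assume "(\<nu>, \<eta>) \<in> Pairs"
    then have "(\<eta>, 2 *\<^sub>R \<nu> - \<eta>) \<in> weyl_orbit R \<omega> \<times> weyl_orbit R \<omega>" by (simp add: Pairs_iff)
    from imageI[OF this, of "\<lambda>(\<eta>, \<eta>'). ((1/2) *\<^sub>R (\<eta> + \<eta>'), \<eta>)"]
    show "(\<nu>, \<eta>) \<in> (\<lambda>(\<eta>, \<eta>'). ((1/2) *\<^sub>R (\<eta> + \<eta>'), \<eta>)) ` (weyl_orbit R \<omega> \<times> weyl_orbit R \<omega>)"
      by simp
  qed
  then show ?thesis by (rule finite_subset) auto
qed

lemma Pairs_Lam: "(\<nu>, \<eta>) \<in> Pairs \<Longrightarrow> \<nu> \<in> Lam"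
proof -
  assume p: "(\<nu>, \<eta>) \<in> Pairs"
  then have "\<eta> \<in> Lam" using Lam_weyl[OF \<omega>_Lam] by (auto simp: Pairs_iff elim: orbitE)
  then have "\<eta> - (\<eta> - \<nu>) \<in> Lam" using p by (intro Lam_diff coroot_lattice_Lam[of "\<eta> - \<nu>"]) (auto simp: Pairs_iff)
  then show ?thesis by simp
qed

text \<open>Both \<open>\<eta>\<close> and \<open>2 *\<^sub>R \<nu> - \<eta>\<close> pair with
  \<open>st \<alpha>\<close> within \<open>[-2, 2]\<close>, and \<open>\<nu>\<close> has integral
  pairings because \<open>\<eta> - \<nu>\<close> lies in the coroot lattice; thirteen possibilities
  remain. The case distinctions for transitivity, pole cancellation, leading coefficients and
  adjointness all read off this table.\<close>

lemma Pairs_cases: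
  assumes "(\<nu>, \<eta>) \<in> Pairs" "\<alpha> \<in> R"
  shows "(\<nu> \<bullet> st \<alpha>, \<eta> \<bullet> st \<alpha>) \<in> {(0,0),(0,1),(0,-1),(0,2),(0,-2),(1,0),(1,1),(1,2),
    (-1,0),(-1,-1),(-1,-2),(2,2),(-2,-2)}"
proof -
  obtain n m :: int where nm: "\<nu> \<bullet> st \<alpha> = of_int n" "\<eta> \<bullet> st \<alpha> = of_int m"
    using Pairs_Lam[OF assms(1)] orbit_small(2)[of \<eta> \<alpha>] assms
    by (auto simp: Lam_iff Pairs_iff elim!: Ints_cases)
  have "\<bar>\<eta> \<bullet> st \<alpha>\<bar> \<le> 2" "\<bar>(2 *\<^sub>R \<nu> - \<eta>) \<bullet> st \<alpha>\<bar> \<le> 2"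
    using orbit_small(1) assms by (auto simp: Pairs_iff)
  then have "\<bar>real_of_int m\<bar> \<le> 2" "\<bar>2 * real_of_int n - real_of_int m\<bar> \<le> 2"
    by (simp_all add: nm inner_diff_left)
  then have b: "m \<le> 2" "- 2 \<le> m" "2 * n - m \<le> 2" "- 2 \<le> 2 * n - m" by linarith+
  have m: "m = -2 \<or> m = -1 \<or> m = 0 \<or> m = 1 \<or> m = 2" using b(1,2) by presburger
  from m show ?thesis
  proof (elim disjE)
    assume m: "m = -2"
    then have "n = -2 \<or> n = -1 \<or> n = 0" using b(3,4) by presburger
    with m show ?thesis unfolding nm by (elim disjE) simp_all
  next
    assume m: "m = -1"
    then have "n = -1 \<or> n = 0" using b(3,4) by presburger
    with m show ?thesis unfolding nm by (elim disjE) simp_all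
  next
    assume m: "m = 0"
    then have "n = -1 \<or> n = 0 \<or> n = 1" using b(3,4) by presburger
    with m show ?thesis unfolding nm by (elim disjE) simp_all
  next
    assume m: "m = 1"
    then have "n = 0 \<or> n = 1" using b(3,4) by presburger
    with m show ?thesis unfolding nm by (elim disjE) simp_all
  next
    assume m: "m = 2"
    then have "n = 0 \<or> n = 1 \<or> n = 2" using b(3,4) by presburger
    with m show ?thesis unfolding nm by (elim disjE) simp_all
  qed
qed

lemma Pairs_weyl: assumes "(\<nu>, \<eta>) \<in> Pairs" "w \<in> W" shows "(w \<nu>, w \<eta>) \<in> Pairs"
proof -
  have "w (2 *\<^sub>R \<nu> - \<eta>) \<in> weyl_orbit R \<omega>" "w (\<eta> - \<nu>) \<in> coroot_lattice"
    using assms(1) by (simp_all add: Pairs_iff orbit_closed[OF _ assms(2)] coroot_lattice_weyl[OF _ assms(2)])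
  then show ?thesis
    using assms(1)
    by (simp add: Pairs_iff weyl_diff[OF assms(2)] weyl_scale[OF assms(2)] orbit_closed[OF _ assms(2)])
qed

text \<open>Interchanging the two orbit elements fixes their midpoint; this symmetry becomes the
  self-adjointness of the operator.\<close>

lemma Pairs_flip: "(\<nu>, \<eta>) \<in> Pairs \<Longrightarrow> (\<nu>, 2 *\<^sub>R \<nu> - \<eta>) \<in> Pairs"
  using coroot_lattice_minus[of "\<eta> - \<nu>"] by (auto simp: Pairs_iff scaleR_2)

text \<open>Reflecting only \<open>2 *\<^sub>R \<nu> - \<eta>\<close>, whose pairing is
  \<open>-2\<close>, moves the midpoint by \<open>d \<alpha>\<close> and keeps
  \<open>\<eta>\<close>. Together with its inverse \<open>Pairs_down\<close> this matches the terms
  whose poles along \<open>1 - q_\<alpha> e^\<alpha>\<close> cancel.\<close>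

lemma Pairs_up:
  assumes "(\<nu>, \<eta>) \<in> Pairs" "\<alpha> \<in> R" "\<nu> \<bullet> st \<alpha> = 0" "\<eta> \<bullet> st \<alpha> = 2"
  shows "(\<nu> + d \<alpha>, \<eta>) \<in> Pairs"
proof -
  have *: "(2 *\<^sub>R \<nu> - \<eta>) \<bullet> st \<alpha> = - 2" unfolding inner_diff_left inner_scaleR_left assms by simp
  have eq: "reflection \<alpha> (2 *\<^sub>R \<nu> - \<eta>) = 2 *\<^sub>R (\<nu> + d \<alpha>) - \<eta>"
    unfolding reflection_st[OF assms(2)] * by (simp add: algebra_simps)
  have mem: "reflection \<alpha> (2 *\<^sub>R \<nu> - \<eta>) \<in> weyl_orbit R \<omega>"
    using assms(1) by (intro orbit_closed[OF _ weyl_reflection[OF assms(2)]]) (simp add: Pairs_iff)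
  have "(\<eta> - \<nu>) + - d \<alpha> \<in> coroot_lattice"
    using assms by (intro coroot_lattice_add coroot_lattice_minus coroot_lattice_d) (auto simp: Pairs_iff)
  then have "\<eta> - (\<nu> + d \<alpha>) \<in> coroot_lattice" by (simp add: algebra_simps)
  then show ?thesis using assms(1) mem unfolding Pairs_iff eq by blast
qed

lemma Pairs_down:
  assumes "(\<nu>, \<eta>) \<in> Pairs" "\<alpha> \<in> R" "\<nu> \<bullet> st \<alpha> = 2"
  shows "(\<nu> - d \<alpha>, \<eta>) \<in> Pairs" "\<eta> \<bullet> st \<alpha> = 2" "(\<nu> - d \<alpha>) \<bullet> st \<alpha> = 0"
proof -
  show 2: "\<eta> \<bullet> st \<alpha> = 2" using Pairs_cases[OF assms(1,2)] assms(3) by auto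
  show "(\<nu> - d \<alpha>) \<bullet> st \<alpha> = 0" using assms d_st_self by (simp add: inner_diff_left)
  have *: "(2 *\<^sub>R \<nu> - \<eta>) \<bullet> st \<alpha> = 2" unfolding inner_diff_left inner_scaleR_left assms 2 by simp
  have eq: "reflection \<alpha> (2 *\<^sub>R \<nu> - \<eta>) = 2 *\<^sub>R (\<nu> - d \<alpha>) - \<eta>"
    unfolding reflection_st[OF assms(2)] * by (simp add: algebra_simps)
  have mem: "reflection \<alpha> (2 *\<^sub>R \<nu> - \<eta>) \<in> weyl_orbit R \<omega>"
    using assms(1) by (intro orbit_closed[OF _ weyl_reflection[OF assms(2)]]) (simp add: Pairs_iff)
  have "(\<eta> - \<nu>) + d \<alpha> \<in> coroot_lattice"
    using assms by (intro coroot_lattice_add coroot_lattice_d) (auto simp: Pairs_iff)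
  then have "\<eta> - (\<nu> - d \<alpha>) \<in> coroot_lattice" by (simp add: algebra_simps)
  then show "(\<nu> - d \<alpha>, \<eta>) \<in> Pairs" using assms(1) mem unfolding Pairs_iff eq by blast
qed

lemma Pairs_\<omega>: "(\<omega>, \<omega>) \<in> Pairs"
  by (simp add: Pairs_iff scaleR_2 orbit_self)

text \<open>The stabilizer of \<open>\<nu>\<close> can make \<open>\<eta>\<close> dominant for the
  roots orthogonal to \<open>\<nu>\<close>. On the other positive roots \<open>\<nu>\<close> pairs
  strictly positively, and there the table leaves only nonnegative pairings of
  \<open>\<eta>\<close>. So \<open>\<eta>\<close> becomes dominant and must be
  \<open>\<omega>\<close>.\<close>

lemma Pairs_dominant_stabilizer:
  assumes "(\<nu>, \<eta>) \<in> Pairs" "dominant \<nu>"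
  shows "\<exists>x\<in>weyl_stabilizer R \<nu>. x \<eta> = \<omega>"
proof -
  obtain x where x: "x \<in> weyl_stabilizer R \<nu>" "\<forall>\<alpha>\<in>Rp. \<alpha> \<bullet> \<nu> = 0 \<longrightarrow> x \<eta> \<bullet> \<alpha> \<ge> 0"
    using exists_stabilizer_dominant by blast
  then have xW: "x \<in> W" "x \<nu> = \<nu>" by (auto simp: weyl_stabilizer_def)
  have p: "(\<nu>, x \<eta>) \<in> Pairs" using Pairs_weyl[OF assms(1) xW(1)] xW(2) by simp
  have "x \<eta> \<bullet> st \<alpha> \<ge> 0" if \<alpha>: "\<alpha> \<in> Rp" for \<alpha>
  proof (cases "\<alpha> \<bullet> \<nu> = 0")
    case True
    then show ?thesis using x(2) \<alpha> inner_st_nonneg_iff[OF Rp_R[OF \<alpha>]] by simp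
  next
    case False
    then have "\<nu> \<bullet> st \<alpha> \<noteq> 0" using inner_st_zero_iff[OF Rp_R[OF \<alpha>], of \<nu>] by (simp add: inner_commute)
    moreover have "\<nu> \<bullet> st \<alpha> \<ge> 0" using assms(2) \<alpha> by (simp add: dominant_st)
    ultimately show ?thesis using Pairs_cases[OF p Rp_R[OF \<alpha>]] by auto
  qed
  then have "dominant (x \<eta>)" by (simp add: dominant_st)
  then have "x \<eta> = \<omega>" using dominant_unique[OF \<omega>_dominant] p by (simp add: Pairs_iff)
  then show ?thesis using x(1) by blast
qed

text \<open>The vectors \<open>d \<beta>\<close> are removed one at a time without leaving the set
  of midpoints. Some \<open>\<beta>\<close> in the sum \<open>x\<close> has
  \<open>x \<bullet> d \<beta> > 0\<close>, because \<open>x \<bullet> x > 0\<close>, and then the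
  midpoint pairs with \<open>st \<beta>\<close> to \<open>1\<close> or \<open>2\<close>. In the
  first case the whole pair is reflected, in the second only one of its members; both lower the
  midpoint by \<open>d \<beta>\<close>.\<close>

lemma dominant_below_Pairs:
  assumes "dominant \<mu>" "(\<mu> + (\<Sum>\<alpha>\<in>Rp. real (c \<alpha>) *\<^sub>R d \<alpha>), \<eta>) \<in> Pairs"
  shows "\<exists>\<eta>. (\<mu>, \<eta>) \<in> Pairs"
  using assms(2)
proof (induction "sum c Rp" arbitrary: c \<eta> rule: less_induct)
  case less
  define x where "x = (\<Sum>\<alpha>\<in>Rp. real (c \<alpha>) *\<^sub>R d \<alpha>)"
  show ?case
  proof (cases "x = 0")
    case True
    then show ?thesis using less.prems by (auto simp: x_def)
  next
    case False
    have "\<exists>\<beta>\<in>Rp. real (c \<beta>) * (x \<bullet> d \<beta>) > 0"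
    proof (rule ccontr)
      assume "\<not> ?thesis"
      then have "(\<Sum>\<beta>\<in>Rp. real (c \<beta>) * (x \<bullet> d \<beta>)) \<le> 0" by (intro sum_nonpos) (auto simp: not_less)
      then have "x \<bullet> x \<le> 0" by (subst (2) x_def) (simp add: inner_sum_right)
      then show False using False inner_gt_zero_iff[of x] by (simp del: inner_gt_zero_iff)
    qed
    then obtain \<beta> where \<beta>: "\<beta> \<in> Rp" "c \<beta> > 0" "x \<bullet> d \<beta> > 0" by (auto simp: zero_less_mult_iff)
    then have \<beta>R: "\<beta> \<in> R" using Rp_R by auto
    have "x \<bullet> st \<beta> > 0" using \<beta>(3) inner_d_pos_iff[OF \<beta>R] by simp
    moreover have "\<mu> \<bullet> st \<beta> \<ge> 0" using assms(1) \<beta>(1) by (simp add: dominant_st)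
    ultimately have pos: "(\<mu> + x) \<bullet> st \<beta> > 0" by (simp add: inner_add_left)
    have p: "(\<mu> + x, \<eta>) \<in> Pairs" using less.prems by (simp add: x_def)
    then have "(\<mu> + x) \<bullet> st \<beta> = 1 \<or> (\<mu> + x) \<bullet> st \<beta> = 2" using Pairs_cases[OF p \<beta>R] pos by auto
    then have "\<exists>\<eta>. (\<mu> + x - d \<beta>, \<eta>) \<in> Pairs"
    proof
      assume "(\<mu> + x) \<bullet> st \<beta> = 1"
      then show ?thesis using Pairs_weyl[OF p weyl_reflection[OF \<beta>R]] by (auto simp: reflection_st[OF \<beta>R])
    next
      assume "(\<mu> + x) \<bullet> st \<beta> = 2"
      then show ?thesis using Pairs_down(1)[OF p \<beta>R] by blast
    qed
    then obtain \<eta>' where \<eta>': "(\<mu> + x - d \<beta>, \<eta>') \<in> Pairs" by blast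
    define c' where "c' = c(\<beta> := c \<beta> - 1)"
    have "x = real (c \<beta>) *\<^sub>R d \<beta> + (\<Sum>\<alpha>\<in>Rp - {\<beta>}. real (c \<alpha>) *\<^sub>R d \<alpha>)"
      unfolding x_def using \<beta>(1) by (simp add: sum.remove)
    moreover have "(\<Sum>\<alpha>\<in>Rp. real (c' \<alpha>) *\<^sub>R d \<alpha>) =
        real (c \<beta> - 1) *\<^sub>R d \<beta> + (\<Sum>\<alpha>\<in>Rp - {\<beta>}. real (c \<alpha>) *\<^sub>R d \<alpha>)"
      using \<beta>(1) by (subst sum.remove[of _ \<beta>]) (auto simp: c'_def intro!: sum.cong)
    ultimately have "x - d \<beta> = (\<Sum>\<alpha>\<in>Rp. real (c' \<alpha>) *\<^sub>R d \<alpha>)"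
      using \<beta>(2) by (simp add: of_nat_diff algebra_simps)
    then have p': "(\<mu> + (\<Sum>\<alpha>\<in>Rp. real (c' \<alpha>) *\<^sub>R d \<alpha>), \<eta>') \<in> Pairs"
      using \<eta>' by (simp add: add_diff_eq[symmetric])
    have "sum c' Rp < sum c Rp"
      using \<beta>(1,2) by (intro sum_strict_mono_ex1) (auto simp: c'_def)
    then show ?thesis using less.hyps p' by blast
  qed
qed

text \<open>In a shortest representation of \<open>\<omega> - \<mu>\<close> every summand has
  pairing at least \<open>2\<close> with \<open>\<omega> - \<mu>\<close>. At a negative root
  \<open>\<omega>\<close> pairs nonpositively, and the table then allows at most \<open>1\<close>;
  hence all summands are positive.\<close>

lemma Pairs_below:
  assumes "(\<mu>, \<omega>) \<in> Pairs"
  shows "\<exists>c :: 'a \<Rightarrow> nat. \<omega> - \<mu> = (\<Sum>\<alpha>\<in>Rp. real (c \<alpha>) *\<^sub>R d \<alpha>)"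
proof -
  have "\<omega> - \<mu> \<in> coroot_lattice" using assms by (simp add: Pairs_iff)
  from shortest_sum[OF this] obtain bs where bs: "set bs \<subseteq> R" "\<omega> - \<mu> = sum_list (map d bs)"
    "\<And>\<beta>. \<beta> \<in> set bs \<Longrightarrow> (\<omega> - \<mu>) \<bullet> st \<beta> \<ge> 2" by blast
  have "\<beta> \<in> Rp" if \<beta>: "\<beta> \<in> set bs" for \<beta>
  proof (rule ccontr)
    assume "\<beta> \<notin> Rp"
    have \<beta>R: "\<beta> \<in> R" using bs(1) \<beta> by auto
    then have "- \<beta> \<in> Rp" using \<open>\<beta> \<notin> Rp\<close> Rp_cases by blast
    then have "\<omega> \<bullet> st (- \<beta>) \<ge> 0" using \<omega>_dominant unfolding dominant_st by blast
    then show False using Pairs_cases[OF assms \<beta>R] bs(3)[OF \<beta>] by (auto simp: inner_diff_left)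
  qed
  then have "set bs \<subseteq> Rp" by auto
  then have "\<exists>c :: 'a \<Rightarrow> nat. sum_list (map d bs) = (\<Sum>\<alpha>\<in>Rp. real (c \<alpha>) *\<^sub>R d \<alpha>)"
  proof (induction bs)
    case Nil
    then show ?case by (intro exI[of _ "\<lambda>_. 0"]) simp
  next
    case (Cons \<beta> bs)
    then obtain c :: "'a \<Rightarrow> nat" where c: "sum_list (map d bs) = (\<Sum>\<alpha>\<in>Rp. real (c \<alpha>) *\<^sub>R d \<alpha>)" by auto
    have "(\<Sum>\<alpha>\<in>Rp. real ((c(\<beta> := c \<beta> + 1)) \<alpha>) *\<^sub>R d \<alpha>) =
        (\<Sum>\<alpha>\<in>Rp. real (c \<alpha>) *\<^sub>R d \<alpha> + (if \<alpha> = \<beta> then d \<beta> else 0))"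
      by (intro sum.cong) (auto simp: scaleR_add_left)
    also have "\<dots> = sum_list (map d (\<beta> # bs))"
      using Cons.prems c by (simp add: sum.distrib)
    finally show ?case by (intro exI[of _ "c(\<beta> := c \<beta> + 1)"]) simp
  qed
  then show ?thesis using bs(2) by simp
qed

lemma dominant_below_iff:
  "\<mu> \<in> dominant_Lambda_below R Rp S \<omega> \<longleftrightarrow> dominant \<mu> \<and> (\<mu>, \<omega>) \<in> Pairs"
proof
  assume "\<mu> \<in> dominant_Lambda_below R Rp S \<omega>"
  then obtain c :: "'a \<Rightarrow> nat" where \<mu>: "dominant \<mu>" and c: "\<omega> - \<mu> = (\<Sum>\<alpha>\<in>Rp. real (c \<alpha>) *\<^sub>R d \<alpha>)"
    by (auto simp: dominant_Lambda_below_def dominant_Lambda_iff dominance_d)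
  have "\<mu> + (\<Sum>\<alpha>\<in>Rp. real (c \<alpha>) *\<^sub>R d \<alpha>) = \<omega>" using c by (simp flip: c)
  then obtain \<eta> where \<eta>: "(\<mu>, \<eta>) \<in> Pairs" using dominant_below_Pairs[OF \<mu>] Pairs_\<omega> by metis
  obtain x where x: "x \<in> weyl_stabilizer R \<mu>" "x \<eta> = \<omega>" using Pairs_dominant_stabilizer[OF \<eta> \<mu>] by blast
  have "(x \<mu>, x \<eta>) \<in> Pairs" using Pairs_weyl[OF \<eta>, of x] x by (simp add: weyl_stabilizer_def)
  then show "dominant \<mu> \<and> (\<mu>, \<omega>) \<in> Pairs" using \<mu> x by (simp add: weyl_stabilizer_def)
next
  assume "dominant \<mu> \<and> (\<mu>, \<omega>) \<in> Pairs"
  then show "\<mu> \<in> dominant_Lambda_below R Rp S \<omega>"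
    using Pairs_below Pairs_Lam by (auto simp: dominant_Lambda_below_def dominant_Lambda_iff dominance_d)
qed

text \<open>Any two elements making \<open>\<nu>\<close> dominant send it to the same weight, and
  the stabilizer is transitive on the \<open>\<eta>\<close> over a given midpoint. So the orbit in
  the definition of the operator does not depend on the choice of the dominating element.\<close>

lemma stabilizer_orbit_Pairs:
  assumes "\<nu> \<in> weyl_orbit R \<mu>" "\<mu> \<in> dominant_Lambda_below R Rp S \<omega>" "x \<in> W" "dominant (x \<nu>)"
  shows "stabilizer_orbit R \<nu> (inv x \<omega>) = {\<eta>. (\<nu>, \<eta>) \<in> Pairs}"
proof -
  have \<mu>: "dominant \<mu>" "(\<mu>, \<omega>) \<in> Pairs" using assms(2) by (auto simp: dominant_below_iff)
  have x\<nu>: "x \<nu> = \<mu>" using dominant_unique[OF \<mu>(1) orbit_closed[OF assms(1,3)] assms(4)] .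
  then have \<nu>: "inv x \<mu> = \<nu>" using weyl_inv(2)[OF assms(3)] by auto
  have base: "(\<nu>, inv x \<omega>) \<in> Pairs" using Pairs_weyl[OF \<mu>(2) weyl_inv(1)[OF assms(3)]] \<nu> by simp
  show ?thesis
  proof (intro set_eqI iffI; clarify)
    fix \<eta> assume "\<eta> \<in> stabilizer_orbit R \<nu> (inv x \<omega>)"
    then show "(\<nu>, \<eta>) \<in> Pairs"
      using Pairs_weyl[OF base] by (fastforce simp: stabilizer_orbit_def weyl_stabilizer_def)
  next
    fix \<eta> assume p: "(\<nu>, \<eta>) \<in> Pairs"
    have "(\<mu>, x \<eta>) \<in> Pairs" using Pairs_weyl[OF p assms(3)] x\<nu> by simp
    from Pairs_dominant_stabilizer[OF this \<mu>(1)] obtain y where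
      y: "y \<in> W" "y \<mu> = \<mu>" "y (x \<eta>) = \<omega>" by (auto simp: weyl_stabilizer_def)
    let ?z = "inv x \<circ> (inv y \<circ> x)"
    have "?z \<in> W" by (intro weyl_comp weyl_inv(1) assms(3) y(1))
    moreover have "?z \<nu> = \<nu>" using x\<nu> \<nu> y(2) weyl_inv(2)[OF y(1), of \<mu>] by simp
    moreover have "?z (inv x \<omega>) = \<eta>"
      using y(3) weyl_inv(2)[OF y(1), of "x \<eta>"] weyl_inv(2,3)[OF assms(3)] by simp
    ultimately show "\<eta> \<in> stabilizer_orbit R \<nu> (inv x \<omega>)"
      unfolding stabilizer_orbit_def weyl_stabilizer_def by (intro image_eqI[of _ _ ?z]) auto
  qed
qed

lemma stabilizer_orbit_dominant:
  assumes "\<mu> \<in> dominant_Lambda_below R Rp S \<omega>"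
  shows "stabilizer_orbit R \<mu> \<omega> = {\<eta>. (\<mu>, \<eta>) \<in> Pairs}"
  using stabilizer_orbit_Pairs[OF orbit_self assms weyl_id] assms by (simp add: dominant_below_iff)

lemma saturated_iff: "\<nu> \<in> Lambda_saturated R Rp S \<omega> \<longleftrightarrow> (\<exists>\<eta>. (\<nu>, \<eta>) \<in> Pairs)"
proof
  assume "\<nu> \<in> Lambda_saturated R Rp S \<omega>"
  then obtain \<mu> w where "(\<mu>, \<omega>) \<in> Pairs" "w \<in> W" "\<nu> = w \<mu>"
    unfolding Lambda_saturated_def using dominant_below_iff orbitE by blast
  then show "\<exists>\<eta>. (\<nu>, \<eta>) \<in> Pairs" using Pairs_weyl by blast
next
  assume "\<exists>\<eta>. (\<nu>, \<eta>) \<in> Pairs"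
  then obtain \<eta> where \<eta>: "(\<nu>, \<eta>) \<in> Pairs" by blast
  obtain w where w: "w \<in> W" "dominant (w \<nu>)" using exists_dominant by blast
  have p: "(w \<nu>, w \<eta>) \<in> Pairs" using Pairs_weyl[OF \<eta> w(1)] .
  from Pairs_dominant_stabilizer[OF this w(2)] obtain y where
    y: "y \<in> W" "y (w \<nu>) = w \<nu>" "y (w \<eta>) = \<omega>" by (auto simp: weyl_stabilizer_def)
  have "(w \<nu>, \<omega>) \<in> Pairs" using Pairs_weyl[OF p y(1)] y by simp
  then have "w \<nu> \<in> dominant_Lambda_below R Rp S \<omega>" using w(2) by (simp add: dominant_below_iff)
  moreover have "\<nu> \<in> weyl_orbit R (w \<nu>)" using orbit_sym[OF orbitI[OF w(1)]] .
  ultimately show "\<nu> \<in> Lambda_saturated R Rp S \<omega>" unfolding Lambda_saturated_def by blast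
qed

lemma finite_below [simp]: "finite (dominant_Lambda_below R Rp S \<omega>)"
  by (rule finite_subset[OF _ finite_imageI[OF finite_Pairs, of fst]]) (force simp: dominant_below_iff)

lemma finite_saturated [simp]: "finite (Lambda_saturated R Rp S \<omega>)"
  by (rule finite_subset[OF _ finite_imageI[OF finite_Pairs, of fst]]) (force simp: saturated_iff)

lemma finite_Pairs_fibre [simp]: "finite {\<eta>. (\<nu>, \<eta>) \<in> Pairs}"
  by (rule finite_subset[OF _ finite_imageI[OF finite_Pairs, of snd]]) force

lemma D_operator_eq:
  assumes "dominating_choice R Rp S w"
  shows "D_operator R Rp S q t w \<omega> f =
    (\<Sum>(\<nu>, \<eta>)\<in>Pairs. U_term R S q t \<nu> \<eta> * V_term R S q t \<nu> * ga_frac (translation q \<nu> f))"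
proof -
  have st: "stabilizer_orbit R \<nu> (inv (w \<nu>) \<omega>) = {\<eta>. (\<nu>, \<eta>) \<in> Pairs}"
    if \<nu>: "\<nu> \<in> Lambda_saturated R Rp S \<omega>" for \<nu>
  proof -
    obtain \<mu> where "\<mu> \<in> dominant_Lambda_below R Rp S \<omega>" "\<nu> \<in> weyl_orbit R \<mu>"
      using \<nu> unfolding Lambda_saturated_def by blast
    moreover have "\<nu> \<in> Lam" using \<nu> Pairs_Lam by (auto simp: saturated_iff)
    then have "w \<nu> \<in> W" "dominant (w \<nu> \<nu>)"
      using assms by (auto simp: dominating_choice_def dominant_Lambda_iff)
    ultimately show ?thesis by (intro stabilizer_orbit_Pairs)
  qed
  have "Pairs = Sigma (Lambda_saturated R Rp S \<omega>) (\<lambda>\<nu>. {\<eta>. (\<nu>, \<eta>) \<in> Pairs})"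
    by (auto simp: saturated_iff)
  then show ?thesis
    unfolding D_operator_def by (simp add: st sum.Sigma cong: sum.cong)
qed

end

section \<open>Divisibility in the group algebra\<close>

lemma ga_expand:
  fixes f :: "'a::zero \<Rightarrow>\<^sub>0 complex"
  shows "f = (\<Sum>x\<in>Poly_Mapping.keys f. Poly_Mapping.single x (Poly_Mapping.lookup f x))"
proof (rule poly_mapping_eqI)
  fix k
  have "Poly_Mapping.lookup (\<Sum>x\<in>Poly_Mapping.keys f. Poly_Mapping.single x (Poly_Mapping.lookup f x)) k =
    (\<Sum>x\<in>Poly_Mapping.keys f. if x = k then Poly_Mapping.lookup f k else 0)"
    by (auto simp: lookup_sum lookup_single when_def intro!: sum.cong)
  then show "Poly_Mapping.lookup f k =
    Poly_Mapping.lookup (\<Sum>x\<in>Poly_Mapping.keys f. Poly_Mapping.single x (Poly_Mapping.lookup f x)) k"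
    by (simp add: in_keys_iff)
qed

lemma ga_induct [case_names zero single add]:
  fixes f :: "'a::zero \<Rightarrow>\<^sub>0 complex"
  assumes "P 0" "\<And>x c. P (Poly_Mapping.single x c)" "\<And>f g. P f \<Longrightarrow> P g \<Longrightarrow> P (f + g)"
  shows "P f"
proof -
  have "P (\<Sum>x\<in>A. Poly_Mapping.single x (Poly_Mapping.lookup f x))" if "finite A" for A
    using that by (induction A rule: finite_induct) (auto intro: assms)
  then show ?thesis by (subst ga_expand) simp
qed

lemma lookup_single_mult:
  "Poly_Mapping.lookup (Poly_Mapping.single a c * g) x = (c :: complex) * Poly_Mapping.lookup g (x - (a :: 'a :: euclidean_space))"
proof (induction g rule: ga_induct)
  case (single y d)
  then show ?case by (auto simp: mult_single lookup_single when_def algebra_simps)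
qed (auto simp: lookup_add algebra_simps)

definition binom :: "'a::euclidean_space \<Rightarrow> complex \<Rightarrow> ('a \<Rightarrow>\<^sub>0 complex)" where
  "binom \<alpha> c = 1 - Poly_Mapping.single \<alpha> c"

lemma binom_nonzero: "\<alpha> \<noteq> 0 \<Longrightarrow> binom \<alpha> c \<noteq> 0"
proof
  assume "\<alpha> \<noteq> 0" "binom \<alpha> c = 0"
  then have "Poly_Mapping.lookup (binom \<alpha> c) 0 = 0" by simp
  then show False using \<open>\<alpha> \<noteq> 0\<close> by (simp add: binom_def lookup_minus lookup_one lookup_single when_def)
qed

text \<open>Coprimality as cancellation: \<open>d\<close> is not a zero divisor modulo
  \<open>b\<close>. The notion is multiplicative in \<open>d\<close> and makes no reference to
  irreducible factors, which the binomials lack because exponents can be halved.\<close>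

definition rel_coprime :: "('a::euclidean_space \<Rightarrow>\<^sub>0 complex) \<Rightarrow> ('a \<Rightarrow>\<^sub>0 complex) \<Rightarrow> bool" where
  "rel_coprime d b \<longleftrightarrow> (\<forall>g. b dvd d * g \<longrightarrow> b dvd g)"

lemma rel_coprime_one [simp]: "rel_coprime 1 b"
  by (simp add: rel_coprime_def)

lemma rel_coprime_mult: "rel_coprime d b \<Longrightarrow> rel_coprime d' b \<Longrightarrow> rel_coprime (d * d') b"
  unfolding rel_coprime_def mult.assoc by blast

text \<open>A combination of the two binomials with constant coefficients is the nonzero constant
  \<open>c - c'\<close>, so they generate the unit ideal.\<close>

lemma binom_coprime_same:
  assumes "c \<noteq> c'"
  shows "rel_coprime (binom \<alpha> c') (binom \<alpha> c)"
  unfolding rel_coprime_def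
proof (intro allI impI)
  fix g assume dv: "binom \<alpha> c dvd binom \<alpha> c' * g"
  let ?k = "Poly_Mapping.single 0 (inverse (c - c')) :: 'a \<Rightarrow>\<^sub>0 complex"
  have "Poly_Mapping.single 0 c * (binom \<alpha> c' * g) - Poly_Mapping.single 0 c' * (binom \<alpha> c * g)
      = Poly_Mapping.single 0 (c - c') * g"
  proof -
    have "Poly_Mapping.single 0 c * (binom \<alpha> c' * g) - Poly_Mapping.single 0 c' * (binom \<alpha> c * g) =
        (Poly_Mapping.single 0 c * binom \<alpha> c' - Poly_Mapping.single 0 c' * binom \<alpha> c) * g"
      by (simp add: algebra_simps)
    also have "Poly_Mapping.single 0 c * binom \<alpha> c' - Poly_Mapping.single 0 c' * binom \<alpha> c
        = Poly_Mapping.single 0 (c - c')"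
      by (simp add: binom_def right_diff_distrib mult_single single_diff mult.commute)
    finally show ?thesis .
  qed
  moreover have "binom \<alpha> c dvd Poly_Mapping.single 0 c * (binom \<alpha> c' * g) - Poly_Mapping.single 0 c' * (binom \<alpha> c * g)"
    by (rule dvd_diff[OF dvd_mult[OF dv] dvd_mult[OF dvd_triv_left]])
  ultimately have dv: "binom \<alpha> c dvd ?k * (Poly_Mapping.single 0 (c - c') * g)" by simp
  have "?k * Poly_Mapping.single 0 (c - c') = 1" using assms by (simp add: mult_single)
  then have "?k * (Poly_Mapping.single 0 (c - c') * g) = g" by (simp flip: mult.assoc)
  then show "binom \<alpha> c dvd g" using dv by simp
qed

text \<open>Multiplying the first binomial by \<open>c e^\<alpha>\<close> and adding the second
  gives the constant \<open>1 - c c'\<close>, a unit.\<close>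

lemma binom_coprime_opposite:
  assumes "c * c' \<noteq> 1"
  shows "rel_coprime (binom (- \<alpha>) c') (binom \<alpha> c)"
  unfolding rel_coprime_def
proof (intro allI impI)
  fix g assume dv: "binom \<alpha> c dvd binom (- \<alpha>) c' * g"
  let ?k = "Poly_Mapping.single 0 (inverse (1 - c * c')) :: 'a \<Rightarrow>\<^sub>0 complex"
  have "Poly_Mapping.single \<alpha> c * (binom (- \<alpha>) c' * g) + binom \<alpha> c * g
      = Poly_Mapping.single 0 (1 - c * c') * g"
  proof -
    have "Poly_Mapping.single \<alpha> c * (binom (- \<alpha>) c' * g) + binom \<alpha> c * g =
        (Poly_Mapping.single \<alpha> c * binom (- \<alpha>) c' + binom \<alpha> c) * g"
      by (simp add: algebra_simps)
    also have "Poly_Mapping.single \<alpha> c * binom (- \<alpha>) c' + binom \<alpha> c = Poly_Mapping.single 0 (1 - c * c')"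
      by (simp add: binom_def right_diff_distrib mult_single single_diff)
    finally show ?thesis .
  qed
  moreover have "binom \<alpha> c dvd Poly_Mapping.single \<alpha> c * (binom (- \<alpha>) c' * g) + binom \<alpha> c * g"
    by (rule dvd_add[OF dvd_mult[OF dv] dvd_mult2[OF dvd_refl]])
  ultimately have dv: "binom \<alpha> c dvd ?k * (Poly_Mapping.single 0 (1 - c * c') * g)" by simp
  have "?k * Poly_Mapping.single 0 (1 - c * c') = 1" using assms by (simp add: mult_single)
  then have "?k * (Poly_Mapping.single 0 (1 - c * c') * g) = g" by (simp flip: mult.assoc)
  then show "binom \<alpha> c dvd g" using dv by simp
qed

definition graded :: "'a::euclidean_space \<Rightarrow> real \<Rightarrow> ('a \<Rightarrow>\<^sub>0 complex) \<Rightarrow> ('a \<Rightarrow>\<^sub>0 complex)" where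
  "graded y s f = Poly_Mapping.mapp (\<lambda>x c. if x \<bullet> y = s then c else 0) f"

lemma lookup_graded: "Poly_Mapping.lookup (graded y s f) x = (if x \<bullet> y = s then Poly_Mapping.lookup f x else 0)"
  by (auto simp: graded_def lookup_mapp when_def in_keys_iff)

lemma graded_diff: "graded y s (f - g) = graded y s f - graded y s g"
  by (rule poly_mapping_eqI) (simp add: lookup_graded lookup_minus)

lemma graded_single_mult:
  "graded y s (Poly_Mapping.single a c * g) = Poly_Mapping.single a c * graded y (s - a \<bullet> y) g"
  by (rule poly_mapping_eqI) (auto simp: lookup_graded lookup_single_mult inner_diff_left)

lemma graded_binom_mult:
  "graded y s (binom \<alpha> c * g) = graded y s g - Poly_Mapping.single \<alpha> c * graded y (s - \<alpha> \<bullet> y) g"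
  by (simp add: binom_def left_diff_distrib graded_diff graded_single_mult)

text \<open>\<open>1 - c e\<^sup>\<alpha>\<close> is homogeneous for the grading by \<open>y\<close>, whereas \<open>1 - c' e\<^sup>\<beta>\<close> has lowest
  term \<open>1\<close>; so the lowest term of a multiple can be divided off.\<close>

lemma binom_coprime_graded:
  assumes "\<alpha> \<bullet> y = 0" "\<beta> \<bullet> y > 0"
  shows "rel_coprime (binom \<beta> c') (binom \<alpha> c)"
  unfolding rel_coprime_def
proof (intro allI impI)
  fix g assume "binom \<alpha> c dvd binom \<beta> c' * g"
  then show "binom \<alpha> c dvd g"
  proof (induction "card ((\<lambda>x. x \<bullet> y) ` Poly_Mapping.keys g)" arbitrary: g rule: less_induct)
    case less
    show ?case
    proof (cases "g = 0")
      case True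
      then show ?thesis by simp
    next
      case False
      let ?D = "(\<lambda>x. x \<bullet> y) ` Poly_Mapping.keys g"
      define s where "s = Min ?D"
      have s: "s \<in> ?D" unfolding s_def using False by (intro Min_in) auto
      have low: "graded y r g = 0" if "r < s" for r
      proof (rule poly_mapping_eqI)
        fix x
        have "x \<notin> Poly_Mapping.keys g" if "x \<bullet> y = r"
          using that \<open>r < s\<close> Min_le[of ?D "x \<bullet> y"] unfolding s_def by (auto simp: not_le[symmetric])
        then show "Poly_Mapping.lookup (graded y r g) x = Poly_Mapping.lookup 0 x"
          by (auto simp: lookup_graded in_keys_iff)
      qed
      obtain k where k: "binom \<beta> c' * g = binom \<alpha> c * k" using less.prems by (auto simp: dvd_def)
      have "graded y s (binom \<beta> c' * g) = graded y s g"
        using low[of "s - \<beta> \<bullet> y"] assms(2) by (simp add: graded_binom_mult)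
      moreover have "graded y s (binom \<alpha> c * k) = binom \<alpha> c * graded y s k"
        using assms(1) by (simp add: graded_binom_mult) (simp add: binom_def algebra_simps)
      ultimately have dv: "binom \<alpha> c dvd graded y s g" using k by (metis dvd_triv_left)
      let ?g = "g - graded y s g"
      have lk: "Poly_Mapping.lookup ?g x = (if x \<bullet> y = s then 0 else Poly_Mapping.lookup g x)" for x
        by (simp add: lookup_minus lookup_graded)
      have "(\<lambda>x. x \<bullet> y) ` Poly_Mapping.keys ?g \<subseteq> ?D - {s}"
      proof (intro image_subsetI)
        fix x assume "x \<in> Poly_Mapping.keys ?g"
        then have "Poly_Mapping.lookup ?g x \<noteq> 0" by (simp add: in_keys_iff)
        then have "x \<bullet> y \<noteq> s" "x \<in> Poly_Mapping.keys g" unfolding lk by (auto simp: in_keys_iff split: if_splits)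
        then show "x \<bullet> y \<in> ?D - {s}" by simp
      qed
      then have "(\<lambda>x. x \<bullet> y) ` Poly_Mapping.keys ?g \<subset> ?D" using s by blast
      then have "card ((\<lambda>x. x \<bullet> y) ` Poly_Mapping.keys ?g) < card ?D" by (intro psubset_card_mono) auto
      moreover have "binom \<alpha> c dvd binom \<beta> c' * ?g"
        using less.prems dv by (simp add: right_diff_distrib dvd_diff)
      ultimately have "binom \<alpha> c dvd ?g" using less.hyps by blast
      then have "binom \<alpha> c dvd ?g + graded y s g" using dv by (intro dvd_add)
      then show ?thesis by simp
    qed
  qed
qed

lemma binom_coprime_independent:
  assumes "\<alpha> \<noteq> 0" "\<And>r. \<beta> \<noteq> r *\<^sub>R \<alpha>"
  shows "rel_coprime (binom \<beta> c') (binom \<alpha> c)"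
proof -
  \<comment> \<open>The component of \<open>\<beta>\<close> orthogonal to \<open>\<alpha>\<close>;
    its pairing with \<open>\<beta>\<close> is its own squared norm, so it is a grading of the
    required kind.\<close>
  define y where "y = \<beta> - (\<beta> \<bullet> \<alpha> / (\<alpha> \<bullet> \<alpha>)) *\<^sub>R \<alpha>"
  have y: "y \<noteq> 0" using assms(2)[of "\<beta> \<bullet> \<alpha> / (\<alpha> \<bullet> \<alpha>)"] by (auto simp: y_def)
  have o: "\<alpha> \<bullet> y = 0" using assms(1) by (simp add: y_def inner_diff_right inner_commute)
  have "y \<bullet> y = \<beta> \<bullet> y" by (subst (1) y_def) (simp add: inner_diff_left o)
  then have "\<beta> \<bullet> y > 0" using y by (metis inner_gt_zero_iff)
  then show ?thesis by (rule binom_coprime_graded[OF o])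
qed

text \<open>Modulo the binomial \<open>e^\<alpha>\<close> becomes \<open>1 / c\<close>, so shifting
  an exponent by \<open>-j \<alpha>\<close> multiplies by the power \<open>j\<close> of
  \<open>c\<close>. For nonnegative \<open>j\<close> this is the factorisation of
  \<open>1 - X^n\<close>; for negative \<open>j\<close> the two exponents exchange roles.\<close>

lemma binom_dvd_shift:
  assumes "c \<noteq> 0" "j \<in> \<int>"
  shows "binom \<alpha> (complex_of_real c) dvd Poly_Mapping.single (x - j *\<^sub>R \<alpha>) a -
    Poly_Mapping.single x (a * (complex_of_real (c powi \<lfloor>j\<rfloor>)))"
proof -
  let ?c = "complex_of_real c"
  have nat: "binom \<alpha> ?c dvd Poly_Mapping.single x a - Poly_Mapping.single (x + of_nat n *\<^sub>R \<alpha>) (a * ?c ^ n)"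
    for x a n
  proof -
    have pow: "Poly_Mapping.single \<alpha> ?c ^ n = Poly_Mapping.single (of_nat n *\<^sub>R \<alpha>) (?c ^ n)"
      by (induction n) (auto simp: mult_single scaleR_add_left)
    have "binom \<alpha> ?c dvd 1 - Poly_Mapping.single \<alpha> ?c ^ n"
      unfolding binom_def one_diff_power_eq[of "Poly_Mapping.single \<alpha> ?c" n] by simp
    then have "binom \<alpha> ?c dvd Poly_Mapping.single x a * (1 - Poly_Mapping.single \<alpha> ?c ^ n)" by simp
    also have "\<dots> = Poly_Mapping.single x a - Poly_Mapping.single (x + of_nat n *\<^sub>R \<alpha>) (a * ?c ^ n)"
      by (simp add: pow right_diff_distrib mult_single)
    finally show ?thesis .
  qed
  obtain i :: int where i: "j = of_int i" using assms(2) by (auto elim: Ints_cases)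
  show ?thesis
  proof (cases "i \<ge> 0")
    case True
    then show ?thesis using nat[of "x - j *\<^sub>R \<alpha>" a "nat i"] i by (simp add: power_int_def)
  next
    case False
    have "binom \<alpha> ?c dvd Poly_Mapping.single x (a * of_real (c powi i)) -
        Poly_Mapping.single (x + of_nat (nat (- i)) *\<^sub>R \<alpha>) (a * of_real (c powi i) * ?c ^ nat (- i))"
      by (rule nat)
    moreover have "of_real (c powi i) * ?c ^ nat (- i) = 1"
      using False assms(1) by (simp add: power_int_def field_simps)
    moreover have "x + of_nat (nat (- i)) *\<^sub>R \<alpha> = x - j *\<^sub>R \<alpha>" using False i by simp
    ultimately have "binom \<alpha> ?c dvd Poly_Mapping.single x (a * of_real (c powi i)) - Poly_Mapping.single (x - j *\<^sub>R \<alpha>) a"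
      by (simp add: mult.assoc)
    then have "binom \<alpha> ?c dvd - (Poly_Mapping.single x (a * of_real (c powi i)) - Poly_Mapping.single (x - j *\<^sub>R \<alpha>) a)"
      by (simp only: dvd_minus_iff)
    then show ?thesis using i by simp
  qed
qed

section \<open>The quotient field\<close>

lemma to_ga_domain_hom:
  "to_ga_domain (f + g) = to_ga_domain f + to_ga_domain g"
  "to_ga_domain (f - g) = to_ga_domain f - to_ga_domain g"
  "to_ga_domain (f * g) = to_ga_domain f * to_ga_domain g"
  "to_ga_domain 0 = 0" "to_ga_domain 1 = 1"
  by (simp_all add: plus_ga_domain.abs_eq minus_ga_domain.abs_eq times_ga_domain.abs_eq
    zero_ga_domain_def one_ga_domain_def)

lemma ga_frac_add: "ga_frac (f + g) = ga_frac f + ga_frac g"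
  by (simp add: ga_frac_def to_ga_domain_hom)

lemma ga_frac_diff: "ga_frac (f - g) = ga_frac f - ga_frac g"
  by (simp add: ga_frac_def to_ga_domain_hom)

lemma ga_frac_mult: "ga_frac (f * g) = ga_frac f * ga_frac g"
  by (simp add: ga_frac_def to_ga_domain_hom)

lemma ga_frac_0 [simp]: "ga_frac 0 = 0"
  by (simp add: ga_frac_def to_ga_domain_hom Zero_fract_def)

lemma ga_frac_1 [simp]: "ga_frac 1 = 1"
  by (simp add: ga_frac_def to_ga_domain_hom One_fract_def)

lemma ga_frac_eq_iff [simp]: "ga_frac f = ga_frac g \<longleftrightarrow> f = g"
  by (simp add: ga_frac_def eq_fract to_ga_domain_inject)

lemma ga_frac_eq_0_iff [simp]: "ga_frac f = 0 \<longleftrightarrow> f = 0"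
  using ga_frac_eq_iff[of f 0] by simp

lemma ga_frac_sum: "ga_frac (sum f I) = (\<Sum>i\<in>I. ga_frac (f i))"
  by (induction I rule: infinite_finite_induct) (auto simp: ga_frac_add)

lemma ga_frac_prod: "ga_frac (prod f I) = (\<Prod>i\<in>I. ga_frac (f i))"
  by (induction I rule: infinite_finite_induct) (auto simp: ga_frac_mult)

lemma fract_quotient: obtains f g where "x = ga_frac f / ga_frac g" "g \<noteq> 0"
proof -
  obtain a b where ab: "x = Fract a b" "b \<noteq> 0" by (cases x) auto
  have "x = ga_frac (of_ga_domain a) / ga_frac (of_ga_domain b)"
    by (simp add: ga_frac_def of_ga_domain_inverse ab)
  moreover have "of_ga_domain b \<noteq> 0" using ab(2) by (metis of_ga_domain_inverse to_ga_domain_hom(4))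
  ultimately show ?thesis using that by blast
qed

text \<open>Membership in the localisation at \<open>b\<close>: some denominator of \<open>F\<close>
  can be cancelled modulo \<open>b\<close>. Products of such denominators are again of this kind, so
  the regular elements form a ring, in which \<open>cong_at\<close> is congruence modulo
  \<open>b\<close>.\<close>

definition regular_at :: "('a::euclidean_space \<Rightarrow>\<^sub>0 complex) \<Rightarrow> 'a ga_domain fract \<Rightarrow> bool" where
  "regular_at b F \<longleftrightarrow> (\<exists>N d. d \<noteq> 0 \<and> rel_coprime d b \<and> F * ga_frac d = ga_frac N)"

lemma regular_at_ga_frac [simp]: "regular_at b (ga_frac f)"
  unfolding regular_at_def by (intro exI[of _ f] exI[of _ 1]) auto

lemma regular_at_0 [simp]: "regular_at b 0" and regular_at_1 [simp]: "regular_at b 1"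
  using regular_at_ga_frac[of b 0] regular_at_ga_frac[of b 1] by auto

lemma ga_nonzero_mult: "f \<noteq> 0 \<Longrightarrow> g \<noteq> 0 \<Longrightarrow> f * g \<noteq> (0 :: 'a::euclidean_space \<Rightarrow>\<^sub>0 complex)"
  by (rule group_algebra_no_zero_divisors)

lemma regular_at_mult: assumes "regular_at b F" "regular_at b G" shows "regular_at b (F * G)"
proof -
  obtain N d N' d' where F: "d \<noteq> 0" "rel_coprime d b" "F * ga_frac d = ga_frac N"
    and G: "d' \<noteq> 0" "rel_coprime d' b" "G * ga_frac d' = ga_frac N'" using assms by (auto simp: regular_at_def)
  have "F * G * ga_frac (d * d') = (F * ga_frac d) * (G * ga_frac d')"
    by (simp add: ga_frac_mult mult_ac)
  also have "\<dots> = ga_frac (N * N')" unfolding F G by (simp add: ga_frac_mult)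
  finally show ?thesis unfolding regular_at_def
    using rel_coprime_mult[OF F(2) G(2)] ga_nonzero_mult[OF F(1) G(1)] by blast
qed

lemma regular_at_add: assumes "regular_at b F" "regular_at b G" shows "regular_at b (F + G)"
proof -
  obtain N d N' d' where F: "d \<noteq> 0" "rel_coprime d b" "F * ga_frac d = ga_frac N"
    and G: "d' \<noteq> 0" "rel_coprime d' b" "G * ga_frac d' = ga_frac N'" using assms by (auto simp: regular_at_def)
  have "(F + G) * ga_frac (d * d') = (F * ga_frac d) * ga_frac d' + (G * ga_frac d') * ga_frac d"
    unfolding ga_frac_mult by (simp only: ring_distribs mult_ac)
  also have "\<dots> = ga_frac (N * d' + N' * d)" unfolding F G by (simp add: ga_frac_mult ga_frac_add)
  finally show ?thesis unfolding regular_at_def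
    using rel_coprime_mult[OF F(2) G(2)] ga_nonzero_mult[OF F(1) G(1)] by blast
qed

lemma regular_at_minus: "regular_at b F \<Longrightarrow> regular_at b (- F)"
  using regular_at_mult[OF regular_at_ga_frac[of b "- 1"]]
  by (metis diff_0 ga_frac_0 ga_frac_1 ga_frac_diff mult_minus1)

lemma regular_at_diff: "regular_at b F \<Longrightarrow> regular_at b G \<Longrightarrow> regular_at b (F - G)"
  using regular_at_add[OF _ regular_at_minus] by fastforce

lemma regular_at_sum: "(\<And>i. i \<in> I \<Longrightarrow> regular_at b (F i)) \<Longrightarrow> regular_at b (sum F I)"
  by (induction I rule: infinite_finite_induct) (auto intro: regular_at_add)

lemma regular_at_prod: "(\<And>i. i \<in> I \<Longrightarrow> regular_at b (F i)) \<Longrightarrow> regular_at b (prod F I)"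
  by (induction I rule: infinite_finite_induct) (auto intro: regular_at_mult)

lemma regular_at_inverse: "d \<noteq> 0 \<Longrightarrow> rel_coprime d b \<Longrightarrow> regular_at b (inverse (ga_frac d))"
  unfolding regular_at_def by (intro exI[of _ 1] exI[of _ d]) auto

definition cong_at :: "('a::euclidean_space \<Rightarrow>\<^sub>0 complex) \<Rightarrow> 'a ga_domain fract \<Rightarrow> 'a ga_domain fract \<Rightarrow> bool" where
  "cong_at b F G \<longleftrightarrow> regular_at b F \<and> regular_at b G \<and> (\<exists>H. regular_at b H \<and> F - G = ga_frac b * H)"

lemma cong_at_refl: "regular_at b F \<Longrightarrow> cong_at b F F"
  unfolding cong_at_def by (auto intro!: exI[of _ 0])

lemma cong_atI:
  "F - G = ga_frac b * H \<Longrightarrow> regular_at b F \<Longrightarrow> regular_at b G \<Longrightarrow> regular_at b H \<Longrightarrow> cong_at b F G"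
  by (auto simp: cong_at_def)

lemma cong_atE:
  assumes "cong_at b F G"
  obtains H where "regular_at b F" "regular_at b G" "regular_at b H" "F - G = ga_frac b * H"
  using assms by (auto simp: cong_at_def)

lemma cong_at_sym: assumes "cong_at b F G" shows "cong_at b G F"
proof -
  obtain H where H: "regular_at b F" "regular_at b G" "regular_at b H" "F - G = ga_frac b * H"
    using assms by (rule cong_atE)
  show ?thesis
  proof (rule cong_atI[where H = "- H"])
    show "G - F = ga_frac b * (- H)" using H(4) by (metis minus_diff_eq mult_minus_right)
  qed (intro H regular_at_minus)+
qed

lemma cong_at_mult: assumes "cong_at b F G" "cong_at b F' G'" shows "cong_at b (F * F') (G * G')"
proof -
  obtain H where H: "regular_at b F" "regular_at b G" "regular_at b H" "F - G = ga_frac b * H"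
    using assms(1) by (rule cong_atE)
  obtain H' where H': "regular_at b F'" "regular_at b G'" "regular_at b H'" "F' - G' = ga_frac b * H'"
    using assms(2) by (rule cong_atE)
  show ?thesis
  proof (rule cong_atI[where H = "H * F' + G * H'"])
    have "F * F' - G * G' = (F - G) * F' + G * (F' - G')" by (simp add: algebra_simps)
    also have "\<dots> = ga_frac b * (H * F' + G * H')" unfolding H H' by (simp only: ring_distribs mult_ac)
    finally show "F * F' - G * G' = ga_frac b * (H * F' + G * H')" .
  qed (intro H H' regular_at_mult regular_at_add)+
qed

lemma cong_at_prod: "(\<And>i. i \<in> I \<Longrightarrow> cong_at b (F i) (G i)) \<Longrightarrow> cong_at b (prod F I) (prod G I)"
  by (induction I rule: infinite_finite_induct) (auto intro: cong_at_mult cong_at_refl)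

lemma cong_at_diff: assumes "cong_at b F G" "cong_at b F' G'" shows "cong_at b (F - F') (G - G')"
proof -
  obtain H where H: "regular_at b F" "regular_at b G" "regular_at b H" "F - G = ga_frac b * H"
    using assms(1) by (rule cong_atE)
  obtain H' where H': "regular_at b F'" "regular_at b G'" "regular_at b H'" "F' - G' = ga_frac b * H'"
    using assms(2) by (rule cong_atE)
  show ?thesis
  proof (rule cong_atI[where H = "H - H'"])
    have "(F - F') - (G - G') = (F - G) - (F' - G')" by (simp add: algebra_simps)
    also have "\<dots> = ga_frac b * (H - H')" unfolding H H' by (simp only: ring_distribs)
    finally show "(F - F') - (G - G') = ga_frac b * (H - H')" .
  qed (intro H H' regular_at_diff)+
qed

lemma cong_at_inverse:
  assumes "cong_at b F G" "regular_at b (inverse F)" "regular_at b (inverse G)" "F \<noteq> 0" "G \<noteq> 0"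
  shows "cong_at b (inverse F) (inverse G)"
proof -
  obtain H where H: "regular_at b F" "regular_at b G" "regular_at b H" "F - G = ga_frac b * H"
    using assms(1) by (rule cong_atE)
  show ?thesis
  proof (rule cong_atI[where H = "H * - (inverse F * inverse G)"])
    have "inverse F - inverse G = (F - G) * (- (inverse F * inverse G))"
      using assms(4,5) by (simp add: field_simps)
    also have "\<dots> = ga_frac b * (H * - (inverse F * inverse G))" unfolding H by (simp only: mult_ac)
    finally show "inverse F - inverse G = ga_frac b * (H * - (inverse F * inverse G))" .
  qed (intro H assms regular_at_minus regular_at_mult)+
qed

lemma cong_at_ga_frac: "b dvd f - g \<Longrightarrow> cong_at b (ga_frac f) (ga_frac g)"
proof (elim dvdE)
  fix k assume "f - g = b * k"
  then have "ga_frac f - ga_frac g = ga_frac b * ga_frac k" by (simp flip: ga_frac_diff ga_frac_mult)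
  then show ?thesis by (rule cong_atI) simp_all
qed

text \<open>Regularity at \<open>b i\<close> gives a second denominator, which can be cancelled
  modulo \<open>b i\<close>. Comparing it with the common denominator shows that \<open>b i\<close>
  divides the numerator, so the factors are removed one by one.\<close>

lemma regular_everywhere:
  assumes "finite I" "\<And>i. i \<in> I \<Longrightarrow> regular_at (b i) F" "\<And>i. i \<in> I \<Longrightarrow> b i \<noteq> 0"
    and "F * ga_frac (\<Prod>i\<in>I. b i) = ga_frac N"
  shows "\<exists>M. F = ga_frac M"
  using assms
proof (induction I arbitrary: N rule: finite_induct)
  case empty
  then show ?case by auto
next
  case (insert i I)
  obtain M d where d: "d \<noteq> 0" "rel_coprime d (b i)" "F * ga_frac d = ga_frac M"
    using insert.prems(1)[of i] by (auto simp: regular_at_def)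
  let ?B = "\<Prod>i\<in>I. b i"
  have "ga_frac (d * N) = ga_frac d * (F * ga_frac (b i * ?B))"
    using insert.prems(3) insert.hyps by (simp add: ga_frac_mult)
  also have "\<dots> = (F * ga_frac d) * ga_frac (b i * ?B)" by (simp add: mult_ac)
  also have "\<dots> = ga_frac (b i * (M * ?B))" unfolding d by (simp add: ga_frac_mult mult_ac)
  finally have "d * N = b i * (M * ?B)" by simp
  then have "b i dvd d * N" by simp
  then have "b i dvd N" using d(2) unfolding rel_coprime_def by blast
  then obtain N' where N': "N = b i * N'" by (auto simp: dvd_def)
  have "ga_frac (b i) * (F * ga_frac ?B) = ga_frac (b i) * ga_frac N'"
    using insert.prems(3) insert.hyps by (simp add: N' ga_frac_mult algebra_simps)
  moreover have "ga_frac (b i) \<noteq> 0" using insert.prems(2) by simp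
  ultimately have "F * ga_frac ?B = ga_frac N'" by simp
  then show ?case using insert.IH insert.prems by blast
qed

subsection \<open>The functions \<open>v\<close>\<close>

definition vf :: "real \<Rightarrow> real \<Rightarrow> 'a::euclidean_space \<Rightarrow> 'a ga_domain fract" where
  "vf \<tau> c \<alpha> = v_factor \<tau> (scaled_exp c \<alpha>)"

lemma scaled_exp_mult: "scaled_exp c \<alpha> * scaled_exp c' \<beta> = scaled_exp (c * c') (\<alpha> + \<beta>)"
  by (simp add: scaled_exp_def mult_single flip: ga_frac_mult)

lemma scaled_exp_one: "scaled_exp 1 0 = 1"
  by (simp add: scaled_exp_def)

lemma one_minus_scaled_exp: "1 - scaled_exp c \<alpha> = ga_frac (binom \<alpha> (of_real c))"
  by (simp add: scaled_exp_def binom_def ga_frac_diff)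

lemma vf_eq:
  "vf \<tau> c \<alpha> = scaled_exp (\<tau> powr (- 1 / 2)) 0 *
    (ga_frac (binom \<alpha> (of_real (\<tau> * c))) * inverse (ga_frac (binom \<alpha> (of_real c))))"
  unfolding vf_def v_factor_def scaled_exp_mult one_minus_scaled_exp divide_inverse add_0 ..

lemma regular_at_vf:
  assumes "\<alpha> \<noteq> 0" "rel_coprime (binom \<alpha> (of_real c)) b"
  shows "regular_at b (vf \<tau> c \<alpha>)"
  unfolding vf_eq using assms
  by (intro regular_at_mult regular_at_inverse binom_nonzero) (auto simp: scaled_exp_def)

lemma cong_at_vf:
  assumes "cong_at b (scaled_exp c \<alpha>) (scaled_exp c' \<beta>)" "\<alpha> \<noteq> 0" "\<beta> \<noteq> 0"
    "rel_coprime (binom \<alpha> (of_real c)) b" "rel_coprime (binom \<beta> (of_real c')) b"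
  shows "cong_at b (vf \<tau> c \<alpha>) (vf \<tau> c' \<beta>)"
proof -
  have const: "cong_at b (scaled_exp r 0) (scaled_exp r 0)" for r
    by (rule cong_at_refl) (simp add: scaled_exp_def)
  have one: "cong_at b 1 1" by (rule cong_at_refl) simp
  have ne: "1 - scaled_exp c \<alpha> \<noteq> 0" "1 - scaled_exp c' \<beta> \<noteq> 0"
    using assms by (auto simp: one_minus_scaled_exp binom_nonzero)
  have reg: "regular_at b (inverse (1 - scaled_exp c \<alpha>))" "regular_at b (inverse (1 - scaled_exp c' \<beta>))"
    using assms by (auto simp: one_minus_scaled_exp binom_nonzero intro!: regular_at_inverse)
  show ?thesis
    unfolding vf_def v_factor_def divide_inverse
    by (intro cong_at_mult cong_at_diff cong_at_inverse const one assms(1) ne reg)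
qed

text \<open>The sum of \<open>v(z)\<close> and \<open>v(1/z)\<close> is constant, so the two
  functions have opposite poles. All pole cancellations of the operator come from this
  identity.\<close>

lemma vf_reflection:
  assumes "c \<noteq> 0" "\<alpha> \<noteq> 0"
  shows "vf \<tau> c \<alpha> + vf \<tau> (inverse c) (- \<alpha>) = scaled_exp (\<tau> powr (- 1 / 2)) 0 * (1 + scaled_exp \<tau> 0)"
proof -
  let ?z = "scaled_exp c \<alpha>" and ?y = "scaled_exp (inverse c) (- \<alpha>)"
  have zy: "?z * ?y = 1" using assms by (simp add: scaled_exp_mult scaled_exp_one)
  have ne: "1 - ?z \<noteq> 0" "1 - ?y \<noteq> 0"
    using assms by (auto simp: one_minus_scaled_exp binom_nonzero)
  have *: "(1 - T * ?z) / (1 - ?z) + (1 - T * ?y) / (1 - ?y) = 1 + T" for T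
  proof -
    have "(1 - T * ?z) * (1 - ?y) + (1 - T * ?y) * (1 - ?z) = (1 + T) * ((1 - ?z) * (1 - ?y)) + (1 - T) * (1 - ?z * ?y)"
      by (simp add: algebra_simps)
    then show ?thesis using ne by (simp add: zy add_frac_eq divide_eq_eq)
  qed
  show ?thesis unfolding vf_def v_factor_def distrib_left[symmetric] * ..
qed

section \<open>Regularity of the operator\<close>

lemma lookup_translation:
  "Poly_Mapping.lookup (translation q \<nu> f) x = of_real (q powr (x \<bullet> \<nu>)) * Poly_Mapping.lookup f x"
proof -
  have "Poly_Mapping.lookup (translation q \<nu> f) x =
    (\<Sum>y\<in>Poly_Mapping.keys f. if y = x then of_real (q powr (x \<bullet> \<nu>)) * Poly_Mapping.lookup f x else 0)"
    by (auto simp: translation_def lookup_sum lookup_single when_def intro!: sum.cong)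
  then show ?thesis by (simp add: in_keys_iff)
qed

lemma translation_add: "translation q \<nu> (f + g) = translation q \<nu> f + translation q \<nu> g"
  by (rule poly_mapping_eqI) (simp add: lookup_translation lookup_add algebra_simps)

lemma translation_single:
  "translation q \<nu> (Poly_Mapping.single x c) = Poly_Mapping.single x (of_real (q powr (x \<bullet> \<nu>)) * c)"
  by (rule poly_mapping_eqI) (auto simp: lookup_translation lookup_single when_def)

text \<open>Rewriting the sum as \<open>(x + x') Y - x' (Y - Y')\<close> leaves only the simple pole
  of \<open>x'\<close>, in front of a difference divisible by \<open>b\<close>.\<close>

lemma pair_regular:
  assumes "x + x' = K" "regular_at b K" "cong_at b Y Y'" "regular_at b (x' * ga_frac b)"
  shows "regular_at b (x * Y + x' * Y')"
proof -
  obtain H where H: "regular_at b Y" "regular_at b Y'" "regular_at b H" "Y - Y' = ga_frac b * H"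
    using assms(3) by (rule cong_atE)
  have "x * Y + x' * Y' = (x + x') * Y - x' * (Y - Y')" by (simp add: algebra_simps)
  also have "\<dots> = K * Y - (x' * ga_frac b) * H" unfolding H assms(1) by (simp only: mult_ac)
  finally show ?thesis
    by (simp only:) (intro regular_at_diff regular_at_mult assms H)
qed

section \<open>The factors of the operator, root by root, and their behaviour under
  reflections\<close>

locale macd = admissible_pair R Rp v S for R Rp :: "'a::euclidean_space set" and v S +
  fixes q :: real and t :: "'a \<Rightarrow> real"
  assumes q: "0 < q" "q < 1" and param: "parameter_family R t"
begin

definition qa where "qa \<alpha> = q powr u \<alpha>"

lemma qa: "\<alpha> \<in> R \<Longrightarrow> 0 < qa \<alpha>" "\<alpha> \<in> R \<Longrightarrow> qa \<alpha> < 1"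
  using q u_pos[of \<alpha>] powr_less_mono2[of "u \<alpha>" q 1] by (auto simp: qa_def)

lemma qa_minus [simp]: "qa (- \<alpha>) = qa \<alpha>"
  by (simp add: qa_def)

lemma t_bounds: "\<alpha> \<in> R \<Longrightarrow> 0 < t \<alpha>" "\<alpha> \<in> R \<Longrightarrow> t \<alpha> < 1"
  using param by (auto simp: parameter_family_def)

lemma t_weyl: "w \<in> W \<Longrightarrow> \<alpha> \<in> R \<Longrightarrow> t (w \<alpha>) = t \<alpha>"
  using param by (auto simp: parameter_family_def)

lemma t_minus: "\<alpha> \<in> R \<Longrightarrow> t (- \<alpha>) = t \<alpha>"
  using t_weyl[OF weyl_reflection, of \<alpha> \<alpha>] by (simp add: reflection_self)

lemma t_st: "\<alpha> \<in> R \<Longrightarrow> t (st \<alpha>) = t \<alpha>"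
  using param by (cases rule: R_cases) (auto simp: parameter_family_def)

text \<open>The factor of \<open>U\<^sub>\<nu>\<^sub>,\<^sub>\<eta> V\<^sub>\<nu>\<close> at the root \<open>\<alpha>\<close>, where \<open>n = \<langle>\<alpha>\<^sub>*, \<nu>\<rangle>\<close> and \<open>m = \<langle>\<alpha>\<^sub>*, \<eta>\<rangle>\<close>.\<close>

definition gfac :: "'a \<Rightarrow> real \<Rightarrow> real \<Rightarrow> 'a ga_domain fract" where
  "gfac \<alpha> n m =
    (if n > 0 then vf (t \<alpha>) 1 \<alpha> * (if n = 2 then vf (t \<alpha>) (qa \<alpha>) \<alpha> else 1)
     else if n = 0 \<and> m > 0 then vf (t \<alpha>) 1 \<alpha> * (if m = 2 then vf (t \<alpha>) (inverse (qa \<alpha>)) (- \<alpha>) else 1)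
     else 1)"

definition UV :: "'a \<Rightarrow> 'a \<Rightarrow> 'a ga_domain fract" where
  "UV \<nu> \<eta> = (\<Prod>\<alpha>\<in>R. gfac \<alpha> (\<nu> \<bullet> st \<alpha>) (\<eta> \<bullet> st \<alpha>))"

lemma UV_eq: "U_term R S q t \<nu> \<eta> * V_term R S q t \<nu> = UV \<nu> \<eta>"
proof -
  have U1: "(\<Prod>\<alpha> | \<alpha> \<in> R \<and> \<alpha> \<bullet> \<nu> = 0 \<and> st \<alpha> \<bullet> \<eta> > 0. v_factor (t \<alpha>) (scaled_exp 1 \<alpha>)) =
      (\<Prod>\<alpha>\<in>R. if \<nu> \<bullet> st \<alpha> = 0 \<and> \<eta> \<bullet> st \<alpha> > 0 then vf (t \<alpha>) 1 \<alpha> else 1)"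
    unfolding prod.inter_filter[OF finite_R, symmetric] vf_def
    by (intro prod.cong) (auto simp: inner_st_zero_iff inner_commute)
  have U2: "(\<Prod>\<alpha> | \<alpha> \<in> R \<and> \<alpha> \<bullet> \<nu> = 0 \<and> st \<alpha> \<bullet> \<eta> = 2.
        v_factor (t \<alpha>) (scaled_exp (inverse (q powr u \<alpha>)) (- \<alpha>))) =
      (\<Prod>\<alpha>\<in>R. if \<nu> \<bullet> st \<alpha> = 0 \<and> \<eta> \<bullet> st \<alpha> = 2 then vf (t \<alpha>) (inverse (qa \<alpha>)) (- \<alpha>) else 1)"
    unfolding prod.inter_filter[OF finite_R, symmetric] vf_def qa_def
    by (intro prod.cong) (auto simp: inner_st_zero_iff inner_commute)
  have V1: "(\<Prod>\<alpha> | \<alpha> \<in> R \<and> st \<alpha> \<bullet> \<nu> > 0. v_factor (t \<alpha>) (scaled_exp 1 \<alpha>)) =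
      (\<Prod>\<alpha>\<in>R. if \<nu> \<bullet> st \<alpha> > 0 then vf (t \<alpha>) 1 \<alpha> else 1)"
    unfolding prod.inter_filter[OF finite_R, symmetric] vf_def
    by (intro prod.cong) (auto simp: inner_commute)
  have V2: "(\<Prod>\<alpha> | \<alpha> \<in> R \<and> st \<alpha> \<bullet> \<nu> = 2. v_factor (t \<alpha>) (scaled_exp (q powr u \<alpha>) \<alpha>)) =
      (\<Prod>\<alpha>\<in>R. if \<nu> \<bullet> st \<alpha> = 2 then vf (t \<alpha>) (qa \<alpha>) \<alpha> else 1)"
    unfolding prod.inter_filter[OF finite_R, symmetric] vf_def qa_def
    by (intro prod.cong) (auto simp: inner_commute)
  show ?thesis
    unfolding U_term_def V_term_def U1 U2 V1 V2 UV_def prod.distrib[symmetric]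
    by (intro prod.cong) (auto simp: gfac_def)
qed

lemma root_coprime:
  assumes "\<alpha> \<in> R" "\<beta> \<in> R" "\<beta> \<noteq> \<alpha>" "\<beta> \<noteq> - \<alpha>"
  shows "rel_coprime (binom \<beta> c') (binom \<alpha> c)"
proof (rule binom_coprime_independent)
  show "\<alpha> \<noteq> 0" using assms root_nonzero by blast
  fix r show "\<beta> \<noteq> r *\<^sub>R \<alpha>"
    using root_multiple[OF assms(1), of r] assms by fastforce
qed

lemma vf_regular:
  assumes "\<alpha> \<in> R" "\<beta> \<in> R" "\<beta> \<noteq> \<alpha>" "\<beta> \<noteq> - \<alpha>"
  shows "regular_at (binom \<alpha> c) (vf \<tau> c' \<beta>)"
  using assms by (intro regular_at_vf root_coprime) (auto dest: root_nonzero)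

lemma vf_regular_same: "\<alpha> \<in> R \<Longrightarrow> c \<noteq> complex_of_real c' \<Longrightarrow> regular_at (binom \<alpha> c) (vf \<tau> c' \<alpha>)"
  by (intro regular_at_vf binom_coprime_same) (auto dest: root_nonzero)

lemma vf_regular_opposite:
  "\<alpha> \<in> R \<Longrightarrow> c * complex_of_real c' \<noteq> 1 \<Longrightarrow> regular_at (binom \<alpha> c) (vf \<tau> c' (- \<alpha>))"
  by (intro regular_at_vf binom_coprime_opposite) (auto dest: root_nonzero)

lemma gfac_regular:
  assumes "\<alpha> \<in> R" "\<beta> \<in> R" "\<beta> \<noteq> \<alpha>" "\<beta> \<noteq> - \<alpha>"
  shows "regular_at (binom \<alpha> c) (gfac \<beta> n m)"
proof -
  have *: "- \<beta> \<in> R" "- \<beta> \<noteq> \<alpha>" "- \<beta> \<noteq> - \<alpha>" using assms root_minus by auto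
  show ?thesis
    unfolding gfac_def
    by (auto intro!: regular_at_mult vf_regular[OF assms] vf_regular[OF assms(1) *])
qed

lemma scaled_exp_reflection:
  assumes "\<alpha> \<in> R" "x \<in> P" "c \<noteq> 0"
  shows "cong_at (binom \<alpha> (of_real c)) (scaled_exp r (reflection \<alpha> x))
    (scaled_exp (r * c powi \<lfloor>x \<bullet> coroot \<alpha>\<rfloor>) x)"
proof -
  have "x \<bullet> coroot \<alpha> \<in> \<int>" using assms by (simp add: P_iff)
  from binom_dvd_shift[OF assms(3) this, of \<alpha> x "of_real r"]
  show ?thesis unfolding scaled_exp_def reflection_def
    by (intro cong_at_ga_frac) (simp flip: of_real_mult of_real_power_int)
qed

text \<open>Because \<open>d \<alpha> = u \<alpha> *\<^sub>R coroot \<alpha>\<close>, reducing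
  exponents modulo \<open>1 - q_\<alpha> e^\<alpha>\<close> produces the same power of
  \<open>q\<close> as a translation by \<open>d \<alpha>\<close>.\<close>

lemma qa_powi:
  assumes "\<alpha> \<in> R" "x \<in> P"
  shows "qa \<alpha> powi \<lfloor>x \<bullet> coroot \<alpha>\<rfloor> = q powr (x \<bullet> d \<alpha>)"
proof -
  have "x \<bullet> coroot \<alpha> \<in> \<int>" using assms by (simp add: P_iff)
  then have fl: "real_of_int \<lfloor>x \<bullet> coroot \<alpha>\<rfloor> = x \<bullet> coroot \<alpha>" by (auto elim: Ints_cases)
  have "qa \<alpha> powr real_of_int \<lfloor>x \<bullet> coroot \<alpha>\<rfloor> = qa \<alpha> powi \<lfloor>x \<bullet> coroot \<alpha>\<rfloor>"
    using qa(1)[OF assms(1)] by (intro powr_real_of_int') auto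
  then have "qa \<alpha> powi \<lfloor>x \<bullet> coroot \<alpha>\<rfloor> = qa \<alpha> powr (x \<bullet> coroot \<alpha>)" unfolding fl by simp
  also have "\<dots> = q powr (x \<bullet> d \<alpha>)" by (simp add: qa_def powr_powr d_eq[OF assms(1)])
  finally show ?thesis .
qed

lemma reflection_other:
  assumes "\<alpha> \<in> R" "\<beta> \<in> R" "\<beta> \<noteq> \<alpha>" "\<beta> \<noteq> - \<alpha>"
  shows "reflection \<alpha> \<beta> \<in> R" "reflection \<alpha> \<beta> \<noteq> \<alpha>" "reflection \<alpha> \<beta> \<noteq> - \<alpha>"
    "- reflection \<alpha> \<beta> \<noteq> \<alpha>" "- reflection \<alpha> \<beta> \<noteq> - \<alpha>"
proof -
  show "reflection \<alpha> \<beta> \<in> R" using assms reflection_root by blast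
  have r: "reflection \<alpha> \<alpha> = - \<alpha>" "reflection \<alpha> (- \<alpha>) = \<alpha>"
    using linear_neg[OF linear_reflection, of \<alpha> \<alpha>] by (simp_all add: reflection_self)
  show 1: "reflection \<alpha> \<beta> \<noteq> \<alpha>" "reflection \<alpha> \<beta> \<noteq> - \<alpha>"
    using assms(3,4) r by (metis reflection_reflection)+
  show "- reflection \<alpha> \<beta> \<noteq> \<alpha>" "- reflection \<alpha> \<beta> \<noteq> - \<alpha>" using 1 by (metis minus_minus)+
qed

lemma vf_reflection_cong:
  assumes "\<alpha> \<in> R" "\<beta> \<in> R" "\<beta> \<noteq> \<alpha>" "\<beta> \<noteq> - \<alpha>" "c \<noteq> 0"
  shows "cong_at (binom \<alpha> (of_real c)) (vf \<tau> r (reflection \<alpha> \<beta>))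
    (vf \<tau> (r * c powi \<lfloor>\<beta> \<bullet> coroot \<alpha>\<rfloor>) \<beta>)"
proof (rule cong_at_vf)
  show "cong_at (binom \<alpha> (of_real c)) (scaled_exp r (reflection \<alpha> \<beta>))
    (scaled_exp (r * c powi \<lfloor>\<beta> \<bullet> coroot \<alpha>\<rfloor>) \<beta>)"
    using assms R_P by (intro scaled_exp_reflection) auto
qed (use assms root_nonzero reflection_other[OF assms(1-4)] in \<open>auto intro!: root_coprime\<close>)

definition rest :: "'a \<Rightarrow> 'a \<Rightarrow> 'a \<Rightarrow> 'a ga_domain fract" where
  "rest \<alpha> \<nu> \<eta> = (\<Prod>\<beta>\<in>R - {\<alpha>, - \<alpha>}. gfac \<beta> (\<nu> \<bullet> st \<beta>) (\<eta> \<bullet> st \<beta>))"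

lemma UV_split:
  assumes "\<alpha> \<in> R"
  shows "UV \<nu> \<eta> = gfac \<alpha> (\<nu> \<bullet> st \<alpha>) (\<eta> \<bullet> st \<alpha>) * gfac (- \<alpha>) (- (\<nu> \<bullet> st \<alpha>)) (- (\<eta> \<bullet> st \<alpha>)) * rest \<alpha> \<nu> \<eta>"
proof -
  have ne: "\<alpha> \<noteq> - \<alpha>" using root_nonzero[OF assms] by (simp add: eq_neg_iff_add_eq_0 flip: scaleR_2)
  have "R = insert \<alpha> (insert (- \<alpha>) (R - {\<alpha>, - \<alpha>}))" using assms root_minus by auto
  then have "UV \<nu> \<eta> = (\<Prod>\<beta>\<in>insert \<alpha> (insert (- \<alpha>) (R - {\<alpha>, - \<alpha>})). gfac \<beta> (\<nu> \<bullet> st \<beta>) (\<eta> \<bullet> st \<beta>))"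
    unfolding UV_def by simp
  then show ?thesis using ne by (simp add: rest_def mult.assoc)
qed

lemma rest_regular: "\<alpha> \<in> R \<Longrightarrow> regular_at (binom \<alpha> c) (rest \<alpha> \<nu> \<eta>)"
  unfolding rest_def by (intro regular_at_prod gfac_regular) auto

lemma gfac_reflection_cong:
  assumes "\<alpha> \<in> R" "\<beta> \<in> R" "\<beta> \<noteq> \<alpha>" "\<beta> \<noteq> - \<alpha>"
  shows "cong_at (binom \<alpha> 1) (gfac (reflection \<alpha> \<beta>) n m) (gfac \<beta> n m)"
proof -
  have t: "t (reflection \<alpha> \<beta>) = t \<beta>" using assms t_weyl weyl_reflection by blast
  have qa: "qa (reflection \<alpha> \<beta>) = qa \<beta>" unfolding qa_def using assms u_weyl weyl_reflection by simp
  have m: "- \<beta> \<in> R" "- \<beta> \<noteq> \<alpha>" "- \<beta> \<noteq> - \<alpha>" using assms root_minus by auto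
  have mr: "reflection \<alpha> (- \<beta>) = - reflection \<alpha> \<beta>" by (simp add: linear_neg linear_reflection)
  have v: "cong_at (binom \<alpha> 1) (vf \<tau> r (reflection \<alpha> \<beta>)) (vf \<tau> r \<beta>)"
    "cong_at (binom \<alpha> 1) (vf \<tau> r (- reflection \<alpha> \<beta>)) (vf \<tau> r (- \<beta>))" for \<tau> r
    using vf_reflection_cong[OF assms, of 1 \<tau> r] vf_reflection_cong[OF assms(1) m, of 1 \<tau> r] mr by simp_all
  have 1: "cong_at (binom \<alpha> 1) 1 1" by (rule cong_at_refl) simp
  show ?thesis unfolding gfac_def t qa by (auto intro!: cong_at_mult v 1)
qed

text \<open>Reindexing by the reflection restores the pairings of the original pair and puts the
  factors at reflected roots; modulo \<open>1 - e^\<alpha>\<close> a root and its reflection have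
  the same exponential.\<close>

lemma rest_reflection_cong:
  assumes "\<alpha> \<in> R"
  shows "cong_at (binom \<alpha> 1) (rest \<alpha> (reflection \<alpha> \<nu>) (reflection \<alpha> \<eta>)) (rest \<alpha> \<nu> \<eta>)"
proof -
  let ?s = "reflection \<alpha>"
  have st: "st (?s \<beta>) = ?s (st \<beta>)" for \<beta> using st_weyl[OF weyl_reflection[OF assms]] .
  have "rest \<alpha> (?s \<nu>) (?s \<eta>) = (\<Prod>\<beta>\<in>R - {\<alpha>, - \<alpha>}. gfac (?s \<beta>) (\<nu> \<bullet> st \<beta>) (\<eta> \<bullet> st \<beta>))"
    unfolding rest_def
  proof (rule prod.reindex_bij_witness[of _ ?s ?s])
    fix \<beta> assume \<beta>: "\<beta> \<in> R - {\<alpha>, - \<alpha>}"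
    then show "?s \<beta> \<in> R - {\<alpha>, - \<alpha>}" "?s \<beta> \<in> R - {\<alpha>, - \<alpha>}"
      using reflection_other[OF assms, of \<beta>] by auto
    show "gfac (?s (?s \<beta>)) (\<nu> \<bullet> st (?s \<beta>)) (\<eta> \<bullet> st (?s \<beta>)) =
      gfac \<beta> (?s \<nu> \<bullet> st \<beta>) (?s \<eta> \<bullet> st \<beta>)"
      by (simp add: st reflection_adjoint)
  qed auto
  then show ?thesis unfolding rest_def using assms by (auto intro!: cong_at_prod gfac_reflection_cong)
qed

text \<open>The signs of the pairings with \<open>\<alpha>\<close> and with a generic
  \<open>y\<close> orthogonal to \<open>\<alpha>\<close> cut the remaining roots not orthogonal to
  \<open>\<alpha>\<close> into four quadrants; the reflection flips the first sign and negation
  flips both. \<open>Y\<close> is chosen before \<open>g\<close> because one decomposition must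
  serve the two products that are compared.\<close>

lemma prod_quadrants:
  assumes "\<alpha> \<in> R"
  shows "\<exists>Y \<subseteq> {\<beta> \<in> R - {\<alpha>, - \<alpha>}. \<beta> \<bullet> \<alpha> > 0}. \<forall>g :: 'a \<Rightarrow> 'a ga_domain fract.
    (\<Prod>\<beta>\<in>R - {\<alpha>, - \<alpha>}. g \<beta>) = (\<Prod>\<beta>\<in>{\<beta> \<in> R - {\<alpha>, - \<alpha>}. \<beta> \<bullet> \<alpha> = 0}. g \<beta>) *
      (\<Prod>\<beta>\<in>Y. g \<beta> * g (reflection \<alpha> \<beta>) * g (- \<beta>) * g (- reflection \<alpha> \<beta>))"
proof -
  let ?s = "reflection \<alpha>"
  let ?R = "R - {\<alpha>, - \<alpha>}"
  define pr where "pr x = x - (x \<bullet> \<alpha> / (\<alpha> \<bullet> \<alpha>)) *\<^sub>R \<alpha>" for x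
  have \<alpha>0: "\<alpha> \<noteq> 0" using assms root_nonzero by blast
  have "0 \<notin> pr ` ?R"
  proof
    assume "0 \<in> pr ` ?R"
    then obtain \<beta> where "\<beta> \<in> ?R" "pr \<beta> = 0" by (elim imageE) metis
    moreover define r where "r = \<beta> \<bullet> \<alpha> / (\<alpha> \<bullet> \<alpha>)"
    ultimately have \<beta>: "\<beta> \<in> ?R" "\<beta> = r *\<^sub>R \<alpha>" by (simp_all add: pr_def)
    then have "r = 1 \<or> r = - 1" using root_multiple[OF assms, of r] by blast
    then show False using \<beta> by auto
  qed
  \<comment> \<open>Genericity is asked of the projections along \<open>\<alpha>\<close>: pairing a
    projected root with \<open>z\<close> is pairing the root with the projection of
    \<open>z\<close>, which becomes \<open>y\<close>.\<close>
  then obtain z where z: "\<forall>x\<in>pr ` ?R. x \<bullet> z \<noteq> 0" using exists_generic_vector[of "pr ` ?R"] by auto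
  define y where "y = pr z"
  have y\<alpha>: "y \<bullet> \<alpha> = 0" using \<alpha>0 by (simp add: y_def pr_def inner_diff_left)
  have adj: "pr x \<bullet> z = x \<bullet> y" for x
    by (simp add: y_def pr_def inner_diff_left inner_diff_right inner_commute)
  have gen: "\<beta> \<bullet> y \<noteq> 0" if "\<beta> \<in> ?R" for \<beta> using z that adj by auto
  have sy: "?s x \<bullet> y = x \<bullet> y" for x using y\<alpha> by (simp add: reflection_def inner_diff_left inner_commute[of \<alpha> y])
  have s\<alpha>: "?s x \<bullet> \<alpha> = - (x \<bullet> \<alpha>)" for x
    using reflection_adjoint[of \<alpha> x \<alpha>] by (simp add: reflection_self)
  define Y where "Y = {\<beta> \<in> ?R. \<beta> \<bullet> \<alpha> > 0 \<and> \<beta> \<bullet> y > 0}"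
  define Q where "Q a b = {\<beta> \<in> ?R. a * (\<beta> \<bullet> \<alpha>) > 0 \<and> b * (\<beta> \<bullet> y) > 0}" for a b :: real
  have mem: "?s \<beta> \<in> ?R" "- \<beta> \<in> ?R" "- ?s \<beta> \<in> ?R" if "\<beta> \<in> ?R" for \<beta>
    using that reflection_other[OF assms, of \<beta>] root_minus by auto
  have "(\<Prod>\<beta>\<in>?R. g \<beta>) = (\<Prod>\<beta>\<in>{\<beta> \<in> ?R. \<beta> \<bullet> \<alpha> = 0}. g \<beta>) *
      (\<Prod>\<beta>\<in>Y. g \<beta> * g (?s \<beta>) * g (- \<beta>) * g (- ?s \<beta>))" for g :: "'a \<Rightarrow> 'a ga_domain fract"
  proof -
    have fin: "finite (Q a b)" for a b by (simp add: Q_def)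
    have "?R = {\<beta> \<in> ?R. \<beta> \<bullet> \<alpha> = 0} \<union> (Q 1 1 \<union> (Q (-1) 1 \<union> (Q (-1) (-1) \<union> Q 1 (-1))))"
      using gen by (fastforce simp: Q_def)
    then have "(\<Prod>\<beta>\<in>?R. g \<beta>) =
        (\<Prod>\<beta>\<in>{\<beta> \<in> ?R. \<beta> \<bullet> \<alpha> = 0} \<union> (Q 1 1 \<union> (Q (-1) 1 \<union> (Q (-1) (-1) \<union> Q 1 (-1)))). g \<beta>)"
      by (rule arg_cong)
    also have "\<dots> = (\<Prod>\<beta>\<in>{\<beta> \<in> ?R. \<beta> \<bullet> \<alpha> = 0}. g \<beta>) *
        (prod g (Q 1 1) * (prod g (Q (-1) 1) * (prod g (Q (-1) (-1)) * prod g (Q 1 (-1)))))"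
    proof -
      have "Q (-1) (-1) \<inter> Q 1 (-1) = {}" "Q (-1) 1 \<inter> (Q (-1) (-1) \<union> Q 1 (-1)) = {}"
        "Q 1 1 \<inter> (Q (-1) 1 \<union> (Q (-1) (-1) \<union> Q 1 (-1))) = {}"
        "{\<beta> \<in> ?R. \<beta> \<bullet> \<alpha> = 0} \<inter> (Q 1 1 \<union> (Q (-1) 1 \<union> (Q (-1) (-1) \<union> Q 1 (-1)))) = {}"
        by (auto simp: Q_def)
      moreover have "finite {\<beta> \<in> ?R. \<beta> \<bullet> \<alpha> = 0}" by simp
      ultimately show ?thesis using fin by (simp only: prod.union_disjoint finite_Un simp_thms)
    qed
    also have "prod g (Q 1 1) = prod g Y" by (simp add: Q_def Y_def)
    also have "prod g (Q (-1) 1) = (\<Prod>\<beta>\<in>Y. g (?s \<beta>))"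
      by (rule prod.reindex_bij_witness[of _ ?s ?s]) (use mem in \<open>auto simp: Q_def Y_def sy s\<alpha>\<close>)
    also have "prod g (Q (-1) (-1)) = (\<Prod>\<beta>\<in>Y. g (- \<beta>))"
      by (rule prod.reindex_bij_witness[of _ uminus uminus]) (use mem in \<open>auto simp: Q_def Y_def\<close>)
    also have "prod g (Q 1 (-1)) = (\<Prod>\<beta>\<in>Y. g (- ?s \<beta>))"
      by (rule prod.reindex_bij_witness[of _ "\<lambda>\<beta>. - ?s \<beta>" "\<lambda>\<beta>. - ?s \<beta>"])
        (use mem in \<open>auto simp: Q_def Y_def sy s\<alpha> linear_neg[OF linear_reflection]\<close>)
    finally show ?thesis by (simp add: prod.distrib mult.assoc)
  qed
  then show ?thesis by (intro exI[of _ Y]) (auto simp: Y_def)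
qed

lemma vf_reflection_qa:
  assumes "\<alpha> \<in> R" "\<beta> \<in> R" "\<beta> \<noteq> \<alpha>" "\<beta> \<noteq> - \<alpha>" "d \<alpha> \<bullet> st \<beta> = k"
  shows "cong_at (binom \<alpha> (of_real (qa \<alpha>))) (vf \<tau> r (reflection \<alpha> \<beta>)) (vf \<tau> (r * qa \<beta> powr k) \<beta>)"
    and "cong_at (binom \<alpha> (of_real (qa \<alpha>))) (vf \<tau> r (- reflection \<alpha> \<beta>)) (vf \<tau> (r * qa \<beta> powr (- k)) (- \<beta>))"
proof -
  have e: "\<beta> \<bullet> d \<alpha> = u \<beta> * k"
    using assms(5) u_pos[OF assms(2)] by (simp add: inner_st inner_commute[of \<beta>] field_simps)
  have e': "q powr (\<beta> \<bullet> d \<alpha>) = qa \<beta> powr k" "q powr ((- \<beta>) \<bullet> d \<alpha>) = qa \<beta> powr (- k)"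
    using e by (simp_all add: qa_def powr_powr)
  have m: "- \<beta> \<in> R" "- \<beta> \<noteq> \<alpha>" "- \<beta> \<noteq> - \<alpha>" using assms root_minus by auto
  have mr: "reflection \<alpha> (- \<beta>) = - reflection \<alpha> \<beta>" by (simp add: linear_neg linear_reflection)
  have qne: "qa \<alpha> \<noteq> 0" using qa[OF assms(1)] by simp
  show "cong_at (binom \<alpha> (of_real (qa \<alpha>))) (vf \<tau> r (reflection \<alpha> \<beta>)) (vf \<tau> (r * qa \<beta> powr k) \<beta>)"
    using vf_reflection_cong[OF assms(1-4) qne, of \<tau> r] qa_powi[OF assms(1) R_P[OF assms(2)]] e' by simp
  show "cong_at (binom \<alpha> (of_real (qa \<alpha>))) (vf \<tau> r (- reflection \<alpha> \<beta>)) (vf \<tau> (r * qa \<beta> powr (- k)) (- \<beta>))"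
    using vf_reflection_cong[OF assms(1) m qne, of \<tau> r] qa_powi[OF assms(1) R_P[OF m(1)]] e' mr by simp
qed

definition weyl_invariant :: "('a \<Rightarrow>\<^sub>0 complex) \<Rightarrow> bool" where
  "weyl_invariant f \<longleftrightarrow> (\<forall>w\<in>W. \<forall>x. Poly_Mapping.lookup f (w x) = Poly_Mapping.lookup f x)"

text \<open>Invariance allows the sum to be reindexed by the reflection, after which
  \<open>binom_dvd_shift\<close> compares exponentials term by term. It is applied with
  \<open>c = 1\<close> to a reflected midpoint and with \<open>c = q_\<alpha>\<close> to a midpoint
  moved by \<open>d \<alpha>\<close>; \<open>shift\<close> says that the powers of \<open>q\<close>
  match.\<close>

lemma translation_cong:
  assumes "weyl_invariant f" "Poly_Mapping.keys f \<subseteq> P" "\<alpha> \<in> R" "c \<noteq> 0"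
    and shift: "\<And>x. x \<in> P \<Longrightarrow> q powr (reflection \<alpha> x \<bullet> \<nu>') * c powi \<lfloor>x \<bullet> coroot \<alpha>\<rfloor> = q powr (x \<bullet> \<nu>)"
  shows "cong_at (binom \<alpha> (of_real c)) (ga_frac (translation q \<nu>' f)) (ga_frac (translation q \<nu> f))"
proof (rule cong_at_ga_frac)
  let ?s = "reflection \<alpha>" and ?K = "Poly_Mapping.keys f"
  have inv: "Poly_Mapping.lookup f (?s x) = Poly_Mapping.lookup f x" for x
    using assms(1) weyl_reflection[OF assms(3)] by (simp add: weyl_invariant_def)
  have "translation q \<nu>' f = (\<Sum>x\<in>?K. Poly_Mapping.single (?s x)
      (of_real (q powr (?s x \<bullet> \<nu>')) * Poly_Mapping.lookup f x))"
    unfolding translation_def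
    by (rule sum.reindex_bij_witness[of _ ?s ?s]) (auto simp: in_keys_iff inv)
  then have "translation q \<nu>' f - translation q \<nu> f = (\<Sum>x\<in>?K.
      Poly_Mapping.single (?s x) (of_real (q powr (?s x \<bullet> \<nu>')) * Poly_Mapping.lookup f x) -
      Poly_Mapping.single x (of_real (q powr (x \<bullet> \<nu>)) * Poly_Mapping.lookup f x))"
    by (simp add: translation_def sum_subtractf)
  also have "binom \<alpha> (of_real c) dvd \<dots>"
  proof (rule dvd_sum)
    fix x assume "x \<in> ?K"
    then have x: "x \<in> P" using assms(2) by auto
    then have "x \<bullet> coroot \<alpha> \<in> \<int>" using assms(3) by (simp add: P_iff)
    from binom_dvd_shift[OF assms(4) this, of \<alpha> x "of_real (q powr (?s x \<bullet> \<nu>')) * Poly_Mapping.lookup f x"]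
    have "binom \<alpha> (of_real c) dvd Poly_Mapping.single (?s x) (of_real (q powr (?s x \<bullet> \<nu>')) * Poly_Mapping.lookup f x) -
      Poly_Mapping.single x (of_real (q powr (?s x \<bullet> \<nu>')) * Poly_Mapping.lookup f x * of_real (c powi \<lfloor>x \<bullet> coroot \<alpha>\<rfloor>))"
      by (simp only: reflection_def)
    also have "of_real (q powr (?s x \<bullet> \<nu>')) * Poly_Mapping.lookup f x * of_real (c powi \<lfloor>x \<bullet> coroot \<alpha>\<rfloor>) =
      of_real (q powr (?s x \<bullet> \<nu>') * c powi \<lfloor>x \<bullet> coroot \<alpha>\<rfloor>) * Poly_Mapping.lookup f x"
      by (simp only: of_real_mult mult_ac)
    finally show "binom \<alpha> (of_real c) dvd
      Poly_Mapping.single (?s x) (of_real (q powr (?s x \<bullet> \<nu>')) * Poly_Mapping.lookup f x) -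
      Poly_Mapping.single x (of_real (q powr (x \<bullet> \<nu>)) * Poly_Mapping.lookup f x)"
      unfolding shift[OF x] .
  qed
  finally show "binom \<alpha> (of_real c) dvd translation q \<nu>' f - translation q \<nu> f" .
qed

end

locale small_macd = macd R Rp v S q t + small_setup R Rp v S \<omega>
  for R Rp :: "'a::euclidean_space set" and v S q t \<omega>
begin

text \<open>The two products are matched on the sets \<open>{\<plusminus>\<beta>, \<plusminus>s\<^sub>\<alpha>\<beta>}\<close>; single factors do not correspond.\<close>

lemma quadruple_cong:
  assumes p: "(\<nu>, \<eta>) \<in> Pairs" and \<alpha>: "\<alpha> \<in> R" "\<nu> \<bullet> st \<alpha> = 0" "\<eta> \<bullet> st \<alpha> = 2"
    and \<beta>: "\<beta> \<in> R" "\<beta> \<noteq> \<alpha>" "\<beta> \<noteq> - \<alpha>" "\<beta> \<bullet> \<alpha> > 0"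
  defines "F x \<gamma> \<equiv> gfac \<gamma> (x \<bullet> st \<gamma>) (\<eta> \<bullet> st \<gamma>)"
  shows "cong_at (binom \<alpha> (of_real (qa \<alpha>)))
    (F \<nu> \<beta> * F \<nu> (reflection \<alpha> \<beta>) * F \<nu> (- \<beta>) * F \<nu> (- reflection \<alpha> \<beta>))
    (F (\<nu> + d \<alpha>) \<beta> * F (\<nu> + d \<alpha>) (reflection \<alpha> \<beta>) * F (\<nu> + d \<alpha>) (- \<beta>) * F (\<nu> + d \<alpha>) (- reflection \<alpha> \<beta>))"
proof -
  define n m k where "n = \<nu> \<bullet> st \<beta>" and "m = \<eta> \<bullet> st \<beta>" and "k = d \<alpha> \<bullet> st \<beta>"
  let ?s = "reflection \<alpha>" and ?b = "binom \<alpha> (of_real (qa \<alpha>))" and ?\<tau> = "t \<beta>" and ?Q = "qa \<beta>"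
  have p': "(\<nu> + d \<alpha>, \<eta>) \<in> Pairs" using Pairs_up[OF p \<alpha>] .
  have sR: "?s \<beta> \<in> R" using reflection_root \<alpha>(1) \<beta>(1) by blast
  have st: "st (?s \<beta>) = ?s (st \<beta>)" using st_weyl[OF weyl_reflection[OF \<alpha>(1)]] .
  have n's: "\<nu> \<bullet> st (?s \<beta>) = n"
    unfolding st n_def reflection_adjoint[symmetric] using \<alpha>(2) by (simp add: reflection_st[OF \<alpha>(1)])
  have m's: "\<eta> \<bullet> st (?s \<beta>) = m - 2 * k"
    unfolding st m_def k_def reflection_adjoint[symmetric]
    using \<alpha>(3) by (simp add: reflection_st[OF \<alpha>(1)] inner_diff_left)
  have k's: "d \<alpha> \<bullet> st (?s \<beta>) = - k"
    unfolding st k_def reflection_adjoint[symmetric]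
    using d_st_self[OF \<alpha>(1)] by (simp add: reflection_st[OF \<alpha>(1)] inner_diff_left)
  have kpos: "k > 0"
  proof -
    have "st \<beta> \<bullet> \<alpha> > 0" using \<beta>(4) u_pos[OF \<beta>(1)] by (simp add: star_def)
    then show ?thesis
      using inner_d_pos_iff[OF \<alpha>(1), of "st \<beta>"] inner_st_pos_iff[OF \<alpha>(1), of "st \<beta>"]
      by (simp add: k_def inner_commute)
  qed
  have kint: "k \<in> \<int>" unfolding k_def using st_d_int[OF \<alpha>(1) \<beta>(1)] .
  let ?T = "{(0,0),(0,1),(0,-1),(0,2),(0,-2),(1,0),(1,1),(1,2),
    (-1,0),(-1,-1),(-1,-2),(2,2),(-2,-2)} :: (real \<times> real) set"
  \<comment> \<open>The table holds for the pairs with midpoints \<open>\<nu>\<close> and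
    \<open>\<nu> + d \<alpha>\<close>, at \<open>\<beta>\<close> and at its reflection. Only six
    configurations satisfy all four conditions.\<close>
  have T: "(n, m) \<in> ?T" "(n, m - 2 * k) \<in> ?T" "(n + k, m) \<in> ?T" "(n - k, m - 2 * k) \<in> ?T"
  proof -
    show "(n, m) \<in> ?T" using Pairs_cases[OF p \<beta>(1)] unfolding n_def m_def .
    show "(n, m - 2 * k) \<in> ?T" using Pairs_cases[OF p sR] unfolding n's m's .
    show "(n + k, m) \<in> ?T" using Pairs_cases[OF p' \<beta>(1)] unfolding inner_add_left n_def m_def k_def .
    show "(n - k, m - 2 * k) \<in> ?T"
      using Pairs_cases[OF p' sR] unfolding inner_add_left n's m's k's diff_conv_add_uminus[of n] .
  qed
  have cases: "(k = 1 \<and> ((n, m) = (0, 0) \<or> (n, m) = (- 1, 0) \<or> (n, m) = (0, 1) \<or> (n, m) = (0, 2) \<or> (n, m) = (1, 2)))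
      \<or> (k = 2 \<and> (n, m) = (0, 2))"
  proof -
    obtain i :: int where i: "k = of_int i" using kint by (auto elim: Ints_cases)
    have "\<bar>m\<bar> \<le> 2" "\<bar>m - 2 * k\<bar> \<le> 2" using T(1,2) by auto
    then have "k \<le> 2" by linarith
    then have "i = 1 \<or> i = 2" using kpos i by auto
    then have "k = 1 \<or> k = 2" using i by auto
    then show ?thesis
    proof
      assume k: "k = 1"
      show ?thesis using T(1) by (elim insertE emptyE) (use T(2-4)[unfolded k] k in simp_all)
    next
      assume k: "k = 2"
      show ?thesis using T(1) by (elim insertE emptyE) (use T(2-4)[unfolded k] k in simp_all)
    qed
  qed
  have ts: "t (?s \<beta>) = ?\<tau>" "t (- \<beta>) = ?\<tau>" "t (- ?s \<beta>) = ?\<tau>"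
    using t_weyl[OF weyl_reflection[OF \<alpha>(1)] \<beta>(1)] t_minus[OF \<beta>(1)] t_minus[OF sR] by auto
  have qs: "qa (?s \<beta>) = ?Q" unfolding qa_def u_weyl[OF weyl_reflection[OF \<alpha>(1)]] ..
  have Qpos: "?Q > 0" using qa[OF \<beta>(1)] by simp
  have F1: "F \<nu> \<beta> = gfac \<beta> n m" "F \<nu> (?s \<beta>) = gfac (?s \<beta>) n (m - 2 * k)"
    "F \<nu> (- \<beta>) = gfac (- \<beta>) (- n) (- m)" "F \<nu> (- ?s \<beta>) = gfac (- ?s \<beta>) (- n) (2 * k - m)"
    unfolding F_def st_minus inner_minus_right n's m's by (simp_all add: n_def m_def)
  have F2: "F (\<nu> + d \<alpha>) \<beta> = gfac \<beta> (n + k) m" "F (\<nu> + d \<alpha>) (?s \<beta>) = gfac (?s \<beta>) (n - k) (m - 2 * k)"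
    "F (\<nu> + d \<alpha>) (- \<beta>) = gfac (- \<beta>) (- n - k) (- m)" "F (\<nu> + d \<alpha>) (- ?s \<beta>) = gfac (- ?s \<beta>) (k - n) (2 * k - m)"
    unfolding F_def st_minus inner_minus_right inner_add_left n's m's k's
    by (simp_all add: n_def m_def k_def)
  have m\<beta>: "- \<beta> \<in> R" "- \<beta> \<noteq> \<alpha>" "- \<beta> \<noteq> - \<alpha>" using \<beta> root_minus by auto
  have r\<beta>: "cong_at ?b (vf \<tau> r \<beta>) (vf \<tau> r \<beta>)" "cong_at ?b (vf \<tau> r (- \<beta>)) (vf \<tau> r (- \<beta>))" for \<tau> r
    by (intro cong_at_refl vf_regular \<alpha> \<beta> m\<beta>)+
  have rs: "cong_at ?b (vf \<tau> r (- ?s \<beta>)) (vf \<tau> r (- ?s \<beta>))" for \<tau> r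
    using reflection_other[OF \<alpha>(1) \<beta>(1-3)] root_minus
    by (intro cong_at_refl vf_regular \<alpha>) auto
  \<comment> \<open>Modulo \<open>1 - q_\<alpha> e^\<alpha>\<close> the exponential of the reflected
    root is \<open>q_\<beta>^k e^\<beta>\<close>. So a shifted factor of one product matches an
    unshifted factor, or one shifted the other way, in the other product.\<close>
  note E = vf_reflection_qa[OF \<alpha>(1) \<beta>(1-3) k_def[symmetric], of ?\<tau>]
  have one: "cong_at ?b 1 1" by (rule cong_at_refl) simp
  from cases show ?thesis
  proof (elim disjE conjE)
    assume k: "k = 1" and "(n, m) = (0, 0)"
    moreover have "cong_at ?b (vf ?\<tau> (inverse ?Q) (?s \<beta>)) (vf ?\<tau> 1 \<beta>)"
      using E(1)[of "inverse ?Q"] k Qpos by simp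
    from cong_at_mult[OF rs[of ?\<tau> 1] this]
    have "cong_at ?b (vf ?\<tau> 1 (- ?s \<beta>) * vf ?\<tau> (inverse ?Q) (?s \<beta>)) (vf ?\<tau> 1 \<beta> * vf ?\<tau> 1 (- ?s \<beta>))"
      by (simp add: mult.commute)
    ultimately show ?thesis unfolding F1 F2 by (simp add: gfac_def ts qs)
  next
    assume k: "k = 1" and "(n, m) = (- 1, 0)"
    moreover have "cong_at ?b (vf ?\<tau> ?Q (- ?s \<beta>)) (vf ?\<tau> 1 (- \<beta>))"
      using E(2)[of ?Q] k Qpos by (simp add: powr_minus)
    from cong_at_mult[OF cong_at_sym[OF this] rs[of ?\<tau> 1]]
    have "cong_at ?b (vf ?\<tau> 1 (- \<beta>) * vf ?\<tau> 1 (- ?s \<beta>)) (vf ?\<tau> 1 (- ?s \<beta>) * vf ?\<tau> ?Q (- ?s \<beta>))"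
      by (simp add: mult.commute)
    ultimately show ?thesis unfolding F1 F2 by (simp add: gfac_def ts qs)
  next
    assume k: "k = 1" and "(n, m) = (0, 1)"
    moreover have "cong_at ?b (vf ?\<tau> 1 \<beta> * vf ?\<tau> 1 (- ?s \<beta>)) (vf ?\<tau> 1 \<beta> * vf ?\<tau> 1 (- ?s \<beta>))"
      by (intro cong_at_mult r\<beta> rs)
    ultimately show ?thesis unfolding F1 F2 by (simp add: gfac_def ts qs)
  next
    assume k: "k = 1" and "(n, m) = (0, 2)"
    moreover have "cong_at ?b (vf ?\<tau> 1 (- ?s \<beta>)) (vf ?\<tau> (inverse ?Q) (- \<beta>))"
      using E(2)[of 1] k Qpos by (simp add: powr_minus)
    from cong_at_mult[OF r\<beta>(1)[of ?\<tau> 1] cong_at_sym[OF this]]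
    have "cong_at ?b (vf ?\<tau> 1 \<beta> * vf ?\<tau> (inverse ?Q) (- \<beta>)) (vf ?\<tau> 1 \<beta> * vf ?\<tau> 1 (- ?s \<beta>))" .
    ultimately show ?thesis unfolding F1 F2 by (simp add: gfac_def ts qs)
  next
    assume k: "k = 1" and "(n, m) = (1, 2)"
    moreover have "cong_at ?b (vf ?\<tau> 1 (?s \<beta>)) (vf ?\<tau> ?Q \<beta>)"
      using E(1)[of 1] k Qpos by simp
    from cong_at_mult[OF r\<beta>(1)[of ?\<tau> 1] this]
    have "cong_at ?b (vf ?\<tau> 1 \<beta> * vf ?\<tau> 1 (?s \<beta>)) (vf ?\<tau> 1 \<beta> * vf ?\<tau> ?Q \<beta>)" .
    ultimately show ?thesis unfolding F1 F2 by (simp add: gfac_def ts qs)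
  next
    assume k: "k = 2" and "(n, m) = (0, 2)"
    have Q2: "inverse ?Q * ?Q powr 2 = ?Q" "?Q * ?Q powr (- 2) = inverse ?Q"
      using Qpos by (simp_all add: powr_minus powr_numeral power2_eq_square)
    have 1: "cong_at ?b (vf ?\<tau> (inverse ?Q) (?s \<beta>)) (vf ?\<tau> ?Q \<beta>)"
      using E(1)[of "inverse ?Q"] unfolding k Q2 .
    have 2: "cong_at ?b (vf ?\<tau> ?Q (- ?s \<beta>)) (vf ?\<tau> (inverse ?Q) (- \<beta>))"
      using E(2)[of ?Q] unfolding k Q2 .
    have "cong_at ?b ((vf ?\<tau> 1 \<beta> * vf ?\<tau> 1 (- ?s \<beta>)) * (vf ?\<tau> (inverse ?Q) (?s \<beta>) * vf ?\<tau> (inverse ?Q) (- \<beta>)))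
      ((vf ?\<tau> 1 \<beta> * vf ?\<tau> 1 (- ?s \<beta>)) * (vf ?\<tau> ?Q \<beta> * vf ?\<tau> ?Q (- ?s \<beta>)))"
      by (intro cong_at_mult r\<beta> rs 1 cong_at_sym[OF 2])
    then show ?thesis using k \<open>(n, m) = (0, 2)\<close> unfolding F1 F2 by (simp add: gfac_def ts qs mult_ac)
  qed
qed

lemma rest_up_cong:
  assumes p: "(\<nu>, \<eta>) \<in> Pairs" and \<alpha>: "\<alpha> \<in> R" "\<nu> \<bullet> st \<alpha> = 0" "\<eta> \<bullet> st \<alpha> = 2"
  shows "cong_at (binom \<alpha> (of_real (qa \<alpha>))) (rest \<alpha> \<nu> \<eta>) (rest \<alpha> (\<nu> + d \<alpha>) \<eta>)"
proof -
  let ?s = "reflection \<alpha>"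
  let ?R0 = "{\<beta> \<in> R - {\<alpha>, - \<alpha>}. \<beta> \<bullet> \<alpha> = 0}"
  obtain Y where Y: "Y \<subseteq> {\<beta> \<in> R - {\<alpha>, - \<alpha>}. \<beta> \<bullet> \<alpha> > 0}"
    "\<And>g :: 'a \<Rightarrow> 'a ga_domain fract.
    (\<Prod>\<beta>\<in>R - {\<alpha>, - \<alpha>}. g \<beta>) = (\<Prod>\<beta>\<in>?R0. g \<beta>) *
      (\<Prod>\<beta>\<in>Y. g \<beta> * g (?s \<beta>) * g (- \<beta>) * g (- ?s \<beta>))"
    using prod_quadrants[OF \<alpha>(1)] by blast
  have same: "(\<nu> + d \<alpha>) \<bullet> st \<beta> = \<nu> \<bullet> st \<beta>" if "\<beta> \<in> ?R0" for \<beta>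
  proof -
    have "d \<alpha> \<bullet> st \<beta> = 0" using that by (simp add: d_eq[OF \<alpha>(1)] coroot_def star_def inner_commute)
    then show ?thesis by (simp add: inner_add_left)
  qed
  show ?thesis
    unfolding rest_def Y(2)
  proof (rule cong_at_mult; rule cong_at_prod)
    fix \<beta> assume \<beta>: "\<beta> \<in> ?R0"
    show "cong_at (binom \<alpha> (of_real (qa \<alpha>))) (gfac \<beta> (\<nu> \<bullet> st \<beta>) (\<eta> \<bullet> st \<beta>))
      (gfac \<beta> ((\<nu> + d \<alpha>) \<bullet> st \<beta>) (\<eta> \<bullet> st \<beta>))"
      unfolding same[OF \<beta>] using \<beta> \<alpha>(1) by (intro cong_at_refl gfac_regular) auto
  next
    fix \<beta> assume "\<beta> \<in> Y"
    then show "cong_at (binom \<alpha> (of_real (qa \<alpha>)))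
      (gfac \<beta> (\<nu> \<bullet> st \<beta>) (\<eta> \<bullet> st \<beta>) * gfac (?s \<beta>) (\<nu> \<bullet> st (?s \<beta>)) (\<eta> \<bullet> st (?s \<beta>)) *
        gfac (- \<beta>) (\<nu> \<bullet> st (- \<beta>)) (\<eta> \<bullet> st (- \<beta>)) * gfac (- ?s \<beta>) (\<nu> \<bullet> st (- ?s \<beta>)) (\<eta> \<bullet> st (- ?s \<beta>)))
      (gfac \<beta> ((\<nu> + d \<alpha>) \<bullet> st \<beta>) (\<eta> \<bullet> st \<beta>) * gfac (?s \<beta>) ((\<nu> + d \<alpha>) \<bullet> st (?s \<beta>)) (\<eta> \<bullet> st (?s \<beta>)) *
        gfac (- \<beta>) ((\<nu> + d \<alpha>) \<bullet> st (- \<beta>)) (\<eta> \<bullet> st (- \<beta>)) *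
        gfac (- ?s \<beta>) ((\<nu> + d \<alpha>) \<bullet> st (- ?s \<beta>)) (\<eta> \<bullet> st (- ?s \<beta>)))"
      using Y(1) by (intro quadruple_cong[OF p \<alpha>]) auto
  qed
qed

end

lemma lookup_map_key_inj: "inj g \<Longrightarrow> Poly_Mapping.lookup (Poly_Mapping.map_key g f) x = Poly_Mapping.lookup f (g x)"
  by (simp add: Poly_Mapping.map_key.rep_eq)

context small_macd
begin

section \<open>The operator on invariant Laurent polynomials and the cancellation of its
  poles\<close>

definition Dop :: "('a \<Rightarrow>\<^sub>0 complex) \<Rightarrow> 'a ga_domain fract" where
  "Dop f = (\<Sum>(\<nu>, \<eta>)\<in>Pairs. UV \<nu> \<eta> * ga_frac (translation q \<nu> f))"

lemma D_operator_Dop: "dominating_choice R Rp S w \<Longrightarrow> D_operator R Rp S q t w \<omega> f = Dop f"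
  by (simp add: D_operator_eq Dop_def UV_eq)

definition pole_free where "pole_free F \<longleftrightarrow> (\<exists>M. F = ga_frac M)"

lemma pole_free_ga_frac [simp]: "pole_free (ga_frac f)"
  by (auto simp: pole_free_def)

lemma pole_free_1 [simp]: "pole_free 1"
  using pole_free_ga_frac[of 1] by simp

lemma pole_free_mult: "pole_free F \<Longrightarrow> pole_free G \<Longrightarrow> pole_free (F * G)"
  by (auto simp: pole_free_def simp flip: ga_frac_mult)

lemma pole_free_diff: "pole_free F \<Longrightarrow> pole_free G \<Longrightarrow> pole_free (F - G)"
  by (auto simp: pole_free_def simp flip: ga_frac_diff)

lemma pole_free_add: "pole_free F \<Longrightarrow> pole_free G \<Longrightarrow> pole_free (F + G)"
  by (auto simp: pole_free_def simp flip: ga_frac_add)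

lemma pole_free_sum: "(\<And>i. i \<in> I \<Longrightarrow> pole_free (F i)) \<Longrightarrow> pole_free (sum F I)"
  by (induction I rule: infinite_finite_induct) (auto intro: pole_free_add simp flip: ga_frac_0)

lemma pole_free_prod: "(\<And>i. i \<in> I \<Longrightarrow> pole_free (F i)) \<Longrightarrow> pole_free (prod F I)"
  by (induction I rule: infinite_finite_induct) (auto intro: pole_free_mult)

lemma vf_constant: "pole_free (scaled_exp r 0 * (1 + scaled_exp s 0))"
  by (intro pole_free_mult pole_free_add) (simp_all add: scaled_exp_def)

lemma vf_binom: "\<alpha> \<noteq> 0 \<Longrightarrow> vf \<tau> c \<alpha> * ga_frac (binom \<alpha> (of_real c)) =
    scaled_exp (\<tau> powr (- 1 / 2)) 0 * ga_frac (binom \<alpha> (of_real (\<tau> * c)))"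
  using binom_nonzero[of \<alpha> "of_real c"] by (simp add: vf_eq)

lemma vf_binom_pole_free: "\<alpha> \<noteq> 0 \<Longrightarrow> pole_free (vf \<tau> c \<alpha> * ga_frac (binom \<alpha> (of_real c)))"
  unfolding vf_binom scaled_exp_def by (intro pole_free_mult pole_free_ga_frac)

definition dens :: "'a \<Rightarrow> 'a \<Rightarrow>\<^sub>0 complex" where
  "dens \<alpha> = binom \<alpha> 1 * binom \<alpha> (of_real (qa \<alpha>))"

lemma gfac_dens: assumes "\<alpha> \<in> R" shows "pole_free (gfac \<alpha> n m * ga_frac (dens \<alpha>))"
proof -
  let ?b1 = "ga_frac (binom \<alpha> 1)" and ?bq = "ga_frac (binom \<alpha> (of_real (qa \<alpha>)))"
  have \<alpha>0: "\<alpha> \<noteq> 0" and q0: "qa \<alpha> \<noteq> 0" using assms root_nonzero qa[OF assms] by auto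
  have 1: "pole_free (vf \<tau> 1 \<alpha> * ?b1)" for \<tau> using vf_binom_pole_free[OF \<alpha>0, of \<tau> 1] by simp
  have 2: "pole_free (vf \<tau> (qa \<alpha>) \<alpha> * ?bq)" for \<tau> using vf_binom_pole_free[OF \<alpha>0] .
  \<comment> \<open>By \<open>vf_reflection\<close> this factor is a constant minus the factor at
    \<open>q_\<alpha> e^\<alpha>\<close>, so the same binomial clears both.\<close>
  have 3: "pole_free (vf \<tau> (inverse (qa \<alpha>)) (- \<alpha>) * ?bq)" for \<tau>
  proof -
    have "vf \<tau> (inverse (qa \<alpha>)) (- \<alpha>) * ?bq =
        (scaled_exp (\<tau> powr (- 1 / 2)) 0 * (1 + scaled_exp \<tau> 0)) * ?bq - vf \<tau> (qa \<alpha>) \<alpha> * ?bq"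
      unfolding vf_reflection[OF q0 \<alpha>0, symmetric] by (simp add: algebra_simps)
    then show ?thesis using pole_free_diff[OF pole_free_mult[OF vf_constant pole_free_ga_frac] 2] by simp
  qed
  have 12: "pole_free (vf \<tau> 1 \<alpha> * vf \<tau> (qa \<alpha>) \<alpha> * (?b1 * ?bq))" for \<tau>
    using pole_free_mult[OF 1 2, of \<tau> \<tau>] by (simp add: mult_ac)
  have 13: "pole_free (vf \<tau> 1 \<alpha> * vf \<tau> (inverse (qa \<alpha>)) (- \<alpha>) * (?b1 * ?bq))" for \<tau>
    using pole_free_mult[OF 1 3, of \<tau> \<tau>] by (simp add: mult_ac)
  have 11: "pole_free (vf \<tau> 1 \<alpha> * (?b1 * ?bq))" for \<tau>
    using pole_free_mult[OF 1 pole_free_ga_frac, of \<tau> "binom \<alpha> (of_real (qa \<alpha>))"] by (simp only: mult.assoc)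
  have "pole_free (?b1 * ?bq)" by (intro pole_free_mult pole_free_ga_frac)
  then show ?thesis
    unfolding gfac_def dens_def ga_frac_mult using 11 12 13 by auto
qed

lemma UV_dens: "pole_free (UV \<nu> \<eta> * ga_frac (\<Prod>\<alpha>\<in>R. dens \<alpha>))"
  unfolding UV_def ga_frac_prod prod.distrib[symmetric] by (intro pole_free_prod gfac_dens)

lemma Dop_dens: "pole_free (Dop f * ga_frac (\<Prod>\<alpha>\<in>R. dens \<alpha>))"
proof -
  have "Dop f * ga_frac (\<Prod>\<alpha>\<in>R. dens \<alpha>) =
      (\<Sum>(\<nu>, \<eta>)\<in>Pairs. (UV \<nu> \<eta> * ga_frac (\<Prod>\<alpha>\<in>R. dens \<alpha>)) * ga_frac (translation q \<nu> f))"
    unfolding Dop_def sum_distrib_right by (intro sum.cong) (auto simp: mult_ac)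
  also have "pole_free \<dots>" by (intro pole_free_sum) (auto intro!: pole_free_mult UV_dens)
  finally show ?thesis .
qed

lemma regular_at_pole_free: "pole_free F \<Longrightarrow> regular_at b F"
  by (auto simp: pole_free_def)

text \<open>Only a factor \<open>v\<close> at \<open>q_\<alpha> e^\<alpha>\<close> or at its inverse
  has a pole along this binomial; a pole from the corresponding factors of \<open>-\<alpha>\<close>
  would require \<open>q_\<alpha>^2 = 1\<close>.\<close>

lemma UV_regular_qa:
  assumes "\<alpha> \<in> R" "\<nu> \<bullet> st \<alpha> \<noteq> 2" "\<not> (\<nu> \<bullet> st \<alpha> = 0 \<and> \<eta> \<bullet> st \<alpha> = 2)"
  shows "regular_at (binom \<alpha> (of_real (qa \<alpha>))) (UV \<nu> \<eta>)"
proof -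
  let ?q = "qa \<alpha>" and ?b = "binom \<alpha> (of_real (qa \<alpha>))"
  have q: "0 < ?q" "?q < 1" using qa[OF assms(1)] by auto
  have m: "?q * ?q < 1 * 1" using q by (intro mult_strict_mono) auto
  have inv: "?q \<noteq> inverse ?q"
  proof
    assume "?q = inverse ?q"
    then have "?q * ?q = 1" using q by (metis less_irrefl right_inverse)
    then show False using m by simp
  qed
  have r: "regular_at ?b (vf \<tau> 1 \<alpha>)" "regular_at ?b (vf \<tau> 1 (- \<alpha>))"
    "regular_at ?b (vf \<tau> ?q (- \<alpha>))" "regular_at ?b (vf \<tau> (inverse ?q) \<alpha>)" for \<tau>
    using vf_regular_same[OF assms(1)] vf_regular_opposite[OF assms(1)] q m inv
    by (auto simp flip: of_real_mult of_real_inverse)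
  show ?thesis
    unfolding UV_split[OF assms(1)] gfac_def using assms(2,3) r rest_regular[OF assms(1)]
    by (auto intro!: regular_at_mult)
qed

lemma UV_regular_one:
  assumes "\<alpha> \<in> R" "\<nu> \<bullet> st \<alpha> = 0" "\<eta> \<bullet> st \<alpha> = 0"
  shows "regular_at (binom \<alpha> 1) (UV \<nu> \<eta>)"
  unfolding UV_split[OF assms(1)] gfac_def using assms rest_regular[OF assms(1)] by auto

text \<open>The two terms share \<open>v_\<alpha>(e^\<alpha>)\<close> and otherwise have at
  \<open>\<alpha>\<close> the value of \<open>v_\<alpha>\<close> at
  \<open>q_\<alpha>^(-1) e^(-\<alpha>)\<close> and at \<open>q_\<alpha> e^\<alpha>\<close>, with
  opposite poles; everything multiplied to these agrees modulo the binomial.\<close>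

lemma pair_regular_qa:
  assumes f: "weyl_invariant f" "Poly_Mapping.keys f \<subseteq> P"
    and p: "(\<nu>, \<eta>) \<in> Pairs" and \<alpha>: "\<alpha> \<in> R" "\<nu> \<bullet> st \<alpha> = 0" "\<eta> \<bullet> st \<alpha> = 2"
  shows "regular_at (binom \<alpha> (of_real (qa \<alpha>)))
    (UV \<nu> \<eta> * ga_frac (translation q \<nu> f) + UV (\<nu> + d \<alpha>) \<eta> * ga_frac (translation q (\<nu> + d \<alpha>) f))"
proof -
  let ?q = "qa \<alpha>" and ?b = "binom \<alpha> (of_real (qa \<alpha>))" and ?s = "reflection \<alpha>"
  have q: "0 < ?q" "?q < 1" using qa[OF \<alpha>(1)] by auto
  have \<alpha>0: "\<alpha> \<noteq> 0" using root_nonzero \<alpha>(1) by blast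
  have n': "(\<nu> + d \<alpha>) \<bullet> st \<alpha> = 2" using \<alpha>(2) d_st_self[OF \<alpha>(1)] by (simp add: inner_add_left)
  have X1: "UV \<nu> \<eta> = vf (t \<alpha>) 1 \<alpha> * vf (t \<alpha>) (inverse ?q) (- \<alpha>) * rest \<alpha> \<nu> \<eta>"
    unfolding UV_split[OF \<alpha>(1)] \<alpha> by (simp add: gfac_def)
  have X2: "UV (\<nu> + d \<alpha>) \<eta> = vf (t \<alpha>) 1 \<alpha> * vf (t \<alpha>) ?q \<alpha> * rest \<alpha> (\<nu> + d \<alpha>) \<eta>"
    unfolding UV_split[OF \<alpha>(1)] \<alpha>(3) n' by (simp add: gfac_def)
  have T: "cong_at ?b (ga_frac (translation q \<nu> f)) (ga_frac (translation q (\<nu> + d \<alpha>) f))"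
  proof (rule cong_at_sym[OF translation_cong[OF f \<alpha>(1)]])
    show "?q \<noteq> 0" using q by simp
    fix x assume x: "x \<in> P"
    have "?s x \<bullet> (\<nu> + d \<alpha>) = x \<bullet> ?s (\<nu> + d \<alpha>)" by (rule reflection_adjoint)
    also have "?s (\<nu> + d \<alpha>) = \<nu> - d \<alpha>"
      unfolding reflection_st[OF \<alpha>(1)] n' by (simp add: scaleR_2)
    finally have "?s x \<bullet> (\<nu> + d \<alpha>) + x \<bullet> d \<alpha> = x \<bullet> \<nu>" by (simp add: inner_diff_right)
    then have "q powr (?s x \<bullet> (\<nu> + d \<alpha>)) * q powr (x \<bullet> d \<alpha>) = q powr (x \<bullet> \<nu>)"
      by (simp flip: powr_add)
    then show "q powr (?s x \<bullet> (\<nu> + d \<alpha>)) * ?q powi \<lfloor>x \<bullet> coroot \<alpha>\<rfloor> = q powr (x \<bullet> \<nu>)"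
      using qa_powi[OF \<alpha>(1) x] by simp
  qed
  have v1: "regular_at ?b (vf (t \<alpha>) 1 \<alpha>)"
    using q by (intro vf_regular_same \<alpha>) (simp add: of_real_eq_1_iff)
  have "regular_at ?b (vf (t \<alpha>) (inverse ?q) (- \<alpha>) * (rest \<alpha> \<nu> \<eta> * ga_frac (translation q \<nu> f)) +
      vf (t \<alpha>) ?q \<alpha> * (rest \<alpha> (\<nu> + d \<alpha>) \<eta> * ga_frac (translation q (\<nu> + d \<alpha>) f)))"
  proof (rule pair_regular)
    show "vf (t \<alpha>) (inverse ?q) (- \<alpha>) + vf (t \<alpha>) ?q \<alpha> =
        scaled_exp (t \<alpha> powr (- 1 / 2)) 0 * (1 + scaled_exp (t \<alpha>) 0)"
      using vf_reflection[of ?q \<alpha> "t \<alpha>"] q \<alpha>0 by (simp add: add.commute)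
    show "regular_at ?b (scaled_exp (t \<alpha> powr (- 1 / 2)) 0 * (1 + scaled_exp (t \<alpha>) 0))"
      by (rule regular_at_pole_free[OF vf_constant])
    show "regular_at ?b (vf (t \<alpha>) ?q \<alpha> * ga_frac ?b)"
      by (rule regular_at_pole_free[OF vf_binom_pole_free[OF \<alpha>0]])
  qed (rule cong_at_mult[OF rest_up_cong[OF p \<alpha>] T])
  from regular_at_mult[OF v1 this] show ?thesis
    unfolding X1 X2 by (simp only: ring_distribs mult_ac)
qed

text \<open>The poles of \<open>v_\<alpha>(e^\<alpha>)\<close> and
  \<open>v_\<alpha>(e^(-\<alpha>))\<close> are opposite, and modulo \<open>1 - e^\<alpha>\<close>
  the remaining factors of a pair and of its reflection agree.\<close>

lemma pair_regular_one:
  assumes f: "weyl_invariant f" "Poly_Mapping.keys f \<subseteq> P" and \<alpha>: "\<alpha> \<in> R"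
    and pos: "\<nu> \<bullet> st \<alpha> > 0 \<or> \<nu> \<bullet> st \<alpha> = 0 \<and> \<eta> \<bullet> st \<alpha> > 0"
  shows "regular_at (binom \<alpha> 1) (UV \<nu> \<eta> * ga_frac (translation q \<nu> f) +
    UV (reflection \<alpha> \<nu>) (reflection \<alpha> \<eta>) * ga_frac (translation q (reflection \<alpha> \<nu>) f))"
proof -
  let ?q = "qa \<alpha>" and ?b = "binom \<alpha> 1" and ?s = "reflection \<alpha>"
  define n m where "n = \<nu> \<bullet> st \<alpha>" and "m = \<eta> \<bullet> st \<alpha>"
  have q: "0 < ?q" "?q < 1" using qa[OF \<alpha>(1)] by auto
  have \<alpha>0: "\<alpha> \<noteq> 0" using root_nonzero \<alpha>(1) by blast
  have sst: "?s (st \<alpha>) = - st \<alpha>"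
    using st_weyl[OF weyl_reflection[OF \<alpha>], of \<alpha>] by (simp add: reflection_self)
  have sn: "?s \<nu> \<bullet> st \<alpha> = - n" "?s \<eta> \<bullet> st \<alpha> = - m"
    unfolding reflection_adjoint sst by (simp_all add: n_def m_def)
  \<comment> \<open>The possible second factor at the root, kept as a function of the root to
    compare \<open>\<alpha>\<close> with \<open>-\<alpha>\<close>. Its scale
    \<open>q_\<alpha>\<close> or \<open>q_\<alpha>^(-1)\<close> differs from \<open>1\<close>, so it
    has no pole along \<open>1 - e^\<alpha>\<close>.\<close>
  define e where "e \<gamma> = (if n = 2 then vf (t \<alpha>) ?q \<gamma> else if n = 0 \<and> m = 2 then vf (t \<alpha>) (inverse ?q) (- \<gamma>) else 1)" for \<gamma> :: 'a
  have tm: "t (- \<alpha>) = t \<alpha>" using t_minus[OF \<alpha>] .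
  have X1: "UV \<nu> \<eta> = vf (t \<alpha>) 1 \<alpha> * (e \<alpha> * rest \<alpha> \<nu> \<eta>)"
    unfolding UV_split[OF \<alpha>(1)] using pos by (auto simp: gfac_def e_def mult.assoc simp flip: n_def m_def)
  have X2: "UV (?s \<nu>) (?s \<eta>) = vf (t \<alpha>) 1 (- \<alpha>) * (e (- \<alpha>) * rest \<alpha> (?s \<nu>) (?s \<eta>))"
    unfolding UV_split[OF \<alpha>(1)] sn using pos unfolding n_def[symmetric] m_def[symmetric]
    by (auto simp: gfac_def e_def mult.assoc tm)
  have se: "cong_at ?b (scaled_exp r (- \<alpha>)) (scaled_exp r \<alpha>)" for r
    using scaled_exp_reflection[OF \<alpha> R_P[OF \<alpha>], of 1 r] by (simp add: reflection_self)
  have cop: "rel_coprime (binom (- \<alpha>) (of_real r)) ?b" "rel_coprime (binom \<alpha> (of_real r)) ?b" if "r \<noteq> 1" for r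
    using that binom_coprime_opposite[of 1 "of_real r" \<alpha>] binom_coprime_same[of 1 "of_real r" \<alpha>] by auto
  have inv: "inverse ?q \<noteq> 1" using q by simp
  have e: "cong_at ?b (e \<alpha>) (e (- \<alpha>))"
    unfolding e_def using q \<alpha>0 cop inv se cong_at_sym[OF se]
    by (auto intro!: cong_at_vf cong_at_refl simp del: of_real_inverse)
  have T: "cong_at ?b (ga_frac (translation q \<nu> f)) (ga_frac (translation q (?s \<nu>) f))"
    using cong_at_sym[OF translation_cong[OF f \<alpha>(1), of 1 "?s \<nu>" \<nu>]] by simp
  show ?thesis
    unfolding X1 X2 mult.assoc
  proof (rule pair_regular)
    show "vf (t \<alpha>) 1 \<alpha> + vf (t \<alpha>) 1 (- \<alpha>) = scaled_exp (t \<alpha> powr (- 1 / 2)) 0 * (1 + scaled_exp (t \<alpha>) 0)"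
      using vf_reflection[of 1 \<alpha> "t \<alpha>"] \<alpha>0 by simp
    show "regular_at ?b (scaled_exp (t \<alpha> powr (- 1 / 2)) 0 * (1 + scaled_exp (t \<alpha>) 0))"
      by (rule regular_at_pole_free[OF vf_constant])
    show "regular_at ?b (vf (t \<alpha>) 1 (- \<alpha>) * ga_frac ?b)"
    proof -
      have "?b = Poly_Mapping.single \<alpha> (- 1) * binom (- \<alpha>) 1"
        by (simp add: binom_def right_diff_distrib mult_single single_uminus)
      then have "vf (t \<alpha>) 1 (- \<alpha>) * ga_frac ?b =
          ga_frac (Poly_Mapping.single \<alpha> (- 1)) * (vf (t \<alpha>) 1 (- \<alpha>) * ga_frac (binom (- \<alpha>) 1))"
        by (simp add: ga_frac_mult mult_ac)
      moreover have "pole_free (vf (t \<alpha>) 1 (- \<alpha>) * ga_frac (binom (- \<alpha>) 1))"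
        using vf_binom_pole_free[of "- \<alpha>" "t \<alpha>" 1] \<alpha>0 by simp
      ultimately show ?thesis using regular_at_pole_free pole_free_mult pole_free_ga_frac by metis
    qed
  qed (intro cong_at_mult e T cong_at_sym[OF rest_reflection_cong[OF \<alpha>]])
qed

lemma Dop_regular_qa:
  assumes f: "weyl_invariant f" "Poly_Mapping.keys f \<subseteq> P" and \<alpha>: "\<alpha> \<in> R"
  shows "regular_at (binom \<alpha> (of_real (qa \<alpha>))) (Dop f)"
proof -
  define g where "g = (\<lambda>(\<nu>, \<eta>). UV \<nu> \<eta> * ga_frac (translation q \<nu> f))"
  \<comment> \<open>These are the terms with a pole; \<open>Pairs_down\<close> maps \<open>A\<close>
    onto \<open>B\<close>, with inverse \<open>Pairs_up\<close>.\<close>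
  define A B where "A = {(\<nu>, \<eta>). (\<nu>, \<eta>) \<in> Pairs \<and> \<nu> \<bullet> st \<alpha> = 2}"
    and "B = {(\<nu>, \<eta>). (\<nu>, \<eta>) \<in> Pairs \<and> \<nu> \<bullet> st \<alpha> = 0 \<and> \<eta> \<bullet> st \<alpha> = 2}"
  have sub: "A \<subseteq> Pairs" "B \<subseteq> Pairs" by (auto simp: A_def B_def)
  have fin: "finite A" "finite B" using sub finite_Pairs finite_subset by blast+
  have "Dop f = sum g ((Pairs - A - B) \<union> (A \<union> B))"
    unfolding Dop_def g_def by (rule arg_cong2[where f = sum]) (use sub in auto)
  also have "\<dots> = sum g (Pairs - A - B) + (sum g A + sum g B)"
    using fin by (subst sum.union_disjoint; auto simp: A_def B_def intro!: sum.union_disjoint)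
  also have "sum g A = (\<Sum>(\<nu>, \<eta>)\<in>B. g (\<nu> + d \<alpha>, \<eta>))"
  proof (rule sum.reindex_bij_witness[of _ "\<lambda>(\<nu>, \<eta>). (\<nu> + d \<alpha>, \<eta>)" "\<lambda>(\<nu>, \<eta>). (\<nu> - d \<alpha>, \<eta>)"])
    fix a assume "a \<in> A"
    then show "(case a of (\<nu>, \<eta>) \<Rightarrow> (\<nu> - d \<alpha>, \<eta>)) \<in> B"
      using Pairs_down[OF _ \<alpha>] by (auto simp: A_def B_def)
  next
    fix b assume "b \<in> B"
    then show "(case b of (\<nu>, \<eta>) \<Rightarrow> (\<nu> + d \<alpha>, \<eta>)) \<in> A"
      using Pairs_up[OF _ \<alpha>] d_st_self[OF \<alpha>] by (auto simp: A_def B_def inner_add_left)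
  qed (auto simp: A_def B_def)
  also have "\<dots> + sum g B = (\<Sum>(\<nu>, \<eta>)\<in>B. g (\<nu>, \<eta>) + g (\<nu> + d \<alpha>, \<eta>))"
    by (simp add: sum.distrib[symmetric] case_prod_unfold add.commute)
  finally have eq: "Dop f = sum g (Pairs - A - B) + (\<Sum>(\<nu>, \<eta>)\<in>B. g (\<nu>, \<eta>) + g (\<nu> + d \<alpha>, \<eta>))" .
  show ?thesis
    unfolding eq
  proof (intro regular_at_add regular_at_sum)
    fix p assume "p \<in> Pairs - A - B"
    then show "regular_at (binom \<alpha> (of_real (qa \<alpha>))) (g p)"
      by (auto simp: g_def A_def B_def intro!: regular_at_mult UV_regular_qa[OF \<alpha>])
  next
    fix p assume "p \<in> B"
    then obtain \<nu> \<eta> where "p = (\<nu>, \<eta>)" "(\<nu>, \<eta>) \<in> Pairs" "\<nu> \<bullet> st \<alpha> = 0" "\<eta> \<bullet> st \<alpha> = 2"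
      by (auto simp: B_def)
    then show "regular_at (binom \<alpha> (of_real (qa \<alpha>)))
        (case p of (\<nu>, \<eta>) \<Rightarrow> g (\<nu>, \<eta>) + g (\<nu> + d \<alpha>, \<eta>))"
      using pair_regular_qa[OF f _ \<alpha>] by (simp add: g_def)
  qed
qed

lemma Dop_regular_one:
  assumes f: "weyl_invariant f" "Poly_Mapping.keys f \<subseteq> P" and \<alpha>: "\<alpha> \<in> R"
  shows "regular_at (binom \<alpha> 1) (Dop f)"
proof -
  let ?s = "reflection \<alpha>"
  define g where "g = (\<lambda>(\<nu>, \<eta>). UV \<nu> \<eta> * ga_frac (translation q \<nu> f))"
  \<comment> \<open>A lexicographic sign of the two pairings, which the reflection reverses. A pair
    with both pairings zero contributes no factor at \<open>\<alpha>\<close> or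
    \<open>-\<alpha>\<close>, hence no pole.\<close>
  define pos where "pos n m \<longleftrightarrow> n > 0 \<or> n = 0 \<and> m > 0" for n m :: real
  define A B where "A = {(\<nu>, \<eta>). (\<nu>, \<eta>) \<in> Pairs \<and> pos (- (\<nu> \<bullet> st \<alpha>)) (- (\<eta> \<bullet> st \<alpha>))}"
    and "B = {(\<nu>, \<eta>). (\<nu>, \<eta>) \<in> Pairs \<and> pos (\<nu> \<bullet> st \<alpha>) (\<eta> \<bullet> st \<alpha>)}"
  have sst: "?s (st \<alpha>) = - st \<alpha>"
    using st_weyl[OF weyl_reflection[OF \<alpha>], of \<alpha>] by (simp add: reflection_self)
  have sn: "?s x \<bullet> st \<alpha> = - (x \<bullet> st \<alpha>)" for x
    unfolding reflection_adjoint sst by simp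
  have sub: "A \<subseteq> Pairs" "B \<subseteq> Pairs" by (auto simp: A_def B_def)
  have fin: "finite A" "finite B" using sub finite_Pairs finite_subset by blast+
  have "Dop f = sum g ((Pairs - A - B) \<union> (A \<union> B))"
    unfolding Dop_def g_def by (rule arg_cong2[where f = sum]) (use sub in auto)
  also have "\<dots> = sum g (Pairs - A - B) + (sum g A + sum g B)"
    using fin by (subst sum.union_disjoint; auto simp: A_def B_def pos_def intro!: sum.union_disjoint)
  also have "sum g A = (\<Sum>(\<nu>, \<eta>)\<in>B. g (?s \<nu>, ?s \<eta>))"
  proof (rule sum.reindex_bij_witness[of _ "\<lambda>(\<nu>, \<eta>). (?s \<nu>, ?s \<eta>)" "\<lambda>(\<nu>, \<eta>). (?s \<nu>, ?s \<eta>)"])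
    fix a assume "a \<in> A"
    then show "(case a of (\<nu>, \<eta>) \<Rightarrow> (?s \<nu>, ?s \<eta>)) \<in> B"
      using Pairs_weyl[OF _ weyl_reflection[OF \<alpha>]] by (auto simp: A_def B_def sn)
  next
    fix b assume "b \<in> B"
    then show "(case b of (\<nu>, \<eta>) \<Rightarrow> (?s \<nu>, ?s \<eta>)) \<in> A"
      using Pairs_weyl[OF _ weyl_reflection[OF \<alpha>]] by (auto simp: A_def B_def sn)
  qed (auto simp: A_def B_def)
  also have "\<dots> + sum g B = (\<Sum>(\<nu>, \<eta>)\<in>B. g (\<nu>, \<eta>) + g (?s \<nu>, ?s \<eta>))"
    by (simp add: sum.distrib[symmetric] case_prod_unfold add.commute)
  finally have eq: "Dop f = sum g (Pairs - A - B) + (\<Sum>(\<nu>, \<eta>)\<in>B. g (\<nu>, \<eta>) + g (?s \<nu>, ?s \<eta>))" .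
  show ?thesis
    unfolding eq
  proof (intro regular_at_add regular_at_sum)
    fix p assume p: "p \<in> Pairs - A - B"
    obtain \<nu> \<eta> where \<nu>\<eta>: "p = (\<nu>, \<eta>)" by fastforce
    then have "\<nu> \<bullet> st \<alpha> = 0 \<and> \<eta> \<bullet> st \<alpha> = 0"
      using p by (auto simp: A_def B_def pos_def)
    then show "regular_at (binom \<alpha> 1) (g p)"
      unfolding g_def \<nu>\<eta> by (auto intro!: regular_at_mult UV_regular_one[OF \<alpha>])
  next
    fix p assume "p \<in> B"
    then obtain \<nu> \<eta> where "p = (\<nu>, \<eta>)" "\<nu> \<bullet> st \<alpha> > 0 \<or> \<nu> \<bullet> st \<alpha> = 0 \<and> \<eta> \<bullet> st \<alpha> > 0"
      by (auto simp: B_def pos_def)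
    then show "regular_at (binom \<alpha> 1) (case p of (\<nu>, \<eta>) \<Rightarrow> g (\<nu>, \<eta>) + g (?s \<nu>, ?s \<eta>))"
      using pair_regular_one[OF f \<alpha>] by (simp add: g_def)
  qed
qed

theorem Dop_pole_free:
  assumes f: "weyl_invariant f" "Poly_Mapping.keys f \<subseteq> P"
  shows "\<exists>G. Dop f = ga_frac G"
proof -
  define b where "b = (\<lambda>(\<alpha>, i). if i then binom \<alpha> 1 else binom \<alpha> (of_real (qa \<alpha>)))"
  have "(\<Prod>p\<in>R \<times> UNIV. b p) = (\<Prod>\<alpha>\<in>R. \<Prod>i\<in>UNIV. b (\<alpha>, i))"
    by (simp add: prod.cartesian_product)
  also have "\<dots> = (\<Prod>\<alpha>\<in>R. dens \<alpha>)" by (simp add: b_def dens_def UNIV_bool mult.commute)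
  finally have prod: "(\<Prod>p\<in>R \<times> UNIV. b p) = (\<Prod>\<alpha>\<in>R. dens \<alpha>)" .
  obtain N where N: "Dop f * ga_frac (\<Prod>p\<in>R \<times> UNIV. b p) = ga_frac N"
    using Dop_dens[of f] unfolding prod pole_free_def by blast
  show ?thesis
  proof (rule regular_everywhere[OF _ _ _ N])
    fix p assume "p \<in> R \<times> (UNIV :: bool set)"
    then show "regular_at (b p) (Dop f)" "b p \<noteq> 0"
      using Dop_regular_one[OF f] Dop_regular_qa[OF f] binom_nonzero[OF root_nonzero]
      by (auto simp: b_def split: if_splits)
  qed simp
qed

end

subsection \<open>Invariance under the Weyl group\<close>

context root_sys
begin

definition weyl_act :: "('a \<Rightarrow> 'a) \<Rightarrow> ('a \<Rightarrow>\<^sub>0 complex) \<Rightarrow> ('a \<Rightarrow>\<^sub>0 complex)" where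
  "weyl_act w f = Poly_Mapping.map_key (inv w) f"

lemma lookup_weyl_act: assumes "w \<in> W" shows "Poly_Mapping.lookup (weyl_act w f) x = Poly_Mapping.lookup f (inv w x)"
  unfolding weyl_act_def
  by (rule lookup_map_key_inj[OF bij_is_inj[OF weyl_inv(4)[OF weyl_inv(1)[OF assms]]]])

lemma weyl_act_add: "w \<in> W \<Longrightarrow> weyl_act w (f + g) = weyl_act w f + weyl_act w g"
  by (rule poly_mapping_eqI) (simp add: lookup_weyl_act[of w] lookup_add)

lemma weyl_act_single: assumes "w \<in> W" shows "weyl_act w (Poly_Mapping.single x c) = Poly_Mapping.single (w x) c"
  using weyl_inv(2,3)[OF assms]
  by (intro poly_mapping_eqI) (auto simp: lookup_weyl_act[OF assms] lookup_single when_def)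

lemma weyl_act_0: "w \<in> W \<Longrightarrow> weyl_act w 0 = 0"
  by (rule poly_mapping_eqI) (simp add: lookup_weyl_act[of w])

lemma weyl_act_mult: assumes w: "w \<in> W" shows "weyl_act w (f * g) = weyl_act w f * weyl_act w g"
proof (induction f rule: ga_induct)
  case (single x c)
  show ?case
  proof (induction g rule: ga_induct)
    case (single y e)
    show ?case by (simp add: mult_single weyl_act_single[OF w] weyl_add[OF w])
  qed (simp_all add: weyl_act_0[OF w] distrib_left weyl_act_add[OF w])
qed (simp_all add: weyl_act_0[OF w] distrib_right weyl_act_add[OF w])

lemma weyl_act_1: "w \<in> W \<Longrightarrow> weyl_act w 1 = 1"
  using weyl_act_single[of w 0 1] by (simp add: weyl_zero[of w])

lemma weyl_act_eq_0_iff: assumes "w \<in> W" shows "weyl_act w f = 0 \<longleftrightarrow> f = 0"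
proof
  assume "weyl_act w f = 0"
  then have "Poly_Mapping.lookup f (inv w (w x)) = 0" for x
    using lookup_weyl_act[OF assms, of f "w x"] by simp
  then show "f = 0" using weyl_inv(2)[OF assms] by (intro poly_mapping_eqI) simp
qed (simp add: weyl_act_0[OF assms])

text \<open>The extension of the Weyl action to the quotient field. The presentation as a quotient
  is arbitrary; \<open>fract_act_quotient\<close> shows independence of it by cross-multiplication,
  as \<open>weyl_act w\<close> is an injective ring homomorphism for \<open>w\<close> in the Weyl
  group.\<close>

definition fract_act :: "('a \<Rightarrow> 'a) \<Rightarrow> 'a ga_domain fract \<Rightarrow> 'a ga_domain fract" where
  "fract_act w x = (let p = SOME p. x = ga_frac (fst p) / ga_frac (snd p) \<and> snd p \<noteq> 0
    in ga_frac (weyl_act w (fst p)) / ga_frac (weyl_act w (snd p)))"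

lemma fract_act_quotient:
  assumes w: "w \<in> W" and "b \<noteq> 0"
  shows "fract_act w (ga_frac a / ga_frac b) = ga_frac (weyl_act w a) / ga_frac (weyl_act w b)"
proof -
  define p where "p = (SOME p. ga_frac a / ga_frac b = ga_frac (fst p) / ga_frac (snd p) \<and> snd p \<noteq> 0)"
  have "ga_frac a / ga_frac b = ga_frac (fst p) / ga_frac (snd p) \<and> snd p \<noteq> 0"
    unfolding p_def by (rule someI[of _ "(a, b)"]) (use assms in simp)
  then have p: "ga_frac a / ga_frac b = ga_frac (fst p) / ga_frac (snd p)" "snd p \<noteq> 0" by auto
  have "ga_frac (a * snd p) = ga_frac (fst p * b)"
    using p assms(2) by (simp add: ga_frac_mult frac_eq_eq)
  then have "weyl_act w a * weyl_act w (snd p) = weyl_act w (fst p) * weyl_act w b"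
    by (simp flip: weyl_act_mult[OF w])
  then have "ga_frac (weyl_act w a) * ga_frac (weyl_act w (snd p)) = ga_frac (weyl_act w (fst p)) * ga_frac (weyl_act w b)"
    by (simp flip: ga_frac_mult)
  then have "ga_frac (weyl_act w (fst p)) / ga_frac (weyl_act w (snd p)) = ga_frac (weyl_act w a) / ga_frac (weyl_act w b)"
    using p(2) assms(2) by (simp add: frac_eq_eq weyl_act_eq_0_iff[OF w])
  then show ?thesis unfolding fract_act_def p_def[symmetric] Let_def .
qed

lemma fract_act_ga_frac: "w \<in> W \<Longrightarrow> fract_act w (ga_frac a) = ga_frac (weyl_act w a)"
  using fract_act_quotient[of w 1 a] by (simp add: weyl_act_1[of w])

lemma fract_act_mult: assumes w: "w \<in> W" shows "fract_act w (x * y) = fract_act w x * fract_act w y"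
proof -
  obtain a b where x: "x = ga_frac a / ga_frac b" "b \<noteq> 0" by (rule fract_quotient)
  obtain a' b' where y: "y = ga_frac a' / ga_frac b'" "b' \<noteq> 0" by (rule fract_quotient)
  have xy: "x * y = ga_frac (a * a') / ga_frac (b * b')" by (simp add: x y ga_frac_mult)
  show ?thesis
    unfolding xy fract_act_quotient[OF w ga_nonzero_mult[OF x(2) y(2)]]
    unfolding x(1) y(1) fract_act_quotient[OF w x(2)] fract_act_quotient[OF w y(2)]
    by (simp add: weyl_act_mult[OF w] ga_frac_mult)
qed

lemma fract_act_add: assumes w: "w \<in> W" shows "fract_act w (x + y) = fract_act w x + fract_act w y"
proof -
  obtain a b where x: "x = ga_frac a / ga_frac b" "b \<noteq> 0" by (rule fract_quotient)
  obtain a' b' where y: "y = ga_frac a' / ga_frac b'" "b' \<noteq> 0" by (rule fract_quotient)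
  have xy: "x + y = ga_frac (a * b' + a' * b) / ga_frac (b * b')"
    using x(2) y(2) by (simp add: x(1) y(1) ga_frac_mult ga_frac_add add_frac_eq)
  have "ga_frac (weyl_act w b) \<noteq> 0" "ga_frac (weyl_act w b') \<noteq> 0" using x(2) y(2) by (simp_all add: weyl_act_eq_0_iff[OF w])
  then show ?thesis
    unfolding xy fract_act_quotient[OF w ga_nonzero_mult[OF x(2) y(2)]]
    unfolding x(1) y(1) fract_act_quotient[OF w x(2)] fract_act_quotient[OF w y(2)]
    by (simp add: weyl_act_mult[OF w] weyl_act_add[OF w] ga_frac_mult ga_frac_add add_frac_eq)
qed

lemma fract_act_1: "w \<in> W \<Longrightarrow> fract_act w 1 = 1"
  using fract_act_ga_frac[of w 1] by (simp add: weyl_act_1[of w])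

lemma fract_act_0: "w \<in> W \<Longrightarrow> fract_act w 0 = 0"
  using fract_act_ga_frac[of w 0] by (simp add: weyl_act_0[of w])

lemma fract_act_inverse: assumes w: "w \<in> W" shows "fract_act w (inverse x) = inverse (fract_act w x)"
proof (cases "x = 0")
  case True
  then show ?thesis by (simp add: fract_act_0[OF w])
next
  case False
  then have "fract_act w x * fract_act w (inverse x) = 1" by (simp add: fract_act_1[OF w] flip: fract_act_mult[OF w])
  then show ?thesis by (metis inverse_unique)
qed

lemma fract_act_prod: "w \<in> W \<Longrightarrow> fract_act w (prod f I) = (\<Prod>i\<in>I. fract_act w (f i))"
  by (induction I rule: infinite_finite_induct) (simp_all add: fract_act_1[of w] fract_act_mult[of w])

lemma fract_act_sum: "w \<in> W \<Longrightarrow> fract_act w (sum f I) = (\<Sum>i\<in>I. fract_act w (f i))"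
  by (induction I rule: infinite_finite_induct) (simp_all add: fract_act_0[of w] fract_act_add[of w])

lemma weyl_act_binom: assumes w: "w \<in> W" shows "weyl_act w (binom \<alpha> c) = binom (w \<alpha>) c"
proof -
  have "binom \<alpha> c = 1 + Poly_Mapping.single \<alpha> (- c)" for \<alpha> :: 'a
    by (simp add: binom_def single_uminus)
  then show ?thesis by (simp add: weyl_act_add[OF w] weyl_act_1[OF w] weyl_act_single[OF w])
qed

lemma fract_act_vf: assumes w: "w \<in> W" shows "fract_act w (vf \<tau> c \<alpha>) = vf \<tau> c (w \<alpha>)"
  unfolding vf_eq scaled_exp_def
  by (simp add: fract_act_mult[OF w] fract_act_inverse[OF w] fract_act_ga_frac[OF w] weyl_act_binom[OF w] weyl_act_single[OF w] weyl_zero[OF w])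

end

context small_macd
begin

lemma weyl_invariant_weyl_act: "weyl_invariant f \<longleftrightarrow> (\<forall>w\<in>W. weyl_act w f = f)"
proof
  assume f: "weyl_invariant f"
  show "\<forall>w\<in>W. weyl_act w f = f"
  proof
    fix w assume w: "w \<in> W"
    show "weyl_act w f = f"
      using f weyl_inv(1)[OF w] by (intro poly_mapping_eqI) (simp add: lookup_weyl_act[OF w] weyl_invariant_def)
  qed
next
  assume f: "\<forall>w\<in>W. weyl_act w f = f"
  show "weyl_invariant f" unfolding weyl_invariant_def
  proof (intro ballI allI)
    fix w x assume w: "w \<in> W"
    have "Poly_Mapping.lookup f (w x) = Poly_Mapping.lookup (weyl_act w f) (w x)" using f w by simp
    then show "Poly_Mapping.lookup f (w x) = Poly_Mapping.lookup f x"
      by (simp add: lookup_weyl_act[OF w] weyl_inv(2)[OF w])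
  qed
qed

lemma weyl_act_translation:
  assumes w: "w \<in> W" and "weyl_invariant f"
  shows "weyl_act w (translation q \<nu> f) = translation q (w \<nu>) f"
proof (rule poly_mapping_eqI)
  fix x
  have "Poly_Mapping.lookup f (inv w x) = Poly_Mapping.lookup f x"
    using assms(2) weyl_inv(1)[OF w] by (simp add: weyl_invariant_def)
  moreover have "inv w x \<bullet> \<nu> = x \<bullet> w \<nu>"
    using weyl_inner_swap[OF w, of \<nu> x] by (simp add: inner_commute)
  ultimately show "Poly_Mapping.lookup (weyl_act w (translation q \<nu> f)) x = Poly_Mapping.lookup (translation q (w \<nu>) f) x"
    by (simp add: lookup_weyl_act[OF w] lookup_translation)
qed

lemma fract_act_gfac: assumes w: "w \<in> W" and "\<alpha> \<in> R" shows "fract_act w (gfac \<alpha> n m) = gfac (w \<alpha>) n m"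
proof -
  have "t (w \<alpha>) = t \<alpha>" "qa (w \<alpha>) = qa \<alpha>"
    using t_weyl[OF assms] u_weyl[OF w] by (simp_all add: qa_def)
  then show ?thesis
    by (simp add: gfac_def fract_act_mult[OF w] fract_act_vf[OF w] fract_act_1[OF w] weyl_minus[OF w])
qed

lemma fract_act_UV: assumes w: "w \<in> W" shows "fract_act w (UV \<nu> \<eta>) = UV (w \<nu>) (w \<eta>)"
proof -
  have inner: "x \<bullet> st \<alpha> = w x \<bullet> st (w \<alpha>)" for x \<alpha>
    unfolding st_weyl[OF w] weyl_inner[OF w] ..
  have "fract_act w (UV \<nu> \<eta>) = (\<Prod>\<alpha>\<in>R. gfac (w \<alpha>) (w \<nu> \<bullet> st (w \<alpha>)) (w \<eta> \<bullet> st (w \<alpha>)))"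
    unfolding UV_def fract_act_prod[OF w] inner[symmetric] by (intro prod.cong refl fract_act_gfac[OF w])
  also have "\<dots> = (\<Prod>\<alpha>\<in>w ` R. gfac \<alpha> (w \<nu> \<bullet> st \<alpha>) (w \<eta> \<bullet> st \<alpha>))"
    using bij_is_inj[OF weyl_inv(4)[OF w]] by (subst prod.reindex) (auto intro: inj_on_subset)
  finally show ?thesis unfolding weyl_image_R[OF w] UV_def .
qed

text \<open>The factors depend on \<open>\<nu>\<close> and \<open>\<eta>\<close> only through
  pairings with roots, so \<open>w\<close> sends the term of a pair to the term of its image and
  permutes the summands.\<close>

lemma Dop_weyl_invariant:
  assumes f: "weyl_invariant f" and G: "Dop f = ga_frac G"
  shows "weyl_invariant G"
  unfolding weyl_invariant_weyl_act
proof
  fix w assume w: "w \<in> W"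
  have "ga_frac (weyl_act w G) = fract_act w (Dop f)" unfolding G fract_act_ga_frac[OF w] ..
  also have "\<dots> = (\<Sum>(\<nu>, \<eta>)\<in>Pairs. UV (w \<nu>) (w \<eta>) * ga_frac (translation q (w \<nu>) f))"
    unfolding Dop_def fract_act_sum[OF w]
    by (intro sum.cong refl)
      (auto simp: fract_act_mult[OF w] fract_act_UV[OF w] fract_act_ga_frac[OF w] weyl_act_translation[OF w f])
  also have "\<dots> = Dop f"
    unfolding Dop_def
  proof (rule sum.reindex_bij_witness[of _ "\<lambda>(\<nu>, \<eta>). (inv w \<nu>, inv w \<eta>)" "\<lambda>(\<nu>, \<eta>). (w \<nu>, w \<eta>)"])
    fix a assume "a \<in> Pairs"
    then show "(case a of (\<nu>, \<eta>) \<Rightarrow> (w \<nu>, w \<eta>)) \<in> Pairs" using Pairs_weyl[OF _ w] by (cases a) simp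
  next
    fix a assume "a \<in> Pairs"
    then show "(case a of (\<nu>, \<eta>) \<Rightarrow> (inv w \<nu>, inv w \<eta>)) \<in> Pairs" using Pairs_weyl[OF _ weyl_inv(1)[OF w]] by (cases a) simp
  qed (auto simp: weyl_inv(2,3)[OF w])
  finally show "weyl_act w G = G" unfolding G by simp
qed

end

section \<open>Leading terms and the eigenvalue\<close>

context root_sys
begin

definition low :: "'a \<Rightarrow> ('a \<Rightarrow>\<^sub>0 complex) \<Rightarrow> bool" where
  "low \<kappa> f \<longleftrightarrow> (\<forall>x\<in>Poly_Mapping.keys f. \<kappa> - x \<in> root_cone)"

lemma low_single: "\<kappa> - x \<in> root_cone \<Longrightarrow> low \<kappa> (Poly_Mapping.single x c)"
  by (auto simp: low_def split: if_splits)

lemma low_lookup: "low \<kappa> f \<Longrightarrow> Poly_Mapping.lookup f x \<noteq> 0 \<Longrightarrow> \<kappa> - x \<in> root_cone"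
  by (auto simp: low_def in_keys_iff)

lemma lowI: "(\<And>x. Poly_Mapping.lookup f x \<noteq> 0 \<Longrightarrow> \<kappa> - x \<in> root_cone) \<Longrightarrow> low \<kappa> f"
  by (auto simp: low_def in_keys_iff)

lemma low_0 [simp]: "low \<kappa> 0"
  by (simp add: low_def)

lemma low_add: assumes "low \<kappa> f" "low \<kappa> g" shows "low \<kappa> (f + g)"
proof (rule lowI)
  fix x assume "Poly_Mapping.lookup (f + g) x \<noteq> 0"
  then have "Poly_Mapping.lookup f x \<noteq> 0 \<or> Poly_Mapping.lookup g x \<noteq> 0" by (auto simp: lookup_add)
  then show "\<kappa> - x \<in> root_cone" using assms low_lookup by blast
qed

lemma low_sum: "(\<And>i. i \<in> I \<Longrightarrow> low \<kappa> (f i)) \<Longrightarrow> low \<kappa> (sum f I)"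
  by (induction I rule: infinite_finite_induct) (auto intro: low_add)

lemma lookup_mult_expand:
  "Poly_Mapping.lookup (f * g) x =
    (\<Sum>y\<in>Poly_Mapping.keys f. Poly_Mapping.lookup f y * Poly_Mapping.lookup (g :: 'a \<Rightarrow>\<^sub>0 complex) (x - y))"
  by (subst (1) ga_expand[of f]) (simp add: sum_distrib_right lookup_sum lookup_single_mult)

lemma low_mult: assumes "low \<kappa> f" "low \<mu> g" shows "low (\<kappa> + \<mu>) (f * g)"
proof (rule lowI)
  fix x assume "Poly_Mapping.lookup (f * g) x \<noteq> 0"
  then obtain y where "y \<in> Poly_Mapping.keys f" "Poly_Mapping.lookup g (x - y) \<noteq> 0"
    unfolding lookup_mult_expand by (rule sum.not_neutral_contains_not_neutral) auto
  then have "\<kappa> - y \<in> root_cone" "\<mu> - (x - y) \<in> root_cone" using assms low_lookup by (auto simp: low_def)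
  from root_cone_add[OF this] show "\<kappa> + \<mu> - x \<in> root_cone" by (simp add: algebra_simps)
qed

lemma low_mult_lookup:
  assumes "low \<kappa> f" "low \<mu> g"
  shows "Poly_Mapping.lookup (f * g) (\<kappa> + \<mu>) = Poly_Mapping.lookup f \<kappa> * Poly_Mapping.lookup g \<mu>"
proof -
  have "Poly_Mapping.lookup (f * g) (\<kappa> + \<mu>) =
      (\<Sum>y\<in>Poly_Mapping.keys f. if y = \<kappa> then Poly_Mapping.lookup f \<kappa> * Poly_Mapping.lookup g \<mu> else 0)"
    unfolding lookup_mult_expand
  proof (intro sum.cong refl)
    fix y assume y: "y \<in> Poly_Mapping.keys f"
    have "Poly_Mapping.lookup g (\<kappa> + \<mu> - y) = 0" if "y \<noteq> \<kappa>"
    proof (rule ccontr)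
      assume "Poly_Mapping.lookup g (\<kappa> + \<mu> - y) \<noteq> 0"
      then have "\<mu> - (\<kappa> + \<mu> - y) \<in> root_cone" using assms(2) low_lookup by blast
      then have "- (\<kappa> - y) \<in> root_cone" by (simp add: algebra_simps)
      moreover have "\<kappa> - y \<in> root_cone" using assms(1) y by (simp add: low_def)
      ultimately show False using root_cone_antisym that by fastforce
    qed
    then show "Poly_Mapping.lookup f y * Poly_Mapping.lookup g (\<kappa> + \<mu> - y) =
      (if y = \<kappa> then Poly_Mapping.lookup f \<kappa> * Poly_Mapping.lookup g \<mu> else 0)" by simp
  qed
  then show ?thesis by (simp add: in_keys_iff)
qed

text \<open>The expansion at infinity in the positive chamber, expressed without series: the
  denominator is \<open>1\<close> plus lower terms, so the expansion of \<open>F\<close> is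
  supported below \<open>\<kappa>\<close> and has coefficient \<open>c\<close> there. The value
  \<open>c = 0\<close> is allowed, which makes the notion additive.\<close>

definition leads :: "'a \<Rightarrow> complex \<Rightarrow> 'a ga_domain fract \<Rightarrow> bool" where
  "leads \<kappa> c F \<longleftrightarrow> (\<exists>N d. F * ga_frac d = ga_frac N \<and> low 0 d \<and> Poly_Mapping.lookup d 0 = 1 \<and>
    low \<kappa> N \<and> Poly_Mapping.lookup N \<kappa> = c)"

lemma leadsE:
  assumes "leads \<kappa> c F"
  obtains N d where "F * ga_frac d = ga_frac N" "low 0 d" "Poly_Mapping.lookup d 0 = 1"
    "low \<kappa> N" "Poly_Mapping.lookup N \<kappa> = c"
  using assms by (auto simp: leads_def)

lemma leadsI:
  "F * ga_frac d = ga_frac N \<Longrightarrow> low 0 d \<Longrightarrow> Poly_Mapping.lookup d 0 = 1 \<Longrightarrow>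
    low \<kappa> N \<Longrightarrow> Poly_Mapping.lookup N \<kappa> = c \<Longrightarrow> leads \<kappa> c F"
  unfolding leads_def by blast

lemma low_1: "low 0 1"
  by (auto simp: low_def)

lemma leads_ga_frac: "low \<kappa> f \<Longrightarrow> Poly_Mapping.lookup f \<kappa> = c \<Longrightarrow> leads \<kappa> c (ga_frac f)"
  by (rule leadsI[of _ 1 f]) (simp_all add: low_1)

lemma leads_1: "leads 0 1 1"
  using leads_ga_frac[OF low_1, of 1] by simp

lemma leads_mult: assumes "leads \<kappa> c F" "leads \<mu> c' G" shows "leads (\<kappa> + \<mu>) (c * c') (F * G)"
proof -
  obtain N d where F: "F * ga_frac d = ga_frac N" "low 0 d" "Poly_Mapping.lookup d 0 = 1"
    "low \<kappa> N" "Poly_Mapping.lookup N \<kappa> = c" using assms(1) by (rule leadsE)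
  obtain N' d' where G: "G * ga_frac d' = ga_frac N'" "low 0 d'" "Poly_Mapping.lookup d' 0 = 1"
    "low \<mu> N'" "Poly_Mapping.lookup N' \<mu> = c'" using assms(2) by (rule leadsE)
  show ?thesis
  proof (rule leadsI)
    have "F * G * ga_frac (d * d') = (F * ga_frac d) * (G * ga_frac d')" by (simp add: ga_frac_mult mult_ac)
    also have "\<dots> = ga_frac (N * N')" unfolding F(1) G(1) by (simp add: ga_frac_mult)
    finally show "F * G * ga_frac (d * d') = ga_frac (N * N')" .
    show "low 0 (d * d')" "Poly_Mapping.lookup (d * d') 0 = 1"
      using low_mult[OF F(2) G(2)] low_mult_lookup[OF F(2) G(2)] F(3) G(3) by simp_all
    show "low (\<kappa> + \<mu>) (N * N')" "Poly_Mapping.lookup (N * N') (\<kappa> + \<mu>) = c * c'"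
      using low_mult[OF F(4) G(4)] low_mult_lookup[OF F(4) G(4)] F(5) G(5) by simp_all
  qed
qed

lemma leads_add: assumes "leads \<kappa> c F" "leads \<kappa> c' G" shows "leads \<kappa> (c + c') (F + G)"
proof -
  obtain N d where F: "F * ga_frac d = ga_frac N" "low 0 d" "Poly_Mapping.lookup d 0 = 1"
    "low \<kappa> N" "Poly_Mapping.lookup N \<kappa> = c" using assms(1) by (rule leadsE)
  obtain N' d' where G: "G * ga_frac d' = ga_frac N'" "low 0 d'" "Poly_Mapping.lookup d' 0 = 1"
    "low \<kappa> N'" "Poly_Mapping.lookup N' \<kappa> = c'" using assms(2) by (rule leadsE)
  show ?thesis
  proof (rule leadsI)
    have "(F + G) * ga_frac (d * d') = (F * ga_frac d) * ga_frac d' + (G * ga_frac d') * ga_frac d"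
      unfolding ga_frac_mult by (simp only: ring_distribs mult_ac)
    also have "\<dots> = ga_frac (N * d' + N' * d)" unfolding F(1) G(1) by (simp add: ga_frac_mult ga_frac_add)
    finally show "(F + G) * ga_frac (d * d') = ga_frac (N * d' + N' * d)" .
    show "low 0 (d * d')" "Poly_Mapping.lookup (d * d') 0 = 1"
      using low_mult[OF F(2) G(2)] low_mult_lookup[OF F(2) G(2)] F(3) G(3) by simp_all
    show "low \<kappa> (N * d' + N' * d)" "Poly_Mapping.lookup (N * d' + N' * d) \<kappa> = c + c'"
      using low_mult[OF F(4) G(2)] low_mult_lookup[OF F(4) G(2)] low_mult[OF G(4) F(2)] low_mult_lookup[OF G(4) F(2)]
        F(3,5) G(3,5) by (simp_all add: lookup_add low_add)
  qed
qed

lemma leads_sum: "finite I \<Longrightarrow> (\<And>i. i \<in> I \<Longrightarrow> leads \<kappa> (c i) (F i)) \<Longrightarrow> leads \<kappa> (sum c I) (sum F I)"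
  by (induction I rule: finite_induct) (auto intro: leads_add leads_ga_frac[of \<kappa> 0 0, simplified])

lemma leads_prod: "finite I \<Longrightarrow> (\<And>i. i \<in> I \<Longrightarrow> leads 0 (c i) (F i)) \<Longrightarrow> leads 0 (prod c I) (prod F I)"
proof (induction I rule: finite_induct)
  case (insert i I)
  then show ?case using leads_mult[of 0 "c i" "F i" 0 "prod c I" "prod F I"] by simp
qed (simp add: leads_1)

text \<open>Among the exponents of \<open>G\<close> that are not below \<open>\<kappa>\<close> take
  one of greatest height. Multiplication by \<open>1\<close> plus lower terms cannot cancel it,
  since a cancelling contribution would come from a higher exponent that is not below
  \<open>\<kappa>\<close> either.\<close>

lemma leads_pole_free:
  assumes "leads \<kappa> c (ga_frac G)"
  shows "low \<kappa> G" "Poly_Mapping.lookup G \<kappa> = c"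
proof -
  obtain N d where N: "ga_frac G * ga_frac d = ga_frac N" "low 0 d" "Poly_Mapping.lookup d 0 = 1"
    "low \<kappa> N" "Poly_Mapping.lookup N \<kappa> = c" using assms by (rule leadsE)
  have Gd: "d * G = N" using N(1) by (simp add: mult.commute flip: ga_frac_mult)
  have expand: "Poly_Mapping.lookup N x = Poly_Mapping.lookup G x +
      (\<Sum>y\<in>Poly_Mapping.keys d - {0}. Poly_Mapping.lookup d y * Poly_Mapping.lookup G (x - y))" for x
  proof -
    have "0 \<in> Poly_Mapping.keys d" using N(3) by (simp add: in_keys_iff)
    then show ?thesis
      unfolding Gd[symmetric] lookup_mult_expand using N(3) by (subst sum.remove[of _ 0]) auto
  qed
  show low: "low \<kappa> G"
  proof (rule ccontr)
    assume "\<not> low \<kappa> G"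
    then have ne: "{x \<in> Poly_Mapping.keys G. \<kappa> - x \<notin> root_cone} \<noteq> {}" by (auto simp: low_def)
    have fin: "finite {x \<in> Poly_Mapping.keys G. \<kappa> - x \<notin> root_cone}" by simp
    obtain x where x: "x \<in> {x \<in> Poly_Mapping.keys G. \<kappa> - x \<notin> root_cone}"
      "\<And>y. y \<in> {x \<in> Poly_Mapping.keys G. \<kappa> - x \<notin> root_cone} \<Longrightarrow> y \<bullet> v \<le> x \<bullet> v"
      using maximal_exists[OF fin ne] by blast
    have "Poly_Mapping.lookup G (x - y) = 0" if y: "y \<in> Poly_Mapping.keys d - {0}" for y
    proof (rule ccontr)
      assume ne: "Poly_Mapping.lookup G (x - y) \<noteq> 0"
      have yQ: "- y \<in> root_cone" using N(2) y by (auto simp: low_def)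
      have "\<kappa> - (x - y) \<notin> root_cone"
      proof
        assume "\<kappa> - (x - y) \<in> root_cone"
        from root_cone_add[OF this yQ] have "\<kappa> - x \<in> root_cone" by simp
        then show False using x(1) by simp
      qed
      then have "(x - y) \<bullet> v \<le> x \<bullet> v" using x(2) ne by (simp add: in_keys_iff)
      moreover have "- y \<bullet> v > 0" using root_cone_pos[OF yQ] y by simp
      ultimately show False by (simp add: inner_diff_left)
    qed
    then have "Poly_Mapping.lookup N x = Poly_Mapping.lookup G x" unfolding expand by simp
    then have "Poly_Mapping.lookup N x \<noteq> 0" using x(1) by (simp add: in_keys_iff)
    then show False using low_lookup[OF N(4)] x(1) by blast
  qed
  have "Poly_Mapping.lookup G (\<kappa> - y) = 0" if y: "y \<in> Poly_Mapping.keys d - {0}" for y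
  proof (rule ccontr)
    assume ne: "Poly_Mapping.lookup G (\<kappa> - y) \<noteq> 0"
    have "y \<in> root_cone" using low_lookup[OF low ne] by simp
    moreover have "- y \<in> root_cone" using N(2) y by (auto simp: low_def)
    ultimately show False using root_cone_antisym y by blast
  qed
  then show "Poly_Mapping.lookup G \<kappa> = c" using N(5) unfolding expand by simp
qed

text \<open>Whatever the scale \<open>r\<close>, the function \<open>v\<close> tends to
  \<open>\<tau>^(1/2)\<close> as its argument goes to infinity and to \<open>\<tau>^(-1/2)\<close>
  as it goes to zero.\<close>

lemma leads_vf:
  assumes "\<alpha> \<in> Rp" "\<tau> > 0" "r > 0"
  shows "leads 0 (of_real (\<tau> powr (1 / 2))) (vf \<tau> r \<alpha>)"
    and "leads 0 (of_real (\<tau> powr (- 1 / 2))) (vf \<tau> r (- \<alpha>))"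
proof -
  have \<alpha>: "\<alpha> \<in> root_cone" "\<alpha> \<noteq> 0" using Rp_root_cone Rp_R root_nonzero assms(1) by auto
  have lowb: "low 0 (Poly_Mapping.single 0 x - Poly_Mapping.single (- \<alpha>) y)" for x y
  proof -
    have "low 0 (Poly_Mapping.single 0 x + Poly_Mapping.single (- \<alpha>) (- y))"
      using \<alpha> by (intro low_add low_single) auto
    then show ?thesis by (simp add: single_uminus)
  qed
  have binom: "binom (- \<alpha>) c = Poly_Mapping.single 0 1 - Poly_Mapping.single (- \<alpha>) c" for c
    by (simp add: binom_def)
  have lb: "low 0 (binom (- \<alpha>) c)" "Poly_Mapping.lookup (binom (- \<alpha>) c) 0 = 1" for c
    using lowb[of 1 c] \<alpha>(2) unfolding binom by (simp_all add: lookup_minus lookup_single when_def)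
  let ?s = "Poly_Mapping.single 0 (of_real (\<tau> powr (- 1 / 2))) :: 'a \<Rightarrow>\<^sub>0 complex"
  have ls: "low 0 ?s" by (rule low_single) simp
  have ne: "ga_frac (binom (- \<alpha>) (of_real r)) \<noteq> 0" "ga_frac (binom \<alpha> (of_real r)) \<noteq> 0"
    using \<alpha>(2) by (simp_all add: binom_nonzero)
  show "leads 0 (of_real (\<tau> powr (- 1 / 2))) (vf \<tau> r (- \<alpha>))"
  proof (rule leadsI[OF _ lb])
    show "vf \<tau> r (- \<alpha>) * ga_frac (binom (- \<alpha>) (of_real r)) = ga_frac (?s * binom (- \<alpha>) (of_real (\<tau> * r)))"
      using ne by (simp add: vf_eq scaled_exp_def ga_frac_mult)
    show "low 0 (?s * binom (- \<alpha>) (of_real (\<tau> * r)))"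
      "Poly_Mapping.lookup (?s * binom (- \<alpha>) (of_real (\<tau> * r))) 0 = of_real (\<tau> powr (- 1 / 2))"
      using low_mult[OF ls lb(1)] low_mult_lookup[OF ls lb(1)] lb(2) by simp_all
  qed
  \<comment> \<open>This multiplier turns the denominator \<open>1 - r e^\<alpha>\<close> into
    \<open>1 - e^(-\<alpha>) / r\<close>, which is \<open>1\<close> plus lower terms.\<close>
  let ?k = "Poly_Mapping.single (- \<alpha>) (- inverse (of_real r)) :: 'a \<Rightarrow>\<^sub>0 complex"
  let ?M = "Poly_Mapping.single 0 (of_real \<tau>) - Poly_Mapping.single (- \<alpha>) (inverse (of_real r)) :: 'a \<Rightarrow>\<^sub>0 complex"
  have k: "?k * binom \<alpha> (of_real r) = binom (- \<alpha>) (inverse (of_real r))"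
    "?k * binom \<alpha> (of_real (\<tau> * r)) = ?M"
    using assms(3)
    by (simp_all add: binom_def right_diff_distrib mult_single single_uminus) (simp add: field_simps)
  have M: "Poly_Mapping.lookup ?M 0 = of_real \<tau>"
    using \<alpha>(2) by (simp add: lookup_minus lookup_single when_def)
  have half: "\<tau> powr (- 1 / 2) * \<tau> = \<tau> powr (1 / 2)"
    using assms(2) powr_add[of \<tau> "- 1 / 2" 1] by simp
  show "leads 0 (of_real (\<tau> powr (1 / 2))) (vf \<tau> r \<alpha>)"
  proof (rule leadsI[OF _ lb])
    have "vf \<tau> r \<alpha> * ga_frac (binom (- \<alpha>) (inverse (of_real r))) =
        ga_frac ?s * (ga_frac (?k * binom \<alpha> (of_real (\<tau> * r))))"
      unfolding k(1)[symmetric] ga_frac_mult using ne by (simp add: vf_eq scaled_exp_def mult_ac)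
    then show "vf \<tau> r \<alpha> * ga_frac (binom (- \<alpha>) (inverse (of_real r))) = ga_frac (?s * ?M)"
      unfolding k(2) ga_frac_mult .
    show "low 0 (?s * ?M)" "Poly_Mapping.lookup (?s * ?M) 0 = of_real (\<tau> powr (1 / 2))"
      using low_mult[OF ls lowb] low_mult_lookup[OF ls lowb] M
      by (simp_all flip: of_real_mult add: half[simplified])
  qed
qed

lemma lookup_monomial_sym:
  "Poly_Mapping.lookup (monomial_sym R \<kappa>) x = (if x \<in> weyl_orbit R \<kappa> then 1 else 0)"
proof -
  have "Poly_Mapping.lookup (monomial_sym R \<kappa>) x = (\<Sum>y\<in>weyl_orbit R \<kappa>. if y = x then 1 else 0)"
    by (auto simp: monomial_sym_def lookup_sum lookup_single when_def intro!: sum.cong)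
  then show ?thesis by simp
qed

end

context small_macd
begin

lemma weyl_invariant_monomial: "weyl_invariant (monomial_sym R \<kappa>)"
  unfolding weyl_invariant_def
proof (intro ballI allI)
  fix w x assume w: "w \<in> W"
  have "w x \<in> weyl_orbit R \<kappa> \<longleftrightarrow> x \<in> weyl_orbit R \<kappa>"
    using orbit_closed[OF _ w, of x \<kappa>] orbit_closed[OF _ weyl_inv(1)[OF w], of "w x" \<kappa>]
      weyl_inv(2)[OF w, of x] by auto
  then show "Poly_Mapping.lookup (monomial_sym R \<kappa>) (w x) = Poly_Mapping.lookup (monomial_sym R \<kappa>) x"
    by (simp add: lookup_monomial_sym)
qed

lemma keys_monomial: "\<kappa> \<in> P \<Longrightarrow> Poly_Mapping.keys (monomial_sym R \<kappa>) \<subseteq> P"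
  using P_weyl by (auto simp: in_keys_iff lookup_monomial_sym elim!: orbitE split: if_splits)

lemma low_monomial: "\<kappa> \<in> P \<Longrightarrow> dominant \<kappa> \<Longrightarrow> low \<kappa> (monomial_sym R \<kappa>)"
  by (rule lowI) (auto simp: lookup_monomial_sym intro: orbit_below split: if_splits)

text \<open>Over the positive roots the first factor assembles to the power of \<open>q\<close> at
  \<open>rho_t\<close>, the second to a summand of \<open>epsilon_coeff\<close>.\<close>

definition gfac_lead :: "'a \<Rightarrow> real \<Rightarrow> real \<Rightarrow> real" where
  "gfac_lead \<alpha> n m = t \<alpha> powr (n / 2) * (if n = 0 \<and> \<bar>m\<bar> = 1 then t \<alpha> powr (m / 2) else 1)"

lemma leads_gfac:
  assumes p: "(\<nu>, \<eta>) \<in> Pairs" and \<alpha>: "\<alpha> \<in> Rp"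
  defines "n \<equiv> \<nu> \<bullet> st \<alpha>" and "m \<equiv> \<eta> \<bullet> st \<alpha>"
  shows "leads 0 (of_real (gfac_lead \<alpha> n m)) (gfac \<alpha> n m * gfac (- \<alpha>) (- n) (- m))"
proof -
  have \<alpha>R: "\<alpha> \<in> R" using \<alpha> Rp_R by blast
  have t: "t \<alpha> > 0" "t (- \<alpha>) = t \<alpha>" using t_bounds[OF \<alpha>R] t_minus[OF \<alpha>R] by auto
  have q: "qa \<alpha> > 0" "inverse (qa \<alpha>) > 0" using qa[OF \<alpha>R] by auto
  note 1 = leads_vf(1)[OF \<alpha> t(1) zero_less_one] and 2 = leads_vf(1)[OF \<alpha> t(1) q(1)] and 3 = leads_vf(1)[OF \<alpha> t(1) q(2)]
  note 4 = leads_vf(2)[OF \<alpha> t(1) zero_less_one] and 5 = leads_vf(2)[OF \<alpha> t(1) q(1)] and 6 = leads_vf(2)[OF \<alpha> t(1) q(2)]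
  note 12 = leads_mult[OF 1 2] and 45 = leads_mult[OF 4 5] and 16 = leads_mult[OF 1 6] and 43 = leads_mult[OF 4 3]
  have pw: "t \<alpha> powr (1/2) * t \<alpha> powr (1/2) = t \<alpha>" "t \<alpha> powr (-1/2) * t \<alpha> powr (-1/2) = t \<alpha> powr (- 1)"
    "t \<alpha> powr (1/2) * t \<alpha> powr (-1/2) = 1" "t \<alpha> powr (-1/2) * t \<alpha> powr (1/2) = 1"
    using t(1) by (simp_all flip: powr_add)
  \<comment> \<open>For the pairings \<open>(0, 2)\<close> and \<open>(0, -2)\<close> the two
    factors point in opposite directions and their limits multiply to \<open>1\<close>; this is why
    only pairings of absolute value \<open>1\<close> enter \<open>epsilon_coeff\<close>.\<close>
  have A: "leads 0 (of_real (t \<alpha>)) (vf (t \<alpha>) 1 \<alpha> * vf (t \<alpha>) (qa \<alpha>) \<alpha>)"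
    "leads 0 (of_real (t \<alpha> powr (- 1))) (vf (t \<alpha>) 1 (- \<alpha>) * vf (t \<alpha>) (qa \<alpha>) (- \<alpha>))"
    "leads 0 1 (vf (t \<alpha>) 1 \<alpha> * vf (t \<alpha>) (inverse (qa \<alpha>)) (- \<alpha>))"
    "leads 0 1 (vf (t \<alpha>) 1 (- \<alpha>) * vf (t \<alpha>) (inverse (qa \<alpha>)) \<alpha>)"
    using 12 45 16 43 unfolding of_real_mult[symmetric] pw by simp_all
  have "(n, m) \<in> {(0,0),(0,1),(0,-1),(0,2),(0,-2),(1,0),(1,1),(1,2),
    (-1,0),(-1,-1),(-1,-2),(2,2),(-2,-2)}"
    unfolding n_def m_def by (rule Pairs_cases[OF p \<alpha>R])
  then consider "n = 0" "m = 0" | "n = 0" "m = 1" | "n = 0" "m = -1" | "n = 0" "m = 2" | "n = 0" "m = -2"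
    | "n = 1" | "n = -1" | "n = 2" | "n = -2" by auto
  then show ?thesis
  proof cases
    case 1
    then show ?thesis using t leads_1 by (simp add: gfac_def gfac_lead_def)
  next
    case 2
    then show ?thesis using t \<open>leads 0 _ (vf (t \<alpha>) 1 \<alpha>)\<close> by (simp add: gfac_def gfac_lead_def)
  next
    case 3
    then show ?thesis using t \<open>leads 0 _ (vf (t \<alpha>) 1 (- \<alpha>))\<close> by (simp add: gfac_def gfac_lead_def)
  next
    case 4
    then show ?thesis using t A by (simp add: gfac_def gfac_lead_def)
  next
    case 5
    then show ?thesis using t A by (simp add: gfac_def gfac_lead_def)
  next
    case 6
    then show ?thesis using t \<open>leads 0 _ (vf (t \<alpha>) 1 \<alpha>)\<close> by (simp add: gfac_def gfac_lead_def)
  next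
    case 7
    then show ?thesis using t \<open>leads 0 _ (vf (t \<alpha>) 1 (- \<alpha>))\<close> by (simp add: gfac_def gfac_lead_def)
  next
    case 8
    then show ?thesis using t A(1) by (simp add: gfac_def gfac_lead_def)
  next
    case 9
    then show ?thesis using t A(2) by (simp add: gfac_def gfac_lead_def)
  qed
qed

lemma UV_pairs: "UV \<nu> \<eta> = (\<Prod>\<alpha>\<in>Rp. gfac \<alpha> (\<nu> \<bullet> st \<alpha>) (\<eta> \<bullet> st \<alpha>) * gfac (- \<alpha>) (- (\<nu> \<bullet> st \<alpha>)) (- (\<eta> \<bullet> st \<alpha>)))"
proof -
  have R: "R = Rp \<union> uminus ` Rp"
  proof
    show "R \<subseteq> Rp \<union> uminus ` Rp" using Rp_cases by (auto simp: image_iff) (metis minus_minus)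
    show "Rp \<union> uminus ` Rp \<subseteq> R" using Rp_R root_minus by auto
  qed
  have "UV \<nu> \<eta> = (\<Prod>\<alpha>\<in>Rp \<union> uminus ` Rp. gfac \<alpha> (\<nu> \<bullet> st \<alpha>) (\<eta> \<bullet> st \<alpha>))"
    unfolding UV_def by (rule arg_cong[OF R])
  also have "\<dots> = (\<Prod>\<alpha>\<in>Rp. gfac \<alpha> (\<nu> \<bullet> st \<alpha>) (\<eta> \<bullet> st \<alpha>)) * (\<Prod>\<alpha>\<in>uminus ` Rp. gfac \<alpha> (\<nu> \<bullet> st \<alpha>) (\<eta> \<bullet> st \<alpha>))"
    using Rp_not_minus by (intro prod.union_disjoint) auto
  also have "(\<Prod>\<alpha>\<in>uminus ` Rp. gfac \<alpha> (\<nu> \<bullet> st \<alpha>) (\<eta> \<bullet> st \<alpha>)) =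
      (\<Prod>\<alpha>\<in>Rp. gfac (- \<alpha>) (- (\<nu> \<bullet> st \<alpha>)) (- (\<eta> \<bullet> st \<alpha>)))"
    by (subst prod.reindex) (auto simp: inj_on_def)
  finally show ?thesis by (simp add: prod.distrib)
qed

definition orbit_weight :: "'a \<Rightarrow> 'a \<Rightarrow> real" where
  "orbit_weight \<nu> \<eta> = (\<Prod>\<alpha> | \<alpha> \<in> Rp \<and> \<nu> \<bullet> st \<alpha> = 0 \<and> \<bar>\<eta> \<bullet> st \<alpha>\<bar> = 1. t \<alpha> powr ((\<eta> \<bullet> st \<alpha>) / 2))"

abbreviation "rho \<equiv> rho_t R Rp S q t"

lemma inj_st: "inj_on st R"
proof (rule inj_onI)
  fix \<alpha> \<beta> assume ab: "\<alpha> \<in> R" "\<beta> \<in> R" "st \<alpha> = st \<beta>"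
  then have "d \<alpha> = d \<beta>" by (simp add: d_def)
  then show "\<alpha> = \<beta>" using inj_onD[OF inj_d] ab by blast
qed

lemma rho_inner: "q powr (\<nu> \<bullet> rho) = (\<Prod>\<alpha>\<in>Rp. t \<alpha> powr ((\<nu> \<bullet> st \<alpha>) / 2))"
proof -
  have inj: "inj_on st Rp" using inj_st inj_on_subset Rp_R by blast
  have "\<nu> \<bullet> rho = (\<Sum>\<alpha>\<in>Rp. log q (t \<alpha>) * ((\<nu> \<bullet> st \<alpha>) / 2))"
    unfolding rho_t_def positive_star_def sum.reindex[OF inj]
    by (auto simp: inner_sum_right sum_distrib_left t_st[OF Rp_R] intro!: sum.cong)
  also have "q powr \<dots> = (\<Prod>\<alpha>\<in>Rp. q powr (log q (t \<alpha>) * ((\<nu> \<bullet> st \<alpha>) / 2)))"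
    using q by (simp add: powr_sum)
  also have "\<dots> = (\<Prod>\<alpha>\<in>Rp. t \<alpha> powr ((\<nu> \<bullet> st \<alpha>) / 2))"
  proof (intro prod.cong refl)
    fix \<alpha> assume "\<alpha> \<in> Rp"
    then have "q powr log q (t \<alpha>) = t \<alpha>" using q t_bounds(1)[OF Rp_R] by simp
    then show "q powr (log q (t \<alpha>) * (\<nu> \<bullet> st \<alpha> / 2)) = t \<alpha> powr (\<nu> \<bullet> st \<alpha> / 2)"
      by (simp only: powr_powr[symmetric])
  qed
  finally show ?thesis .
qed

lemma prod_gfac_lead: "(\<Prod>\<alpha>\<in>Rp. gfac_lead \<alpha> (\<nu> \<bullet> st \<alpha>) (\<eta> \<bullet> st \<alpha>)) = q powr (\<nu> \<bullet> rho) * orbit_weight \<nu> \<eta>"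
  unfolding gfac_lead_def prod.distrib rho_inner orbit_weight_def prod.inter_filter[OF finite_Rp, symmetric]
  by (auto intro!: arg_cong2[where f = "(*)"] prod.cong)

definition eigen :: "'a \<Rightarrow> complex" where
  "eigen \<kappa> = (\<Sum>(\<nu>, \<eta>)\<in>Pairs. of_real (q powr (\<nu> \<bullet> (\<kappa> + rho)) * orbit_weight \<nu> \<eta>))"

lemma leads_Dop:
  assumes "\<kappa> \<in> P" "dominant \<kappa>"
  shows "leads \<kappa> (eigen \<kappa>) (Dop (monomial_sym R \<kappa>))"
  unfolding Dop_def eigen_def
proof (rule leads_sum[OF finite_Pairs])
  fix p assume "p \<in> Pairs"
  then obtain \<nu> \<eta> where p: "p = (\<nu>, \<eta>)" "(\<nu>, \<eta>) \<in> Pairs" by (cases p) auto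
  have 1: "leads 0 (of_real (q powr (\<nu> \<bullet> rho) * orbit_weight \<nu> \<eta>)) (UV \<nu> \<eta>)"
    unfolding UV_pairs prod_gfac_lead[symmetric] of_real_prod by (rule leads_prod[OF finite_Rp leads_gfac[OF p(2)]])
  have 2: "leads \<kappa> (of_real (q powr (\<nu> \<bullet> \<kappa>))) (ga_frac (translation q \<nu> (monomial_sym R \<kappa>)))"
  proof (rule leads_ga_frac)
    show "low \<kappa> (translation q \<nu> (monomial_sym R \<kappa>))"
      using low_lookup[OF low_monomial[OF assms]] by (intro lowI) (simp add: lookup_translation)
    show "Poly_Mapping.lookup (translation q \<nu> (monomial_sym R \<kappa>)) \<kappa> = of_real (q powr (\<nu> \<bullet> \<kappa>))"
      by (simp add: lookup_translation lookup_monomial_sym orbit_self inner_commute)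
  qed
  have "q powr (\<nu> \<bullet> rho) * orbit_weight \<nu> \<eta> * q powr (\<nu> \<bullet> \<kappa>) = q powr (\<nu> \<bullet> (\<kappa> + rho)) * orbit_weight \<nu> \<eta>"
    by (simp add: inner_add_right powr_add)
  then have eq: "complex_of_real (q powr (\<nu> \<bullet> rho) * orbit_weight \<nu> \<eta>) * of_real (q powr (\<nu> \<bullet> \<kappa>)) =
      of_real (q powr (\<nu> \<bullet> (\<kappa> + rho)) * orbit_weight \<nu> \<eta>)" by (simp flip: of_real_mult)
  show "leads \<kappa> (case p of (\<nu>, \<eta>) \<Rightarrow> of_real (q powr (\<nu> \<bullet> (\<kappa> + rho)) * orbit_weight \<nu> \<eta>))
      (case p of (\<nu>, \<eta>) \<Rightarrow> UV \<nu> \<eta> * ga_frac (translation q \<nu> (monomial_sym R \<kappa>)))"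
    using leads_mult[OF 1 2] unfolding p(1) prod.case eq add_0 .
qed

text \<open>The weight refers to positive roots orthogonal to the midpoint, which an arbitrary
  element carrying \<open>\<mu>\<close> to \<open>\<nu>\<close> need not respect. The element from
  \<open>orbit_positive_transport\<close> matches these roots in both directions.\<close>

lemma orbit_weight_sum_orbit:
  assumes "\<mu> \<in> dominant_Lambda_below R Rp S \<omega>" "\<nu> \<in> weyl_orbit R \<mu>"
  shows "(\<Sum>\<eta> | (\<nu>, \<eta>) \<in> Pairs. orbit_weight \<nu> \<eta>) = epsilon_coeff R Rp S t \<omega> \<mu>"
proof -
  have \<mu>: "dominant \<mu>" "(\<mu>, \<omega>) \<in> Pairs" using assms(1) by (auto simp: dominant_below_iff)
  obtain w where w: "w \<in> W" "w \<mu> = \<nu>" "\<And>\<alpha>. \<alpha> \<in> Rp \<Longrightarrow> \<alpha> \<bullet> \<nu> = 0 \<Longrightarrow> inv w \<alpha> \<in> Rp"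
    using orbit_positive_transport[OF assms(2)] by blast
  have w\<nu>: "inv w \<nu> = \<mu>" using weyl_inv(2)[OF w(1), of \<mu>] w(2) by simp
  have inner: "w x \<bullet> st (w \<alpha>) = x \<bullet> st \<alpha>" for x \<alpha>
    unfolding st_weyl[OF w(1)] weyl_inner[OF w(1)] ..
  have fw: "w \<alpha> \<in> Rp" if \<alpha>: "\<alpha> \<in> Rp" "\<mu> \<bullet> st \<alpha> = 0" for \<alpha>
  proof (rule ccontr)
    assume "w \<alpha> \<notin> Rp"
    then have "- w \<alpha> \<in> Rp" using Rp_cases[OF weyl_root[OF w(1) Rp_R[OF \<alpha>(1)]]] by blast
    moreover have "\<nu> \<bullet> st (w \<alpha>) = 0" using inner[of \<mu> \<alpha>] \<alpha>(2) w(2) by simp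
    then have "- w \<alpha> \<bullet> \<nu> = 0"
      using inner_st_zero_iff[OF weyl_root[OF w(1) Rp_R[OF \<alpha>(1)]], of \<nu>] by (simp add: inner_commute)
    ultimately have "inv w (- w \<alpha>) \<in> Rp" by (rule w(3))
    then have "- \<alpha> \<in> Rp" unfolding weyl_minus[OF weyl_inv(1)[OF w(1)]] weyl_inv(2)[OF w(1)] .
    then show False using \<alpha>(1) Rp_not_minus by blast
  qed
  have bw: "inv w \<alpha> \<in> Rp" if \<alpha>: "\<alpha> \<in> Rp" "\<nu> \<bullet> st \<alpha> = 0" for \<alpha>
    using w(3)[OF \<alpha>(1)] inner_st_zero_iff[OF Rp_R[OF \<alpha>(1)], of \<nu>] \<alpha>(2) by (simp add: inner_commute)
  have inv_inner: "x \<bullet> st (inv w \<alpha>) = w x \<bullet> st \<alpha>" for x \<alpha>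
    using inner[of x "inv w \<alpha>"] weyl_inv(3)[OF w(1)] by simp
  have orbit_weight: "orbit_weight \<nu> (w \<eta>) = orbit_weight \<mu> \<eta>" for \<eta>
    unfolding orbit_weight_def
  proof (rule prod.reindex_bij_witness[of _ w "inv w"])
    fix \<alpha> assume a: "\<alpha> \<in> {\<alpha> \<in> Rp. \<nu> \<bullet> st \<alpha> = 0 \<and> \<bar>w \<eta> \<bullet> st \<alpha>\<bar> = 1}"
    then show "inv w \<alpha> \<in> {\<alpha> \<in> Rp. \<mu> \<bullet> st \<alpha> = 0 \<and> \<bar>\<eta> \<bullet> st \<alpha>\<bar> = 1}"
      using bw by (simp add: inv_inner w(2))
    show "w (inv w \<alpha>) = \<alpha>" by (rule weyl_inv(3)[OF w(1)])
    show "t (inv w \<alpha>) powr (\<eta> \<bullet> st (inv w \<alpha>) / 2) = t \<alpha> powr (w \<eta> \<bullet> st \<alpha> / 2)"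
      using a Rp_R by (simp add: inv_inner t_weyl[OF weyl_inv(1)[OF w(1)]])
  next
    fix \<alpha> assume a: "\<alpha> \<in> {\<alpha> \<in> Rp. \<mu> \<bullet> st \<alpha> = 0 \<and> \<bar>\<eta> \<bullet> st \<alpha>\<bar> = 1}"
    then show "w \<alpha> \<in> {\<alpha> \<in> Rp. \<nu> \<bullet> st \<alpha> = 0 \<and> \<bar>w \<eta> \<bullet> st \<alpha>\<bar> = 1}"
      using fw inner[of \<mu> \<alpha>] by (simp add: inner w(2))
    show "inv w (w \<alpha>) = \<alpha>" by (rule weyl_inv(2)[OF w(1)])
  qed
  have "(\<Sum>\<eta> | (\<nu>, \<eta>) \<in> Pairs. orbit_weight \<nu> \<eta>) = (\<Sum>\<eta> | (\<mu>, \<eta>) \<in> Pairs. orbit_weight \<mu> \<eta>)"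
  proof (rule sum.reindex_bij_witness[of _ w "inv w"])
    fix \<eta> assume "\<eta> \<in> {\<eta>. (\<nu>, \<eta>) \<in> Pairs}"
    then show "inv w \<eta> \<in> {\<eta>. (\<mu>, \<eta>) \<in> Pairs}" using Pairs_weyl[OF _ weyl_inv(1)[OF w(1)], of \<nu> \<eta>] w\<nu> by simp
    show "w (inv w \<eta>) = \<eta>" by (rule weyl_inv(3)[OF w(1)])
    show "orbit_weight \<mu> (inv w \<eta>) = orbit_weight \<nu> \<eta>" using orbit_weight[of "inv w \<eta>"] weyl_inv(3)[OF w(1)] by simp
  next
    fix \<eta> assume "\<eta> \<in> {\<eta>. (\<mu>, \<eta>) \<in> Pairs}"
    then show "w \<eta> \<in> {\<eta>. (\<nu>, \<eta>) \<in> Pairs}" using Pairs_weyl[OF _ w(1), of \<mu> \<eta>] w(2) by simp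
    show "inv w (w \<eta>) = \<eta>" by (rule weyl_inv(2)[OF w(1)])
  qed
  also have "\<dots> = epsilon_coeff R Rp S t \<omega> \<mu>"
    unfolding epsilon_coeff_def stabilizer_orbit_dominant[OF assms(1)]
  proof (intro sum.cong refl)
    fix \<eta>
    have inj: "inj_on st {\<alpha> \<in> Rp. \<mu> \<bullet> st \<alpha> = 0 \<and> \<bar>\<eta> \<bullet> st \<alpha>\<bar> = 1}"
      by (rule inj_on_subset[OF inj_st]) (use Rp_R in auto)
    have "{\<alpha> \<in> positive_star R Rp S. \<alpha> \<bullet> \<mu> = 0 \<and> \<bar>\<alpha> \<bullet> \<eta>\<bar> = 1} =
        st ` {\<alpha> \<in> Rp. \<mu> \<bullet> st \<alpha> = 0 \<and> \<bar>\<eta> \<bullet> st \<alpha>\<bar> = 1}"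
      by (auto simp: positive_star_def inner_commute[of _ \<mu>] inner_commute[of _ \<eta>])
    then have "(\<Prod>\<alpha> | \<alpha> \<in> positive_star R Rp S \<and> \<alpha> \<bullet> \<mu> = 0 \<and> \<bar>\<alpha> \<bullet> \<eta>\<bar> = 1. t \<alpha> powr (\<alpha> \<bullet> \<eta> / 2)) =
        (\<Prod>\<alpha> | \<alpha> \<in> Rp \<and> \<mu> \<bullet> st \<alpha> = 0 \<and> \<bar>\<eta> \<bullet> st \<alpha>\<bar> = 1. t (st \<alpha>) powr (st \<alpha> \<bullet> \<eta> / 2))"
      using prod.reindex[OF inj, of "\<lambda>\<alpha>. t \<alpha> powr (\<alpha> \<bullet> \<eta> / 2)"] by (simp add: o_def)
    also have "\<dots> = orbit_weight \<mu> \<eta>"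
      unfolding orbit_weight_def by (intro prod.cong refl) (simp add: t_st Rp_R inner_commute[of _ \<eta>])
    finally show "orbit_weight \<mu> \<eta> = (\<Prod>\<alpha> | \<alpha> \<in> positive_star R Rp S \<and> \<alpha> \<bullet> \<mu> = 0 \<and> \<bar>\<alpha> \<bullet> \<eta>\<bar> = 1. t \<alpha> powr (\<alpha> \<bullet> \<eta> / 2))"
      by simp
  qed
  finally show ?thesis .
qed

lemma ga_eval_add:
  fixes f g :: "'a \<Rightarrow>\<^sub>0 complex"
  shows "ga_eval q (f + g) x = ga_eval q f x + ga_eval q g x"
proof -
  have ext: "ga_eval q f x = (\<Sum>y\<in>A. Poly_Mapping.lookup f y * of_real (q powr (y \<bullet> x)))"
    if "finite A" "Poly_Mapping.keys f \<subseteq> A" for f :: "'a \<Rightarrow>\<^sub>0 complex" and A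
    unfolding ga_eval_def using that by (intro sum.mono_neutral_left) (auto simp: in_keys_iff)
  let ?A = "Poly_Mapping.keys f \<union> Poly_Mapping.keys g"
  show ?thesis
    using keys_add[of f g] by (simp add: ext[of ?A] lookup_add distrib_right sum.distrib)
qed

lemma ga_eval_sum:
  fixes f :: "'i \<Rightarrow> 'a \<Rightarrow>\<^sub>0 complex"
  shows "ga_eval q (sum f I) x = (\<Sum>i\<in>I. ga_eval q (f i) x)"
  by (induction I rule: infinite_finite_induct) (auto simp: ga_eval_add ga_eval_def[of q 0])

lemma ga_eval_single: "ga_eval q (Poly_Mapping.single y c) x = c * of_real (q powr (y \<bullet> x))"
  by (auto simp: ga_eval_def)

text \<open>The midpoints decompose into disjoint orbits of the dominant weights below
  \<open>\<omega>\<close>, and the total weight over a midpoint is constant on each orbit.\<close>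

lemma eigen_eq: "ga_eval q (E_symmetric R Rp S t \<omega>) (\<kappa> + rho) = eigen \<kappa>"
proof -
  let ?B = "dominant_Lambda_below R Rp S \<omega>"
  define X :: "'a \<Rightarrow> complex" where "X \<nu> = of_real (q powr (\<nu> \<bullet> (\<kappa> + rho)))" for \<nu>
  have disj: "weyl_orbit R \<mu> \<inter> weyl_orbit R \<mu>' = {}" if "\<mu> \<in> ?B" "\<mu>' \<in> ?B" "\<mu> \<noteq> \<mu>'" for \<mu> \<mu>'
  proof (rule ccontr)
    assume "weyl_orbit R \<mu> \<inter> weyl_orbit R \<mu>' \<noteq> {}"
    then have "weyl_orbit R \<mu> = weyl_orbit R \<mu>'" using orbit_eq by blast
    then have "\<mu>' \<in> weyl_orbit R \<mu>" using orbit_self by blast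
    then show False using dominant_unique[of \<mu> \<mu>'] that by (simp add: dominant_below_iff)
  qed
  have "eigen \<kappa> = (\<Sum>\<nu>\<in>Lambda_saturated R Rp S \<omega>. \<Sum>\<eta> | (\<nu>, \<eta>) \<in> Pairs. X \<nu> * of_real (orbit_weight \<nu> \<eta>))"
  proof -
    have "Pairs = Sigma (Lambda_saturated R Rp S \<omega>) (\<lambda>\<nu>. {\<eta>. (\<nu>, \<eta>) \<in> Pairs})"
      by (auto simp: saturated_iff)
    then show ?thesis unfolding eigen_def X_def by (subst sum.Sigma) (auto simp: saturated_iff intro!: sum.cong)
  qed
  also have "\<dots> = (\<Sum>\<mu>\<in>?B. \<Sum>\<nu>\<in>weyl_orbit R \<mu>. \<Sum>\<eta> | (\<nu>, \<eta>) \<in> Pairs. X \<nu> * of_real (orbit_weight \<nu> \<eta>))"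
    unfolding Lambda_saturated_def by (rule sum.UNION_disjoint) (use disj in auto)
  also have "\<dots> = (\<Sum>\<mu>\<in>?B. \<Sum>\<nu>\<in>weyl_orbit R \<mu>. of_real (epsilon_coeff R Rp S t \<omega> \<mu>) * X \<nu>)"
    by (intro sum.cong refl) (simp add: orbit_weight_sum_orbit[symmetric] sum_distrib_left mult.commute)
  also have "\<dots> = ga_eval q (E_symmetric R Rp S t \<omega>) (\<kappa> + rho)"
    unfolding E_symmetric_def monomial_sym_def ga_eval_sum sum_distrib_left X_def
    by (simp add: mult_single ga_eval_single)
  finally show ?thesis ..
qed

theorem Dop_triangular:
  assumes "\<kappa> \<in> P" "dominant \<kappa>"
  shows "\<exists>G. Dop (monomial_sym R \<kappa>) = ga_frac G \<and> weyl_invariant G \<and> low \<kappa> G \<and> Poly_Mapping.lookup G \<kappa> = eigen \<kappa>"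
proof -
  obtain G where G: "Dop (monomial_sym R \<kappa>) = ga_frac G"
    using Dop_pole_free[OF weyl_invariant_monomial keys_monomial[OF assms(1)]] by blast
  have "leads \<kappa> (eigen \<kappa>) (ga_frac G)" using leads_Dop[OF assms] unfolding G .
  then show ?thesis using G Dop_weyl_invariant[OF weyl_invariant_monomial G] leads_pole_free by blast
qed

end

section \<open>Absolutely summable series\<close>

definition asum :: "('i \<Rightarrow> complex) \<Rightarrow> 'i set \<Rightarrow> bool" where
  "asum f A \<longleftrightarrow> (\<lambda>x. norm (f x)) summable_on A"

lemma asum_summable: "asum f A \<Longrightarrow> f summable_on A"
  unfolding asum_def by (rule abs_summable_summable)

lemma asum_subset: "asum f A \<Longrightarrow> B \<subseteq> A \<Longrightarrow> asum f B"
  unfolding asum_def by (rule summable_on_subset_banach)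

lemma asum_cmult: "asum f A \<Longrightarrow> asum (\<lambda>x. c * f x) A"
  unfolding asum_def norm_mult by (rule summable_on_cmult_right)

lemma asum_comparison: "asum f A \<Longrightarrow> (\<And>x. x \<in> A \<Longrightarrow> norm (g x) \<le> norm (f x)) \<Longrightarrow> asum g A"
  unfolding asum_def by (rule summable_on_comparison_test[where f = "\<lambda>x. norm (f x)"]) auto

lemma asum_add: "asum f A \<Longrightarrow> asum g A \<Longrightarrow> asum (\<lambda>x. f x + g x) A"
  unfolding asum_def
  by (rule summable_on_comparison_test[where f = "\<lambda>x. norm (f x) + norm (g x)"])
    (auto intro: norm_triangle_ineq summable_on_add)

lemma asum_reindex: "bij_betw h A B \<Longrightarrow> asum (\<lambda>x. f (h x)) A \<longleftrightarrow> asum f B"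
  unfolding asum_def using summable_on_reindex_bij_betw[of h A B "\<lambda>x. norm (f x)"] by simp

lemma asum_Sigma_iff: "asum f (Sigma A B) \<longleftrightarrow> (\<forall>x\<in>A. asum (\<lambda>y. f (x, y)) (B x)) \<and>
    (\<lambda>x. infsum (\<lambda>y. norm (f (x, y))) (B x)) summable_on A"
proof -
  have *: "norm (infsum (\<lambda>y. norm (f (x, y))) (B x)) = infsum (\<lambda>y. norm (f (x, y))) (B x)" for x
    by (simp add: infsum_nonneg)
  show ?thesis unfolding asum_def Infinite_Sum.abs_summable_on_Sigma_iff
    by (auto simp only: * asum_def)
qed

lemma asum_Sigma_infsum:
  assumes "asum f (Sigma A B)"
  shows "asum (\<lambda>x. infsum (\<lambda>y. f (x, y)) (B x)) A"
  unfolding asum_def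
proof (rule summable_on_comparison_test)
  show "(\<lambda>x. infsum (\<lambda>y. norm (f (x, y))) (B x)) summable_on A"
    using assms unfolding asum_Sigma_iff by blast
  fix x assume "x \<in> A"
  then have "asum (\<lambda>y. f (x, y)) (B x)" using assms unfolding asum_Sigma_iff by blast
  then show "norm (infsum (\<lambda>y. f (x, y)) (B x)) \<le> infsum (\<lambda>y. norm (f (x, y))) (B x)"
    unfolding asum_def by (rule norm_infsum_bound)
qed simp

lemma asum_product:
  assumes "asum f A" "asum g B"
  shows "asum (\<lambda>(x, y). f x * g y) (A \<times> B)"
  unfolding asum_Sigma_iff
proof (intro conjI ballI)
  fix x show "asum (\<lambda>y. case (x, y) of (x, y) \<Rightarrow> f x * g y) B"
    using asum_cmult[OF assms(2)] by simp
next
  have "infsum (\<lambda>y. norm (f x) * norm (g y)) B = norm (f x) * infsum (\<lambda>y. norm (g y)) B" for x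
    using assms(2) unfolding asum_def by (intro infsum_cmult_right)
  then show "(\<lambda>x. infsum (\<lambda>y. norm (case (x, y) of (x, y) \<Rightarrow> f x * g y)) B) summable_on A"
    using assms(1) unfolding asum_def by (simp add: norm_mult summable_on_cmult_left)
qed

lemma asum_bounded:
  assumes "asum f UNIV"
  obtains C where "\<And>x. norm (f x) \<le> C"
proof -
  have "norm (f x) \<le> infsum (\<lambda>x. norm (f x)) UNIV" for x
  proof -
    have "infsum (\<lambda>x. norm (f x)) {x} \<le> infsum (\<lambda>x. norm (f x)) UNIV"
      using assms unfolding asum_def by (intro infsum_mono_neutral) auto
    then show ?thesis by simp
  qed
  then show ?thesis using that by blast
qed

lemma asum_finite: "finite {x \<in> A. f x \<noteq> 0} \<Longrightarrow> asum f A"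
  unfolding asum_def
  by (rule iffD1[OF summable_on_cong_neutral[of A "{x \<in> A. f x \<noteq> 0}"]], auto)

lemma infsum_finite_support:
  "finite B \<Longrightarrow> (\<And>x. x \<notin> B \<Longrightarrow> f x = (0::complex)) \<Longrightarrow> infsum f UNIV = sum f B"
  by (subst infsum_finite[symmetric], simp) (rule infsum_cong_neutral, auto)

section \<open>The convolution algebra of absolutely summable families on E\<close>

typedef (overloaded) 'a l1 = "{f :: 'a::euclidean_space \<Rightarrow> complex. asum f UNIV}"
  morphisms coef Abs_l1
  by (rule exI[of _ "\<lambda>_. 0"]) (simp add: asum_def)

lemma asum_coef [simp]: "asum (coef F) UNIV"
  using coef[of F] by simp

lemma l1_eqI: "(\<And>x. coef F x = coef G x) \<Longrightarrow> F = G"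
  by (metis coef_inject ext)

definition conv :: "('a::euclidean_space \<Rightarrow> complex) \<Rightarrow> ('a \<Rightarrow> complex) \<Rightarrow> 'a \<Rightarrow> complex" where
  "conv f g x = infsum (\<lambda>y. f y * g (x - y)) UNIV"

lemma asum_conv_pairs:
  fixes f g :: "'a::euclidean_space \<Rightarrow> complex"
  assumes "asum f UNIV" "asum g UNIV"
  shows "asum (\<lambda>(x, y). f y * g (x - y)) (UNIV \<times> UNIV)"
proof -
  have bij: "bij_betw (\<lambda>(x, y). (y, x - y)) (UNIV \<times> UNIV) (UNIV \<times> (UNIV :: 'a set))"
    by (rule bij_betwI[of _ _ _ "\<lambda>(y, z). (y + z, y)"]) auto
  show ?thesis
    using asum_reindex[OF bij, of "\<lambda>(y, z). f y * g z"] asum_product[OF assms] by (simp add: case_prod_unfold)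
qed

lemma asum_conv:
  fixes f g :: "'a::euclidean_space \<Rightarrow> complex"
  shows "asum f UNIV \<Longrightarrow> asum g UNIV \<Longrightarrow> asum (conv f g) UNIV"
  using asum_Sigma_infsum[OF asum_conv_pairs, of f g] unfolding conv_def by simp

lemma asum_conv_fibre:
  fixes f g :: "'a::euclidean_space \<Rightarrow> complex"
  shows "asum f UNIV \<Longrightarrow> asum g UNIV \<Longrightarrow> asum (\<lambda>y. f y * g (x - y)) UNIV"
  using asum_conv_pairs[of f g] unfolding asum_Sigma_iff by simp

lemma conv_commute:
  fixes f g :: "'a::euclidean_space \<Rightarrow> complex"
  shows "conv f g x = conv g f x"
proof -
  have bij: "bij_betw (\<lambda>y. x - y) UNIV (UNIV :: 'a set)"
    by (rule bij_betwI[of _ _ _ "\<lambda>y. x - y"]) auto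
  show ?thesis
    unfolding conv_def using infsum_reindex_bij_betw[OF bij, of "\<lambda>y. f y * g (x - y)"]
    by (simp add: mult.commute)
qed

text \<open>Associativity is an exchange of two infinite sums. It is justified because
  \<open>h\<close> is bounded, so the double family is dominated by a multiple of the summable one
  that belongs to \<open>conv f g\<close>.\<close>

lemma conv_assoc:
  fixes f g h :: "'a::euclidean_space \<Rightarrow> complex"
  assumes "asum f UNIV" "asum g UNIV" "asum h UNIV"
  shows "conv (conv f g) h x = conv f (conv g h) x"
proof -
  obtain C where C: "\<And>x. norm (h x) \<le> C" using asum_bounded[OF assms(3)] by blast
  have "asum (\<lambda>(y, z). f z * g (y - z) * h (x - y)) (UNIV \<times> UNIV)"
  proof (rule asum_comparison[OF asum_cmult[OF asum_conv_pairs[OF assms(1,2)], of "of_real C"]])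
    have "C \<ge> 0" using C[of 0] norm_ge_zero order_trans by blast
    then show "norm (case p of (y, z) \<Rightarrow> f z * g (y - z) * h (x - y)) \<le>
        norm (of_real C * (case p of (x, y) \<Rightarrow> f y * g (x - y)))" for p
      using mult_left_mono[OF C, of "norm (f (snd p) * g (fst p - snd p))" "x - fst p"]
      by (simp add: case_prod_unfold norm_mult mult_ac)
  qed
  then have summ: "(\<lambda>(y, z). f z * g (y - z) * h (x - y)) summable_on (UNIV \<times> UNIV)"
    by (rule asum_summable)
  have "conv (conv f g) h x = (\<Sum>\<^sub>\<infinity>y. \<Sum>\<^sub>\<infinity>z. f z * g (y - z) * h (x - y))"
    unfolding conv_def
    using asum_summable[OF asum_conv_fibre[OF assms(1,2)]] by (intro infsum_cong infsum_cmult_left[symmetric])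
  also have "\<dots> = (\<Sum>\<^sub>\<infinity>z. \<Sum>\<^sub>\<infinity>y. f z * g (y - z) * h (x - y))"
    by (rule infsum_swap_banach[OF summ])
  also have "\<dots> = (\<Sum>\<^sub>\<infinity>z. f z * (\<Sum>\<^sub>\<infinity>y. g y * h (x - z - y)))"
  proof (rule infsum_cong)
    fix z :: 'a
    have bij: "bij_betw (\<lambda>y. y - z) UNIV (UNIV :: 'a set)"
      by (rule bij_betwI[of _ _ _ "\<lambda>y. y + z"]) auto
    have "(\<Sum>\<^sub>\<infinity>y. f z * g (y - z) * h (x - y)) = (\<Sum>\<^sub>\<infinity>y. f z * (g y * h (x - z - y)))"
      using infsum_reindex_bij_betw[OF bij, of "\<lambda>y. f z * (g y * h (x - z - y))"]
      by (simp add: algebra_simps)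
    also have "\<dots> = f z * (\<Sum>\<^sub>\<infinity>y. g y * h (x - z - y))"
      using asum_summable[OF asum_conv_fibre[OF assms(2,3)]] by (intro infsum_cmult_right)
    finally show "(\<Sum>\<^sub>\<infinity>y. f z * g (y - z) * h (x - y)) = f z * (\<Sum>\<^sub>\<infinity>y. g y * h (x - z - y))" .
  qed
  finally show ?thesis unfolding conv_def .
qed

instantiation l1 :: (euclidean_space) comm_ring_1
begin

definition "0 = Abs_l1 (\<lambda>_. 0)"
definition "1 = Abs_l1 (\<lambda>x. if x = 0 then 1 else 0)"
definition "F + G = Abs_l1 (\<lambda>x. coef F x + coef G x)"
definition "F - G = Abs_l1 (\<lambda>x. coef F x - coef G x)"
definition "- F = Abs_l1 (\<lambda>x. - coef F x)"
definition "F * G = Abs_l1 (conv (coef F) (coef G))"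

lemma coef_0 [simp]: "coef 0 x = 0"
  unfolding zero_l1_def by (subst Abs_l1_inverse) (auto simp: asum_def)

lemma coef_1: "coef 1 x = (if x = 0 then 1 else 0)"
  unfolding one_l1_def by (subst Abs_l1_inverse) (auto intro: asum_finite)

lemma coef_add [simp]: "coef (F + G) x = coef F x + coef G x"
  unfolding plus_l1_def by (subst Abs_l1_inverse) (auto intro: asum_add)

lemma coef_minus [simp]: "coef (- F) x = - coef F x"
  unfolding uminus_l1_def using asum_coef[of F] by (subst Abs_l1_inverse) (auto simp: asum_def)

lemma coef_diff [simp]: "coef (F - G) x = coef F x - coef G x"
  unfolding minus_l1_def using asum_add[OF asum_coef[of F] asum_coef[of "- G"]]
  by (subst Abs_l1_inverse) auto

lemma coef_mult: "coef (F * G) x = (\<Sum>\<^sub>\<infinity>y. coef F y * coef G (x - y))"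
  unfolding times_l1_def by (subst Abs_l1_inverse) (auto intro: asum_conv simp: conv_def)

lemma coef_mult_conv: "coef (F * G) = conv (coef F) (coef G)"
  by (rule ext) (simp add: coef_mult conv_def)

instance
proof
  fix a b c :: "'a l1"
  show "a * b * c = a * (b * c)"
    by (rule l1_eqI) (simp add: coef_mult_conv conv_assoc)
  show "a * b = b * a"
    by (rule l1_eqI) (simp add: coef_mult_conv conv_commute)
  show "1 * a = a"
  proof (rule l1_eqI)
    fix x
    have "(\<Sum>\<^sub>\<infinity>y. coef 1 y * coef a (x - y)) = sum (\<lambda>y. coef 1 y * coef a (x - y)) {0}"
      by (rule infsum_finite_support) (auto simp: coef_1)
    then show "coef (1 * a) x = coef a x" by (simp add: coef_mult coef_1)
  qed
  show "(a + b) * c = a * c + b * c"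
  proof (rule l1_eqI)
    fix x
    show "coef ((a + b) * c) x = coef (a * c + b * c) x"
      unfolding coef_add coef_mult distrib_right
      by (rule infsum_add) (auto intro!: asum_summable asum_conv_fibre)
  qed
  show "(0::'a l1) \<noteq> 1" by (metis coef_0 coef_1 zero_neq_one)
qed (rule l1_eqI; simp)+

end

lemma coef_sum: "coef (sum F I) x = (\<Sum>i\<in>I. coef (F i) x)"
  by (induction I rule: infinite_finite_induct) auto

definition emb :: "('a::euclidean_space \<Rightarrow>\<^sub>0 complex) \<Rightarrow> 'a l1" where
  "emb f = Abs_l1 (Poly_Mapping.lookup f)"

lemma coef_emb [simp]: "coef (emb f) = Poly_Mapping.lookup f"
  unfolding emb_def by (rule Abs_l1_inverse) (auto intro: asum_finite)

lemma emb_add: "emb (f + g) = emb f + emb g"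
  by (rule l1_eqI) (simp add: lookup_add)

lemma emb_diff: "emb (f - g) = emb f - emb g"
  by (rule l1_eqI) (simp add: lookup_minus)

lemma emb_0 [simp]: "emb 0 = 0"
  by (rule l1_eqI) simp

lemma emb_1 [simp]: "emb 1 = 1"
  by (rule l1_eqI) (simp add: lookup_one coef_1 when_def)

lemma coef_emb_mult:
  "coef (emb f * F) x = (\<Sum>y\<in>Poly_Mapping.keys f. Poly_Mapping.lookup f y * coef F (x - y))"
  unfolding coef_mult by (subst infsum_finite_support[of "Poly_Mapping.keys f"]) (auto simp: in_keys_iff)

lemma coef_emb_single_mult: "coef (emb (Poly_Mapping.single a c) * F) x = c * coef F (x - a)"
  by (cases "c = 0") (simp_all add: coef_emb_mult)

lemma emb_mult: "emb (f * g) = emb f * emb g"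
proof (rule l1_eqI)
  fix x
  have "Poly_Mapping.lookup (f * g) x = (\<Sum>y\<in>Poly_Mapping.keys f. Poly_Mapping.lookup f y * Poly_Mapping.lookup g (x - y))"
    by (subst (1) ga_expand[of f]) (simp add: sum_distrib_right lookup_sum lookup_single_mult)
  then show "coef (emb (f * g)) x = coef (emb f * emb g) x" by (simp add: coef_emb_mult)
qed

lemma emb_sum: "emb (sum f I) = (\<Sum>i\<in>I. emb (f i))"
  by (induction I rule: infinite_finite_induct) (auto simp: emb_add)

lemma emb_prod: "emb (prod f I) = (\<Prod>i\<in>I. emb (f i))"
  by (induction I rule: infinite_finite_induct) (auto simp: emb_mult)

definition l1_bar :: "'a::euclidean_space l1 \<Rightarrow> 'a l1" where
  "l1_bar F = Abs_l1 (\<lambda>x. cnj (coef F (- x)))"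

lemma coef_l1_bar [simp]: "coef (l1_bar F) x = cnj (coef F (- x))"
proof -
  have bij: "bij_betw uminus UNIV (UNIV :: 'a set)" by (rule bij_betwI[of _ _ _ uminus]) auto
  have "asum (\<lambda>x. coef F (- x)) UNIV" using asum_reindex[OF bij, of "coef F"] by simp
  then have "asum (\<lambda>x. cnj (coef F (- x))) UNIV" by (simp add: asum_def)
  then show ?thesis unfolding l1_bar_def by (subst Abs_l1_inverse) auto
qed

lemma l1_bar_l1_bar [simp]: "l1_bar (l1_bar F) = F"
  by (rule l1_eqI) simp

lemma l1_bar_add: "l1_bar (F + G) = l1_bar F + l1_bar G"
  by (rule l1_eqI) simp

lemma l1_bar_0 [simp]: "l1_bar 0 = 0"
  by (rule l1_eqI) simp

lemma l1_bar_1 [simp]: "l1_bar 1 = 1"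
  by (rule l1_eqI) (simp add: coef_1)

lemma l1_bar_mult: "l1_bar (F * G) = l1_bar F * l1_bar G"
proof (rule l1_eqI)
  fix x
  have bij: "bij_betw uminus UNIV (UNIV :: 'a set)" by (rule bij_betwI[of _ _ _ uminus]) auto
  have "- (x + y) = - x - y" for y :: 'a by simp
  then have *: "coef (l1_bar F) (- y) * coef (l1_bar G) (x - (- y)) = cnj (coef F y * coef G (- x - y))" for y by simp
  have "(\<Sum>\<^sub>\<infinity>y. coef (l1_bar F) y * coef (l1_bar G) (x - y)) = (\<Sum>\<^sub>\<infinity>y. cnj (coef F y * coef G (- x - y)))"
    using infsum_reindex_bij_betw[OF bij, of "\<lambda>y. coef (l1_bar F) y * coef (l1_bar G) (x - y)"] unfolding * by (rule sym)
  then show "coef (l1_bar (F * G)) x = coef (l1_bar F * l1_bar G) x"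
    by (simp add: coef_mult infsum_cnj flip: complex_cnj_mult)
qed

lemma l1_bar_sum: "l1_bar (sum F I) = (\<Sum>i\<in>I. l1_bar (F i))"
  by (induction I rule: infinite_finite_induct) (auto simp: l1_bar_add)

lemma l1_bar_prod: "l1_bar (prod F I) = (\<Prod>i\<in>I. l1_bar (F i))"
  by (induction I rule: infinite_finite_induct) (auto simp: l1_bar_mult)

lemma lookup_ga_bar: "Poly_Mapping.lookup (ga_bar f) x = cnj (Poly_Mapping.lookup f (- x))"
proof -
  have "Poly_Mapping.lookup (ga_bar f) x =
    (\<Sum>y\<in>Poly_Mapping.keys f. if y = - x then cnj (Poly_Mapping.lookup f (- x)) else 0)"
    unfolding ga_bar_def lookup_sum
    by (intro sum.cong refl) (auto simp: lookup_single when_def)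
  then show ?thesis by (simp add: in_keys_iff)
qed

lemma emb_ga_bar: "emb (ga_bar f) = l1_bar (emb f)"
  by (rule l1_eqI) (simp add: lookup_ga_bar)

lemma coef_mult_l1_bar: "coef (F * l1_bar G) 0 = (\<Sum>\<^sub>\<infinity>y. coef F y * cnj (coef G y))"
  by (simp add: coef_mult)

text \<open>The translation by \<open>\<nu>\<close> is only partially defined, hence a relation.\<close>

definition translates :: "real \<Rightarrow> 'a::euclidean_space \<Rightarrow> 'a l1 \<Rightarrow> 'a l1 \<Rightarrow> bool" where
  "translates q \<nu> F G \<longleftrightarrow> (\<forall>x. coef G x = of_real (q powr (x \<bullet> \<nu>)) * coef F x)"

lemma translates_mult:
  assumes "translates q \<nu> F G" "translates q \<nu> F' G'" "q > 0"
  shows "translates q \<nu> (F * F') (G * G')"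
  unfolding translates_def
proof
  fix x
  have "(\<Sum>\<^sub>\<infinity>y. coef G y * coef G' (x - y)) = (\<Sum>\<^sub>\<infinity>y. of_real (q powr (x \<bullet> \<nu>)) * (coef F y * coef F' (x - y)))"
  proof (rule infsum_cong)
    fix y
    have "q powr (y \<bullet> \<nu>) * q powr ((x - y) \<bullet> \<nu>) = q powr (x \<bullet> \<nu>)"
      by (simp add: inner_diff_left flip: powr_add)
    then have eq: "complex_of_real (q powr (y \<bullet> \<nu>)) * of_real (q powr ((x - y) \<bullet> \<nu>)) = of_real (q powr (x \<bullet> \<nu>))"
      by (simp flip: of_real_mult)
    have G: "coef G y = of_real (q powr (y \<bullet> \<nu>)) * coef F y"
      "coef G' (x - y) = of_real (q powr ((x - y) \<bullet> \<nu>)) * coef F' (x - y)"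
      using assms(1,2) unfolding translates_def by blast+
    show "coef G y * coef G' (x - y) = of_real (q powr (x \<bullet> \<nu>)) * (coef F y * coef F' (x - y))"
      unfolding G eq[symmetric] by (simp only: mult_ac)
  qed
  then show "coef (G * G') x = of_real (q powr (x \<bullet> \<nu>)) * coef (F * F') x"
    unfolding coef_mult by (simp add: infsum_cmult_right asum_summable asum_conv_fibre)
qed

lemma translates_1: "q > 0 \<Longrightarrow> translates q \<nu> 1 1"
  by (simp add: translates_def coef_1)

lemma translates_prod:
  "q > 0 \<Longrightarrow> (\<And>i. i \<in> I \<Longrightarrow> translates q \<nu> (F i) (G i)) \<Longrightarrow> translates q \<nu> (prod F I) (prod G I)"
  by (induction I rule: infinite_finite_induct) (auto intro: translates_mult translates_1)

lemma translates_emb: "translates q \<nu> (emb f) (emb (translation q \<nu> f))"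
  by (simp add: translates_def lookup_translation)

text \<open>The multiplier \<open>q powr (y \<bullet> \<nu>)\<close> is real and acts
  coefficientwise, so it may be attached to either argument of the constant-term pairing.\<close>

lemma translates_adjoint:
  assumes "translates q \<nu> F F'" "translates q \<nu> G G'"
  shows "coef (F' * l1_bar G) 0 = coef (F * l1_bar G') 0"
  unfolding coef_mult_l1_bar
proof (rule infsum_cong)
  fix y
  have *: "coef F' y = of_real (q powr (y \<bullet> \<nu>)) * coef F y" "coef G' y = of_real (q powr (y \<bullet> \<nu>)) * coef G y"
    using assms unfolding translates_def by blast+
  show "coef F' y * cnj (coef G y) = coef F y * cnj (coef G' y)" unfolding * by simp
qed

text \<open>The series with terms \<open>c i e^(g i)\<close>, collected by exponent. Keeping the
  index set apart from the exponents lets products be formed over multi-indices, as in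
  \<open>Delta_coeff\<close>, before equal exponents are merged.\<close>

definition push :: "'i set \<Rightarrow> ('i \<Rightarrow> 'a::euclidean_space) \<Rightarrow> ('i \<Rightarrow> complex) \<Rightarrow> 'a l1" where
  "push A g c = Abs_l1 (\<lambda>x. infsum c {i \<in> A. g i = x})"

lemma coef_push:
  assumes "asum c A"
  shows "coef (push A g c) x = infsum c {i \<in> A. g i = x}"
proof -
  have bij: "bij_betw snd (Sigma UNIV (\<lambda>x. {i \<in> A. g i = x})) A"
    by (rule bij_betwI[of _ _ _ "\<lambda>i. (g i, i)"]) auto
  have "asum (\<lambda>p. c (snd p)) (Sigma UNIV (\<lambda>x. {i \<in> A. g i = x}))"
    using asum_reindex[OF bij, of c] assms by simp
  from asum_Sigma_infsum[OF this] show ?thesis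
    unfolding push_def by (subst Abs_l1_inverse) auto
qed

lemma push_mult:
  assumes "asum c A" "asum c' B"
  shows "push A g c * push B g' c' = push (A \<times> B) (\<lambda>(i, j). g i + g' j) (\<lambda>(i, j). c i * c' j)"
proof (rule l1_eqI)
  fix x
  define D where "D y = {i \<in> A. g i = y} \<times> {j \<in> B. g' j = x - y}" for y
  let ?E = "{p \<in> A \<times> B. (case p of (i, j) \<Rightarrow> g i + g' j) = x}"
  have as: "asum (\<lambda>(i, j). c i * c' j) (A \<times> B)" by (rule asum_product[OF assms])
  have bij: "bij_betw snd (Sigma UNIV D) ?E"
    by (rule bij_betwI[of _ _ _ "\<lambda>(i, j). (g i, (i, j))"]) (auto simp: D_def)
  have "asum (\<lambda>(i, j). c i * c' j) ?E" by (rule asum_subset[OF as]) auto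
  then have as': "asum (\<lambda>p. (case snd p of (i, j) \<Rightarrow> c i * c' j)) (Sigma UNIV D)"
    using asum_reindex[OF bij, of "\<lambda>(i, j). c i * c' j"] by simp
  have "coef (push A g c * push B g' c') x = (\<Sum>\<^sub>\<infinity>y. infsum c {i \<in> A. g i = y} * infsum c' {j \<in> B. g' j = x - y})"
    by (simp add: coef_mult coef_push assms)
  also have "\<dots> = (\<Sum>\<^sub>\<infinity>y. infsum (\<lambda>(i, j). c i * c' j) (D y))"
  proof (rule infsum_cong)
    fix y
    have 1: "asum c {i \<in> A. g i = y}" "asum c' {j \<in> B. g' j = x - y}"
      using assms by (auto intro: asum_subset)
    have "infsum (\<lambda>(i, j). c i * c' j) (D y) =
        (\<Sum>\<^sub>\<infinity>i\<in>{i \<in> A. g i = y}. \<Sum>\<^sub>\<infinity>j\<in>{j \<in> B. g' j = x - y}. c i * c' j)"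
      unfolding D_def using asum_summable[OF asum_product[OF 1]] by (simp add: infsum_Sigma'_banach)
    also have "\<dots> = (\<Sum>\<^sub>\<infinity>i\<in>{i \<in> A. g i = y}. c i * infsum c' {j \<in> B. g' j = x - y})"
      using asum_summable[OF 1(2)] by (intro infsum_cong infsum_cmult_right)
    also have "\<dots> = infsum c {i \<in> A. g i = y} * infsum c' {j \<in> B. g' j = x - y}"
      using asum_summable[OF 1(1)] by (intro infsum_cmult_left)
    finally show "infsum c {i \<in> A. g i = y} * infsum c' {j \<in> B. g' j = x - y} = infsum (\<lambda>(i, j). c i * c' j) (D y)" ..
  qed
  also have "\<dots> = infsum (\<lambda>p. case snd p of (i, j) \<Rightarrow> c i * c' j) (Sigma UNIV D)"
    using infsum_Sigma_banach[OF asum_summable[OF as']] by simp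
  also have "\<dots> = infsum (\<lambda>(i, j). c i * c' j) ?E"
    by (rule infsum_reindex_bij_betw[OF bij])
  also have "\<dots> = coef (push (A \<times> B) (\<lambda>(i, j). g i + g' j) (\<lambda>(i, j). c i * c' j)) x"
    by (simp add: coef_push as)
  finally show "coef (push A g c * push B g' c') x = coef (push (A \<times> B) (\<lambda>(i, j). g i + g' j) (\<lambda>(i, j). c i * c' j)) x" .
qed

lemma push_reindex:
  assumes "bij_betw h A B" "asum c B"
  shows "push B g c = push A (\<lambda>i. g (h i)) (\<lambda>i. c (h i))"
proof (rule l1_eqI)
  fix x
  have as: "asum (\<lambda>i. c (h i)) A" using asum_reindex[OF assms(1)] assms(2) by blast
  have "bij_betw h {i \<in> A. g (h i) = x} {j \<in> B. g j = x}"
    using assms(1) by (auto simp: bij_betw_def inj_on_def)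
  from infsum_reindex_bij_betw[OF this, of c]
  show "coef (push B g c) x = coef (push A (\<lambda>i. g (h i)) (\<lambda>i. c (h i))) x"
    by (simp add: coef_push assms(2) as)
qed

text \<open>Multiplying out the series of the single roots gives a sum over multi-indices, in
  exactly the form of the infinite sum that defines \<open>Delta_coeff\<close>.\<close>

lemma push_prod:
  fixes c :: "'a::euclidean_space \<Rightarrow> nat \<Rightarrow> complex"
  assumes "finite I" "\<And>\<alpha>. \<alpha> \<in> I \<Longrightarrow> asum (c \<alpha>) UNIV"
  shows "asum (\<lambda>n. \<Prod>\<alpha>\<in>I. c \<alpha> (n \<alpha>)) (I \<rightarrow>\<^sub>E UNIV) \<and>
    (\<Prod>\<alpha>\<in>I. push UNIV (\<lambda>n. real n *\<^sub>R \<alpha>) (c \<alpha>)) =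
    push (I \<rightarrow>\<^sub>E UNIV) (\<lambda>n. \<Sum>\<alpha>\<in>I. real (n \<alpha>) *\<^sub>R \<alpha>) (\<lambda>n. \<Prod>\<alpha>\<in>I. c \<alpha> (n \<alpha>))"
  using assms
proof (induction I rule: finite_induct)
  case empty
  have as: "asum (\<lambda>n. 1) {\<lambda>x::'a. undefined :: nat}" by (rule asum_finite) auto
  have "push {\<lambda>x::'a. undefined :: nat} (\<lambda>n. 0 :: 'a) (\<lambda>n. 1) = 1"
    by (rule l1_eqI) (auto simp: coef_push[OF as] coef_1)
  then show ?case using as by simp
next
  case (insert a I)
  \<comment> \<open>A multi-index on \<open>insert a I\<close> is its value at \<open>a\<close>
    together with a multi-index on \<open>I\<close>, which has the default value
    \<open>undefined\<close> at \<open>a\<close>.\<close>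
  define h where "h = (\<lambda>(k :: nat, n). (n(a := k)) :: 'a \<Rightarrow> nat)"
  let ?E = "I \<rightarrow>\<^sub>E (UNIV :: nat set)"
  have bij: "bij_betw h (UNIV \<times> ?E) (insert a I \<rightarrow>\<^sub>E UNIV)"
    unfolding h_def using insert.hyps
    by (intro bij_betwI[of _ _ _ "\<lambda>n. (n a, n(a := undefined))"])
      (auto simp: PiE_def extensional_def fun_eq_iff)
  have IH: "asum (\<lambda>n. \<Prod>\<alpha>\<in>I. c \<alpha> (n \<alpha>)) ?E"
    "(\<Prod>\<alpha>\<in>I. push UNIV (\<lambda>n. real n *\<^sub>R \<alpha>) (c \<alpha>)) =
      push ?E (\<lambda>n. \<Sum>\<alpha>\<in>I. real (n \<alpha>) *\<^sub>R \<alpha>) (\<lambda>n. \<Prod>\<alpha>\<in>I. c \<alpha> (n \<alpha>))"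
    using insert by auto
  have prod: "(\<Prod>\<alpha>\<in>insert a I. c \<alpha> (h p \<alpha>)) = (case p of (k, n) \<Rightarrow> c a k * (\<Prod>\<alpha>\<in>I. c \<alpha> (n \<alpha>)))" for p
  proof -
    have "(\<Prod>\<alpha>\<in>I. c \<alpha> (h p \<alpha>)) = (\<Prod>\<alpha>\<in>I. c \<alpha> (snd p \<alpha>))"
      using insert.hyps by (intro prod.cong) (auto simp: h_def case_prod_unfold)
    then show ?thesis using insert.hyps by (simp add: h_def case_prod_unfold)
  qed
  have sum: "(\<Sum>\<alpha>\<in>insert a I. real (h p \<alpha>) *\<^sub>R \<alpha>) = (case p of (k, n) \<Rightarrow> real k *\<^sub>R a + (\<Sum>\<alpha>\<in>I. real (n \<alpha>) *\<^sub>R \<alpha>))" for p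
  proof -
    have "(\<Sum>\<alpha>\<in>I. real (h p \<alpha>) *\<^sub>R \<alpha>) = (\<Sum>\<alpha>\<in>I. real (snd p \<alpha>) *\<^sub>R \<alpha>)"
      using insert.hyps by (intro sum.cong) (auto simp: h_def case_prod_unfold)
    then show ?thesis using insert.hyps by (simp add: h_def case_prod_unfold)
  qed
  have ca: "asum (c a) UNIV" using insert.prems by simp
  have as: "asum (\<lambda>n. \<Prod>\<alpha>\<in>insert a I. c \<alpha> (n \<alpha>)) (insert a I \<rightarrow>\<^sub>E UNIV)"
    unfolding asum_reindex[OF bij, symmetric] prod by (rule asum_product[OF ca IH(1)])
  have "(\<Prod>\<alpha>\<in>insert a I. push UNIV (\<lambda>n. real n *\<^sub>R \<alpha>) (c \<alpha>)) =
      push (UNIV \<times> ?E) (\<lambda>(k, n). real k *\<^sub>R a + (\<Sum>\<alpha>\<in>I. real (n \<alpha>) *\<^sub>R \<alpha>))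
        (\<lambda>(k, n). c a k * (\<Prod>\<alpha>\<in>I. c \<alpha> (n \<alpha>)))"
    using insert.hyps IH(2) by (simp add: push_mult[OF ca IH(1)])
  also have "\<dots> = push (insert a I \<rightarrow>\<^sub>E UNIV) (\<lambda>n. \<Sum>\<alpha>\<in>insert a I. real (n \<alpha>) *\<^sub>R \<alpha>)
      (\<lambda>n. \<Prod>\<alpha>\<in>insert a I. c \<alpha> (n \<alpha>))"
    unfolding push_reindex[OF bij as] prod sum by (simp add: case_prod_unfold)
  finally show ?case using as by blast
qed

section \<open>The weight function\<close>

text \<open>The coefficients of the q-binomial theorem: comparing coefficients in
  \<open>(1 - \<tau> z) F(z) = (1 - z) F(q z)\<close> with \<open>F(0) = 1\<close> gives this
  recursion.\<close>

fun qcoef :: "real \<Rightarrow> real \<Rightarrow> nat \<Rightarrow> real" where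
  "qcoef q \<tau> 0 = 1"
| "qcoef q \<tau> (Suc n) = qcoef q \<tau> n * (\<tau> - q ^ n) / (1 - q ^ Suc n)"

lemma qcoef_rec:
  assumes "0 < q" "q < 1"
  shows "qcoef q \<tau> (Suc n) * (1 - q ^ Suc n) = qcoef q \<tau> n * (\<tau> - q ^ n)"
proof -
  have "q ^ Suc n < 1" using assms by (intro power_Suc_less_one) auto
  then show ?thesis by simp
qed

text \<open>Successive quotients tend to \<open>\<tau> < 1\<close> in absolute value, so the series
  still converges absolutely on the unit circle; this makes the factors of the weight elements of
  the convolution algebra.\<close>

lemma qcoef_summable:
  assumes "0 < q" "q < 1" "0 < \<tau>" "\<tau> < 1"
  shows "summable (\<lambda>n. norm (qcoef q \<tau> n))"
proof -
  have "(\<lambda>n. \<bar>\<tau> - q ^ n\<bar> / (1 - q * q ^ n)) \<longlonglongrightarrow> \<bar>\<tau> - 0\<bar> / (1 - q * 0)"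
    using assms by (intro tendsto_intros LIMSEQ_power_zero) auto
  then have "(\<lambda>n. \<bar>\<tau> - q ^ n\<bar> / (1 - q ^ Suc n)) \<longlonglongrightarrow> \<tau>" using assms by simp
  then have "\<forall>\<^sub>F n in sequentially. \<bar>\<tau> - q ^ n\<bar> / (1 - q ^ Suc n) < (1 + \<tau>) / 2"
    using assms by (intro order_tendstoD(2)) auto
  then obtain N where N: "\<And>n. n \<ge> N \<Longrightarrow> \<bar>\<tau> - q ^ n\<bar> / (1 - q ^ Suc n) < (1 + \<tau>) / 2"
    by (auto simp: eventually_sequentially)
  show ?thesis
  proof (rule summable_ratio_test[where c = "(1 + \<tau>) / 2" and N = N])
    show "(1 + \<tau>) / 2 < 1" using assms by simp
    fix n assume n: "n \<ge> N"
    have "q ^ Suc n < 1" using assms by (intro power_Suc_less_one) auto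
    then have "norm (norm (qcoef q \<tau> (Suc n))) = norm (qcoef q \<tau> n) * (\<bar>\<tau> - q ^ n\<bar> / (1 - q ^ Suc n))"
      by (simp add: abs_mult)
    also have "\<dots> \<le> norm (qcoef q \<tau> n) * ((1 + \<tau>) / 2)"
      using N[OF n] by (intro mult_left_mono) auto
    finally show "norm (norm (qcoef q \<tau> (Suc n))) \<le> (1 + \<tau>) / 2 * norm (norm (qcoef q \<tau> n))"
      by (simp add: mult.commute)
  qed
qed

definition qser :: "real \<Rightarrow> real \<Rightarrow> complex \<Rightarrow> complex" where
  "qser q \<tau> z = suminf (\<lambda>n. of_real (qcoef q \<tau> n) * z ^ n)"

lemma qser_summable:
  fixes z :: complex
  assumes "0 < q" "q < 1" "0 < \<tau>" "\<tau> < 1" "norm z \<le> 1"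
  shows "summable (\<lambda>n. of_real (qcoef q \<tau> n) * z ^ n)"
proof (rule summable_comparison_test'[OF qcoef_summable[OF assms(1-4)], of 0])
  fix n
  have "norm (z ^ n) \<le> 1" using assms(5) by (simp add: norm_power power_le_one)
  then have "norm (qcoef q \<tau> n) * norm (z ^ n) \<le> norm (qcoef q \<tau> n) * 1" by (intro mult_left_mono) auto
  then show "norm (of_real (qcoef q \<tau> n) * z ^ n) \<le> norm (qcoef q \<tau> n)" by (simp add: norm_mult)
qed

lemma qser_functional:
  assumes "0 < q" "q < 1" "0 < \<tau>" "\<tau> < 1" "norm z \<le> 1"
  shows "(1 - of_real \<tau> * z) * qser q \<tau> z = (1 - z) * qser q \<tau> (of_real q * z)"
proof -
  let ?c = "\<lambda>n. complex_of_real (qcoef q \<tau> n)"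
  have nq: "norm (of_real q * z) \<le> 1"
    using assms mult_mono[of q 1 "norm z" 1] by (simp add: norm_mult)
  have s: "(\<lambda>n. ?c n * z ^ n) sums qser q \<tau> z" "(\<lambda>n. ?c n * (of_real q * z) ^ n) sums qser q \<tau> (of_real q * z)"
    unfolding qser_def using qser_summable[OF assms(1-4)] assms(5) nq by (auto intro: summable_sums)
  have "(\<lambda>n. ?c n * (of_real q * z) ^ n - ?c n * z ^ n) sums (qser q \<tau> (of_real q * z) - qser q \<tau> z)"
    by (rule sums_diff[OF s(2,1)])
  then have "(\<lambda>n. ?c (Suc n) * (of_real q * z) ^ Suc n - ?c (Suc n) * z ^ Suc n) sums
      (qser q \<tau> (of_real q * z) - qser q \<tau> z)"
    by (subst sums_Suc_iff) simp
  moreover have "?c (Suc n) * (of_real q * z) ^ Suc n - ?c (Suc n) * z ^ Suc n =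
      z * (?c n * (of_real q * z) ^ n) - of_real \<tau> * z * (?c n * z ^ n)" for n
  proof -
    have "?c (Suc n) * (1 - of_real q ^ Suc n) = ?c n * (of_real \<tau> - of_real q ^ n)"
      using arg_cong[OF qcoef_rec[OF assms(1,2), of \<tau> n], of complex_of_real]
      by (simp only: of_real_mult of_real_diff of_real_power of_real_1)
    then have "?c (Suc n) * (of_real q ^ Suc n - 1) * z ^ Suc n = ?c n * (of_real q ^ n - of_real \<tau>) * z ^ Suc n"
      by (metis minus_diff_eq mult_minus_right)
    then show ?thesis by (simp only: power_mult_distrib) (simp add: algebra_simps del: qcoef.simps)
  qed
  ultimately have "(\<lambda>n. z * (?c n * (of_real q * z) ^ n) - of_real \<tau> * z * (?c n * z ^ n)) sums
      (qser q \<tau> (of_real q * z) - qser q \<tau> z)" by (simp only:)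
  moreover have "(\<lambda>n. z * (?c n * (of_real q * z) ^ n) - of_real \<tau> * z * (?c n * z ^ n)) sums
      (z * qser q \<tau> (of_real q * z) - of_real \<tau> * z * qser q \<tau> z)"
    by (intro sums_diff sums_mult s)
  ultimately have "qser q \<tau> (of_real q * z) - qser q \<tau> z =
      z * qser q \<tau> (of_real q * z) - of_real \<tau> * z * qser q \<tau> z" by (rule sums_unique2)
  then show ?thesis by (simp add: algebra_simps)
qed

lemma qpoch_convergent:
  assumes "0 < q" "q < 1"
  shows "convergent_prod (\<lambda>k. 1 - a * complex_of_real q ^ k)"
proof -
  have "summable (\<lambda>k. norm (1 - a * complex_of_real q ^ k - 1))"
    using assms by (simp add: norm_mult norm_power summable_mult summable_geometric)
  then show ?thesis
    by (intro abs_convergent_prod_imp_convergent_prod summable_imp_abs_convergent_prod)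
qed

lemma qpoch_limit:
  assumes "0 < q" "q < 1"
  shows "(\<lambda>n. \<Prod>k<n. 1 - a * complex_of_real q ^ k) \<longlonglongrightarrow> qpoch_inf a q"
proof -
  have "(\<lambda>n. \<Prod>k\<le>n. 1 - a * complex_of_real q ^ k) \<longlonglongrightarrow> qpoch_inf a q"
    unfolding qpoch_inf_def by (rule convergent_prod_LIMSEQ[OF qpoch_convergent[OF assms]])
  then have "(\<lambda>n. \<Prod>k<Suc n. 1 - a * complex_of_real q ^ k) \<longlonglongrightarrow> qpoch_inf a q"
    by (simp only: lessThan_Suc_atMost)
  then show ?thesis by (rule LIMSEQ_imp_Suc)
qed

lemma qpoch_nonzero:
  assumes "0 < q" "q < 1" "norm a < 1"
  shows "qpoch_inf a q \<noteq> 0"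
  unfolding qpoch_inf_def
proof (rule prodinf_nonzero[OF qpoch_convergent[OF assms(1,2)]])
  fix k
  have "norm (a * complex_of_real q ^ k) \<le> norm a * 1"
    using assms by (auto simp: norm_mult norm_power intro!: mult_left_le power_le_one)
  then have "norm (a * complex_of_real q ^ k) < 1" using assms(3) by simp
  then show "1 - a * complex_of_real q ^ k \<noteq> 0" by auto
qed

text \<open>Iterating the functional equation pulls out the first \<open>n\<close> factors of both
  infinite products and leaves the series at \<open>q^n z\<close>, which tends to its constant term
  \<open>1\<close>.\<close>

lemma qser_eq_qpoch:
  assumes "0 < q" "q < 1" "0 < \<tau>" "\<tau> < 1" "norm z < 1"
  shows "qser q \<tau> z = qpoch_inf z q / qpoch_inf (of_real \<tau> * z) q"
proof -
  have small: "norm (of_real q ^ n * z) \<le> 1" for n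
    using assms power_le_one[of q n] mult_mono[of "q ^ n" 1 "norm z" 1] by (simp add: norm_mult norm_power)
  have iter: "(\<Prod>k<n. 1 - of_real \<tau> * z * of_real q ^ k) * qser q \<tau> z =
      (\<Prod>k<n. 1 - z * of_real q ^ k) * qser q \<tau> (of_real q ^ n * z)" for n
  proof (induction n)
    case (Suc n)
    have "(\<Prod>k<Suc n. 1 - of_real \<tau> * z * of_real q ^ k) * qser q \<tau> z =
        (\<Prod>k<n. 1 - z * of_real q ^ k) * ((1 - of_real \<tau> * (of_real q ^ n * z)) * qser q \<tau> (of_real q ^ n * z))"
      using Suc by (simp add: mult_ac)
    also have "\<dots> = (\<Prod>k<Suc n. 1 - z * of_real q ^ k) * qser q \<tau> (of_real q ^ Suc n * z)"
      unfolding qser_functional[OF assms(1-4) small] by (simp add: mult_ac)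
    finally show ?case .
  qed simp
  have cont: "isCont (qser q \<tau>) 0"
  proof -
    have "summable (\<lambda>n. complex_of_real (qcoef q \<tau> n) * 1 ^ n)"
      by (rule qser_summable[OF assms(1-4)]) simp
    from isCont_powser[OF this, of 0] show ?thesis unfolding qser_def by simp
  qed
  have "(\<lambda>n. of_real q ^ n * z) \<longlonglongrightarrow> 0 * z"
    using assms by (intro tendsto_intros LIMSEQ_power_zero) auto
  then have "(\<lambda>n. qser q \<tau> (of_real q ^ n * z)) \<longlonglongrightarrow> qser q \<tau> 0"
    using isCont_tendsto_compose[OF cont] by simp
  moreover have "qser q \<tau> 0 = 1"
  proof -
    have "qser q \<tau> 0 = (\<Sum>n\<in>{0}. of_real (qcoef q \<tau> n) * 0 ^ n)"
      unfolding qser_def by (rule suminf_finite) auto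
    then show ?thesis by simp
  qed
  ultimately have "(\<lambda>n. (\<Prod>k<n. 1 - z * of_real q ^ k) * qser q \<tau> (of_real q ^ n * z)) \<longlonglongrightarrow> qpoch_inf z q * 1"
    by (intro tendsto_mult qpoch_limit assms) simp
  moreover have "(\<lambda>n. (\<Prod>k<n. 1 - of_real \<tau> * z * of_real q ^ k) * qser q \<tau> z) \<longlonglongrightarrow>
      qpoch_inf (of_real \<tau> * z) q * qser q \<tau> z"
    by (intro tendsto_mult qpoch_limit assms tendsto_const)
  ultimately have "qpoch_inf (of_real \<tau> * z) q * qser q \<tau> z = qpoch_inf z q"
    unfolding iter using LIMSEQ_unique by fastforce
  moreover have "qpoch_inf (of_real \<tau> * z) q \<noteq> 0"
  proof (rule qpoch_nonzero[OF assms(1,2)])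
    show "norm (of_real \<tau> * z) < 1" using assms mult_strict_mono[of \<tau> 1 "norm z" 1] by (simp add: norm_mult)
  qed
  ultimately show ?thesis by (simp add: field_simps)
qed

lemma qpoch_ratio_coeff:
  assumes "0 < q" "q < 1" "0 < \<tau>" "\<tau> < 1"
  shows "fps_nth (fps_expansion (\<lambda>z. qpoch_inf z q / qpoch_inf (of_real \<tau> * z) q) 0) n = of_real (qcoef q \<tau> n)"
proof -
  let ?f = "\<lambda>z. qpoch_inf z q / qpoch_inf (of_real \<tau> * z) q"
  have "?f has_fps_expansion Abs_fps (\<lambda>n. of_real (qcoef q \<tau> n))"
  proof (rule has_fps_expansionI)
    have "\<forall>\<^sub>F z in nhds 0. z \<in> ball (0::complex) 1" by (rule eventually_nhds_in_open) auto
    then show "\<forall>\<^sub>F u in nhds 0. (\<lambda>n. Abs_fps (\<lambda>n. complex_of_real (qcoef q \<tau> n)) $ n * u ^ n) sums ?f u"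
    proof eventually_elim
      case (elim z)
      then have z: "norm z < 1" by simp
      have "(\<lambda>n. of_real (qcoef q \<tau> n) * z ^ n) sums qser q \<tau> z"
        unfolding qser_def using z by (intro summable_sums qser_summable assms) auto
      then show ?case unfolding qser_eq_qpoch[OF assms z] by simp
    qed
  qed
  from fps_nth_fps_expansion[OF this, of n] show ?thesis by (simp add: fps_expansion_def)
qed

subsection \<open>Power series in a single exponential\<close>

definition expser :: "'a::euclidean_space \<Rightarrow> (nat \<Rightarrow> real) \<Rightarrow> 'a l1" where
  "expser \<alpha> c = push UNIV (\<lambda>n. real n *\<^sub>R \<alpha>) (\<lambda>n. of_real (c n))"

abbreviation asums :: "(nat \<Rightarrow> real) \<Rightarrow> bool" where
  "asums c \<equiv> summable (\<lambda>n. \<bar>c n\<bar>)"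

lemma asums_asum: "asums c \<Longrightarrow> asum (\<lambda>n. complex_of_real (c n)) UNIV"
  unfolding asum_def by (rule norm_summable_imp_summable_on) simp

lemma coef_expser: "asums c \<Longrightarrow> coef (expser \<alpha> c) x = infsum (\<lambda>n. of_real (c n)) {n. real n *\<^sub>R \<alpha> = x}"
  unfolding expser_def by (subst coef_push[OF asums_asum]) auto

lemma expser_diff:
  assumes "asums c" "asums c'"
  shows "expser \<alpha> (\<lambda>n. c n - c' n) = expser \<alpha> c - expser \<alpha> c'"
proof (rule l1_eqI)
  fix x
  have s: "asums (\<lambda>n. c n - c' n)"
    using summable_comparison_test'[OF summable_add[OF assms], of 0 "\<lambda>n. \<bar>c n - c' n\<bar>"] abs_triangle_ineq4
    by simp
  have "(\<Sum>\<^sub>\<infinity>n\<in>{n. real n *\<^sub>R \<alpha> = x}. complex_of_real (c n) + - of_real (c' n)) =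
      (\<Sum>\<^sub>\<infinity>n\<in>{n. real n *\<^sub>R \<alpha> = x}. of_real (c n)) + (\<Sum>\<^sub>\<infinity>n\<in>{n. real n *\<^sub>R \<alpha> = x}. - complex_of_real (c' n))"
    using assms
    by (intro infsum_add) (auto intro!: asum_summable asum_subset[OF asums_asum] simp: summable_on_uminus)
  then show "coef (expser \<alpha> (\<lambda>n. c n - c' n)) x = coef (expser \<alpha> c - expser \<alpha> c') x"
    by (simp add: coef_expser assms s infsum_uminus)
qed

lemma expser_shift:
  assumes "\<alpha> \<noteq> 0" "asums c"
  shows "asums (\<lambda>n. case n of 0 \<Rightarrow> 0 | Suc k \<Rightarrow> a * c k)"
    and "emb (Poly_Mapping.single \<alpha> (of_real a)) * expser \<alpha> c = expser \<alpha> (\<lambda>n. case n of 0 \<Rightarrow> 0 | Suc k \<Rightarrow> a * c k)"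
proof -
  let ?c = "\<lambda>n. case n of 0 \<Rightarrow> 0 | Suc k \<Rightarrow> a * c k"
  have "summable (\<lambda>n. \<bar>?c (Suc n)\<bar>)" using assms(2) by (simp add: abs_mult summable_mult)
  then show s: "asums ?c" by (subst (asm) summable_Suc_iff)
  show "emb (Poly_Mapping.single \<alpha> (of_real a)) * expser \<alpha> c = expser \<alpha> ?c"
  proof (rule l1_eqI)
    fix x
    let ?A = "{n. real n *\<^sub>R \<alpha> = x - \<alpha>}"
    have "infsum (\<lambda>n. complex_of_real (?c n)) {n. real n *\<^sub>R \<alpha> = x} = infsum (\<lambda>n. complex_of_real (?c n)) (Suc ` ?A)"
    proof (rule infsum_cong_neutral)
      fix n assume n: "n \<in> {n. real n *\<^sub>R \<alpha> = x} - Suc ` ?A"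
      then have "n = 0" by (cases n) (auto simp: algebra_simps)
      then show "complex_of_real (?c n) = 0" by simp
    qed (auto simp: algebra_simps)
    also have "\<dots> = infsum (\<lambda>n. of_real a * complex_of_real (c n)) ?A"
      by (subst infsum_reindex) (auto simp: o_def)
    also have "\<dots> = of_real a * infsum (\<lambda>n. of_real (c n)) ?A"
      using assms(2) by (intro infsum_cmult_right) (auto intro!: asum_summable asum_subset[OF asums_asum])
    finally show "coef (emb (Poly_Mapping.single \<alpha> (of_real a)) * expser \<alpha> c) x = coef (expser \<alpha> ?c) x"
      by (simp add: coef_emb_single_mult coef_expser assms(2) s)
  qed
qed

lemma expser_binom:
  assumes "\<alpha> \<noteq> 0" "asums c"
  shows "emb (binom \<alpha> (of_real a)) * expser \<alpha> c = expser \<alpha> (\<lambda>n. c n - (case n of 0 \<Rightarrow> 0 | Suc k \<Rightarrow> a * c k))"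
  unfolding expser_diff[OF assms(2) expser_shift(1)[OF assms]] expser_shift(2)[OF assms, symmetric]
  by (simp add: binom_def emb_diff left_diff_distrib)

lemma expser_one: "\<alpha> \<noteq> 0 \<Longrightarrow> expser \<alpha> (\<lambda>n. if n = 0 then 1 else 0) = 1"
proof (rule l1_eqI)
  fix x assume \<alpha>: "\<alpha> \<noteq> 0"
  have s: "asums (\<lambda>n. if n = 0 then 1 else 0)" by (rule summable_finite[of "{0}"]) auto
  have "infsum (\<lambda>n. complex_of_real (if n = 0 then 1 else 0)) {n. real n *\<^sub>R \<alpha> = x} =
      infsum (\<lambda>n. complex_of_real (if n = 0 then 1 else 0)) (if x = 0 then {0::nat} else {})"
    using \<alpha> by (cases "x = 0"; intro infsum_cong_neutral) auto
  then show "coef (expser \<alpha> (\<lambda>n. if n = 0 then 1 else 0)) x = coef 1 x"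
    by (auto simp: coef_expser s coef_1)
qed

lemma l1_bar_expser: "asums c \<Longrightarrow> l1_bar (expser \<alpha> c) = expser (- \<alpha>) c"
proof (rule l1_eqI)
  fix x assume c: "asums c"
  have "{n. real n *\<^sub>R \<alpha> = - x} = {n. real n *\<^sub>R (- \<alpha>) = x}" by (auto simp: minus_equation_iff)
  then show "coef (l1_bar (expser \<alpha> c)) x = coef (expser (- \<alpha>) c) x"
    by (simp add: coef_expser c flip: infsum_cnj)
qed

lemma translates_expser:
  assumes "asums c" "asums (\<lambda>n. r ^ n * c n)" "r = q powr (\<alpha> \<bullet> \<nu>)" "q > 0"
  shows "translates q \<nu> (expser \<alpha> c) (expser \<alpha> (\<lambda>n. r ^ n * c n))"
  unfolding translates_def
proof
  fix x
  let ?A = "{n. real n *\<^sub>R \<alpha> = x}"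
  have "infsum (\<lambda>n. complex_of_real (r ^ n * c n)) ?A = infsum (\<lambda>n. of_real (q powr (x \<bullet> \<nu>)) * complex_of_real (c n)) ?A"
  proof (rule infsum_cong)
    fix n assume "n \<in> ?A"
    then have "x = real n *\<^sub>R \<alpha>" by simp
    then have "q powr (x \<bullet> \<nu>) = r ^ n"
      using assms(3,4) by (simp add: powr_realpow[symmetric] powr_powr mult.commute)
    then show "complex_of_real (r ^ n * c n) = of_real (q powr (x \<bullet> \<nu>)) * complex_of_real (c n)" by simp
  qed
  also have "\<dots> = of_real (q powr (x \<bullet> \<nu>)) * infsum (\<lambda>n. complex_of_real (c n)) ?A"
    using assms(1) by (intro infsum_cmult_right) (auto intro!: asum_summable asum_subset[OF asums_asum])
  finally show "coef (expser \<alpha> (\<lambda>n. r ^ n * c n)) x = of_real (q powr (x \<bullet> \<nu>)) * coef (expser \<alpha> c) x"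
    unfolding coef_expser[OF assms(1)] coef_expser[OF assms(2)] .
qed

lemma asums_scale: assumes "asums c" "0 \<le> r" "r \<le> 1" shows "asums (\<lambda>n. r ^ n * c n)"
proof (rule summable_comparison_test'[OF assms(1), of 0])
  fix n
  have "r ^ n * \<bar>c n\<bar> \<le> 1 * \<bar>c n\<bar>" using assms by (intro mult_right_mono power_le_one) auto
  then show "norm (\<bar>r ^ n * c n\<bar>) \<le> \<bar>c n\<bar>" using assms by (simp add: abs_mult)
qed

definition geom :: "'a::euclidean_space \<Rightarrow> real \<Rightarrow> 'a l1" where
  "geom \<alpha> a = expser \<alpha> (\<lambda>n. a ^ n)"

lemma asums_geom: "0 \<le> a \<Longrightarrow> a < 1 \<Longrightarrow> asums (\<lambda>n. a ^ n)"
  by (simp add: summable_geometric power_abs)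

lemma binom_geom: "\<alpha> \<noteq> 0 \<Longrightarrow> 0 \<le> a \<Longrightarrow> a < 1 \<Longrightarrow> emb (binom \<alpha> (of_real a)) * geom \<alpha> a = 1"
proof -
  assume a: "\<alpha> \<noteq> 0" "0 \<le> a" "a < 1"
  have "(\<lambda>n. a ^ n - (case n of 0 \<Rightarrow> 0 | Suc k \<Rightarrow> a * a ^ k)) = (\<lambda>n. if n = 0 then 1 else 0)"
    by (auto split: nat.splits)
  then show ?thesis
    unfolding geom_def expser_binom[OF a(1) asums_geom[OF a(2,3)]] using expser_one[OF a(1)] by simp
qed

lemma l1_bar_emb_const: "l1_bar (emb (Poly_Mapping.single 0 (of_real a))) = emb (Poly_Mapping.single 0 (of_real a))"
  by (rule l1_eqI) (auto simp: lookup_single when_def)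

section \<open>The weight as an element of the convolution algebra and the associated form\<close>

context macd
begin

text \<open>For a root, the series of \<open>(s z; q_\<alpha>)_\<infinity> / (t_\<alpha> s z;
  q_\<alpha>)_\<infinity>\<close> at \<open>z = e^\<alpha>\<close>; translations multiply the scale
  \<open>s\<close> by a power of \<open>q\<close>.\<close>

definition Dser :: "'a \<Rightarrow> real \<Rightarrow> 'a l1" where
  "Dser \<alpha> s = expser \<alpha> (\<lambda>n. s ^ n * qcoef (qa \<alpha>) (t \<alpha>) n)"

lemma asums_qcoef: "\<alpha> \<in> R \<Longrightarrow> asums (qcoef (qa \<alpha>) (t \<alpha>))"
  using qcoef_summable[of "qa \<alpha>" "t \<alpha>"] qa t_bounds by simp

lemma asums_Dser: "\<alpha> \<in> R \<Longrightarrow> 0 \<le> s \<Longrightarrow> s \<le> 1 \<Longrightarrow> asums (\<lambda>n. s ^ n * qcoef (qa \<alpha>) (t \<alpha>) n)"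
  by (intro asums_scale asums_qcoef)

text \<open>The q-difference equation, checked on coefficients. At \<open>s = 1\<close> it exhibits
  \<open>1 - t_\<alpha> e^\<alpha>\<close> times the factor of the weight as a multiple of
  \<open>1 - e^\<alpha>\<close>.\<close>

lemma Dser_functional:
  assumes \<alpha>: "\<alpha> \<in> R" and s: "0 \<le> s" "s \<le> 1"
  shows "emb (binom \<alpha> (of_real (t \<alpha> * s))) * Dser \<alpha> s = emb (binom \<alpha> (of_real s)) * Dser \<alpha> (s * qa \<alpha>)"
proof -
  let ?q = "qa \<alpha>" and ?\<tau> = "t \<alpha>"
  have q: "0 < ?q" "?q < 1" using qa[OF \<alpha>] by auto
  have sq: "0 \<le> s * ?q" "s * ?q \<le> 1" using s q mult_mono[of s 1 ?q 1] by auto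
  have \<alpha>0: "\<alpha> \<noteq> 0" using root_nonzero[OF \<alpha>] .
  have "s ^ n * qcoef ?q ?\<tau> n - (case n of 0 \<Rightarrow> 0 | Suc k \<Rightarrow> ?\<tau> * s * (s ^ k * qcoef ?q ?\<tau> k)) =
      (s * ?q) ^ n * qcoef ?q ?\<tau> n - (case n of 0 \<Rightarrow> 0 | Suc k \<Rightarrow> s * ((s * ?q) ^ k * qcoef ?q ?\<tau> k))" for n
  proof (cases n)
    case (Suc k)
    have "s ^ Suc k * (qcoef ?q ?\<tau> (Suc k) * (1 - ?q ^ Suc k)) = s ^ Suc k * (qcoef ?q ?\<tau> k * (?\<tau> - ?q ^ k))"
      using qcoef_rec[OF q] by simp
    then show ?thesis unfolding Suc by (simp only: power_mult_distrib nat.case) (simp add: algebra_simps del: qcoef.simps)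
  qed simp
  then show ?thesis
    unfolding Dser_def expser_binom[OF \<alpha>0 asums_Dser[OF \<alpha> s]] expser_binom[OF \<alpha>0 asums_Dser[OF \<alpha> sq]]
    by simp
qed

lemma l1_bar_Dser: "\<alpha> \<in> R \<Longrightarrow> 0 \<le> s \<Longrightarrow> s \<le> 1 \<Longrightarrow> l1_bar (Dser \<alpha> s) = Dser (- \<alpha>) s"
  unfolding Dser_def by (simp add: l1_bar_expser asums_Dser t_minus)

text \<open>For \<open>\<alpha> \<bullet> \<nu> \<ge> 0\<close> the new scale stays in
  \<open>[0, 1]\<close>, which keeps the coefficients summable. In the opposite direction
  summability could be lost, so translations are applied to the factors of roots nonnegative on
  \<open>\<nu>\<close>.\<close>

lemma translates_Dser:
  assumes \<alpha>: "\<alpha> \<in> R" and s: "0 \<le> s" "s \<le> 1" and "\<alpha> \<bullet> \<nu> \<ge> 0"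
  shows "translates q \<nu> (Dser \<alpha> s) (Dser \<alpha> (q powr (\<alpha> \<bullet> \<nu>) * s))"
proof -
  let ?r = "q powr (\<alpha> \<bullet> \<nu>)"
  have r: "0 \<le> ?r" "?r \<le> 1" using q assms(4) powr_mono_both[of 0 "\<alpha> \<bullet> \<nu>" q 1] powr_le1[of "\<alpha> \<bullet> \<nu>" q] by auto
  have "asums (\<lambda>n. ?r ^ n * (s ^ n * qcoef (qa \<alpha>) (t \<alpha>) n))"
    by (intro asums_scale r asums_Dser \<alpha> s)
  from translates_expser[OF asums_Dser[OF \<alpha> s] this refl q(1)] show ?thesis
    unfolding Dser_def by (simp add: power_mult_distrib mult.assoc)
qed

definition Delta :: "'a l1" where
  "Delta = (\<Prod>\<alpha>\<in>R. Dser \<alpha> 1)"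

lemma coef_Delta: "coef Delta \<mu> = Delta_coeff R S q t \<mu>"
proof -
  have c: "Delta_factor_coeff R S q t \<alpha> n = of_real (qcoef (qa \<alpha>) (t \<alpha>) n)" if "\<alpha> \<in> R" for \<alpha> n
    unfolding Delta_factor_coeff_def qa_def[symmetric]
    by (rule qpoch_ratio_coeff) (use that qa t_bounds in auto)
  let ?E = "R \<rightarrow>\<^sub>E (UNIV :: nat set)"
  have as: "asum (\<lambda>n. complex_of_real (qcoef (qa \<alpha>) (t \<alpha>) n)) UNIV" if "\<alpha> \<in> R" for \<alpha>
    by (rule asums_asum[OF asums_qcoef[OF that]])
  note pp = push_prod[OF finite_R as]
  have "Delta = push ?E (\<lambda>n. \<Sum>\<alpha>\<in>R. real (n \<alpha>) *\<^sub>R \<alpha>) (\<lambda>n. \<Prod>\<alpha>\<in>R. complex_of_real (qcoef (qa \<alpha>) (t \<alpha>) (n \<alpha>)))"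
    unfolding Delta_def Dser_def expser_def using pp by simp
  then have "coef Delta \<mu> = infsum (\<lambda>n. \<Prod>\<alpha>\<in>R. complex_of_real (qcoef (qa \<alpha>) (t \<alpha>) (n \<alpha>)))
      {n \<in> ?E. (\<Sum>\<alpha>\<in>R. real (n \<alpha>) *\<^sub>R \<alpha>) = \<mu>}"
    using pp by (simp add: coef_push)
  then show ?thesis unfolding Delta_coeff_def by (simp add: c cong: prod.cong)
qed

definition inn :: "('a \<Rightarrow>\<^sub>0 complex) \<Rightarrow> ('a \<Rightarrow>\<^sub>0 complex) \<Rightarrow> complex" where
  "inn f g = coef (emb f * l1_bar (emb g) * Delta) 0"

lemma Delta_inner_eq: "Delta_inner R S q t f g = inn f g / of_nat (card W)"
proof -
  have "inn f g = coef (emb (f * ga_bar g) * Delta) 0"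
    by (simp add: inn_def emb_mult emb_ga_bar)
  then show ?thesis
    by (simp add: Delta_inner_def Delta_constant_term_def coef_emb_mult coef_Delta)
qed

lemma Delta_inner_0_iff: "Delta_inner R S q t f g = 0 \<longleftrightarrow> inn f g = 0"
  using card_W_pos by (auto simp: Delta_inner_eq card_gt_0_iff)

lemma inn_0_right [simp]: "inn f 0 = 0"
  by (simp add: inn_def)

lemma inn_add_left: "inn (f + f') g = inn f g + inn f' g"
  by (simp add: inn_def emb_add distrib_right)

lemma inn_add_right: "inn f (g + g') = inn f g + inn f g'"
  by (simp add: inn_def emb_add l1_bar_add distrib_left distrib_right)

lemma inn_const_left: "inn (Poly_Mapping.single 0 c * f) g = c * inn f g"
  by (simp add: inn_def emb_mult mult.assoc coef_emb_single_mult)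

lemma l1_bar_emb_single: "l1_bar (emb (Poly_Mapping.single 0 c)) = emb (Poly_Mapping.single 0 (cnj c))"
  by (rule l1_eqI) (auto simp: lookup_single when_def)

lemma inn_const_right: "inn f (Poly_Mapping.single 0 c * g) = cnj c * inn f g"
proof -
  have "emb f * l1_bar (emb (Poly_Mapping.single 0 c * g)) * Delta =
      emb (Poly_Mapping.single 0 (cnj c)) * (emb f * l1_bar (emb g) * Delta)"
    by (simp add: emb_mult l1_bar_mult l1_bar_emb_single mult_ac)
  then show ?thesis by (simp add: inn_def coef_emb_single_mult)
qed

lemma inn_sum_right: "inn f (sum g I) = (\<Sum>i\<in>I. inn f (g i))"
  by (induction I rule: infinite_finite_induct) (auto simp: inn_add_right)

lemma R_split: "(\<Prod>\<alpha>\<in>R. F \<alpha>) = (\<Prod>\<alpha>\<in>Rp. F \<alpha>) * (\<Prod>\<alpha>\<in>Rp. (F (- \<alpha>) :: 'a l1))"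
proof -
  have R: "R = Rp \<union> uminus ` Rp"
  proof
    show "R \<subseteq> Rp \<union> uminus ` Rp" using Rp_cases by (auto simp: image_iff) (metis minus_minus)
    show "Rp \<union> uminus ` Rp \<subseteq> R" using Rp_R root_minus by auto
  qed
  have "(\<Prod>\<alpha>\<in>R. F \<alpha>) = (\<Prod>\<alpha>\<in>Rp \<union> uminus ` Rp. F \<alpha>)" by (rule arg_cong[OF R])
  also have "\<dots> = (\<Prod>\<alpha>\<in>Rp. F \<alpha>) * (\<Prod>\<alpha>\<in>uminus ` Rp. F \<alpha>)"
    using Rp_not_minus by (intro prod.union_disjoint) auto
  also have "(\<Prod>\<alpha>\<in>uminus ` Rp. F \<alpha>) = (\<Prod>\<alpha>\<in>Rp. F (- \<alpha>))"
    by (subst prod.reindex) (auto simp: inj_on_def)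
  finally show ?thesis .
qed

section \<open>Definiteness of the form\<close>

definition high :: "'a l1 \<Rightarrow> bool" where
  "high F \<longleftrightarrow> (\<forall>x. coef F x \<noteq> 0 \<longrightarrow> x \<in> root_cone) \<and> coef F 0 = 1"

lemma high_mult: assumes "high F" "high G" shows "high (F * G)"
proof -
  have "x \<in> root_cone" if nz: "coef (F * G) x \<noteq> 0" for x
  proof -
    have "\<exists>y. coef F y * coef G (x - y) \<noteq> 0"
    proof (rule ccontr)
      assume "\<not> ?thesis"
      then have "coef (F * G) x = 0" unfolding coef_mult by (intro infsum_0) auto
      then show False using nz by simp
    qed
    then obtain y where "y \<in> root_cone" "x - y \<in> root_cone" using assms by (auto simp: high_def)
    then show ?thesis using root_cone_add[of y "x - y"] by simp
  qed
  moreover have "coef (F * G) 0 = 1"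
  proof -
    have "coef F y * coef G (0 - y) = 0" if "y \<notin> {0}" for y
    proof (rule ccontr)
      assume "\<not> ?thesis"
      then have "y \<in> root_cone" "- y \<in> root_cone" using assms by (auto simp: high_def)
      then show False using root_cone_antisym that by blast
    qed
    then have "coef (F * G) 0 = (\<Sum>y\<in>{0}. coef F y * coef G (0 - y))"
      unfolding coef_mult by (intro infsum_finite_support) auto
    then show ?thesis using assms by (simp add: high_def)
  qed
  ultimately show ?thesis by (auto simp: high_def)
qed

lemma high_prod: "finite I \<Longrightarrow> (\<And>i. i \<in> I \<Longrightarrow> high (F i)) \<Longrightarrow> high (prod F I)"
  by (induction I rule: finite_induct) (auto intro: high_mult simp: high_def[of 1] coef_1)

lemma high_Dser: assumes \<alpha>: "\<alpha> \<in> Rp" shows "high (Dser \<alpha> 1)"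
proof -
  have \<alpha>R: "\<alpha> \<in> R" "\<alpha> \<noteq> 0" using \<alpha> Rp_R root_nonzero by auto
  note c = coef_expser[OF asums_Dser[OF \<alpha>R(1), of 1], of \<alpha>, folded Dser_def, simplified]
  have "x \<in> root_cone" if "coef (Dser \<alpha> 1) x \<noteq> 0" for x
  proof -
    have "{n. real n *\<^sub>R \<alpha> = x} \<noteq> {}"
    proof
      assume "{n. real n *\<^sub>R \<alpha> = x} = {}"
      then show False using that unfolding c by simp
    qed
    then show ?thesis using root_cone_scale[OF Rp_root_cone[OF \<alpha>]] by auto
  qed
  moreover have "{n. real n *\<^sub>R \<alpha> = 0} = {0}" using \<alpha>R by auto
  then have "coef (Dser \<alpha> 1) 0 = 1" unfolding c using \<alpha>R by simp
  ultimately show ?thesis by (auto simp: high_def)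
qed

text \<open>With \<open>\<Delta>\<^sub>+\<close> the product over the positive roots, \<open>\<langle>f, f\<rangle>\<close> is the sum of the squared
  moduli of the coefficients of \<open>f \<Delta>\<^sub>+\<close>.\<close>

lemma inn_definite: assumes "inn f f = 0" shows "f = 0"
proof (rule ccontr)
  assume "f \<noteq> 0"
  define B where "B = (\<Prod>\<alpha>\<in>Rp. Dser \<alpha> 1)"
  have highB: "high B" unfolding B_def by (intro high_prod high_Dser) auto
  have "l1_bar B = (\<Prod>\<alpha>\<in>Rp. Dser (- \<alpha>) 1)"
    unfolding B_def l1_bar_prod by (intro prod.cong refl) (simp add: l1_bar_Dser Rp_R)
  then have "Delta = B * l1_bar B" unfolding Delta_def R_split B_def by simp
  then have "inn f f = coef ((emb f * B) * l1_bar (emb f * B)) 0"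
    by (simp add: inn_def l1_bar_mult mult_ac)
  also have "\<dots> = (\<Sum>\<^sub>\<infinity>y. of_real ((norm (coef (emb f * B) y))\<^sup>2))"
    unfolding coef_mult_l1_bar by (intro infsum_cong) (rule complex_norm_square[symmetric])
  finally have zero: "(\<Sum>\<^sub>\<infinity>y. complex_of_real ((norm (coef (emb f * B) y))\<^sup>2)) = 0" using assms by simp
  have "asum (\<lambda>y. coef (emb f * B) y * coef (l1_bar (emb f * B)) (0 - y)) UNIV"
    by (rule asum_conv_fibre[OF asum_coef asum_coef])
  then have sum: "(\<lambda>y. (norm (coef (emb f * B) y))\<^sup>2) summable_on UNIV"
    by (simp add: asum_def norm_mult power2_eq_square)
  have "((\<lambda>y. complex_of_real ((norm (coef (emb f * B) y))\<^sup>2)) has_sum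
      of_real (\<Sum>\<^sub>\<infinity>y. (norm (coef (emb f * B) y))\<^sup>2)) UNIV"
    unfolding has_sum_of_real_iff by (rule has_sum_infsum[OF sum])
  from infsumI[OF this] have "(\<Sum>\<^sub>\<infinity>y. (norm (coef (emb f * B) y))\<^sup>2) = 0" unfolding zero by simp
  then have all0: "(norm (coef (emb f * B) y))\<^sup>2 = 0" for y
    using nonneg_infsum_le_0D[of "\<lambda>y. (norm (coef (emb f * B) y))\<^sup>2" UNIV y] sum by auto
  \<comment> \<open>An exponent of least height survives in the product with \<open>B\<close>, whose
    terms other than the constant \<open>1\<close> have positive height.\<close>
  obtain x where x: "x \<in> Poly_Mapping.keys f" "\<And>y. y \<in> Poly_Mapping.keys f \<Longrightarrow> y \<bullet> (- v) \<le> x \<bullet> (- v)"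
    using maximal_exists[of "Poly_Mapping.keys f" "- v"] \<open>f \<noteq> 0\<close> by auto
  have "coef (emb f * B) x = (\<Sum>y\<in>Poly_Mapping.keys f. if y = x then Poly_Mapping.lookup f x else 0)"
    unfolding coef_emb_mult
  proof (intro sum.cong refl)
    fix y assume y: "y \<in> Poly_Mapping.keys f"
    have "coef B (x - y) = 0" if "y \<noteq> x"
    proof (rule ccontr)
      assume "coef B (x - y) \<noteq> 0"
      then have "x - y \<in> root_cone" using highB by (simp add: high_def)
      then have "(x - y) \<bullet> v > 0" using root_cone_pos that by simp
      then show False using x(2)[OF y] by (simp add: inner_diff_left)
    qed
    then show "Poly_Mapping.lookup f y * coef B (x - y) = (if y = x then Poly_Mapping.lookup f x else 0)"
      using highB by (auto simp: high_def)
  qed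
  also have "\<dots> = Poly_Mapping.lookup f x" using x(1) by simp
  finally show False using all0[of x] x(1) by (simp add: in_keys_iff)
qed

end

section \<open>Self-adjointness and diagonalisation\<close>

context small_macd
begin

section \<open>Clearing the denominators of the operator against the weight\<close>

definition t_half :: "'a \<Rightarrow> ('a \<Rightarrow>\<^sub>0 complex)" where
  "t_half \<alpha> = Poly_Mapping.single 0 (of_real (t \<alpha> powr (- 1 / 2)))"

text \<open>The numerator of \<open>gfac \<alpha> n m\<close> over the fixed denominator
  \<open>dens \<alpha>\<close>. For the pairings \<open>(0, 2)\<close> the difference
  \<open>t_\<alpha> - q_\<alpha> e^\<alpha>\<close> comes from expanding the second factor
  \<open>v\<close> by \<open>- q_\<alpha> e^\<alpha>\<close>.\<close>

definition gnum :: "'a \<Rightarrow> real \<Rightarrow> real \<Rightarrow> ('a \<Rightarrow>\<^sub>0 complex)" where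
  "gnum \<alpha> n m =
    (if n > 0 then (if n = 2 then t_half \<alpha> * t_half \<alpha> * binom \<alpha> (of_real (t \<alpha>)) * binom \<alpha> (of_real (t \<alpha> * qa \<alpha>))
       else t_half \<alpha> * binom \<alpha> (of_real (t \<alpha>)) * binom \<alpha> (of_real (qa \<alpha>)))
     else if n = 0 \<and> m > 0 then
       (if m = 2 then t_half \<alpha> * t_half \<alpha> * binom \<alpha> (of_real (t \<alpha>)) *
          (Poly_Mapping.single 0 (of_real (t \<alpha>)) - Poly_Mapping.single \<alpha> (of_real (qa \<alpha>)))
        else t_half \<alpha> * binom \<alpha> (of_real (t \<alpha>)) * binom \<alpha> (of_real (qa \<alpha>)))
     else dens \<alpha>)"

lemma gfac_gnum: assumes \<alpha>: "\<alpha> \<in> R" shows "gfac \<alpha> n m * ga_frac (dens \<alpha>) = ga_frac (gnum \<alpha> n m)"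
proof -
  let ?b1 = "ga_frac (binom \<alpha> 1)" and ?bq = "ga_frac (binom \<alpha> (of_real (qa \<alpha>)))"
  let ?h = "ga_frac (t_half \<alpha>)" and ?t = "t \<alpha>" and ?q = "qa \<alpha>"
  have \<alpha>0: "\<alpha> \<noteq> 0" and q0: "?q \<noteq> 0" using \<alpha> root_nonzero qa[OF \<alpha>] by auto
  have h: "scaled_exp (?t powr (- 1 / 2)) 0 = ?h" by (simp add: scaled_exp_def t_half_def)
  have 1: "vf ?t 1 \<alpha> * ?b1 = ?h * ga_frac (binom \<alpha> (of_real ?t))"
    using vf_binom[OF \<alpha>0, of ?t 1] h by simp
  have 2: "vf ?t ?q \<alpha> * ?bq = ?h * ga_frac (binom \<alpha> (of_real (?t * ?q)))"
    unfolding vf_binom[OF \<alpha>0] h ..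
  have c: "complex_of_real ?q * (of_real ?t * inverse (of_real ?q)) = of_real ?t"
    using q0 by (simp add: field_simps)
  have e: "binom \<alpha> (of_real ?q) = Poly_Mapping.single \<alpha> (- of_real ?q) * binom (- \<alpha>) (of_real (inverse ?q))"
    "Poly_Mapping.single \<alpha> (- of_real ?q) * binom (- \<alpha>) (of_real (?t * inverse ?q)) =
      Poly_Mapping.single 0 (of_real ?t) - Poly_Mapping.single \<alpha> (of_real ?q)"
    using q0 by (simp_all add: c binom_def right_diff_distrib mult_single single_uminus)
  have "vf ?t (inverse ?q) (- \<alpha>) * ?bq =
      ga_frac (Poly_Mapping.single \<alpha> (- of_real ?q)) * (vf ?t (inverse ?q) (- \<alpha>) * ga_frac (binom (- \<alpha>) (of_real (inverse ?q))))"
    unfolding e(1) ga_frac_mult by (simp only: mult_ac)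
  also have "\<dots> = ?h * ga_frac (Poly_Mapping.single \<alpha> (- of_real ?q) * binom (- \<alpha>) (of_real (?t * inverse ?q)))"
    using vf_binom[of "- \<alpha>" ?t "inverse ?q"] \<alpha>0 unfolding h ga_frac_mult by (simp only: neg_equal_0_iff_equal mult_ac not_False_eq_True)
  finally have 3: "vf ?t (inverse ?q) (- \<alpha>) * ?bq = ?h * ga_frac (Poly_Mapping.single 0 (of_real ?t) - Poly_Mapping.single \<alpha> (of_real ?q))"
    unfolding e(2) .
  have 11: "vf ?t 1 \<alpha> * (?b1 * ?bq) = ga_frac (t_half \<alpha> * binom \<alpha> (of_real ?t) * binom \<alpha> (of_real ?q))"
    unfolding mult.assoc[symmetric] 1 ga_frac_mult ..
  have "vf ?t 1 \<alpha> * vf ?t ?q \<alpha> * (?b1 * ?bq) = (vf ?t 1 \<alpha> * ?b1) * (vf ?t ?q \<alpha> * ?bq)" by (simp only: mult_ac)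
  then have 12: "vf ?t 1 \<alpha> * vf ?t ?q \<alpha> * (?b1 * ?bq) =
      ga_frac (t_half \<alpha> * t_half \<alpha> * binom \<alpha> (of_real ?t) * binom \<alpha> (of_real (?t * ?q)))"
    unfolding 1 2 ga_frac_mult by (simp only: mult_ac)
  have "vf ?t 1 \<alpha> * vf ?t (inverse ?q) (- \<alpha>) * (?b1 * ?bq) = (vf ?t 1 \<alpha> * ?b1) * (vf ?t (inverse ?q) (- \<alpha>) * ?bq)"
    by (simp only: mult_ac)
  then have 13: "vf ?t 1 \<alpha> * vf ?t (inverse ?q) (- \<alpha>) * (?b1 * ?bq) =
      ga_frac (t_half \<alpha> * t_half \<alpha> * binom \<alpha> (of_real ?t) *
        (Poly_Mapping.single 0 (of_real ?t) - Poly_Mapping.single \<alpha> (of_real ?q)))"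
    unfolding 1 3 ga_frac_mult by (simp only: mult_ac)
  have d: "ga_frac (dens \<alpha>) = ?b1 * ?bq" by (simp add: dens_def ga_frac_mult)
  show ?thesis
    unfolding gfac_def gnum_def using 11 12 13 by (auto simp: d)
qed

definition UVnum :: "'a \<Rightarrow> 'a \<Rightarrow> ('a \<Rightarrow>\<^sub>0 complex)" where
  "UVnum \<nu> \<eta> = (\<Prod>\<alpha>\<in>R. gnum \<alpha> (\<nu> \<bullet> st \<alpha>) (\<eta> \<bullet> st \<alpha>))"

definition Dens :: "'a \<Rightarrow>\<^sub>0 complex" where
  "Dens = (\<Prod>\<alpha>\<in>R. dens \<alpha>)"

lemma UV_UVnum: "UV \<nu> \<eta> * ga_frac Dens = ga_frac (UVnum \<nu> \<eta>)"
  unfolding UV_def Dens_def UVnum_def ga_frac_prod prod.distrib[symmetric]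
  by (intro prod.cong refl gfac_gnum)

lemma Dop_UVnum:
  assumes "Dop f = ga_frac G"
  shows "Dens * G = (\<Sum>(\<nu>, \<eta>)\<in>Pairs. UVnum \<nu> \<eta> * translation q \<nu> f)"
proof -
  have "ga_frac (Dens * G) = (\<Sum>(\<nu>, \<eta>)\<in>Pairs. (UV \<nu> \<eta> * ga_frac Dens) * ga_frac (translation q \<nu> f))"
    unfolding ga_frac_mult assms[symmetric] Dop_def sum_distrib_left
    by (intro sum.cong refl) (auto simp: mult_ac)
  also have "\<dots> = ga_frac (\<Sum>(\<nu>, \<eta>)\<in>Pairs. UVnum \<nu> \<eta> * translation q \<nu> f)"
    unfolding UV_UVnum ga_frac_sum by (intro sum.cong refl) (auto simp: ga_frac_mult)
  finally show ?thesis by simp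
qed

text \<open>This is \<open>Dser \<alpha> 1\<close> divided by \<open>dens \<alpha>\<close>. Although
  \<open>1 - e^\<alpha>\<close> has no inverse in the algebra, the equation \<open>(1 - e^\<alpha>)
  D(q_\<alpha>) = (1 - t_\<alpha> e^\<alpha>) D(1)\<close>, with \<open>D(s)\<close> for
  \<open>Dser \<alpha> s\<close>, provides the quotient, and the two other binomials are inverted by
  geometric series.\<close>

definition Dquot :: "'a \<Rightarrow> 'a l1" where
  "Dquot \<alpha> = Dser \<alpha> (qa \<alpha>) * geom \<alpha> (t \<alpha>) * geom \<alpha> (qa \<alpha>)"

lemma geom_inverse:
  assumes "\<alpha> \<in> R"
  shows "emb (binom \<alpha> (of_real (t \<alpha>))) * geom \<alpha> (t \<alpha>) = 1" "emb (binom \<alpha> (of_real (qa \<alpha>))) * geom \<alpha> (qa \<alpha>) = 1"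
  using qa[OF assms] t_bounds[OF assms] root_nonzero[OF assms] by (auto intro!: binom_geom less_imp_le)

lemma dens_Dquot: assumes \<alpha>: "\<alpha> \<in> R" shows "emb (dens \<alpha>) * Dquot \<alpha> = Dser \<alpha> 1"
proof -
  have 1: "emb (binom \<alpha> 1) * Dser \<alpha> (qa \<alpha>) = emb (binom \<alpha> (of_real (t \<alpha>))) * Dser \<alpha> 1"
    using Dser_functional[OF \<alpha>, of 1] by simp
  have "emb (dens \<alpha>) * Dquot \<alpha> = (emb (binom \<alpha> 1) * Dser \<alpha> (qa \<alpha>)) * geom \<alpha> (t \<alpha>) *
      (emb (binom \<alpha> (of_real (qa \<alpha>))) * geom \<alpha> (qa \<alpha>))"
    unfolding dens_def Dquot_def emb_mult by (simp only: mult_ac)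
  also have "\<dots> = Dser \<alpha> 1 * (emb (binom \<alpha> (of_real (t \<alpha>))) * geom \<alpha> (t \<alpha>)) *
      (emb (binom \<alpha> (of_real (qa \<alpha>))) * geom \<alpha> (qa \<alpha>))"
    unfolding 1 by (simp only: mult_ac)
  finally show ?thesis unfolding geom_inverse[OF \<alpha>] by simp
qed

definition Delta_quot :: "'a l1" where
  "Delta_quot = (\<Prod>\<alpha>\<in>R. Dquot \<alpha>)"

lemma Delta_KM: "Delta = emb Dens * Delta_quot"
  unfolding Delta_def Dens_def Delta_quot_def emb_prod prod.distrib[symmetric]
  by (intro prod.cong refl) (simp add: dens_Dquot)

definition zquot :: "'a \<Rightarrow> real \<Rightarrow> real \<Rightarrow> 'a l1" where
  "zquot \<alpha> n m = emb (gnum \<alpha> n m) * Dquot \<alpha>"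

lemma UVnum_Delta_quot: "emb (UVnum \<nu> \<eta>) * Delta_quot = (\<Prod>\<alpha>\<in>R. zquot \<alpha> (\<nu> \<bullet> st \<alpha>) (\<eta> \<bullet> st \<alpha>))"
  unfolding UVnum_def Delta_quot_def emb_prod prod.distrib[symmetric] zquot_def ..

lemma zquot_one:
  assumes \<alpha>: "\<alpha> \<in> R"
  shows "emb (t_half \<alpha> * binom \<alpha> (of_real (t \<alpha>)) * binom \<alpha> (of_real (qa \<alpha>))) * Dquot \<alpha> = emb (t_half \<alpha>) * Dser \<alpha> (qa \<alpha>)"
proof -
  have "emb (t_half \<alpha> * binom \<alpha> (of_real (t \<alpha>)) * binom \<alpha> (of_real (qa \<alpha>))) * Dquot \<alpha> = emb (t_half \<alpha>) * Dser \<alpha> (qa \<alpha>) *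
      (emb (binom \<alpha> (of_real (t \<alpha>))) * geom \<alpha> (t \<alpha>)) * (emb (binom \<alpha> (of_real (qa \<alpha>))) * geom \<alpha> (qa \<alpha>))"
    unfolding Dquot_def emb_mult by (simp only: mult_ac)
  then show ?thesis unfolding geom_inverse[OF \<alpha>] by simp
qed

lemma zquot_two:
  assumes \<alpha>: "\<alpha> \<in> R"
  shows "emb (t_half \<alpha> * t_half \<alpha> * binom \<alpha> (of_real (t \<alpha>)) * B) * Dquot \<alpha> =
    emb (t_half \<alpha> * t_half \<alpha>) * (emb B * Dser \<alpha> (qa \<alpha>) * geom \<alpha> (qa \<alpha>))"
proof -
  have "emb (t_half \<alpha> * t_half \<alpha> * binom \<alpha> (of_real (t \<alpha>)) * B) * Dquot \<alpha> =
      emb (t_half \<alpha> * t_half \<alpha>) * (emb B * Dser \<alpha> (qa \<alpha>) * geom \<alpha> (qa \<alpha>)) * (emb (binom \<alpha> (of_real (t \<alpha>))) * geom \<alpha> (t \<alpha>))"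
    unfolding Dquot_def emb_mult by (simp only: mult_ac)
  then show ?thesis unfolding geom_inverse[OF \<alpha>] by simp
qed

definition kap :: "'a \<Rightarrow> real \<Rightarrow> ('a \<Rightarrow>\<^sub>0 complex)" where
  "kap \<alpha> n = (if n = 2 then t_half \<alpha> * t_half \<alpha> else t_half \<alpha>)"

text \<open>The factors \<open>v\<close> belonging to the pairing \<open>n\<close> turn
  \<open>Dser \<alpha> 1\<close> into a constant times the series at scale
  \<open>q_\<alpha>^n\<close>, its translate by \<open>\<nu>\<close>. For \<open>n = 2\<close> the
  functional equation is used a second time.\<close>

lemma zquot_pos:
  assumes \<alpha>: "\<alpha> \<in> R" and n: "n = 1 \<or> n = 2"
  shows "zquot \<alpha> n m = emb (kap \<alpha> n) * Dser \<alpha> (qa \<alpha> powr n)"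
proof -
  have q: "0 < qa \<alpha>" "qa \<alpha> < 1" using qa[OF \<alpha>] by auto
  show ?thesis
  proof (cases "n = 2")
    case False
    then show ?thesis using n q zquot_one[OF \<alpha>] by (simp add: zquot_def gnum_def kap_def)
  next
    case True
    have "emb (binom \<alpha> (of_real (t \<alpha> * qa \<alpha>))) * Dser \<alpha> (qa \<alpha>) * geom \<alpha> (qa \<alpha>) =
        (emb (binom \<alpha> (of_real (qa \<alpha>))) * geom \<alpha> (qa \<alpha>)) * Dser \<alpha> (qa \<alpha> * qa \<alpha>)"
      using Dser_functional[OF \<alpha>, of "qa \<alpha>"] q by (simp add: mult_ac)
    also have "\<dots> = Dser \<alpha> (qa \<alpha> powr 2)"
      unfolding geom_inverse[OF \<alpha>] using q by (simp add: powr_numeral power2_eq_square)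
    finally show ?thesis using True zquot_two[OF \<alpha>] by (simp add: zquot_def gnum_def kap_def)
  qed
qed

lemma zquot_neg: "\<alpha> \<in> R \<Longrightarrow> n < 0 \<Longrightarrow> zquot \<alpha> n m = Dser \<alpha> 1"
  by (simp add: zquot_def gnum_def dens_Dquot)

lemma l1_bar_geom: "\<alpha> \<in> R \<Longrightarrow> l1_bar (geom \<alpha> (qa \<alpha>)) = geom (- \<alpha>) (qa (- \<alpha>))"
  using qa[of \<alpha>] by (simp add: geom_def l1_bar_expser asums_geom)

lemma zquot_zero_cases:
  assumes "\<alpha> \<in> R"
  shows "zquot \<alpha> 0 m = (if m > 0 then (if m = 2 then emb (t_half \<alpha> * t_half \<alpha>) *
      (emb (Poly_Mapping.single 0 (of_real (t \<alpha>)) - Poly_Mapping.single \<alpha> (of_real (qa \<alpha>))) * Dser \<alpha> (qa \<alpha>) * geom \<alpha> (qa \<alpha>))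
    else emb (t_half \<alpha>) * Dser \<alpha> (qa \<alpha>)) else Dser \<alpha> 1)"
  by (simp add: zquot_def gnum_def dens_Dquot[OF assms] zquot_one[OF assms] zquot_two[OF assms])

lemma t_half_minus: "\<alpha> \<in> R \<Longrightarrow> t_half (- \<alpha>) = t_half \<alpha>"
  by (simp add: t_half_def t_minus)

lemma l1_bar_t_half: "l1_bar (emb (t_half \<alpha>)) = emb (t_half \<alpha>)"
  unfolding t_half_def by (rule l1_bar_emb_const)

text \<open>All coefficients are real, so conjugation only sends \<open>e^\<alpha>\<close> to
  \<open>e^(-\<alpha>)\<close>; the pairing \<open>m\<close> is a label and stays.\<close>

lemma l1_bar_zquot_zero:
  assumes \<alpha>: "\<alpha> \<in> R"
  shows "l1_bar (zquot \<alpha> 0 m) = zquot (- \<alpha>) 0 m"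
proof -
  have q: "0 < qa \<alpha>" "qa \<alpha> < 1" using qa[OF \<alpha>] by auto
  have e: "l1_bar (emb (Poly_Mapping.single 0 (of_real (t \<alpha>)) - Poly_Mapping.single \<alpha> (of_real (qa \<alpha>)))) =
      emb (Poly_Mapping.single 0 (of_real (t \<alpha>)) - Poly_Mapping.single (- \<alpha>) (of_real (qa \<alpha>)))"
    by (rule l1_eqI) (auto simp: lookup_minus lookup_single when_def minus_equation_iff)
  have D: "l1_bar (Dser \<alpha> (qa \<alpha>)) = Dser (- \<alpha>) (qa \<alpha>)" "l1_bar (Dser \<alpha> 1) = Dser (- \<alpha>) 1"
    using q by (simp_all add: l1_bar_Dser[OF \<alpha>])
  show ?thesis
    unfolding zquot_zero_cases[OF \<alpha>] zquot_zero_cases[OF root_minus[OF \<alpha>]]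
    by (simp add: l1_bar_mult l1_bar_t_half emb_mult e D l1_bar_geom[OF \<alpha>] t_half_minus[OF \<alpha>] t_minus[OF \<alpha>])
qed

lemma translates_const: "translates q \<nu> (emb (Poly_Mapping.single 0 c)) (emb (Poly_Mapping.single 0 c))"
  using translates_emb[of q \<nu> "Poly_Mapping.single 0 c"] q by (simp add: translation_single)

lemma translates_t_half: "translates q \<nu> (emb (t_half \<alpha>)) (emb (t_half \<alpha>))"
  unfolding t_half_def by (rule translates_const)

lemma translates_zquot_zero:
  assumes \<alpha>: "\<alpha> \<in> R" "\<alpha> \<bullet> \<nu> = 0"
  shows "translates q \<nu> (zquot \<alpha> 0 m) (zquot \<alpha> 0 m)"
proof -
  have qa: "0 < qa \<alpha>" "qa \<alpha> < 1" using qa[OF \<alpha>(1)] by auto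
  have D: "translates q \<nu> (Dser \<alpha> s) (Dser \<alpha> s)" if "0 \<le> s" "s \<le> 1" for s
    using translates_Dser[OF \<alpha>(1) that, of \<nu>] \<alpha>(2) q by simp
  have g: "translates q \<nu> (geom \<alpha> (qa \<alpha>)) (geom \<alpha> (qa \<alpha>))"
    using translates_expser[of "\<lambda>n. qa \<alpha> ^ n" 1 q \<alpha> \<nu>] asums_geom[of "qa \<alpha>"] qa \<alpha>(2) q by (simp add: geom_def)
  have e: "translates q \<nu> (emb (Poly_Mapping.single 0 a - Poly_Mapping.single \<alpha> b)) (emb (Poly_Mapping.single 0 a - Poly_Mapping.single \<alpha> b))" for a b
    using \<alpha>(2) q by (auto simp: translates_def lookup_minus lookup_single when_def)
  show ?thesis
    unfolding zquot_zero_cases[OF \<alpha>(1)] emb_mult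
    using D[of "qa \<alpha>"] D[of 1] g e translates_t_half q(1) qa by (auto intro!: translates_mult)
qed

text \<open>The coefficient of a term times the weight is the product of \<open>Y\<close>, a
  constant \<open>k\<close>, the translate of \<open>A\<close> and the conjugate of
  \<open>A\<close>, where \<open>A\<close> collects the roots positive on \<open>\<nu>\<close> and
  \<open>Y\<close> those orthogonal to \<open>\<nu>\<close>. Moving the translation to the other
  argument exchanges \<open>A\<close> with its translate and fixes \<open>Y\<close> and
  \<open>k\<close>; conjugating \<open>Y\<close> replaces \<open>\<eta>\<close> by
  \<open>2 *\<^sub>R \<nu> - \<eta>\<close>.\<close>

lemma pair_adjoint:
  assumes p: "(\<nu>, \<eta>) \<in> Pairs"
  shows "coef (emb (UVnum \<nu> \<eta>) * Delta_quot * emb (translation q \<nu> f) * l1_bar (emb g)) 0 =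
    coef (emb f * l1_bar (emb (UVnum \<nu> (2 *\<^sub>R \<nu> - \<eta>)) * Delta_quot * emb (translation q \<nu> g))) 0"
proof -
  define N N0 where "N = {\<alpha> \<in> R. \<nu> \<bullet> st \<alpha> > 0}" and "N0 = {\<alpha> \<in> R. \<nu> \<bullet> st \<alpha> = 0}"
  define A TA where "A = (\<Prod>\<alpha>\<in>N. Dser \<alpha> 1)" and "TA = (\<Prod>\<alpha>\<in>N. Dser \<alpha> (qa \<alpha> powr (\<nu> \<bullet> st \<alpha>)))"
  define k where "k = (\<Prod>\<alpha>\<in>N. emb (kap \<alpha> (\<nu> \<bullet> st \<alpha>)))"
  define YY where "YY \<eta> = (\<Prod>\<alpha>\<in>N0. zquot \<alpha> 0 (\<eta> \<bullet> st \<alpha>))" for \<eta>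
  have fin: "finite N" "finite N0" by (simp_all add: N_def N0_def)
  have ZM: "emb (UVnum \<nu> \<eta>) * Delta_quot = YY \<eta> * k * TA * l1_bar A" if p: "(\<nu>, \<eta>) \<in> Pairs" for \<eta>
  proof -
    let ?F = "\<lambda>\<alpha>. zquot \<alpha> (\<nu> \<bullet> st \<alpha>) (\<eta> \<bullet> st \<alpha>)"
    have R: "R = N0 \<union> (N \<union> uminus ` N)"
    proof (intro equalityI subsetI)
      fix \<alpha> assume \<alpha>: "\<alpha> \<in> R"
      then have "- \<alpha> \<in> R" "\<alpha> = - (- \<alpha>)" using root_minus by auto
      then show "\<alpha> \<in> N0 \<union> (N \<union> uminus ` N)"
        using \<alpha> by (cases "\<nu> \<bullet> st \<alpha>" "0 :: real" rule: linorder_cases) (auto simp: N_def N0_def image_iff intro!: bexI[of _ "- \<alpha>"])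
    qed (auto simp: N_def N0_def root_minus)
    have "emb (UVnum \<nu> \<eta>) * Delta_quot = prod ?F (N0 \<union> (N \<union> uminus ` N))"
      unfolding UVnum_Delta_quot by (rule arg_cong[OF R])
    also have "\<dots> = prod ?F N0 * (prod ?F N * prod ?F (uminus ` N))"
    proof -
      have "N0 \<inter> (N \<union> uminus ` N) = {}" "N \<inter> uminus ` N = {}" by (auto simp: N_def N0_def)
      then show ?thesis using fin by (simp add: prod.union_disjoint)
    qed
    also have "prod ?F N0 = YY \<eta>" unfolding YY_def by (intro prod.cong) (auto simp: N0_def)
    also have "prod ?F N = k * TA"
      unfolding k_def TA_def prod.distrib[symmetric]
    proof (intro prod.cong refl)
      fix \<alpha> assume "\<alpha> \<in> N"
      then have \<alpha>: "\<alpha> \<in> R" "\<nu> \<bullet> st \<alpha> > 0" by (auto simp: N_def)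
      then have "\<nu> \<bullet> st \<alpha> = 1 \<or> \<nu> \<bullet> st \<alpha> = 2" using Pairs_cases[OF p \<alpha>(1)] by auto
      then show "?F \<alpha> = emb (kap \<alpha> (\<nu> \<bullet> st \<alpha>)) * Dser \<alpha> (qa \<alpha> powr (\<nu> \<bullet> st \<alpha>))"
        by (rule zquot_pos[OF \<alpha>(1)])
    qed
    also have "prod ?F (uminus ` N) = (\<Prod>\<alpha>\<in>N. ?F (- \<alpha>))"
      by (subst prod.reindex) (auto simp: inj_on_def)
    also have "\<dots> = l1_bar A"
      unfolding A_def l1_bar_prod
    proof (intro prod.cong refl)
      fix \<alpha> assume "\<alpha> \<in> N"
      then have \<alpha>: "\<alpha> \<in> R" "\<nu> \<bullet> st \<alpha> > 0" by (auto simp: N_def)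
      then show "?F (- \<alpha>) = l1_bar (Dser \<alpha> 1)"
        using zquot_neg[OF root_minus[OF \<alpha>(1)], of "\<nu> \<bullet> st (- \<alpha>)"] by (simp add: l1_bar_Dser)
    qed
    finally show ?thesis by (simp only: mult.assoc)
  qed
  have TA: "translates q \<nu> A TA"
    unfolding A_def TA_def
  proof (rule translates_prod[OF q(1)])
    fix \<alpha> assume "\<alpha> \<in> N"
    then have \<alpha>: "\<alpha> \<in> R" "\<nu> \<bullet> st \<alpha> > 0" by (auto simp: N_def)
    then have pos: "\<alpha> \<bullet> \<nu> \<ge> 0" using inner_st_pos_iff[OF \<alpha>(1), of \<nu>] by (simp add: inner_commute)
    have "\<alpha> \<bullet> \<nu> = u \<alpha> * (\<nu> \<bullet> st \<alpha>)" using u_pos[OF \<alpha>(1)] by (simp add: inner_st inner_commute)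
    then have "q powr (\<alpha> \<bullet> \<nu>) = qa \<alpha> powr (\<nu> \<bullet> st \<alpha>)" by (simp add: qa_def powr_powr)
    then show "translates q \<nu> (Dser \<alpha> 1) (Dser \<alpha> (qa \<alpha> powr (\<nu> \<bullet> st \<alpha>)))"
      using translates_Dser[OF \<alpha>(1) _ _ pos, of 1] by simp
  qed
  have k: "translates q \<nu> k k" "l1_bar k = k"
  proof -
    show "translates q \<nu> k k" unfolding k_def
      by (rule translates_prod[OF q(1)]) (auto simp: kap_def emb_mult intro!: translates_mult translates_t_half q)
    show "l1_bar k = k" unfolding k_def l1_bar_prod
      by (intro prod.cong refl) (auto simp: kap_def emb_mult l1_bar_mult l1_bar_t_half)
  qed
  have YY: "translates q \<nu> (YY \<eta>) (YY \<eta>)" unfolding YY_def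
  proof (rule translates_prod[OF q(1)])
    fix \<alpha> assume "\<alpha> \<in> N0"
    then have \<alpha>: "\<alpha> \<in> R" "\<alpha> \<bullet> \<nu> = 0" using inner_st_zero_iff[of \<alpha> \<nu>] by (auto simp: N0_def inner_commute)
    then show "translates q \<nu> (zquot \<alpha> 0 (\<eta> \<bullet> st \<alpha>)) (zquot \<alpha> 0 (\<eta> \<bullet> st \<alpha>))" by (rule translates_zquot_zero)
  qed
  \<comment> \<open>Conjugation replaces each root by its negative, and reindexing then negates its
    pairing with \<open>\<eta>\<close>. On roots orthogonal to \<open>\<nu>\<close> this is the
    pairing with \<open>2 *\<^sub>R \<nu> - \<eta>\<close>.\<close>
  have bYY: "l1_bar (YY \<eta>) = YY (2 *\<^sub>R \<nu> - \<eta>)"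
  proof -
    have "l1_bar (YY \<eta>) = (\<Prod>\<alpha>\<in>N0. zquot (- \<alpha>) 0 (\<eta> \<bullet> st \<alpha>))"
      unfolding YY_def l1_bar_prod by (intro prod.cong refl) (simp add: N0_def l1_bar_zquot_zero)
    also have "\<dots> = YY (2 *\<^sub>R \<nu> - \<eta>)"
      unfolding YY_def
      by (rule prod.reindex_bij_witness[of _ uminus uminus])
        (auto simp: N0_def root_minus inner_diff_left)
    finally show ?thesis .
  qed
  let ?Tf = "emb (translation q \<nu> f)" and ?Tg = "emb (translation q \<nu> g)"
  have "emb (UVnum \<nu> \<eta>) * Delta_quot * ?Tf * l1_bar (emb g) = (YY \<eta> * k * TA * ?Tf) * l1_bar (A * emb g)"
    unfolding ZM[OF p] l1_bar_mult by (simp only: mult_ac)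
  then have "coef (emb (UVnum \<nu> \<eta>) * Delta_quot * ?Tf * l1_bar (emb g)) 0 = coef ((YY \<eta> * k * TA * ?Tf) * l1_bar (A * emb g)) 0"
    by simp
  also have "\<dots> = coef ((YY \<eta> * k * A * emb f) * l1_bar (TA * ?Tg)) 0"
    by (rule translates_adjoint[of q \<nu>]) (intro translates_mult YY k TA translates_emb q)+
  also have "(YY \<eta> * k * A * emb f) * l1_bar (TA * ?Tg) = emb f * l1_bar (YY (2 *\<^sub>R \<nu> - \<eta>) * k * TA * l1_bar A * ?Tg)"
  proof -
    have "YY \<eta> = l1_bar (YY (2 *\<^sub>R \<nu> - \<eta>))" using bYY by (metis l1_bar_l1_bar)
    then show ?thesis by (simp only: l1_bar_mult l1_bar_l1_bar k mult_ac)
  qed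
  also have "YY (2 *\<^sub>R \<nu> - \<eta>) * k * TA * l1_bar A = emb (UVnum \<nu> (2 *\<^sub>R \<nu> - \<eta>)) * Delta_quot"
    using ZM[OF Pairs_flip[OF p]] by simp
  finally show ?thesis .
qed

lemma l1_bar_Delta: "l1_bar Delta = Delta"
proof -
  have "l1_bar Delta = (\<Prod>\<alpha>\<in>R. Dser (- \<alpha>) 1)"
    unfolding Delta_def l1_bar_prod by (intro prod.cong refl) (simp add: l1_bar_Dser)
  also have "\<dots> = Delta"
    unfolding Delta_def
    by (rule prod.reindex_bij_witness[of _ uminus uminus]) (auto simp: root_minus)
  finally show ?thesis .
qed

text \<open>Writing the weight as \<open>Dens\<close> times \<open>Delta_quot\<close> replaces the
  fractions by their numerators. The terms are then adjoint pair by pair, \<open>Pairs_flip\<close>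
  reindexes the sum, and the weight is invariant under conjugation.\<close>

theorem Dop_adjoint:
  assumes G: "Dop f = ga_frac G" and H: "Dop g = ga_frac H"
  shows "inn G g = inn f H"
proof -
  have "emb G * l1_bar (emb g) * Delta = emb (Dens * G) * Delta_quot * l1_bar (emb g)"
    by (simp add: Delta_KM emb_mult mult_ac)
  also have "\<dots> = (\<Sum>(\<nu>, \<eta>)\<in>Pairs. emb (UVnum \<nu> \<eta>) * Delta_quot * emb (translation q \<nu> f) * l1_bar (emb g))"
    unfolding Dop_UVnum[OF G] emb_sum sum_distrib_right by (intro sum.cong refl) (auto simp: emb_mult mult_ac)
  finally have "inn G g = (\<Sum>(\<nu>, \<eta>)\<in>Pairs. coef (emb (UVnum \<nu> \<eta>) * Delta_quot * emb (translation q \<nu> f) * l1_bar (emb g)) 0)"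
    by (simp add: inn_def coef_sum case_prod_unfold)
  also have "\<dots> = (\<Sum>(\<nu>, \<eta>)\<in>Pairs. coef (emb f * l1_bar (emb (UVnum \<nu> (2 *\<^sub>R \<nu> - \<eta>)) * Delta_quot * emb (translation q \<nu> g))) 0)"
    by (intro sum.cong refl) (auto simp: pair_adjoint)
  also have "\<dots> = (\<Sum>(\<nu>, \<eta>)\<in>Pairs. coef (emb f * l1_bar (emb (UVnum \<nu> \<eta>) * Delta_quot * emb (translation q \<nu> g))) 0)"
    by (rule sum.reindex_bij_witness[of _ "\<lambda>(\<nu>, \<eta>). (\<nu>, 2 *\<^sub>R \<nu> - \<eta>)" "\<lambda>(\<nu>, \<eta>). (\<nu>, 2 *\<^sub>R \<nu> - \<eta>)"])
      (auto simp: Pairs_flip)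
  also have "\<dots> = coef (emb f * l1_bar (emb (Dens * H) * Delta_quot)) 0"
    unfolding Dop_UVnum[OF H] emb_sum sum_distrib_right l1_bar_sum sum_distrib_left coef_sum
    by (intro sum.cong refl) (auto simp: emb_mult mult_ac)
  also have "emb f * l1_bar (emb (Dens * H) * Delta_quot) = emb f * l1_bar (emb H) * l1_bar Delta"
    by (simp add: Delta_KM emb_mult l1_bar_mult mult_ac)
  finally show ?thesis by (simp add: inn_def l1_bar_Delta)
qed

section \<open>Orthogonalisation and the eigenvalue equation\<close>

abbreviation "ms \<equiv> monomial_sym R"
abbreviation "below \<equiv> dominant_strictly_below R Rp"

lemma below_iff: "\<mu> \<in> below lam \<longleftrightarrow> \<mu> \<in> P \<and> dominant \<mu> \<and> lam - \<mu> \<in> root_cone \<and> \<mu> \<noteq> lam"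
  by (auto simp: dominant_strictly_below_def dominant_weights_iff dominance_le_iff)

lemma below_trans:
  assumes "\<mu> \<in> below lam" "\<kappa> \<in> insert \<mu> (below \<mu>)"
  shows "\<kappa> \<in> below lam"
proof (cases "\<kappa> = \<mu>")
  case False
  then have \<kappa>: "\<kappa> \<in> P" "dominant \<kappa>" "\<mu> - \<kappa> \<in> root_cone" using assms(2) by (auto simp: below_iff)
  have \<mu>: "lam - \<mu> \<in> root_cone" "\<mu> \<noteq> lam" using assms(1) by (auto simp: below_iff)
  have "lam - \<kappa> \<in> root_cone" using root_cone_add[OF \<mu>(1) \<kappa>(3)] by simp
  moreover have "\<kappa> \<noteq> lam"
  proof
    assume "\<kappa> = lam"
    then have "- (lam - \<mu>) \<in> root_cone" using \<kappa>(3) by simp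
    then show False using root_cone_antisym[OF \<mu>(1)] \<mu>(2) by simp
  qed
  ultimately show ?thesis using \<kappa> by (simp add: below_iff)
qed (use assms in simp)

text \<open>Every exponent is conjugate to exactly one dominant vector, which is \<open>lam\<close>
  or strictly below it when the coefficient of \<open>h\<close> there is nonzero. So
  \<open>h\<close> is determined by its coefficients on
  \<open>insert lam (below lam)\<close>.\<close>

lemma symmetric_expand:
  assumes h: "weyl_invariant h" "low lam h" and lam: "lam \<in> P" "dominant lam"
  shows "h = (\<Sum>\<kappa>\<in>insert lam (below lam). Poly_Mapping.single 0 (Poly_Mapping.lookup h \<kappa>) * ms \<kappa>)"
proof (rule poly_mapping_eqI)
  fix x
  let ?I = "insert lam (below lam)"
  have fin: "finite ?I" using finite_dominant_below by simp
  have "Poly_Mapping.lookup (\<Sum>\<kappa>\<in>?I. Poly_Mapping.single 0 (Poly_Mapping.lookup h \<kappa>) * ms \<kappa>) x =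
      (\<Sum>\<kappa>\<in>?I. if x \<in> weyl_orbit R \<kappa> then Poly_Mapping.lookup h \<kappa> else 0)"
    unfolding lookup_sum lookup_single_mult lookup_monomial_sym by (intro sum.cong refl) simp
  also have "\<dots> = Poly_Mapping.lookup h x"
  proof -
    obtain w where w: "w \<in> W" "dominant (w x)" using exists_dominant by blast
    define \<kappa> where "\<kappa> = w x"
    have x: "x \<in> weyl_orbit R \<kappa>" unfolding \<kappa>_def by (rule orbit_sym[OF orbitI[OF w(1)]])
    have hx: "Poly_Mapping.lookup h x = Poly_Mapping.lookup h \<kappa>" using h(1) w(1) by (simp add: weyl_invariant_def \<kappa>_def)
    have uniq: "\<kappa>' = \<kappa>" if "\<kappa>' \<in> ?I" "x \<in> weyl_orbit R \<kappa>'" for \<kappa>'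
    proof -
      have "dominant \<kappa>'" using that(1) lam by (auto simp: below_iff)
      moreover have "\<kappa>' \<in> weyl_orbit R \<kappa>" using orbit_trans[OF orbit_sym[OF that(2)] x] .
      ultimately show ?thesis using dominant_unique[of \<kappa> \<kappa>'] w(2) by (simp add: \<kappa>_def)
    qed
    show ?thesis
    proof (cases "\<kappa> \<in> ?I")
      case True
      have "(\<Sum>\<kappa>'\<in>?I. if x \<in> weyl_orbit R \<kappa>' then Poly_Mapping.lookup h \<kappa>' else 0) =
          (\<Sum>\<kappa>'\<in>?I. if \<kappa>' = \<kappa> then Poly_Mapping.lookup h \<kappa> else 0)"
      proof (intro sum.cong refl)
        fix \<kappa>' assume I: "\<kappa>' \<in> ?I"
        show "(if x \<in> weyl_orbit R \<kappa>' then Poly_Mapping.lookup h \<kappa>' else 0) =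
            (if \<kappa>' = \<kappa> then Poly_Mapping.lookup h \<kappa> else 0)"
        proof (cases "\<kappa>' = \<kappa>")
          case False
          then have "x \<notin> weyl_orbit R \<kappa>'" using uniq[OF I] by blast
          then show ?thesis using False by simp
        qed (simp add: x)
      qed
      then show ?thesis using True fin hx by simp
    next
      case False
      have "Poly_Mapping.lookup h \<kappa> = 0"
      proof (rule ccontr)
        assume "Poly_Mapping.lookup h \<kappa> \<noteq> 0"
        then have Q: "lam - \<kappa> \<in> root_cone" using h(2) low_lookup by blast
        then have "\<kappa> \<in> P" using P_diff[OF lam(1) root_cone_P[OF Q]] by simp
        then show False using False Q w(2) by (simp add: below_iff \<kappa>_def)
      qed
      moreover have "(\<Sum>\<kappa>'\<in>?I. if x \<in> weyl_orbit R \<kappa>' then Poly_Mapping.lookup h \<kappa>' else 0) = 0"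
      proof (intro sum.neutral ballI)
        fix \<kappa>' assume I: "\<kappa>' \<in> ?I"
        then have "x \<notin> weyl_orbit R \<kappa>'" using uniq[OF I] False by blast
        then show "(if x \<in> weyl_orbit R \<kappa>' then Poly_Mapping.lookup h \<kappa>' else 0) = 0" by simp
      qed
      ultimately show ?thesis using hx by simp
    qed
  qed
  finally show "Poly_Mapping.lookup h x =
    Poly_Mapping.lookup (\<Sum>\<kappa>\<in>?I. Poly_Mapping.single 0 (Poly_Mapping.lookup h \<kappa>) * ms \<kappa>) x" ..
qed

text \<open>Gram-Schmidt by induction: \<open>r\<close> is \<open>m x\<close> made orthogonal to the
  earlier vectors, and a multiple of \<open>r\<close> corrects \<open>f\<close> at \<open>x\<close>
  without disturbing the rest.\<close>

lemma orthogonal_projection: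
  assumes "finite M"
  shows "\<exists>a. \<forall>\<mu>\<in>M. inn (f + (\<Sum>\<kappa>\<in>M. Poly_Mapping.single 0 (a \<kappa>) * m \<kappa>)) (m \<mu>) = 0"
  using assms
proof (induction M arbitrary: f rule: finite_induct)
  case (insert x M)
  let ?c = "\<lambda>z. Poly_Mapping.single 0 z :: 'a \<Rightarrow>\<^sub>0 complex"
  obtain a where a: "\<And>\<mu>. \<mu> \<in> M \<Longrightarrow> inn (f + (\<Sum>\<kappa>\<in>M. ?c (a \<kappa>) * m \<kappa>)) (m \<mu>) = 0"
    using insert.IH[of f] by blast
  obtain b where b: "\<And>\<mu>. \<mu> \<in> M \<Longrightarrow> inn (m x + (\<Sum>\<kappa>\<in>M. ?c (b \<kappa>) * m \<kappa>)) (m \<mu>) = 0"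
    using insert.IH[of "m x"] by blast
  define F r where "F = f + (\<Sum>\<kappa>\<in>M. ?c (a \<kappa>) * m \<kappa>)" and "r = m x + (\<Sum>\<kappa>\<in>M. ?c (b \<kappa>) * m \<kappa>)"
  \<comment> \<open>If \<open>r = 0\<close>, then \<open>m x\<close> lies in the span of the earlier
    vectors and orthogonality to it is automatic, so the coefficient \<open>0\<close> will do.
    Otherwise \<open>inn r (m x)\<close> equals \<open>inn r r\<close> and is nonzero by
    definiteness.\<close>
  define z where "z = (if r = 0 then 0 else - inn F (m x) / inn r (m x))"
  have r: "inn g r = inn g (m x)" if "\<And>\<mu>. \<mu> \<in> M \<Longrightarrow> inn g (m \<mu>) = 0" for g
    unfolding r_def inn_add_right inn_sum_right inn_const_right using that by simp
  have orth: "inn (F + ?c z * r) (m \<mu>) = 0" if "\<mu> \<in> insert x M" for \<mu>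
  proof (cases "\<mu> = x")
    case True
    show ?thesis
    proof (cases "r = 0")
      case True
      then have "inn F (m x) = 0" using r[of F] a by (simp add: F_def)
      then show ?thesis using True \<open>\<mu> = x\<close> by simp
    next
      case False
      then have "inn r (m x) \<noteq> 0" using inn_definite[of r] r[of r] b by (auto simp: r_def)
      then show ?thesis using False \<open>\<mu> = x\<close> by (simp add: inn_add_left inn_const_left z_def)
    qed
  next
    case False
    then show ?thesis using that a b by (simp add: inn_add_left inn_const_left F_def r_def)
  qed
  have "F + ?c z * r = f + (\<Sum>\<kappa>\<in>insert x M. ?c ((\<lambda>\<kappa>. if \<kappa> = x then z else a \<kappa> + z * b \<kappa>) \<kappa>) * m \<kappa>)"
  proof -
    have "(\<Sum>\<kappa>\<in>M. ?c (if \<kappa> = x then z else a \<kappa> + z * b \<kappa>) * m \<kappa>) =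
        (\<Sum>\<kappa>\<in>M. ?c (a \<kappa>) * m \<kappa> + ?c z * (?c (b \<kappa>) * m \<kappa>))"
      using insert.hyps
      by (intro sum.cong refl) (auto simp: single_add distrib_right mult_single simp flip: mult.assoc)
    then show ?thesis
      using insert.hyps
      by (simp add: F_def r_def distrib_left sum_distrib_left sum.distrib algebra_simps)
  qed
  then show ?case using orth by (intro exI[of _ "\<lambda>\<kappa>. if \<kappa> = x then z else a \<kappa> + z * b \<kappa>"]) metis
qed simp

lemma orthogonal_span_zero:
  assumes "\<And>\<mu>. \<mu> \<in> M \<Longrightarrow> inn h (m \<mu>) = 0" "h = (\<Sum>\<kappa>\<in>M. Poly_Mapping.single 0 (a \<kappa>) * m \<kappa>)"
  shows "h = 0"
proof (rule inn_definite)
  have "inn h h = (\<Sum>\<kappa>\<in>M. cnj (a \<kappa>) * inn h (m \<kappa>))"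
    by (subst (2) assms(2)) (simp add: inn_sum_right inn_const_right)
  then show "inn h h = 0" using assms(1) by simp
qed

lemma is_macdonald_iff:
  "is_macdonald_poly R Rp S q t lam p \<longleftrightarrow>
    (\<exists>a. p = ms lam + (\<Sum>\<mu>\<in>below lam. Poly_Mapping.single 0 (a \<mu>) * ms \<mu>)) \<and>
    (\<forall>\<mu>\<in>below lam. inn p (ms \<mu>) = 0)"
  by (simp add: is_macdonald_poly_def Delta_inner_0_iff)

text \<open>Existence is an orthogonal projection and uniqueness is definiteness on the span of the
  lower orbit sums; together they justify the definite description in
  \<open>macdonald_poly\<close>.\<close>

lemma is_macdonald: "is_macdonald_poly R Rp S q t lam (macdonald_poly R Rp S q t lam)"
  unfolding macdonald_poly_def
proof (rule theI')
  show "\<exists>!p. is_macdonald_poly R Rp S q t lam p"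
  proof (rule ex_ex1I)
    show "\<exists>p. is_macdonald_poly R Rp S q t lam p"
      unfolding is_macdonald_iff
      using orthogonal_projection[OF finite_dominant_below, of lam "ms lam" ms] by blast
  next
    fix p p' assume "is_macdonald_poly R Rp S q t lam p" "is_macdonald_poly R Rp S q t lam p'"
    then obtain a a' where a: "p = ms lam + (\<Sum>\<mu>\<in>below lam. Poly_Mapping.single 0 (a \<mu>) * ms \<mu>)"
        "\<And>\<mu>. \<mu> \<in> below lam \<Longrightarrow> inn p (ms \<mu>) = 0"
      and a': "p' = ms lam + (\<Sum>\<mu>\<in>below lam. Poly_Mapping.single 0 (a' \<mu>) * ms \<mu>)"
        "\<And>\<mu>. \<mu> \<in> below lam \<Longrightarrow> inn p' (ms \<mu>) = 0"
      unfolding is_macdonald_iff by blast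
    have inn_diff: "inn (p - p') g = inn p g - inn p' g" for g
      using inn_add_left[of "p - p'" p' g] by simp
    have "p - p' = (\<Sum>\<mu>\<in>below lam. Poly_Mapping.single 0 (a \<mu> - a' \<mu>) * ms \<mu>)"
      unfolding a(1) a'(1) by (simp add: single_diff left_diff_distrib sum_subtractf)
    moreover have "inn (p - p') (ms \<mu>) = 0" if "\<mu> \<in> below lam" for \<mu>
      using a(2)[OF that] a'(2)[OF that] by (simp add: inn_diff)
    ultimately have "p - p' = 0" by (intro orthogonal_span_zero[of "below lam" "p - p'" ms])
    then show "p = p'" by simp
  qed
qed

lemma weyl_invariant_add: "weyl_invariant f \<Longrightarrow> weyl_invariant g \<Longrightarrow> weyl_invariant (f + g)"
  by (simp add: weyl_invariant_def lookup_add)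

lemma weyl_invariant_diff: "weyl_invariant f \<Longrightarrow> weyl_invariant g \<Longrightarrow> weyl_invariant (f - g)"
  by (simp add: weyl_invariant_def lookup_minus)

lemma weyl_invariant_const: "weyl_invariant f \<Longrightarrow> weyl_invariant (Poly_Mapping.single 0 c * f)"
  by (simp add: weyl_invariant_def lookup_single_mult)

lemma weyl_invariant_sum: "(\<And>i. i \<in> I \<Longrightarrow> weyl_invariant (f i)) \<Longrightarrow> weyl_invariant (sum f I)"
  by (induction I rule: infinite_finite_induct) (auto intro: weyl_invariant_add simp: weyl_invariant_def[of 0])

lemma low_const: "low \<kappa> f \<Longrightarrow> low \<kappa> (Poly_Mapping.single 0 c * f)"
  using low_mult[OF low_single[of 0 0 c], of \<kappa> f] by simp

lemma low_mono: "low \<mu> f \<Longrightarrow> lam - \<mu> \<in> root_cone \<Longrightarrow> low lam f"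
  unfolding low_def using root_cone_add[of "lam - \<mu>"] by fastforce

lemma Dop_add: "Dop (f + g) = Dop f + Dop g"
  unfolding Dop_def by (simp add: translation_add ga_frac_add distrib_left sum.distrib case_prod_unfold)

lemma translation_const:
  "translation q \<nu> (Poly_Mapping.single 0 c * f) = Poly_Mapping.single 0 c * translation q \<nu> f"
  by (rule poly_mapping_eqI) (simp add: lookup_translation lookup_single_mult)

lemma Dop_const: "Dop (Poly_Mapping.single 0 c * f) = ga_frac (Poly_Mapping.single 0 c) * Dop f"
  unfolding Dop_def sum_distrib_left translation_const ga_frac_mult case_prod_unfold
  by (intro sum.cong refl) (simp only: mult_ac)

lemma Dop_0: "Dop 0 = 0"
  using Dop_const[of 0 0] by simp

lemma Dop_sum: "Dop (sum f I) = (\<Sum>i\<in>I. Dop (f i))"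
  by (induction I rule: infinite_finite_induct) (auto simp: Dop_add Dop_0)

theorem Dop_macdonald:
  assumes lam: "lam \<in> P" "dominant lam" and "is_macdonald_poly R Rp S q t lam p"
  shows "Dop p = ga_frac (Poly_Mapping.single 0 (eigen lam) * p)"
proof -
  let ?c = "\<lambda>z. Poly_Mapping.single 0 z :: 'a \<Rightarrow>\<^sub>0 complex"
  obtain a where p: "p = ms lam + (\<Sum>\<mu>\<in>below lam. ?c (a \<mu>) * ms \<mu>)"
    and orth: "\<And>\<mu>. \<mu> \<in> below lam \<Longrightarrow> inn p (ms \<mu>) = 0"
    using assms(3) unfolding is_macdonald_iff by blast
  \<comment> \<open>The images of the orbit sums are chosen for all dominant weights at once, so
    that combining them with the coefficients of \<open>p\<close> presents \<open>Dop p\<close> as a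
    Laurent polynomial.\<close>
  have "\<forall>\<kappa>. \<exists>G. \<kappa> \<in> P \<and> dominant \<kappa> \<longrightarrow>
      Dop (ms \<kappa>) = ga_frac G \<and> weyl_invariant G \<and> low \<kappa> G \<and> Poly_Mapping.lookup G \<kappa> = eigen \<kappa>"
    using Dop_triangular by blast
  then obtain G where G: "\<And>\<kappa>. \<kappa> \<in> P \<Longrightarrow> dominant \<kappa> \<Longrightarrow>
      Dop (ms \<kappa>) = ga_frac (G \<kappa>) \<and> weyl_invariant (G \<kappa>) \<and> low \<kappa> (G \<kappa>) \<and> Poly_Mapping.lookup (G \<kappa>) \<kappa> = eigen \<kappa>"
    by metis
  have Gb: "Dop (ms \<mu>) = ga_frac (G \<mu>)" "weyl_invariant (G \<mu>)" "low \<mu> (G \<mu>)" if "\<mu> \<in> below lam" for \<mu>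
    using G that by (auto simp: below_iff)
  define Gp where "Gp = G lam + (\<Sum>\<mu>\<in>below lam. ?c (a \<mu>) * G \<mu>)"
  have DDp: "Dop p = ga_frac Gp"
    unfolding p Gp_def Dop_add Dop_sum Dop_const ga_frac_add ga_frac_sum ga_frac_mult
    using G[OF lam] Gb(1) by simp
  define h where "h = Gp - ?c (eigen lam) * p"
  have "weyl_invariant h"
    unfolding h_def Gp_def p using G[OF lam] Gb(2)
    by (intro weyl_invariant_diff weyl_invariant_add weyl_invariant_sum weyl_invariant_const weyl_invariant_monomial) auto
  have up: "low lam f" if "low \<mu> f" "\<mu> \<in> below lam" for \<mu> f
    using low_mono[OF that(1)] that(2) by (simp add: below_iff)
  have lm: "low \<mu> (ms \<mu>)" if "\<mu> \<in> below lam" for \<mu>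
    using that low_monomial by (simp add: below_iff)
  have minus: "h = Gp + ?c (- eigen lam) * p" by (simp add: h_def single_uminus)
  have "low lam h"
    unfolding minus Gp_def p using G[OF lam] Gb(3) lm low_monomial[OF lam]
    by (intro low_add low_sum low_const) (auto intro: up)
  have zero: "Poly_Mapping.lookup f lam = 0" if "low \<mu> f" "\<mu> \<in> below lam" for \<mu> f
  proof (rule ccontr)
    assume "Poly_Mapping.lookup f lam \<noteq> 0"
    then have "\<mu> - lam \<in> root_cone" using that(1) low_lookup by blast
    then have "- (lam - \<mu>) \<in> root_cone" by simp
    then show False using root_cone_antisym[of "lam - \<mu>"] that(2) by (simp add: below_iff)
  qed
  have "Poly_Mapping.lookup h lam = 0"
  proof -
    have "Poly_Mapping.lookup Gp lam = eigen lam"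
      unfolding Gp_def lookup_add lookup_sum lookup_single_mult using G[OF lam] zero[OF Gb(3)] by simp
    moreover have "Poly_Mapping.lookup p lam = 1"
      unfolding p lookup_add lookup_sum lookup_single_mult using zero[OF lm] by (simp add: lookup_monomial_sym orbit_self)
    ultimately show ?thesis by (simp add: h_def lookup_minus lookup_single_mult)
  qed
  have "lam \<notin> below lam" by (simp add: below_iff)
  have hsum: "h = (\<Sum>\<kappa>\<in>below lam. ?c (Poly_Mapping.lookup h \<kappa>) * ms \<kappa>)"
    using symmetric_expand[OF \<open>weyl_invariant h\<close> \<open>low lam h\<close> lam] \<open>Poly_Mapping.lookup h lam = 0\<close>
      \<open>lam \<notin> below lam\<close> finite_dominant_below by simp
  have "inn h (ms \<mu>) = 0" if \<mu>: "\<mu> \<in> below lam" for \<mu>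
  proof -
    \<comment> \<open>On the other side the operator only meets \<open>ms \<mu>\<close>, whose image
      is a combination of orbit sums of \<open>\<mu>\<close> and lower weights; all of these are
      strictly below \<open>lam\<close> and hence orthogonal to \<open>p\<close>.\<close>
    have "inn Gp (ms \<mu>) = inn p (G \<mu>)" by (rule Dop_adjoint[OF DDp Gb(1)[OF \<mu>]])
    also have "\<dots> = 0"
    proof -
      have "\<mu> \<in> P" "dominant \<mu>" using \<mu> by (auto simp: below_iff)
      from symmetric_expand[OF Gb(2,3)[OF \<mu>] this]
      have "inn p (G \<mu>) = (\<Sum>\<kappa>\<in>insert \<mu> (below \<mu>). cnj (Poly_Mapping.lookup (G \<mu>) \<kappa>) * inn p (ms \<kappa>))"
        by (metis (no_types, lifting) inn_sum_right inn_const_right sum.cong)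
      also have "\<dots> = 0" using orth below_trans[OF \<mu>] by (intro sum.neutral) auto
      finally show ?thesis .
    qed
    finally have "inn Gp (ms \<mu>) = 0" .
    then show ?thesis unfolding minus inn_add_left inn_const_left using orth[OF \<mu>] by simp
  qed
  then have "h = 0" by (rule orthogonal_span_zero[OF _ hsum])
  then have "Gp = ?c (eigen lam) * p" by (simp add: h_def)
  then show ?thesis using DDp by simp
qed

end

theorem theorem3p1:
  fixes R Rp S :: "'a::euclidean_space set"
    and q :: real and t :: "'a \<Rightarrow> real"
    and w :: "'a \<Rightarrow> 'a \<Rightarrow> 'a" and \<omega> lam :: 'a
  assumes "reduced_root_system R" and "irreducible_root_system R"
    and "admissible R S"
    and "positive_system R Rp"
    and "0 < q" and "q < 1"
    and "parameter_family R t"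
    and "dominating_choice R Rp S w"
    and "small_weight R Rp S \<omega>"
    and "lam \<in> dominant_weights R Rp"
  shows "D_operator R Rp S q t w \<omega> (macdonald_poly R Rp S q t lam) =
         ga_frac (ga_const (ga_eval q (E_symmetric R Rp S t \<omega>) (lam + rho_t R Rp S q t)) *
                  macdonald_poly R Rp S q t lam)"
proof -
  obtain v where v: "\<forall>\<alpha>\<in>R. \<alpha> \<bullet> v \<noteq> 0" "Rp = {\<alpha> \<in> R. \<alpha> \<bullet> v > 0}"
    using assms(4) by (auto simp: positive_system_def)
  interpret small_macd R Rp v S q t \<omega>
    by unfold_locales (use assms v in auto)
  have "lam \<in> P" "dominant lam" using assms(10) by (simp_all add: dominant_weights_iff)
  from Dop_macdonald[OF this is_macdonald] show ?thesis
    unfolding D_operator_Dop[OF assms(8)] eigen_eq .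
qed

end
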